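(* Let $N\in\mathbb{N}$, $T>0$, let $a_2,a_{1,1},\dots,a_{1,N},a_0\in C([0,T];\mathbb{C})$ and consider $$P(t,D_x,D_t)=D_t-a_2(t)\Delta_x+\sum_{j=1}^N a_{1,j}(t)D_{x_j}+a_0(t)$$ and the Cauchy problem (CP): $Pu(t,x)=f(t,x)$, $u(0,x)=g(x)$, $t\in[0,T]$, $x\in\mathbb{T}^N$. Write $c_2=\operatorname{Im}a_2$ and $c_{1,j}=\operatorname{Im}a_{1,j}$. Assume: (1) $c_2(t)\le 0$ for every $t\in[0,T]$. (2) There is a finite set $\{t_1,t_2,\dots,t_m\}\subset[0,T]$, with $t_1<t_2<\dots<t_m$, such that $c_2(t)=0$ if and only if $t\in\{t_1,\dots,t_m\}$. (3) There exists $\delta>0$ such that for every $k\in\{1,\dots,m\}$ one can write $c_2(t)=\alpha^k(t)\,|t-t_k|^{p_k}$ for all $t\in[t_k-\delta,t_k+\delta]\cap[0,T]$, where $p_k>0$, $\alpha^k$ is bounded and there exists $\varepsilon>0$ such that $\alpha^k\le-\varepsilon$ on this set. (4) For each $j\in\{1,\dots,N\}$ and $k\in\{1,\dots,m\}$ one can write $c_{1,j}(t)=\beta^{j,k}(t)\,|t-t_k|^{q_{j,k}}$ for all $t\in[t_k-\delta,t_k+\delta]\cap[0,T]$ (same $\delta$), where $q_{j,k}\ge0$ and $\beta^{j,k}$ is a bounded function that does not vanish on this set. Set $q_k=\min\{q_{1,k},\dots,q_{N,k}\}$ and suppose that $p_k\le2q_k+1$ for each $k\in\{1,\dots,m\}$.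 Then: (i) Given $r\in\mathbb{R}$, $f\in C([0,T];H^r(\mathbb{T}^N))$ and $g\in H^r(\mathbb{T}^N)$, there exists a unique $u\in C([0,T];H^r(\mathbb{T}^N))\cap C^1([0,T];H^{r-2}(\mathbb{T}^N))$ which solves (CP). (ii) For every $f\in C([0,T];C^\infty(\mathbb{T}^N))$ and $g\in C^\infty(\mathbb{T}^N)$, there exists a unique $u\in C^1([0,T];C^\infty(\mathbb{T}^N))$ which solves (CP). (iii) Given $s\ge1$, $f\in C([0,T];G^s(\mathbb{T}^N))$ and $g\in G^s(\mathbb{T}^N)$, there exists a unique $u\in C^1([0,T];G^s(\mathbb{T}^N))$ which solves (CP).
   Context: $\mathbb{T}^N=\mathbb{R}^N/2\pi\mathbb{Z}^N$, $D_t=\frac1i\partial_t$, $D_{x_j}=\frac1i\partial_{x_j}$, $\Delta_x=\sum_j\partial_{x_j}^2$. Spaces. For a distribution $u$ on $\mathbb{T}^N$ its Fourier coefficients are $\widehat u(\xi)=\langle u,e^{-ix\xi}\rangle$, $\xi\in\mathbb{Z}^N$, normalized so that $u=\sum_\xi\widehat u(\xi)e^{ix\xi}$. For $r\in\mathbb{R}$, $H^r(\mathbb{T}^N)$ is the set of distributions with $\|u\|_{H^r}^2=\sum_{\xi}|\widehat u(\xi)|^2(1+|\xi|)^{2r}<\infty$. $C^\infty(\mathbb{T}^N)=\bigcap_r H^r(\mathbb{T}^N)$ carries the projective limit topology. For $s\ge1$, $G^s(\mathbb{T}^N)$ is the set of $f\in C^\infty(\mathbb{T}^N)$ for which there are $C,h>0$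 with $|D^\alpha f(x)|\le Ch^{|\alpha|}|\alpha|!^s$ for all multi-indices $\alpha$ and all $x$. With $\|f\|_{h,s}=\sup_\alpha \|D^\alpha f\|_\infty/(h^{|\alpha|}|\alpha|!^s)$ and $G^s_h(\mathbb{T}^N)=\{f:\|f\|_{h,s}<\infty\}$, $G^s(\mathbb{T}^N)$ carries the (locally convex) inductive limit topology of the Banach spaces $G^s_h(\mathbb{T}^N)$, $h\to\infty$. $C([0,T];X)$ and $C^1([0,T];X)$ denote the continuous, resp. continuously differentiable, maps $[0,T]\to X$. Solutions. $u\in C([0,T];H^\rho(\mathbb{T}^N))$ (some $\rho\in\mathbb{R}$) solves (CP) if $u(0)=g$ and $Pu=f$ holds with $D_tu$ understood as the weak derivative in $t$ on $(0,T)$: $\langle D_tu,\varphi\rangle=\int_0^T u(t)(-D_t\varphi(t))\,dt$ for $\varphi\in C_c^\infty((0,T))$. *)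

theory Defs
  imports "HOL-Analysis.Analysis" "HOL-Library.Function_Algebras"
begin

section \<open>Smooth functions on the torus\<close>

text \<open>
  The torus \<open>\<real>\<^sup>N / 2\<pi>\<int>\<^sup>N\<close> has dimension \<open>N = CARD('n)\<close>. Functions on it are
  functions on \<open>real ^ 'n\<close> that are \<open>2\<pi>\<int>\<^sup>N\<close>-periodic.
\<close>

definition pd :: "'n::finite \<Rightarrow> (real ^ 'n \<Rightarrow> complex) \<Rightarrow> real ^ 'n \<Rightarrow> complex" where
  "pd j \<phi> x = vector_derivative (\<lambda>s. \<phi> (x + s *\<^sub>R axis j 1)) (at 0)"

definition Dx :: "'n::finite \<Rightarrow> (real ^ 'n \<Rightarrow> complex) \<Rightarrow> real ^ 'n \<Rightarrow> complex" where
  "Dx j \<phi> x = 1 / \<i> * pd j \<phi> x"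

definition smooth :: "(real ^ 'n::finite \<Rightarrow> complex) \<Rightarrow> bool" where
  "smooth \<phi> \<longleftrightarrow> (\<forall>js. continuous_on UNIV (foldr Dx js \<phi>) \<and>
     (\<forall>j x. (\<lambda>s. foldr Dx js \<phi> (x + s *\<^sub>R axis j 1)) differentiable (at 0)))"

definition torus_smooth :: "(real ^ 'n::finite \<Rightarrow> complex) set" where
  "torus_smooth = {\<phi>. smooth \<phi> \<and>
     (\<forall>x (k :: int ^ 'n). \<phi> (x + (\<chi> j. 2 * pi * of_int (k $ j))) = \<phi> x)}"

definition mi_order :: "nat ^ 'n::finite \<Rightarrow> nat" where
  "mi_order \<alpha> = (\<Sum>j\<in>UNIV. \<alpha> $ j)"

text \<open>
  \<open>mi_D \<alpha>\<close> is \<open>D\<^sup>\<alpha>\<close>. The index type carries no order, so an arbitrary order of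
  the partial derivatives is chosen; on smooth functions it does not matter.
\<close>

definition mi_D :: "nat ^ 'n::finite \<Rightarrow> (real ^ 'n \<Rightarrow> complex) \<Rightarrow> real ^ 'n \<Rightarrow> complex" where
  "mi_D \<alpha> = foldr Dx (SOME js. \<forall>j. count_list js j = \<alpha> $ j)"


section \<open>Distributions on the torus\<close>

text \<open>
  A distribution is a continuous linear functional on the smooth functions on the
  torus, extended by \<open>0\<close> to all other arguments. With this convention equality of
  distributions is equality of functions, and sums and multiples are pointwise
  (\<open>+\<close>, \<open>-\<close> and \<open>\<Sum>\<close> on functionals come from \<open>Function_Algebras\<close>).
\<close>

type_synonym 'n functional = "(real ^ 'n \<Rightarrow> complex) \<Rightarrow> complex"

definition distributions :: "'n::finite functional set" where
  "distributions = {u.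
     (\<forall>\<phi>. \<phi> \<notin> torus_smooth \<longrightarrow> u \<phi> = 0) \<and>
     (\<forall>\<phi>\<in>torus_smooth. \<forall>\<psi>\<in>torus_smooth. \<forall>c. u (\<lambda>x. \<phi> x + c * \<psi> x) = u \<phi> + c * u \<psi>) \<and>
     (\<exists>C k. \<forall>\<phi>\<in>torus_smooth.
        norm (u \<phi>) \<le> C * (\<Sum>\<alpha> | mi_order \<alpha> \<le> k. SUP x. norm (mi_D \<alpha> \<phi> x)))}"

definition smul :: "complex \<Rightarrow> 'n::finite functional \<Rightarrow> 'n functional" (infixr \<open>*\<^sub>D\<close> 75) where
  "c *\<^sub>D u = (\<lambda>\<phi>. c * u \<phi>)"

definition distr_pd :: "'n::finite \<Rightarrow> 'n functional \<Rightarrow> 'n functional" where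
  "distr_pd j u = (\<lambda>\<phi>. if \<phi> \<in> torus_smooth then - u (pd j \<phi>) else 0)"

definition distr_Dx :: "'n::finite \<Rightarrow> 'n functional \<Rightarrow> 'n functional" where
  "distr_Dx j u = (1 / \<i>) *\<^sub>D distr_pd j u"

definition laplacian :: "'n::finite functional \<Rightarrow> 'n functional" where
  "laplacian u = (\<Sum>j\<in>UNIV. distr_pd j (distr_pd j u))"

text \<open>
  The distribution given by a function. The factor \<open>(2\<pi>)\<^sup>-\<^sup>N\<close> is the one for which
  the Fourier coefficients below satisfy \<open>u = \<Sum>\<xi>. fourier u \<xi> \<cdot> e\<^sup>i\<^sup>x\<^sup>\<xi>\<close>.
\<close>

definition fun_distr :: "(real ^ 'n::finite \<Rightarrow> complex) \<Rightarrow> 'n functional" where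
  "fun_distr F = (\<lambda>\<phi>. if \<phi> \<in> torus_smooth
     then integral (cbox 0 (\<chi> j. 2 * pi)) (\<lambda>x. F x * \<phi> x) / of_real ((2 * pi) ^ CARD('n))
     else 0)"

definition rvec :: "int ^ 'n::finite \<Rightarrow> real ^ 'n" where
  "rvec \<xi> = (\<chi> j. of_int (\<xi> $ j))"

definition fourier :: "'n::finite functional \<Rightarrow> int ^ 'n \<Rightarrow> complex" where
  "fourier u \<xi> = u (\<lambda>x. exp (- \<i> * of_real (x \<bullet> rvec \<xi>)))"


section \<open>Function spaces and their topologies\<close>

definition sobolev :: "real \<Rightarrow> 'n::finite functional set" where
  "sobolev r = {u \<in> distributions.
     (\<lambda>\<xi>. (norm (fourier u \<xi>))\<^sup>2 * (1 + norm (rvec \<xi>)) powr (2 * r)) summable_on UNIV}"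

definition sobolev_norm :: "real \<Rightarrow> 'n::finite functional \<Rightarrow> real" where
  "sobolev_norm r u =
     sqrt (\<Sum>\<^sub>\<infinity>\<xi>. (norm (fourier u \<xi>))\<^sup>2 * (1 + norm (rvec \<xi>)) powr (2 * r))"

definition sobolev_top :: "real \<Rightarrow> 'n::finite functional topology" where
  "sobolev_top r = Metric_space.mtopology (sobolev r) (\<lambda>u v. sobolev_norm r (u - v))"

definition Cinf :: "'n::finite functional set" where
  "Cinf = (\<Inter>r. sobolev r)"

definition Cinf_top :: "'n::finite functional topology" where
  "Cinf_top = topology_generated_by {Cinf \<inter> U | U r. openin (sobolev_top r) U}"

text \<open>
  Elements of \<open>Cinf\<close> are distributions; \<open>the_fun\<close> recovers the smooth function
  whose values and derivatives enter the Gevrey estimates.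
\<close>

definition the_fun :: "'n::finite functional \<Rightarrow> real ^ 'n \<Rightarrow> complex" where
  "the_fun = inv_into torus_smooth fun_distr"

definition gevrey :: "real \<Rightarrow> 'n::finite functional set" where
  "gevrey s = {u \<in> Cinf. \<exists>C>0. \<exists>h>0. \<forall>\<alpha> x.
     norm (mi_D \<alpha> (the_fun u) x) \<le> C * h ^ mi_order \<alpha> * fact (mi_order \<alpha>) powr s}"

definition gevrey_norm :: "real \<Rightarrow> real \<Rightarrow> 'n::finite functional \<Rightarrow> ennreal" where
  "gevrey_norm h s u = (SUP \<alpha>. SUP x.
     ennreal (norm (mi_D \<alpha> (the_fun u) x) / (h ^ mi_order \<alpha> * fact (mi_order \<alpha>) powr s)))"

definition gevrey_h :: "real \<Rightarrow> real \<Rightarrow> 'n::finite functional set" where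
  "gevrey_h h s = {u \<in> Cinf. gevrey_norm h s u < \<infinity>}"

definition abs_convex :: "'n::finite functional set \<Rightarrow> bool" where
  "abs_convex V \<longleftrightarrow> (\<forall>v\<in>V. \<forall>w\<in>V. \<forall>a b. norm a + norm b \<le> 1 \<longrightarrow> a *\<^sub>D v + b *\<^sub>D w \<in> V)"

text \<open>
  The locally convex inductive limit topology: a base of neighbourhoods of \<open>0\<close> is
  formed by the absolutely convex sets that meet every step \<open>gevrey_h h s\<close> in a
  neighbourhood of \<open>0\<close> of that normed space.
\<close>

definition gevrey_nbhd0 :: "real \<Rightarrow> 'n::finite functional set \<Rightarrow> bool" where
  "gevrey_nbhd0 s V \<longleftrightarrow> V \<subseteq> gevrey s \<and> abs_convex V \<and>
     (\<forall>h>0. \<exists>\<epsilon>>0. {v \<in> gevrey_h h s. gevrey_norm h s v < ennreal \<epsilon>} \<subseteq> V)"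

definition gevrey_open :: "real \<Rightarrow> 'n::finite functional set \<Rightarrow> bool" where
  "gevrey_open s U \<longleftrightarrow> U \<subseteq> gevrey s \<and>
     (\<forall>u\<in>U. \<exists>V. gevrey_nbhd0 s V \<and> (\<forall>v\<in>V. u + v \<in> U))"

definition gevrey_top :: "real \<Rightarrow> 'n::finite functional topology" where
  "gevrey_top s = topology (gevrey_open s)"

lemma gevrey_nbhd0_Int:
  assumes "gevrey_nbhd0 s V" "gevrey_nbhd0 s W"
  shows "gevrey_nbhd0 s (V \<inter> W)"
  unfolding gevrey_nbhd0_def
proof (intro conjI allI impI)
  show "V \<inter> W \<subseteq> gevrey s" "abs_convex (V \<inter> W)"
    using assms by (auto simp: gevrey_nbhd0_def abs_convex_def)
next
  fix h :: real assume h: "h > 0"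
  obtain d where d: "d > 0" "{v \<in> gevrey_h h s. gevrey_norm h s v < ennreal d} \<subseteq> V"
    using assms(1) h unfolding gevrey_nbhd0_def by blast
  obtain e where e: "e > 0" "{v \<in> gevrey_h h s. gevrey_norm h s v < ennreal e} \<subseteq> W"
    using assms(2) h unfolding gevrey_nbhd0_def by blast
  have "ennreal (min d e) \<le> ennreal d" "ennreal (min d e) \<le> ennreal e"
    by (auto intro!: ennreal_leI)
  then have "{v \<in> gevrey_h h s. gevrey_norm h s v < ennreal (min d e)} \<subseteq> V \<inter> W"
    using d(2) e(2) by (blast intro: order.strict_trans2)
  then show "\<exists>\<epsilon>>0. {v \<in> gevrey_h h s. gevrey_norm h s v < ennreal \<epsilon>} \<subseteq> V \<inter> W"
    using d(1) e(1) by (intro exI[of _ "min d e"]) auto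
qed

lemma istopology_gevrey_open: "istopology (gevrey_open s)"
  unfolding istopology_def
proof (intro conjI allI impI)
  fix S T :: "'a functional set" assume "gevrey_open s S" "gevrey_open s T"
  then show "gevrey_open s (S \<inter> T)"
    unfolding gevrey_open_def using gevrey_nbhd0_Int by (metis IntD1 IntD2 IntI le_infI1)
next
  fix K :: "'a functional set set" assume "\<forall>S\<in>K. gevrey_open s S"
  then show "gevrey_open s (\<Union>K)"
    unfolding gevrey_open_def by (meson UnionE UnionI Union_least)
qed

lemma openin_gevrey_top: "openin (gevrey_top s) = gevrey_open s"
  by (simp add: gevrey_top_def istopology_gevrey_open topology_inverse')


section \<open>Functions of time\<close>

text \<open>
  Maps on \<open>[0,T]\<close> are required to be \<open>undefined\<close> elsewhere (\<open>extensional\<close>), so that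
  uniqueness of a map on \<open>[0,T]\<close> can be expressed by \<open>\<exists>!\<close>.
\<close>

definition C0_maps :: "real \<Rightarrow> 'n::finite functional topology \<Rightarrow> (real \<Rightarrow> 'n functional) set" where
  "C0_maps T X = {u \<in> extensional {0..T}. continuous_map (top_of_set {0..T}) X u}"

definition C1_maps :: "real \<Rightarrow> 'n::finite functional topology \<Rightarrow> (real \<Rightarrow> 'n functional) set" where
  "C1_maps T X = {u \<in> C0_maps T X. \<exists>u'\<in>C0_maps T X. \<forall>t\<in>{0..T}.
     limitin X (\<lambda>\<tau>. of_real (1 / (\<tau> - t)) *\<^sub>D (u \<tau> - u t)) (u' t) (at t within {0..T})}"

definition Dt :: "(real \<Rightarrow> complex) \<Rightarrow> real \<Rightarrow> complex" where
  "Dt \<phi> t = 1 / \<i> * vector_derivative \<phi> (at t)"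

definition time_test :: "real \<Rightarrow> (real \<Rightarrow> complex) set" where
  "time_test T = {\<phi>. (\<forall>k t. (Dt ^^ k) \<phi> differentiable (at t)) \<and>
     (\<exists>K. compact K \<and> K \<subseteq> {0<..<T} \<and> (\<forall>t. t \<notin> K \<longrightarrow> \<phi> t = 0))}"

text \<open>
  The integral of a distribution-valued map over \<open>[0,T]\<close> is taken in the weak
  sense, tested against each smooth \<open>\<psi>\<close>. For maps that are continuous into some
  \<open>H\<^sup>\<rho>\<close> it is the \<open>H\<^sup>\<rho>\<close>-valued Riemann integral.
\<close>

definition distr_integral :: "real \<Rightarrow> (real \<Rightarrow> 'n::finite functional) \<Rightarrow> 'n functional" where
  "distr_integral T w = (\<lambda>\<psi>. integral {0..T} (\<lambda>t. w t \<psi>))"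

text \<open>
  Vector-valued distributions on \<open>(0,T)\<close>: the one given by a map \<open>w\<close> and the weak
  derivative \<open>D\<^sub>t u\<close> of a map \<open>u\<close>, as functions of the test function on \<open>(0,T)\<close>.
\<close>

definition time_distr :: "real \<Rightarrow> (real \<Rightarrow> 'n::finite functional) \<Rightarrow> (real \<Rightarrow> complex) \<Rightarrow> 'n functional" where
  "time_distr T w \<phi> = distr_integral T (\<lambda>t. \<phi> t *\<^sub>D w t)"

definition weak_Dt :: "real \<Rightarrow> (real \<Rightarrow> 'n::finite functional) \<Rightarrow> (real \<Rightarrow> complex) \<Rightarrow> 'n functional" where
  "weak_Dt T u \<phi> = distr_integral T (\<lambda>t. (- Dt \<phi> t) *\<^sub>D u t)"


section \<open>The Cauchy problem\<close>

definition spatial_part ::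
  "(real \<Rightarrow> complex) \<Rightarrow> ('n::finite \<Rightarrow> real \<Rightarrow> complex) \<Rightarrow> (real \<Rightarrow> complex) \<Rightarrow>
   real \<Rightarrow> 'n functional \<Rightarrow> 'n functional" where
  "spatial_part a2 a1 a0 t v =
     - (a2 t *\<^sub>D laplacian v) + (\<Sum>j\<in>UNIV. a1 j t *\<^sub>D distr_Dx j v) + a0 t *\<^sub>D v"

definition solves_CP ::
  "real \<Rightarrow> (real \<Rightarrow> complex) \<Rightarrow> ('n::finite \<Rightarrow> real \<Rightarrow> complex) \<Rightarrow> (real \<Rightarrow> complex) \<Rightarrow>
   (real \<Rightarrow> 'n functional) \<Rightarrow> 'n functional \<Rightarrow> (real \<Rightarrow> 'n functional) \<Rightarrow> bool" where
  "solves_CP T a2 a1 a0 f g u \<longleftrightarrow>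
     (\<exists>\<rho>. u \<in> C0_maps T (sobolev_top \<rho>)) \<and> u 0 = g \<and>
     (\<forall>\<phi>\<in>time_test T.
        weak_Dt T u \<phi> + time_distr T (\<lambda>t. spatial_part a2 a1 a0 t (u t)) \<phi> = time_distr T f \<phi>)"

text \<open>
  The power \<open>x\<^sup>q\<close> for \<open>x \<ge> 0\<close>, \<open>q \<ge> 0\<close> with \<open>0\<^sup>0 = 1\<close>, whereas \<open>0 powr 0 = 0\<close>. This
  matters for exponents \<open>q = 0\<close>, where \<open>|t - t\<^sub>k|\<^sup>q\<close> is the constant \<open>1\<close>.
\<close>

definition rpow :: "real \<Rightarrow> real \<Rightarrow> real" where
  "rpow x q = (if q = 0 then 1 else x powr q)"

end

theory Submission
  imports Defs
begin

text \<open>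
  In Fourier coefficients the Cauchy problem decouples into the linear equations
  \<open>y' = \<i> F - \<i> a\<^sub>\<xi> y\<close>, where \<open>a\<^sub>\<xi>(t)\<close> is the symbol, with \<open>Im a\<^sub>\<xi> \<le> c\<^sub>2 |\<xi>|\<^sup>2 + C |\<xi>| + Im a\<^sub>0\<close> and
  \<open>C = \<Sum>\<^sub>j |c\<^sub>1\<^sub>,\<^sub>j|\<close>. Everything rests on a bound for \<open>\<integral>\<^sub>s\<^sup>t Im a\<^sub>\<xi>\<close> uniform in \<open>\<xi>\<close> and \<open>s \<le> t\<close>. Away from
  the zeros of \<open>c\<^sub>2\<close> the quadratic term dominates for large \<open>|\<xi>|\<close>. Near \<open>t\<^sub>k\<close> the linear term wins
  only for \<open>|t - t\<^sub>k| \<lesssim> |\<xi>|\<^sup>-\<^sup>1\<^sup>/\<^sup>(\<^sup>p\<^sup>-\<^sup>q\<^sup>)\<close>, which contributes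
  \<open>|\<xi>|\<^sup>1\<^sup>-\<^sup>(\<^sup>q\<^sup>+\<^sup>1\<^sup>)\<^sup>/\<^sup>(\<^sup>p\<^sup>-\<^sup>q\<^sup>)\<close>, bounded because \<open>p \<le> 2 q + 1\<close>. The solution of each equation is then
  bounded by its data with a constant independent of \<open>\<xi>\<close>. The three spaces are described by
  the size of the Fourier coefficients, so this bound and dominated convergence give the
  solution, with a loss of \<open>|\<xi>|\<^sup>2\<close> for the time derivative. Uniqueness holds coefficient by
  coefficient, by the lemma of du Bois-Reymond.
\<close>

section \<open>Fourier analysis on the torus\<close>

text \<open>The exponents of the first order terms may exceed \<open>p\<close>, and then the
  critical time \<open>|\<xi>|^(-1/(p-q))\<close> makes no sense. The estimate is therefore run with
  the smallest non-negative q' satisfying p \<le> 2 q' + 1; it is less than p and at most each given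
  exponent, so for |t - t_k| \<le> 1 it only weakens the bound on the first order terms. The bound
  is needed from every s to every t, not only from 0, because it controls the kernel of the
  variation of constants formula.

  A second obstacle is the Gevrey topology, an inductive limit described by absolutely convex sets:
  continuity of f does not visibly give one decay rate for all times. Weighted suprema of the
  coefficients are continuous seminorms there, and a weight built from a supposed counterexample
  forces such a rate. Halving the rate then absorbs the polynomial growth of the symbol.

  In H^r the difference quotients of u come without a common majorant in frequency. They are
  averages of the time derivative, and Cauchy-Schwarz in time transfers its continuity to
  them.\<close>

definition character :: "int ^ 'n::finite \<Rightarrow> real ^ 'n \<Rightarrow> complex" where
  "character \<xi> x = exp (\<i> * of_real (x \<bullet> rvec \<xi>))"

abbreviation torus_box :: "(real ^ 'n::finite) set" where
  "torus_box \<equiv> cbox 0 (\<chi> j. 2 * pi)"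

definition fcoeff :: "(real ^ 'n::finite \<Rightarrow> complex) \<Rightarrow> int ^ 'n \<Rightarrow> complex" where
  "fcoeff \<phi> \<xi> = integral torus_box (\<lambda>x. \<phi> x * character (- \<xi>) x) / of_real ((2 * pi) ^ CARD('n))"

definition periodic :: "(real ^ 'n::finite \<Rightarrow> complex) \<Rightarrow> bool" where
  "periodic \<phi> \<longleftrightarrow> (\<forall>x (k :: int ^ 'n). \<phi> (x + (\<chi> j. 2 * pi * of_int (k $ j))) = \<phi> x)"

text \<open>A relation beside \<open>pd\<close>: one fact carries both differentiability along the
  axis at every point and the value of the derivative, whereas \<open>pd\<close> is total and says
  nothing about existence.\<close>

definition has_pd :: "'n::finite \<Rightarrow> (real ^ 'n \<Rightarrow> complex) \<Rightarrow> (real ^ 'n \<Rightarrow> complex) \<Rightarrow> bool" where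
  "has_pd j \<phi> \<phi>' \<longleftrightarrow> (\<forall>x. ((\<lambda>s. \<phi> (x + s *\<^sub>R axis j 1)) has_vector_derivative \<phi>' x) (at 0))"

lemma rvec_nth [simp]: "rvec \<xi> $ j = of_int (\<xi> $ j)"
  by (simp add: rvec_def)

lemma rvec_add: "rvec (\<xi> + \<eta>) = rvec \<xi> + rvec \<eta>"
  by (simp add: vec_eq_iff)

lemma rvec_minus: "rvec (- \<xi>) = - rvec \<xi>"
  by (simp add: vec_eq_iff)

lemma rvec_0 [simp]: "rvec 0 = 0"
  by (simp add: vec_eq_iff)

lemma character_add: "character (\<xi> + \<eta>) x = character \<xi> x * character \<eta> x"
  by (simp add: character_def rvec_add inner_add_right ring_distribs exp_add)

lemma character_0 [simp]: "character 0 x = 1"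
  by (simp add: character_def)

lemma norm_character [simp]: "norm (character \<xi> x) = 1"
  by (simp add: character_def)

lemma character_uminus: "character (- \<xi>) x = cnj (character \<xi> x)"
  by (simp add: character_def rvec_minus exp_cnj)

lemma continuous_character [continuous_intros]: "continuous_on A (character \<xi>)"
  unfolding character_def by (intro continuous_intros)

lemma fourier_eq: "fourier u \<xi> = u (character (- \<xi>))"
  by (simp add: fourier_def character_def[abs_def] rvec_minus)

lemma inner_axis_rvec: "axis j 1 \<bullet> rvec \<xi> = of_int (\<xi> $ j)"
  by (simp add: inner_axis')

lemma character_shift:
  "character \<xi> (x + s *\<^sub>R axis j 1) = character \<xi> x * exp (\<i> * of_real (s * of_int (\<xi> $ j)))"
  by (simp add: character_def inner_add_left inner_axis_rvec ring_distribs exp_add)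

lemma has_pd_character: "has_pd j (character \<xi>) (\<lambda>x. \<i> * of_int (\<xi> $ j) * character \<xi> x)"
  unfolding has_pd_def
proof
  fix x
  have "((\<lambda>s. exp (\<i> * of_real (s * of_int (\<xi> $ j)))) has_vector_derivative \<i> * of_int (\<xi> $ j)) (at 0)"
    using has_vector_derivative_real_field[of "\<lambda>z. exp (\<i> * (z * of_int (\<xi> $ j)))" "\<i> * of_int (\<xi> $ j)" 0 UNIV]
    by (simp, elim meta_mp) (auto intro!: derivative_eq_intros)
  from has_vector_derivative_mult_right[OF this, of "character \<xi> x"]
  show "((\<lambda>s. character \<xi> (x + s *\<^sub>R axis j 1)) has_vector_derivative
      \<i> * of_int (\<xi> $ j) * character \<xi> x) (at 0)"
    by (simp add: character_shift mult_ac)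
qed

lemma periodic_character: "periodic (character \<xi>)"
  unfolding periodic_def
proof (intro allI)
  fix x and k :: "int ^ 'a"
  have "(\<chi> j. 2 * pi * of_int (k $ j)) \<bullet> rvec \<xi> = 2 * pi * of_int (\<Sum>j\<in>UNIV. k $ j * \<xi> $ j)"
    by (simp add: inner_vec_def sum_distrib_left mult_ac)
  then have "exp (\<i> * of_real ((\<chi> j. 2 * pi * of_int (k $ j)) \<bullet> rvec \<xi>)) = 1"
    using exp_integer_2pi[OF Ints_of_int, of "\<Sum>j\<in>UNIV. k $ j * \<xi> $ j"] by (simp add: mult_ac)
  then show "character \<xi> (x + (\<chi> j. 2 * pi * of_int (k $ j))) = character \<xi> x"
    by (simp add: character_def inner_add_left ring_distribs exp_add)
qed

section \<open>Partial derivatives, smoothness and the test space\<close>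

lemma pd_eqI: "has_pd j \<phi> \<phi>' \<Longrightarrow> pd j \<phi> = \<phi>'"
  unfolding has_pd_def pd_def by (auto intro: vector_derivative_at)

text \<open>\<open>has_pd\<close> speaks only of the parameter 0, but at every base point; moving
  the base point along the axis gives the derivative at every parameter.\<close>

lemma has_pd_at:
  assumes "has_pd j \<phi> \<phi>'"
  shows "((\<lambda>s. \<phi> (x + s *\<^sub>R axis j 1)) has_vector_derivative \<phi>' (x + s0 *\<^sub>R axis j 1)) (at s0)"
proof -
  have "((\<lambda>s. \<phi> ((x + s0 *\<^sub>R axis j 1) + s *\<^sub>R axis j 1)) has_vector_derivative \<phi>' (x + s0 *\<^sub>R axis j 1)) (at 0)"
    using assms by (simp add: has_pd_def)
  then have "(((\<lambda>s. \<phi> ((x + s0 *\<^sub>R axis j 1) + s *\<^sub>R axis j 1)) \<circ> (\<lambda>s. s - s0)) has_vector_derivative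
      (1 *\<^sub>R \<phi>' (x + s0 *\<^sub>R axis j 1))) (at s0)"
    by (intro vector_diff_chain_at) (auto intro!: derivative_eq_intros)
  then show ?thesis
    by (simp add: o_def algebra_simps flip: scaleR_add_left)
qed

lemma has_pd_mult:
  assumes "has_pd j f f'" "has_pd j g g'"
  shows "has_pd j (\<lambda>x. f x * g x) (\<lambda>x. f x * g' x + f' x * g x)"
  unfolding has_pd_def
proof
  fix x
  show "((\<lambda>s. f (x + s *\<^sub>R axis j 1) * g (x + s *\<^sub>R axis j 1)) has_vector_derivative
      f x * g' x + f' x * g x) (at 0)"
    using has_vector_derivative_mult[OF assms[unfolded has_pd_def, rule_format, of x]] by simp
qed

lemma has_pd_add_mult:
  assumes "has_pd j f f'" "has_pd j g g'"
  shows "has_pd j (\<lambda>x. f x + c * g x) (\<lambda>x. f' x + c * g' x)"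
  using assms unfolding has_pd_def
  by (auto intro!: has_vector_derivative_add has_vector_derivative_mult_right)

lemma has_pd_periodic:
  assumes "periodic f" "has_pd j f f'"
  shows "periodic f'"
  unfolding periodic_def
proof (intro allI)
  fix x and k :: "int ^ 'a"
  let ?v = "\<chi> j. 2 * pi * of_int (k $ j)"
  have "f ((x + ?v) + s *\<^sub>R axis j 1) = f (x + s *\<^sub>R axis j 1)" for s
    using assms(1)[unfolded periodic_def, rule_format, of "x + s *\<^sub>R axis j 1" k] by (simp add: ac_simps)
  then have "((\<lambda>s. f (x + s *\<^sub>R axis j 1)) has_vector_derivative f' (x + ?v)) (at 0)"
    using assms(2)[unfolded has_pd_def, rule_format, of "x + ?v"] by simp
  then show "f' (x + ?v) = f' x"
    using assms(2)[unfolded has_pd_def, rule_format, of x]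
    by (metis vector_derivative_at)
qed

text \<open>Smoothness quantifies over all iterated derivatives. A class \<open>X\<close> of
  continuous functions closed under every \<open>D_j\<close> contains all the iterates of its
  members, so exhibiting such a class proves smoothness without describing the iterates.\<close>

lemma smooth_coinduct:
  assumes "\<phi> \<in> X"
    and "\<And>f. f \<in> X \<Longrightarrow> continuous_on UNIV f"
    and "\<And>f j. f \<in> X \<Longrightarrow> \<exists>f'. has_pd j f f' \<and> (\<lambda>x. 1 / \<i> * f' x) \<in> X"
  shows "smooth \<phi>"
proof -
  have "foldr Dx js \<phi> \<in> X" for js
  proof (induction js)
    case (Cons j js)
    obtain f' where f': "has_pd j (foldr Dx js \<phi>) f'" "(\<lambda>x. 1 / \<i> * f' x) \<in> X"
      using assms(3)[OF Cons] by blast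
    then have "Dx j (foldr Dx js \<phi>) = (\<lambda>x. 1 / \<i> * f' x)"
      by (simp add: Dx_def[abs_def] pd_eqI)
    with f' show ?case by simp
  qed (use assms in simp)
  then show ?thesis
    unfolding smooth_def using assms(2,3)
    by (auto simp: has_pd_def dest: differentiableI_vector) (metis differentiableI_vector)
qed

lemma smooth_Dx: "smooth \<phi> \<Longrightarrow> smooth (Dx j \<phi>)"
  unfolding smooth_def
proof (intro allI)
  fix js
  assume "\<forall>js. continuous_on UNIV (foldr Dx js \<phi>) \<and>
     (\<forall>j x. (\<lambda>s. foldr Dx js \<phi> (x + s *\<^sub>R axis j 1)) differentiable (at 0))"
  from spec[OF this, of "js @ [j]"]
  show "continuous_on UNIV (foldr Dx js (Dx j \<phi>)) \<and>
     (\<forall>i x. (\<lambda>s. foldr Dx js (Dx j \<phi>) (x + s *\<^sub>R axis i 1)) differentiable (at 0))"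
    by simp
qed

lemma smooth_continuous: "smooth \<phi> \<Longrightarrow> continuous_on A \<phi>"
  unfolding smooth_def by (metis foldr.simps(1) id_apply continuous_on_subset subset_UNIV)

lemma smooth_has_pd: "smooth \<phi> \<Longrightarrow> has_pd j \<phi> (pd j \<phi>)"
  unfolding smooth_def has_pd_def pd_def
  by (metis foldr.simps(1) id_apply vector_derivative_works)

lemma pd_eq_Dx: "pd j \<phi> = (\<lambda>x. \<i> * Dx j \<phi> x)"
  by (auto simp: Dx_def)

lemma smooth_add_mult:
  assumes "smooth f" "smooth g"
  shows "smooth (\<lambda>x. f x + c * g x)"
proof (rule smooth_coinduct[of _ "{\<lambda>x. f x + c * g x | f g. smooth f \<and> smooth g}"])
  fix h j assume "h \<in> {\<lambda>x. f x + c * g x | f g. smooth f \<and> smooth g}"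
  then obtain f g where h: "h = (\<lambda>x. f x + c * g x)" "smooth f" "smooth g" by blast
  show "\<exists>h'. has_pd j h h' \<and> (\<lambda>x. 1 / \<i> * h' x) \<in> {\<lambda>x. f x + c * g x | f g. smooth f \<and> smooth g}"
  proof (intro exI conjI)
    show "has_pd j h (\<lambda>x. pd j f x + c * pd j g x)"
      unfolding h by (intro has_pd_add_mult smooth_has_pd h)
    show "(\<lambda>x. 1 / \<i> * (pd j f x + c * pd j g x)) \<in> {\<lambda>x. f x + c * g x | f g. smooth f \<and> smooth g}"
      by (rule CollectI, rule exI[of _ "Dx j f"], rule exI[of _ "Dx j g"])
         (auto simp: Dx_def h smooth_Dx algebra_simps)
  qed
next
  show "(\<lambda>x. f x + c * g x) \<in> {\<lambda>x. f x + c * g x | f g. smooth f \<and> smooth g}"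
    using assms by blast
next
  fix h assume "h \<in> {\<lambda>x. f x + c * g x | f g. smooth f \<and> smooth g}"
  then show "continuous_on UNIV h"
    by clarify (intro continuous_on_add continuous_on_mult_left smooth_continuous)
qed

lemma torus_smooth_iff: "\<phi> \<in> torus_smooth \<longleftrightarrow> smooth \<phi> \<and> periodic \<phi>"
  by (simp add: torus_smooth_def periodic_def)

lemma torus_smooth_add_mult:
  "f \<in> torus_smooth \<Longrightarrow> g \<in> torus_smooth \<Longrightarrow> (\<lambda>x. f x + c * g x) \<in> torus_smooth"
  by (auto simp: torus_smooth_iff smooth_add_mult periodic_def)

lemma smooth_character: "smooth (\<lambda>x. c * character \<xi> x)"
proof (rule smooth_coinduct[of _ "range (\<lambda>c x. c * character \<xi> x)"])
  fix h j assume "h \<in> range (\<lambda>c x. c * character \<xi> x)"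
  then obtain c where h: "h = (\<lambda>x. c * character \<xi> x)" by blast
  have "has_pd j h (\<lambda>x. c * (\<i> * of_int (\<xi> $ j) * character \<xi> x))"
    using has_pd_character[of j \<xi>] unfolding h has_pd_def
    by (auto intro!: has_vector_derivative_mult_right)
  moreover have "(\<lambda>x. 1 / \<i> * (c * (\<i> * of_int (\<xi> $ j) * character \<xi> x))) =
      (\<lambda>x. (c * of_int (\<xi> $ j)) * character \<xi> x)"
    by (simp add: fun_eq_iff field_simps)
  ultimately show "\<exists>h'. has_pd j h h' \<and> (\<lambda>x. 1 / \<i> * h' x) \<in> range (\<lambda>c x. c * character \<xi> x)"
    by (metis rangeI)
next
  fix h assume "h \<in> range (\<lambda>c x. c * character \<xi> x)"
  then show "continuous_on UNIV h"
    by clarify (intro continuous_on_mult_left continuous_character)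
next
  show "(\<lambda>x. c * character \<xi> x) \<in> range (\<lambda>c x. c * character \<xi> x)"
    by (rule rangeI)
qed

lemma torus_smooth_character: "character \<xi> \<in> torus_smooth"
  using smooth_character[of 1 \<xi>] periodic_character by (auto simp: torus_smooth_iff)

lemma torus_smooth_zero: "(\<lambda>x. 0) \<in> torus_smooth"
  using smooth_character[of 0] by (auto simp: torus_smooth_iff periodic_def)

lemma torus_smooth_Dx: "\<phi> \<in> torus_smooth \<Longrightarrow> Dx j \<phi> \<in> torus_smooth"
  unfolding torus_smooth_iff
  using has_pd_periodic[OF _ smooth_has_pd, of \<phi> j]
  by (auto simp: smooth_Dx periodic_def Dx_def)

lemma torus_smooth_pd: "\<phi> \<in> torus_smooth \<Longrightarrow> pd j \<phi> \<in> torus_smooth"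
  using torus_smooth_add_mult[OF torus_smooth_zero torus_smooth_Dx[of \<phi> j], of \<i>]
  by (simp add: pd_eq_Dx)

lemma torus_smooth_foldr: "\<phi> \<in> torus_smooth \<Longrightarrow> foldr Dx js \<phi> \<in> torus_smooth"
  by (induction js) (auto intro: torus_smooth_Dx)

lemma torus_smooth_continuous: "\<phi> \<in> torus_smooth \<Longrightarrow> continuous_on A \<phi>"
  by (simp add: torus_smooth_iff smooth_continuous)

section \<open>Periodicity and integrals over one period\<close>

lemma periodic_reduce:
  fixes x :: "real ^ 'n::finite"
  obtains y k where "y \<in> torus_box" "x = y + (\<chi> j. 2 * pi * of_int ((k :: int ^ 'n) $ j))"
proof -
  define k :: "int ^ 'n" where "k = (\<chi> j. \<lfloor>x $ j / (2 * pi)\<rfloor>)"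
  define y where "y = x - (\<chi> j. 2 * pi * of_int (k $ j))"
  have "0 \<le> y $ j \<and> y $ j \<le> 2 * pi" for j
  proof -
    define z where "z = x $ j / (2 * pi)"
    have "y $ j = 2 * pi * (z - of_int \<lfloor>z\<rfloor>)"
      by (simp add: y_def k_def right_diff_distrib flip: z_def) (simp add: z_def)
    moreover have "0 \<le> z - of_int \<lfloor>z\<rfloor>" "z - of_int \<lfloor>z\<rfloor> \<le> 1"
      by linarith+
    ultimately show ?thesis
      by (simp add: mult_left_le)
  qed
  then have "y \<in> torus_box" by (simp add: mem_box_cart)
  moreover have "x = y + (\<chi> j. 2 * pi * of_int (k $ j))" by (simp add: y_def)
  ultimately show ?thesis using that by blast
qed

lemma periodic_eq:
  assumes "periodic \<phi>" obtains y where "y \<in> torus_box" "\<phi> x = \<phi> y"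
proof -
  obtain y k where "y \<in> torus_box" "x = y + (\<chi> j. 2 * pi * of_int ((k :: int ^ 'a) $ j))"
    by (rule periodic_reduce)
  with assms show ?thesis by (intro that) (simp_all add: periodic_def)
qed

lemma bdd_above_periodic:
  assumes "continuous_on UNIV \<phi>" "periodic \<phi>"
  shows "bdd_above (range (\<lambda>x. norm (\<phi> x)))"
proof -
  have "compact ((\<lambda>x. norm (\<phi> x)) ` torus_box)"
    by (intro compact_continuous_image compact_cbox continuous_intros continuous_on_subset[OF assms(1)]) auto
  then obtain B where B: "\<And>x. x \<in> torus_box \<Longrightarrow> norm (\<phi> x) \<le> B"
    by (force dest!: compact_imp_bounded bounded_imp_bdd_above simp: bdd_above_def)
  then show ?thesis
    by (intro bdd_aboveI2[of _ _ B]) (metis periodic_eq[OF assms(2)])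
qed

lemma torus_smooth_bdd: "\<phi> \<in> torus_smooth \<Longrightarrow> bdd_above (range (\<lambda>x. norm (\<phi> x)))"
  by (intro bdd_above_periodic torus_smooth_continuous) (auto simp: torus_smooth_iff)

lemma periodic_axis:
  assumes "periodic f" shows "f (x + (2 * pi) *\<^sub>R axis j 1) = f x"
proof -
  have "(2 * pi) *\<^sub>R axis j 1 = (\<chi> i. 2 * pi * of_int ((axis j 1 :: int ^ 'a) $ i))"
    by (auto simp: vec_eq_iff axis_def)
  then show ?thesis using assms[unfolded periodic_def, rule_format, of x "axis j 1"] by simp
qed

lemma integral_translate:
  fixes G :: "'a::euclidean_space \<Rightarrow> 'b::banach"
  assumes "continuous_on UNIV G"
  shows "integral (cbox a b) (\<lambda>x. G (x + c)) = integral (cbox (a + c) (b + c)) G"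
proof -
  have "(G has_integral integral (cbox (a + c) (b + c)) G) (cbox (a + c) (b + c))"
    by (intro integrable_integral integrable_continuous continuous_on_subset[OF assms]) auto
  from has_integral_affinity'[OF this, of 1 c] show ?thesis
    by (simp add: integral_unique)
qed

text \<open>The box and its shift by s in direction j both lie in a box that is longer by s. Cutting
  the long box at 2 pi leaves the original box and an end piece, cutting it at s leaves a starting
  piece and the shifted box; the two pieces have equal integrals by periodicity.\<close>

lemma integral_periodic_shift:
  fixes G :: "real ^ 'n::finite \<Rightarrow> complex"
  assumes G: "continuous_on UNIV G" "\<And>x. G (x + (2 * pi) *\<^sub>R axis j 1) = G x"
    and s: "0 \<le> s" "s \<le> 2 * pi"
  shows "integral torus_box (\<lambda>x. G (x + s *\<^sub>R axis j 1)) = integral torus_box G"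
proof -
  let ?e = "axis j (1 :: real)" and ?B = "(\<chi> j. 2 * pi) :: real ^ 'n"
  have int: "G integrable_on cbox a b" for a b
    by (intro integrable_continuous continuous_on_subset[OF G(1)]) auto
  have e: "?e \<in> Basis" by simp
  have box: "x \<in> cbox a b \<longleftrightarrow> (\<forall>i. i \<noteq> j \<longrightarrow> a $ i \<le> x $ i \<and> x $ i \<le> b $ i) \<and> a $ j \<le> x $ j \<and> x $ j \<le> b $ j"
    for a b x :: "real ^ 'n"
    unfolding mem_box_cart by metis
  \<comment> \<open>The condition 0 \<le> s \<le> 2 pi makes all four intersections boxes of the
    expected shape.\<close>
  have sets: "cbox 0 (?B + s *\<^sub>R ?e) \<inter> {x. x \<bullet> ?e \<le> 2 * pi} = cbox 0 ?B"
    "cbox 0 (?B + s *\<^sub>R ?e) \<inter> {x. x \<bullet> ?e \<ge> 2 * pi} = cbox ((2 * pi) *\<^sub>R ?e) (?B + s *\<^sub>R ?e)"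
    "cbox 0 (?B + s *\<^sub>R ?e) \<inter> {x. x \<bullet> ?e \<le> s} = cbox 0 (?B + s *\<^sub>R ?e - (2 * pi) *\<^sub>R ?e)"
    "cbox 0 (?B + s *\<^sub>R ?e) \<inter> {x. x \<bullet> ?e \<ge> s} = cbox (s *\<^sub>R ?e) (?B + s *\<^sub>R ?e)"
    using s pi_gt_zero unfolding set_eq_iff Int_iff mem_Collect_eq box inner_axis
    by (auto simp: axis_def)
  have "integral (cbox 0 ?B) (\<lambda>x. G (x + s *\<^sub>R ?e)) = integral (cbox (s *\<^sub>R ?e) (?B + s *\<^sub>R ?e)) G"
    by (simp add: integral_translate[OF G(1)])
  moreover have "integral (cbox 0 (?B + s *\<^sub>R ?e)) G =
      integral (cbox 0 ?B) G + integral (cbox ((2 * pi) *\<^sub>R ?e) (?B + s *\<^sub>R ?e)) G"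
    using integral_split[OF int e, of 0 "?B + s *\<^sub>R ?e" "2 * pi"] by (simp add: sets)
  moreover have "integral (cbox 0 (?B + s *\<^sub>R ?e)) G =
      integral (cbox 0 (?B + s *\<^sub>R ?e - (2 * pi) *\<^sub>R ?e)) G + integral (cbox (s *\<^sub>R ?e) (?B + s *\<^sub>R ?e)) G"
    using integral_split[OF int e, of 0 "?B + s *\<^sub>R ?e" s] by (simp add: sets)
  moreover have "integral (cbox 0 (?B + s *\<^sub>R ?e - (2 * pi) *\<^sub>R ?e)) (\<lambda>x. G (x + (2 * pi) *\<^sub>R ?e)) =
      integral (cbox ((2 * pi) *\<^sub>R ?e) (?B + s *\<^sub>R ?e)) G"
    by (simp add: integral_translate[OF G(1)])
  ultimately show ?thesis by (simp add: G(2))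
qed

text \<open>Differentiate the translation invariance of the integral over a period.\<close>

lemma integral_has_pd:
  fixes G :: "real ^ 'n::finite \<Rightarrow> complex"
  assumes G: "continuous_on UNIV G" "periodic G" "has_pd j G G'" "continuous_on UNIV G'"
  shows "integral torus_box G' = 0"
proof -
  let ?U = "{0..2 * pi}" and ?e = "axis j (1 :: real)"
  \<comment> \<open>The derivative is taken one-sidedly at 0 because
    \<open>integral_periodic_shift\<close> covers only shifts in [0, 2 pi].\<close>
  have "((\<lambda>s. integral torus_box (\<lambda>x. G (x + s *\<^sub>R ?e))) has_vector_derivative
      integral torus_box (\<lambda>x. G' (x + 0 *\<^sub>R ?e))) (at 0 within ?U)"
  proof (rule leibniz_rule_vector_derivative)
    fix s x
    show "((\<lambda>s. G (x + s *\<^sub>R ?e)) has_vector_derivative G' (x + s *\<^sub>R ?e)) (at s within ?U)"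
      using has_pd_at[OF G(3)] by (rule has_vector_derivative_at_within)
    show "(\<lambda>x. G (x + s *\<^sub>R ?e)) integrable_on torus_box"
      by (intro integrable_continuous continuous_on_compose2[OF G(1)] continuous_intros) auto
  next
    show "continuous_on (?U \<times> torus_box) (\<lambda>(s, x). G' (x + s *\<^sub>R ?e))"
      unfolding split_beta by (intro continuous_on_compose2[OF G(4)] continuous_intros) auto
  qed auto
  moreover have "((\<lambda>s. integral torus_box (\<lambda>x. G (x + s *\<^sub>R ?e))) has_vector_derivative 0) (at 0 within ?U)"
    by (rule has_vector_derivative_transform[OF _ _ has_vector_derivative_const[of "integral torus_box G"]])
      (auto simp: integral_periodic_shift[OF G(1) periodic_axis[OF G(2)]])
  ultimately show ?thesis
    using vector_derivative_unique_within[of 0 ?U] by (force simp: at_within_Icc_at_right)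
qed

text \<open>Integration by parts without boundary terms: \<phi> times a character is periodic, so
  its partial derivative integrates to 0 over a period.\<close>

lemma fcoeff_pd:
  assumes "continuous_on UNIV \<phi>" "periodic \<phi>" "has_pd j \<phi> \<phi>'" "continuous_on UNIV \<phi>'"
  shows "fcoeff \<phi>' \<xi> = \<i> * of_int (\<xi> $ j) * fcoeff \<phi> \<xi>"
proof -
  let ?G' = "\<lambda>x. \<phi> x * (\<i> * of_int ((- \<xi>) $ j) * character (- \<xi>) x) + \<phi>' x * character (- \<xi>) x"
  have "integral torus_box ?G' = 0"
  proof (rule integral_has_pd)
    show "has_pd j (\<lambda>x. \<phi> x * character (- \<xi>) x) ?G'"
      by (intro has_pd_mult assms has_pd_character)
    show "periodic (\<lambda>x. \<phi> x * character (- \<xi>) x)"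
      using assms(2) periodic_character[of "- \<xi>"] by (simp add: periodic_def)
  qed (intro continuous_intros assms)+
  moreover have "integral torus_box ?G' =
     integral torus_box (\<lambda>x. \<i> * of_int ((- \<xi>) $ j) * (\<phi> x * character (- \<xi>) x)) +
     integral torus_box (\<lambda>x. \<phi>' x * character (- \<xi>) x)"
    by (subst integral_add[symmetric])
      (auto intro!: integrable_continuous continuous_intros assms(1,4)[THEN continuous_on_subset] simp: mult_ac)
  moreover have "integral torus_box (\<lambda>x. \<i> * of_int ((- \<xi>) $ j) * (\<phi> x * character (- \<xi>) x)) =
     \<i> * of_int ((- \<xi>) $ j) * integral torus_box (\<lambda>x. \<phi> x * character (- \<xi>) x)"
    by (rule integral_mult_right)
  ultimately have "integral torus_box (\<lambda>x. \<phi>' x * character (- \<xi>) x) =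
     \<i> * of_int (\<xi> $ j) * integral torus_box (\<lambda>x. \<phi> x * character (- \<xi>) x)"
    by (simp add: add_eq_0_iff2)
  then show ?thesis
    by (simp add: fcoeff_def)
qed

lemma fcoeff_cmult: "fcoeff (\<lambda>x. c * \<phi> x) \<xi> = c * fcoeff \<phi> \<xi>"
  by (simp add: fcoeff_def mult.assoc)

lemma fcoeff_Dx: "\<phi> \<in> torus_smooth \<Longrightarrow> fcoeff (Dx j \<phi>) \<xi> = of_int (\<xi> $ j) * fcoeff \<phi> \<xi>"
proof -
  assume \<phi>: "\<phi> \<in> torus_smooth"
  have "fcoeff (pd j \<phi>) \<xi> = \<i> * of_int (\<xi> $ j) * fcoeff \<phi> \<xi>"
    using \<phi> torus_smooth_pd[OF \<phi>, of j]
    by (intro fcoeff_pd) (auto simp: torus_smooth_iff smooth_continuous smooth_has_pd)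
  moreover have "fcoeff (pd j \<phi>) \<xi> = \<i> * fcoeff (Dx j \<phi>) \<xi>"
    by (simp add: pd_eq_Dx fcoeff_cmult)
  ultimately show ?thesis by (metis complex_i_not_zero mult.assoc mult_cancel_left)
qed

lemma measure_torus_box: "measure lborel (torus_box :: (real ^ 'n::finite) set) = (2 * pi) ^ CARD('n)"
proof -
  have "(0 :: real ^ 'n) \<in> torus_box"
    by (simp add: mem_box_cart)
  then have "torus_box \<noteq> ({} :: (real ^ 'n) set)"
    by blast
  from content_cbox_cart[OF this] show ?thesis by simp
qed

lemma norm_fcoeff_le:
  fixes \<phi> :: "real ^ 'n::finite \<Rightarrow> complex"
  assumes "continuous_on UNIV \<phi>" "\<And>x. norm (\<phi> x) \<le> B"
  shows "norm (fcoeff \<phi> \<xi>) \<le> B"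
proof -
  have "norm (integral torus_box (\<lambda>x. \<phi> x * character (- \<xi>) x)) \<le>
      B * measure lborel (torus_box :: (real ^ 'n) set)"
  proof (rule integrable_bound)
    show "0 \<le> B" using assms(2) norm_ge_zero order_trans by blast
    show "(\<lambda>x. \<phi> x * character (- \<xi>) x) integrable_on torus_box"
      by (intro integrable_continuous continuous_intros continuous_on_subset[OF assms(1)]) auto
  qed (simp add: norm_mult assms)
  then show ?thesis
    by (simp add: fcoeff_def norm_divide measure_torus_box norm_mult norm_power divide_le_eq)
qed

text \<open>Orthogonality by comparing eigenvalues: \<open>D_j\<close> multiplies the character by
  \<open>\<eta>_j\<close> and any coefficient at \<xi> by \<open>\<xi>_j\<close>. Where these differ
  the coefficient must vanish.\<close>

lemma fcoeff_character:
  "fcoeff (character \<eta>) \<xi> = (if \<xi> = \<eta> then 1 else 0)"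
proof (cases "\<xi> = \<eta>")
  case True
  have "character \<eta> x * character (- \<eta>) x = 1" for x
    by (simp flip: character_add)
  then show ?thesis
    using True measure_torus_box[where 'n = 'a] by (simp add: fcoeff_def scaleR_conv_of_real)
next
  case False
  then obtain j where j: "\<xi> $ j \<noteq> \<eta> $ j" by (auto simp: vec_eq_iff)
  have "fcoeff (Dx j (character \<eta>)) \<xi> = of_int (\<xi> $ j) * fcoeff (character \<eta>) \<xi>"
    by (rule fcoeff_Dx[OF torus_smooth_character])
  moreover have "Dx j (character \<eta>) = (\<lambda>x. of_int (\<eta> $ j) * character \<eta> x)"
    unfolding Dx_def[abs_def] pd_eqI[OF has_pd_character] by (simp add: fun_eq_iff mult.assoc)
  moreover have "fcoeff (\<lambda>x. of_int (\<eta> $ j) * character \<eta> x) \<xi> = of_int (\<eta> $ j) * fcoeff (character \<eta>) \<xi>"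
    by (rule fcoeff_cmult)
  ultimately show ?thesis using j False by simp
qed

section \<open>Density of trigonometric polynomials and uniqueness of Fourier coefficients\<close>

inductive trig_poly :: "(real ^ 'n::finite \<Rightarrow> complex) \<Rightarrow> bool" where
  trig_poly_character: "trig_poly (\<lambda>x. c * character \<xi> x)"
| trig_poly_add: "trig_poly p \<Longrightarrow> trig_poly q \<Longrightarrow> trig_poly (\<lambda>x. p x + q x)"

lemma trig_poly_mult:
  assumes "trig_poly p" "trig_poly q"
  shows "trig_poly (\<lambda>x. p x * q x)"
  using assms
proof (induction arbitrary: q)
  case (trig_poly_character c \<xi>)
  then show ?case
  proof (induction)
    case (trig_poly_character d \<eta>)
    have "(\<lambda>x. c * character \<xi> x * (d * character \<eta> x)) = (\<lambda>x. (c * d) * character (\<xi> + \<eta>) x)"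
      by (simp add: character_add mult_ac fun_eq_iff)
    then show ?case by (metis trig_poly.trig_poly_character)
  next
    case (trig_poly_add p q)
    then show ?case by (simp add: ring_distribs trig_poly.trig_poly_add)
  qed
next
  case (trig_poly_add p q)
  then show ?case by (simp add: ring_distribs trig_poly.trig_poly_add)
qed

lemma trig_poly_const: "trig_poly (\<lambda>x. c)"
  using trig_poly_character[of c 0] by simp

lemma trig_poly_continuous: "trig_poly p \<Longrightarrow> continuous_on A p"
  by (induction rule: trig_poly.induct) (auto intro!: continuous_intros)

lemma integral_trig_poly_eq_0:
  assumes "continuous_on UNIV \<phi>" "\<And>\<xi>. fcoeff \<phi> \<xi> = 0" "trig_poly p"
  shows "integral torus_box (\<lambda>x. \<phi> x * p x) = 0"
  using assms(3)
proof induction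
  case (trig_poly_character c \<xi>)
  have "integral torus_box (\<lambda>x. c * (\<phi> x * character \<xi> x)) = c * integral torus_box (\<lambda>x. \<phi> x * character \<xi> x)"
    by (rule integral_mult_right)
  also have "integral torus_box (\<lambda>x. \<phi> x * character \<xi> x) = 0"
    using assms(2)[of "- \<xi>"] by (simp add: fcoeff_def)
  finally show ?case by (simp add: mult.left_commute)
next
  case (trig_poly_add p q)
  have "(\<lambda>x. \<phi> x * p x) integrable_on torus_box" "(\<lambda>x. \<phi> x * q x) integrable_on torus_box"
    by (intro integrable_continuous continuous_intros trig_poly_continuous trig_poly_add.hyps
        continuous_on_subset[OF assms(1)]; simp)+
  with trig_poly_add.IH show ?case
    by (simp add: ring_distribs integral_add)
qed

text \<open>Stone-Weierstrass needs a compact space, so the torus is realized as the image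
  \<open>S\<close> of the period box under \<open>E\<close>, a product of unit circles in complex
  N-space. A periodic f descends to \<open>h\<close> on \<open>S\<close>, and the algebra
  \<open>R\<close> consists of the functions on \<open>S\<close> whose pullback is a trigonometric
  polynomial.\<close>

lemma trig_poly_dense:
  fixes f :: "real ^ 'n::finite \<Rightarrow> real"
  assumes f: "continuous_on UNIV f" "periodic (\<lambda>x. of_real (f x))" and "e > 0"
  shows "\<exists>p. trig_poly p \<and> (\<forall>x. norm (of_real (f x) - p x) < e)"
proof -
  define E :: "real ^ 'n \<Rightarrow> complex ^ 'n" where "E x = (\<chi> j. exp (\<i> * of_real (x $ j)))" for x
  define S where "S = E ` torus_box"
  have contE: "continuous_on A E" for A
    unfolding E_def by (intro continuous_intros)
  have E_shift: "E (x + (\<chi> j. 2 * pi * of_int ((k :: int ^ 'n) $ j))) = E x" for x k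
  proof -
    have "exp (\<i> * of_real (2 * pi * of_int (k $ j))) = 1" for j
      using exp_integer_2pi[OF Ints_of_int, of "k $ j"] by (simp add: mult_ac)
    then show ?thesis by (simp add: E_def ring_distribs exp_add vec_eq_iff)
  qed
  have rangeE: "E x \<in> S" for x
    using periodic_reduce[of x] E_shift unfolding S_def by (metis imageI)
  \<comment> \<open>Equal exponentials differ by 2 pi times an integer in each coordinate, so f
    takes the same value; this makes \<open>h\<close> well defined despite the choice in its
    definition.\<close>
  have E_eq: "f x = f y" if "E x = E y" for x y
  proof -
    have "\<exists>n. x $ j = y $ j + 2 * pi * of_int n" for j
    proof -
      have "exp (\<i> * of_real (x $ j)) = exp (\<i> * of_real (y $ j))"
        using that by (simp add: E_def vec_eq_iff)
      then obtain n :: int where "\<i> * of_real (x $ j) = \<i> * of_real (y $ j) + (of_int (2 * n) * pi) * \<i>"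
        unfolding exp_eq by blast
      then have "Im (\<i> * of_real (x $ j)) = Im (\<i> * of_real (y $ j) + (of_int (2 * n) * pi) * \<i>)"
        by simp
      then show ?thesis by (intro exI[of _ n]) simp
    qed
    then obtain n where n: "\<And>j. x $ j = y $ j + 2 * pi * of_int (n j)" by metis
    then have "x = y + (\<chi> j. 2 * pi * of_int ((\<chi> j. n j :: int ^ 'n) $ j))"
      by (simp add: vec_eq_iff)
    then have "of_real (f x) = (of_real (f y) :: complex)"
      using f(2)[unfolded periodic_def, rule_format, of y "\<chi> j. n j"] by simp
    then show ?thesis by simp
  qed
  define h where "h z = f (SOME x. E x = z)" for z
  have h: "h (E x) = f x" for x
    unfolding h_def by (rule E_eq, rule someI[of "\<lambda>y. E y = E x"]) simp
  \<comment> \<open>On the compact box \<open>E\<close> is a quotient map onto \<open>S\<close>, so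
    openness of preimages under \<open>h\<close> can be checked after pulling back to the box, where
    they are preimages under f.\<close>
  have conth: "continuous_on S h"
    unfolding continuous_on_open
  proof (intro allI impI)
    fix U assume U: "openin (top_of_set (h ` S)) U"
    have "openin (top_of_set torus_box) (torus_box \<inter> f -` U)"
    proof -
      have "f ` torus_box = h ` S"
        by (auto simp: S_def h image_image)
      with U show ?thesis
        using continuous_on_subset[OF f(1), of torus_box] unfolding continuous_on_open by simp
    qed
    also have "torus_box \<inter> f -` U = torus_box \<inter> E -` (S \<inter> h -` U)"
      by (auto simp: h S_def dest: E_eq)
    finally show "openin (top_of_set S) (S \<inter> h -` U)"
      using Abstract_Topology_2.continuous_imp_quotient_map[OF contE _ compact_cbox, of 0 "\<chi> j. 2 * pi" S "S \<inter> h -` U"]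
      by (simp add: S_def)
  qed
  define R where "R = {g. continuous_on S g \<and> (\<exists>p. trig_poly p \<and> (\<forall>x. of_real (g (E x)) = p x))}"
  interpret function_ring_on R S
  proof
    show "compact S"
      unfolding S_def by (intro compact_continuous_image contE compact_cbox)
  next
    fix g assume "g \<in> R" then show "continuous_on S g" by (simp add: R_def)
  next
    fix g1 g2 assume "g1 \<in> R" "g2 \<in> R"
    then obtain p1 p2 where *: "continuous_on S g1" "continuous_on S g2" "trig_poly p1" "trig_poly p2"
        "\<And>x. of_real (g1 (E x)) = p1 x" "\<And>x. of_real (g2 (E x)) = p2 x"
      by (auto simp: R_def)
    show "(\<lambda>x. g1 x + g2 x) \<in> R"
      using * trig_poly_add[OF *(3,4)] by (auto simp: R_def intro!: continuous_intros)
    show "(\<lambda>x. g1 x * g2 x) \<in> R"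
      using * trig_poly_mult[OF *(3,4)] by (auto simp: R_def intro!: continuous_intros)
  next
    fix c show "(\<lambda>_. c) \<in> R"
      using trig_poly_const[of "of_real c"] by (auto simp: R_def)
  next
    \<comment> \<open>Points are separated by the real or imaginary part of a coordinate; on the
      torus these are combinations of a character and its conjugate.\<close>
    fix z w assume "z \<in> S" "w \<in> S" "z \<noteq> w"
    then obtain j where j: "z $ j \<noteq> w $ j" by (auto simp: vec_eq_iff)
    have ch: "exp (\<i> * of_real (x $ j)) = character (axis j 1) x" for x :: "real ^ 'n"
    proof -
      have "rvec (axis j 1) = (axis j 1 :: real ^ 'n)"
        by (auto simp: vec_eq_iff axis_def)
      then show ?thesis by (simp add: character_def inner_axis)
    qed
    have Re_eq: "of_real (Re c) = 1/2 * c + 1/2 * cnj c" and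
         Im_eq: "of_real (Im c) = (- \<i> / 2) * c + (\<i> / 2) * cnj c" for c :: complex
      by (simp_all add: complex_eq_iff)
    have Re_R: "(\<lambda>z. Re (z $ j)) \<in> R"
      unfolding R_def
    proof (intro CollectI conjI exI allI)
      show "trig_poly (\<lambda>x. 1/2 * character (axis j 1) x + 1/2 * character (- axis j 1) x)"
        by (intro trig_poly.intros)
    qed (auto intro!: continuous_intros simp: E_def ch Re_eq character_uminus simp del: of_real_divide)
    have Im_R: "(\<lambda>z. Im (z $ j)) \<in> R"
      unfolding R_def
    proof (intro CollectI conjI exI allI)
      show "trig_poly (\<lambda>x. (- \<i> / 2) * character (axis j 1) x + (\<i> / 2) * character (- axis j 1) x)"
        by (intro trig_poly.intros)
    qed (auto intro!: continuous_intros simp: E_def ch Im_eq character_uminus)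
    have "Re (z $ j) \<noteq> Re (w $ j) \<or> Im (z $ j) \<noteq> Im (w $ j)"
      using j by (simp add: complex_eq_iff)
    then show "\<exists>g\<in>R. g z \<noteq> g w"
      using bexI[OF _ Re_R, of "\<lambda>g. g z \<noteq> g w"] bexI[OF _ Im_R, of "\<lambda>g. g z \<noteq> g w"] by argo
  qed
  obtain g where g: "g \<in> R" "\<And>z. z \<in> S \<Longrightarrow> \<bar>h z - g z\<bar> < e"
    using Stone_Weierstrass_basic[OF conth \<open>e > 0\<close>] by blast
  then obtain p where p: "trig_poly p" "\<And>x. of_real (g (E x)) = p x"
    by (auto simp: R_def)
  have "norm (of_real (f x) - p x) < e" for x
  proof -
    have "norm (of_real (f x) - p x) = norm (of_real (h (E x) - g (E x)) :: complex)"
      by (simp add: h flip: p(2))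
    also have "\<dots> < e" using g(2)[OF rangeE] by (simp only: norm_of_real)
    finally show ?thesis .
  qed
  with p(1) show ?thesis by blast
qed

lemma periodic_Re: "periodic \<phi> \<Longrightarrow> periodic (\<lambda>x. of_real (Re (\<phi> x)))"
  and periodic_Im: "periodic \<phi> \<Longrightarrow> periodic (\<lambda>x. of_real (Im (\<phi> x)))"
  by (simp_all add: periodic_def)

text \<open>\<open>\<phi>\<close> is orthogonal to the trigonometric polynomials, which approximate its conjugate
  uniformly; hence the integral of \<open>\<bar>\<phi>\<bar>\<^sup>2\<close> vanishes.\<close>

lemma fcoeff_eq_0_imp:
  fixes \<phi> :: "real ^ 'n::finite \<Rightarrow> complex"
  assumes \<phi>: "continuous_on UNIV \<phi>" "periodic \<phi>" and 0: "\<And>\<xi>. fcoeff \<phi> \<xi> = 0"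
  shows "\<phi> x = 0"
proof -
  have cont: "continuous_on torus_box \<phi>"
    by (rule continuous_on_subset[OF \<phi>(1)]) simp
  obtain B where B: "\<And>x. norm (\<phi> x) \<le> B"
    using bdd_above_periodic[OF \<phi>] by (auto simp: bdd_above_def)
  have B0: "0 \<le> B" using B norm_ge_zero order_trans by blast
  define V where "V = measure lborel (torus_box :: (real ^ 'n) set)"
  have V: "V > 0" unfolding V_def measure_torus_box by simp
  define J where "J = integral torus_box (\<lambda>x. (norm (\<phi> x))\<^sup>2)"
  have J: "integral torus_box (\<lambda>x. \<phi> x * cnj (\<phi> x)) = of_real J"
  proof -
    have "((\<lambda>x. (norm (\<phi> x))\<^sup>2) has_integral J) torus_box"
      unfolding J_def by (intro integrable_integral integrable_continuous continuous_intros cont)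
    from has_integral_linear[OF this bounded_linear_of_real]
    have "((\<lambda>x. of_real ((norm (\<phi> x))\<^sup>2)) has_integral (of_real J :: complex)) torus_box"
      by (simp add: o_def)
    then show ?thesis
      by (simp add: complex_norm_square integral_unique del: of_real_power)
  qed
  have small: "\<bar>J\<bar> \<le> e * (2 * B * V)" if "e > 0" for e
  proof -
    obtain p1 p2 where p: "trig_poly p1" "\<And>x. norm (of_real (Re (\<phi> x)) - p1 x) < e"
        "trig_poly p2" "\<And>x. norm (of_real (Im (\<phi> x)) - p2 x) < e"
      using trig_poly_dense[OF continuous_on_Re[OF \<phi>(1)] periodic_Re[OF \<phi>(2)] \<open>e > 0\<close>]
        trig_poly_dense[OF continuous_on_Im[OF \<phi>(1)] periodic_Im[OF \<phi>(2)] \<open>e > 0\<close>] by blast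
    \<comment> \<open>Approximates the conjugate of \<phi>, that is the real part minus \<i> times
      the imaginary part.\<close>
    define p where "p x = p1 x + (- \<i>) * p2 x" for x
    have tp: "trig_poly p"
      unfolding p_def[abs_def] by (intro trig_poly_add trig_poly_mult trig_poly_const p)
    have close: "norm (cnj (\<phi> x) - p x) \<le> 2 * e" for x
    proof -
      have "cnj (\<phi> x) - p x = (of_real (Re (\<phi> x)) - p1 x) - \<i> * (of_real (Im (\<phi> x)) - p2 x)"
        by (simp add: p_def complex_eq_iff)
      also have "norm \<dots> \<le> norm (of_real (Re (\<phi> x)) - p1 x) + norm (of_real (Im (\<phi> x)) - p2 x)"
        by (rule order_trans[OF norm_triangle_ineq4]) (simp add: norm_mult)
      also have "\<dots> \<le> 2 * e" using p(2)[of x] p(4)[of x] by linarith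
      finally show ?thesis .
    qed
    have "integral torus_box (\<lambda>x. \<phi> x * (cnj (\<phi> x) - p x)) =
        integral torus_box (\<lambda>x. \<phi> x * cnj (\<phi> x)) - integral torus_box (\<lambda>x. \<phi> x * p x)"
      unfolding right_diff_distrib
      by (intro integral_diff integrable_continuous continuous_intros cont trig_poly_continuous tp)
    then have "of_real J = integral torus_box (\<lambda>x. \<phi> x * (cnj (\<phi> x) - p x))"
      by (simp add: J integral_trig_poly_eq_0[OF \<phi>(1) 0 tp])
    then have "norm (of_real J :: complex) = norm (integral torus_box (\<lambda>x. \<phi> x * (cnj (\<phi> x) - p x)))"
      by (rule arg_cong)
    also have "\<dots> \<le> (B * (2 * e)) * measure lborel (torus_box :: (real ^ 'n) set)"
      using \<open>e > 0\<close> B0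
      by (intro integrable_bound integrable_continuous continuous_intros cont trig_poly_continuous tp)
        (auto simp: norm_mult intro!: mult_mono B close)
    finally show ?thesis by (simp add: V_def mult_ac)
  qed
  have "\<bar>J\<bar> \<le> 0 + e" if "e > 0" for e
  proof -
    \<comment> \<open>The added 1 keeps the denominator positive when \<open>B\<close> is 0.\<close>
    have "\<bar>J\<bar> \<le> (e / (2 * B * V + 1)) * (2 * B * V)"
      using that B0 V by (intro small divide_pos_pos add_nonneg_pos) auto
    also have "\<dots> \<le> e"
      using that B0 V by (simp add: divide_le_eq add_nonneg_pos mult_left_mono distrib_left)
    finally show ?thesis by simp
  qed
  then have "J = 0" using field_le_epsilon[of "\<bar>J\<bar>" 0] by simp
  moreover have "box 0 (\<chi> j. 2 * pi) \<noteq> ({} :: (real ^ 'n) set)"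
    unfolding interval_ne_empty_cart by simp
  ultimately have "\<forall>x\<in>torus_box. (norm (\<phi> x))\<^sup>2 = 0"
    unfolding J_def
    by (subst (asm) integral_cbox_eq_0_iff) (auto intro!: continuous_intros cont)
  then show ?thesis
    by (metis periodic_eq[OF \<phi>(2)] norm_eq_zero power2_eq_iff zero_eq_power2)
qed

section \<open>Fourier series of smooth functions and of distributions\<close>

definition weight :: "int ^ 'n::finite \<Rightarrow> real" where
  "weight \<xi> = 1 + norm (rvec \<xi>)"

text \<open>Rapid families turn out to be exactly the coefficient families of smooth periodic
  functions, and \<open>tempered\<close> families those of distributions. Everything later is
  phrased through these two conditions.\<close>

definition rapid :: "(int ^ 'n::finite \<Rightarrow> complex) \<Rightarrow> bool" where
  "rapid c \<longleftrightarrow> (\<forall>k. \<exists>C. \<forall>\<xi>. norm (c \<xi>) * weight \<xi> ^ k \<le> C)"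

definition tempered :: "(int ^ 'n::finite \<Rightarrow> complex) \<Rightarrow> bool" where
  "tempered c \<longleftrightarrow> (\<exists>C k. \<forall>\<xi>. norm (c \<xi>) \<le> C * weight \<xi> ^ k)"

lemma weight_ge_1: "1 \<le> weight \<xi>" and weight_pos: "0 < weight \<xi>" and weight_nonneg: "0 \<le> weight \<xi>"
  by (simp_all add: weight_def add_pos_nonneg)

lemma weight_uminus [simp]: "weight (- \<xi>) = weight \<xi>"
  by (simp add: weight_def rvec_minus)

lemma component_le_weight: "\<bar>of_int (\<xi> $ j)\<bar> + 1 \<le> weight \<xi>"
  using component_le_norm_cart[of "rvec \<xi>" j] by (simp add: weight_def)

text \<open>Take a component of maximal modulus. This lets pure derivatives in a single direction
  control all powers of the frequency.\<close>

lemma norm_rvec_le_component: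
  fixes \<xi> :: "int ^ 'n::finite"
  shows "\<exists>j. norm (rvec \<xi>) \<le> real CARD('n) * \<bar>real_of_int (\<xi> $ j)\<bar>"
proof -
  let ?M = "Max (range (\<lambda>i. \<bar>of_int (\<xi> $ i) :: real\<bar>))"
  have "?M \<in> range (\<lambda>i. \<bar>of_int (\<xi> $ i) :: real\<bar>)"
    by (rule Max_in) auto
  then obtain j where "?M = \<bar>of_int (\<xi> $ j)\<bar>" by blast
  then have j: "\<bar>of_int (\<xi> $ i) :: real\<bar> \<le> \<bar>of_int (\<xi> $ j)\<bar>" for i
    by (metis Max_ge finite_imageI finite_class.finite_UNIV rangeI)
  have "norm (rvec \<xi>) \<le> (\<Sum>i\<in>UNIV. \<bar>rvec \<xi> $ i\<bar>)"
    by (rule norm_le_l1_cart)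
  also have "\<dots> \<le> (\<Sum>i\<in>(UNIV :: 'n set). \<bar>of_int (\<xi> $ j)\<bar>)"
    by (intro sum_mono) (simp add: j)
  finally show ?thesis by auto
qed

lemma summable_int_inverse_square: "(\<lambda>k::int. 1 / (1 + \<bar>of_int k :: real\<bar>)\<^sup>2) summable_on UNIV"
proof -
  let ?f = "\<lambda>k::int. 1 / (1 + \<bar>of_int k :: real\<bar>)\<^sup>2"
  have nat: "(\<lambda>n::nat. 1 / (1 + real n)\<^sup>2) summable_on UNIV"
  proof (rule norm_summable_imp_summable_on)
    have "summable (\<lambda>n. inverse (real (Suc n) ^ 2))"
      using inverse_power_summable[of 2, where 'a = real] summable_Suc_iff[of "\<lambda>n. inverse (real n ^ 2)"]
      by simp
    then show "summable (\<lambda>n. norm (1 / (1 + real n)\<^sup>2))"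
      by (simp add: inverse_eq_divide)
  qed
  have "?f summable_on (range int)"
    by (subst summable_on_reindex) (use nat in \<open>auto simp: o_def\<close>)
  moreover have "?f summable_on (range (\<lambda>n. - int n))"
    by (subst summable_on_reindex) (use nat in \<open>auto simp: o_def inj_def\<close>)
  then have "?f summable_on (range (\<lambda>n. - int n) - range int)"
    by (rule summable_on_subset_banach) auto
  ultimately have "?f summable_on (range int \<union> (range (\<lambda>n. - int n) - range int))"
    by (intro summable_on_Un_disjoint) auto
  moreover have "range int \<union> (range (\<lambda>n. - int n) - range int) = UNIV"
    by (auto simp: image_iff) (metis int_cases2)
  ultimately show ?thesis by simp
qed

text \<open>The weight dominates each 1 + |\<xi>_j|, so the term is at most the product of the
  one-dimensional terms 1/(1 + |\<xi>_j|)^2. A finite set of frequencies sits in a cube B^N, over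
  which the sum of products factors into a product of one-dimensional sums.\<close>

lemma summable_weight:
  "(\<lambda>\<xi>::int ^ 'n::finite. 1 / weight \<xi> ^ (2 * CARD('n))) summable_on UNIV"
proof (rule nonneg_bdd_above_summable_on)
  let ?g = "\<lambda>k::int. 1 / (1 + \<bar>of_int k :: real\<bar>)\<^sup>2"
  let ?f = "\<lambda>\<xi>::int ^ 'n. 1 / weight \<xi> ^ (2 * CARD('n))"
  show "bdd_above (sum ?f ` {F. F \<subseteq> UNIV \<and> finite F})"
  proof (rule bdd_aboveI2)
    fix F :: "(int ^ 'n) set" assume "F \<in> {F. F \<subseteq> UNIV \<and> finite F}"
    then have F: "finite F" by simp
    define B where "B = (\<Union>j. (\<lambda>\<xi>. \<xi> $ j) ` F)"
    have B: "finite B" using F by (simp add: B_def)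
    have "sum ?f F \<le> (\<Sum>\<xi>\<in>F. \<Prod>j\<in>UNIV. ?g (\<xi> $ j))"
    proof (rule sum_mono)
      fix \<xi> :: "int ^ 'n"
      have "(\<Prod>j\<in>(UNIV :: 'n set). (1 + \<bar>of_int (\<xi> $ j)\<bar>)\<^sup>2) \<le> (\<Prod>j\<in>(UNIV :: 'n set). (weight \<xi>)\<^sup>2)"
        by (intro prod_mono conjI power_mono) (use component_le_weight[of \<xi>] in \<open>auto simp: add.commute\<close>)
      moreover have "(\<Prod>j\<in>(UNIV :: 'n set). (1 + \<bar>of_int (\<xi> $ j) :: real\<bar>)\<^sup>2) > 0"
        by (intro prod_pos) (simp add: add_pos_nonneg)
      ultimately show "?f \<xi> \<le> (\<Prod>j\<in>UNIV. ?g (\<xi> $ j))"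
        by (simp add: prod_dividef frac_le power_mult)
    qed
    also have "\<dots> = (\<Sum>g\<in>(\<lambda>\<xi> j. \<xi> $ j) ` F. \<Prod>j\<in>UNIV. ?g (g j))"
      by (subst sum.reindex) (auto simp: inj_on_def vec_eq_iff fun_eq_iff)
    also have "\<dots> \<le> (\<Sum>g\<in>PiE UNIV (\<lambda>j::'n. B). \<Prod>j\<in>UNIV. ?g (g j))"
      using B by (intro sum_mono2 finite_PiE) (auto simp: B_def intro!: prod_nonneg)
    also have "\<dots> = (\<Prod>j\<in>(UNIV :: 'n set). \<Sum>k\<in>B. ?g k)"
      using B by (subst prod_sum_PiE) auto
    also have "\<dots> \<le> (\<Prod>j\<in>(UNIV :: 'n set). infsum ?g UNIV)"
      by (intro prod_mono conjI sum_nonneg finite_sum_le_infsum summable_int_inverse_square B) auto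
    finally show "sum ?f F \<le> (\<Prod>j\<in>(UNIV :: 'n set). infsum ?g UNIV)" .
  qed
qed (simp add: weight_nonneg)

lemma tempered_mult:
  assumes "tempered c" "tempered d" shows "tempered (\<lambda>\<xi>. c \<xi> * d \<xi>)"
proof -
  obtain A k where c: "\<And>\<xi>. norm (c \<xi>) \<le> A * weight \<xi> ^ k"
    using assms(1) unfolding tempered_def by metis
  obtain B l where d: "\<And>\<xi>. norm (d \<xi>) \<le> B * weight \<xi> ^ l"
    using assms(2) unfolding tempered_def by metis
  have "norm (c \<xi> * d \<xi>) \<le> (A * B) * weight \<xi> ^ (k + l)" for \<xi>
  proof -
    have "norm (c \<xi> * d \<xi>) \<le> (A * weight \<xi> ^ k) * (B * weight \<xi> ^ l)"
      unfolding norm_mult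
      by (rule mult_mono[OF c d order_trans[OF norm_ge_zero c] norm_ge_zero])
    then show ?thesis by (simp add: power_add mult_ac)
  qed
  then show ?thesis unfolding tempered_def by metis
qed

lemma tempered_add:
  assumes "tempered c" "tempered d" shows "tempered (\<lambda>\<xi>. c \<xi> + d \<xi>)"
proof -
  obtain A k where c: "\<And>\<xi>. norm (c \<xi>) \<le> A * weight \<xi> ^ k"
    using assms(1) unfolding tempered_def by metis
  obtain B l where d: "\<And>\<xi>. norm (d \<xi>) \<le> B * weight \<xi> ^ l"
    using assms(2) unfolding tempered_def by metis
  have "norm (c \<xi> + d \<xi>) \<le> (\<bar>A\<bar> + \<bar>B\<bar>) * weight \<xi> ^ (k + l)" for \<xi>
  proof -
    have "norm (c \<xi>) \<le> \<bar>A\<bar> * weight \<xi> ^ (k + l)"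
      by (rule order_trans[OF c]) (intro mult_mono power_increasing weight_ge_1; simp add: weight_nonneg)
    moreover have "norm (d \<xi>) \<le> \<bar>B\<bar> * weight \<xi> ^ (k + l)"
      by (rule order_trans[OF d]) (intro mult_mono power_increasing weight_ge_1; simp add: weight_nonneg)
    ultimately show ?thesis
      using norm_triangle_ineq[of "c \<xi>" "d \<xi>"] by (simp add: distrib_right)
  qed
  then show ?thesis unfolding tempered_def by metis
qed

lemma tempered_const: "tempered (\<lambda>\<xi>. c)"
  unfolding tempered_def by (intro exI[of _ "norm c"] exI[of _ 0]) simp

lemma tempered_component: "tempered (\<lambda>\<xi>. of_int (\<xi> $ j))"
  unfolding tempered_def
proof (intro exI allI)
  show "norm (of_int (\<xi> $ j) :: complex) \<le> 1 * weight \<xi> ^ 1" for \<xi> :: "int ^ 'a"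
    using component_le_weight[of \<xi> j] by simp
qed

lemma tempered_sum: "(\<And>i. i \<in> I \<Longrightarrow> tempered (c i)) \<Longrightarrow> tempered (\<lambda>\<xi>. \<Sum>i\<in>I. c i \<xi>)"
  by (induction I rule: infinite_finite_induct) (auto intro: tempered_add tempered_const)

lemma tempered_prod: "(\<And>i. i \<in> I \<Longrightarrow> tempered (c i)) \<Longrightarrow> tempered (\<lambda>\<xi>. \<Prod>i\<in>I. c i \<xi>)"
  by (induction I rule: infinite_finite_induct) (auto intro: tempered_mult tempered_const)

lemma tempered_power: "tempered c \<Longrightarrow> tempered (\<lambda>\<xi>. c \<xi> ^ k)"
  by (induction k) (auto intro: tempered_mult tempered_const)

lemma rapid_mult:
  assumes "tempered d" "rapid c" shows "rapid (\<lambda>\<xi>. d \<xi> * c \<xi>)"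
  unfolding rapid_def
proof
  fix k
  obtain B l where d: "\<And>\<xi>. norm (d \<xi>) \<le> B * weight \<xi> ^ l"
    using assms(1) unfolding tempered_def by metis
  obtain A where c: "\<And>\<xi>. norm (c \<xi>) * weight \<xi> ^ (l + k) \<le> A"
    using assms(2) unfolding rapid_def by metis
  have "norm (d \<xi> * c \<xi>) * weight \<xi> ^ k \<le> \<bar>B\<bar> * A" for \<xi>
  proof -
    have "norm (d \<xi>) * (norm (c \<xi>) * weight \<xi> ^ k) \<le> (\<bar>B\<bar> * weight \<xi> ^ l) * (norm (c \<xi>) * weight \<xi> ^ k)"
      by (intro mult_right_mono order_trans[OF d]) (auto intro!: mult_right_mono mult_nonneg_nonneg simp: weight_nonneg)
    also have "\<dots> = \<bar>B\<bar> * (norm (c \<xi>) * weight \<xi> ^ (l + k))"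
      by (simp add: power_add mult_ac)
    also have "\<dots> \<le> \<bar>B\<bar> * A" by (intro mult_left_mono c) simp
    finally show ?thesis by (simp add: norm_mult mult_ac)
  qed
  then show "\<exists>C. \<forall>\<xi>. norm (d \<xi> * c \<xi>) * weight \<xi> ^ k \<le> C" by blast
qed

text \<open>Another 2N powers of the weight are available from rapid decay, and their reciprocal is
  summable.\<close>

lemma rapid_summable:
  fixes c :: "int ^ 'n::finite \<Rightarrow> complex"
  assumes "rapid c" shows "(\<lambda>\<xi>. norm (c \<xi>) * weight \<xi> ^ k) summable_on UNIV"
proof -
  obtain A where c: "\<And>\<xi>. norm (c \<xi>) * weight \<xi> ^ (k + 2 * CARD('n)) \<le> A"
    using assms unfolding rapid_def by metis
  have "(\<lambda>\<xi>::int ^ 'n. A * (1 / weight \<xi> ^ (2 * CARD('n)))) summable_on UNIV"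
    by (intro summable_on_cmult_right summable_weight)
  then show ?thesis
  proof (rule summable_on_comparison_test)
    fix \<xi> :: "int ^ 'n"
    have "(norm (c \<xi>) * weight \<xi> ^ k) * weight \<xi> ^ (2 * CARD('n)) \<le> A"
      using c[of \<xi>] by (simp only: power_add mult.assoc)
    then show "norm (c \<xi>) * weight \<xi> ^ k \<le> A * (1 / weight \<xi> ^ (2 * CARD('n)))"
      using weight_pos[of \<xi>] by (simp add: le_divide_eq)
  qed (simp add: weight_nonneg)
qed

lemma rapid_norm_summable: "rapid c \<Longrightarrow> (\<lambda>\<xi>. norm (c \<xi>)) summable_on UNIV"
  using rapid_summable[of c 0] by simp

section \<open>Fourier series with rapidly decreasing coefficients\<close>

definition fourier_series :: "(int ^ 'n::finite \<Rightarrow> complex) \<Rightarrow> real ^ 'n \<Rightarrow> complex" where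
  "fourier_series c x = (\<Sum>\<^sub>\<infinity>\<xi>. c \<xi> * character \<xi> x)"

lemma has_sum_fourier_series:
  assumes "rapid c" shows "((\<lambda>\<xi>. c \<xi> * character \<xi> x) has_sum fourier_series c x) UNIV"
proof -
  have "(\<lambda>\<xi>. norm (c \<xi> * character \<xi> x)) summable_on UNIV"
    using rapid_norm_summable[OF assms] by (simp add: norm_mult)
  then show ?thesis
    unfolding fourier_series_def by (rule has_sum_infsum[OF abs_summable_summable])
qed

lemma norm_fourier_series_le:
  assumes "rapid c" shows "norm (fourier_series c x) \<le> (\<Sum>\<^sub>\<infinity>\<xi>. norm (c \<xi>))"
  by (rule norm_infsum_le[OF has_sum_fourier_series[OF assms] has_sum_infsum[OF rapid_norm_summable[OF assms]]])
     (simp add: norm_mult)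

lemma uniform_limit_fourier_series:
  assumes "rapid c"
  shows "uniform_limit A (\<lambda>F x. \<Sum>\<xi>\<in>F. c \<xi> * character \<xi> x) (fourier_series c) (finite_subsets_at_top UNIV)"
  unfolding fourier_series_def[abs_def]
  by (rule Weierstrass_m_test_general[OF _ rapid_norm_summable[OF assms]]) (simp add: norm_mult)

lemma continuous_fourier_series:
  assumes "rapid c" shows "continuous_on A (fourier_series c)"
  by (rule uniform_limit_theorem[OF _ uniform_limit_fourier_series[OF assms]])
     (auto intro!: always_eventually continuous_intros)

lemma periodic_fourier_series: "periodic (fourier_series c)"
  unfolding periodic_def fourier_series_def
  by (intro allI infsum_cong) (simp add: periodic_character[unfolded periodic_def, rule_format])

text \<open>A criterion that passes well through infinite sums: a remainder bounded by
  \<open>K s^2\<close> gives the derivative at once. It serves for Fourier series and for the flat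
  functions at the edge of their support.\<close>

lemma has_vector_derivative_quadratic:
  fixes F :: "real \<Rightarrow> 'a::real_normed_vector"
  assumes "\<And>s. norm (F (t + s) - F t - s *\<^sub>R D) \<le> K * s\<^sup>2"
  shows "(F has_vector_derivative D) (at t)"
  unfolding has_vector_derivative_def has_derivative_at
proof (intro conjI bounded_linear_scaleR_left)
  show "(\<lambda>h. norm (F (t + h) - F t - h *\<^sub>R D) / norm h) \<midarrow>0\<rightarrow> 0"
  proof (rule Lim_null_comparison)
    show "\<forall>\<^sub>F h in at 0. norm (norm (F (t + h) - F t - h *\<^sub>R D) / norm h) \<le> K * \<bar>h\<bar>"
      unfolding eventually_at
    proof (intro exI[of _ 1] conjI ballI impI)
      fix h :: real assume "h \<noteq> 0 \<and> dist h 0 < 1"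
      then show "norm (norm (F (t + h) - F t - h *\<^sub>R D) / norm h) \<le> K * \<bar>h\<bar>"
        using assms[of h] by (simp add: divide_le_eq power2_eq_square abs_mult_self mult.assoc)
    qed simp
    show "(\<lambda>h. K * \<bar>h\<bar>) \<midarrow>0\<rightarrow> 0"
      by (auto intro!: tendsto_eq_intros)
  qed
qed

lemma norm_exp_i_le: "norm (exp (\<i> * of_real \<theta>) - 1 - \<i> * of_real \<theta>) \<le> \<theta>\<^sup>2"
  using Taylor_exp[of "\<i> * of_real \<theta>" 1] by (simp add: norm_mult power2_eq_square diff_diff_eq)

text \<open>The first order Taylor remainder of the term at \<xi> is at most
  \<open>|c \<xi>| |\<xi>_j|^2 s^2\<close>. Rapid decay makes these bounds summable, so the whole
  series has a quadratic remainder.\<close>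

lemma has_pd_fourier_series:
  fixes c :: "int ^ 'n::finite \<Rightarrow> complex"
  assumes "rapid c"
  shows "has_pd j (fourier_series c) (fourier_series (\<lambda>\<xi>. (\<i> * of_int (\<xi> $ j)) * c \<xi>))"
  unfolding has_pd_def
proof (intro allI has_vector_derivative_quadratic)
  fix x :: "real ^ 'n" and s :: real
  let ?c' = "\<lambda>\<xi>. (\<i> * of_int (\<xi> $ j)) * c \<xi>"
  have c': "rapid ?c'"
    by (intro rapid_mult assms tempered_mult tempered_const tempered_component)
  have "((\<lambda>\<xi>. c \<xi> * character \<xi> (x + s *\<^sub>R axis j 1) + - (c \<xi> * character \<xi> x)
         + of_real s * - (?c' \<xi> * character \<xi> x)) has_sum
      (fourier_series c (x + s *\<^sub>R axis j 1) + - fourier_series c x + of_real s * - fourier_series ?c' x)) UNIV"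
    by (intro has_sum_add has_sum_uminusI has_sum_cmult_right has_sum_fourier_series assms c')
  moreover have "((\<lambda>\<xi>. (norm (c \<xi>) * weight \<xi> ^ 2) * s\<^sup>2) has_sum
      ((\<Sum>\<^sub>\<infinity>\<xi>. norm (c \<xi>) * weight \<xi> ^ 2) * s\<^sup>2)) UNIV"
    by (intro has_sum_cmult_left has_sum_infsum rapid_summable assms)
  moreover have "norm (c \<xi> * character \<xi> (x + s *\<^sub>R axis j 1) + - (c \<xi> * character \<xi> x)
         + of_real s * - (?c' \<xi> * character \<xi> x)) \<le> (norm (c \<xi>) * weight \<xi> ^ 2) * s\<^sup>2" for \<xi>
  proof -
    define \<theta> where "\<theta> = s * of_int (\<xi> $ j)"
    have "c \<xi> * character \<xi> (x + s *\<^sub>R axis j 1) + - (c \<xi> * character \<xi> x)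
         + of_real s * - (?c' \<xi> * character \<xi> x) =
       (c \<xi> * character \<xi> x) * (exp (\<i> * of_real \<theta>) - 1 - \<i> * of_real \<theta>)"
      by (simp add: character_shift \<theta>_def algebra_simps)
    also have "norm \<dots> \<le> norm (c \<xi>) * \<theta>\<^sup>2"
      unfolding norm_mult by (simp add: mult_left_mono norm_exp_i_le)
    also have "\<theta>\<^sup>2 = (of_int (\<xi> $ j))\<^sup>2 * s\<^sup>2" by (simp add: \<theta>_def power_mult_distrib)
    also have "(of_int (\<xi> $ j))\<^sup>2 \<le> weight \<xi> ^ 2"
      using component_le_weight[of \<xi> j] by (intro abs_le_square_iff[THEN iffD1]) simp
    finally show ?thesis by (simp add: mult_left_mono mult_right_mono mult.assoc)
  qed
  ultimately have "norm (fourier_series c (x + s *\<^sub>R axis j 1) + - fourier_series c x + of_real s * - fourier_series ?c' x)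
      \<le> (\<Sum>\<^sub>\<infinity>\<xi>. norm (c \<xi>) * weight \<xi> ^ 2) * s\<^sup>2"
    by (rule norm_infsum_le)
  then show "norm (fourier_series c (x + (0 + s) *\<^sub>R axis j 1) - fourier_series c (x + 0 *\<^sub>R axis j 1) -
      s *\<^sub>R fourier_series ?c' x) \<le> (\<Sum>\<^sub>\<infinity>\<xi>. norm (c \<xi>) * weight \<xi> ^ 2) * s\<^sup>2"
    by (simp add: scaleR_conv_of_real)
qed

lemma Dx_fourier_series:
  assumes "rapid c" shows "Dx j (fourier_series c) = fourier_series (\<lambda>\<xi>. of_int (\<xi> $ j) * c \<xi>)"
proof
  fix x
  have "fourier_series (\<lambda>\<xi>. (\<i> * of_int (\<xi> $ j)) * c \<xi>) x = \<i> * fourier_series (\<lambda>\<xi>. of_int (\<xi> $ j) * c \<xi>) x"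
    unfolding fourier_series_def by (simp only: mult.assoc infsum_cmult_right')
  then show "Dx j (fourier_series c) x = fourier_series (\<lambda>\<xi>. of_int (\<xi> $ j) * c \<xi>) x"
    by (simp add: Dx_def pd_eqI[OF has_pd_fourier_series[OF assms]])
qed

lemma smooth_fourier_series:
  assumes "rapid c" shows "smooth (fourier_series c)"
proof (rule smooth_coinduct[of _ "fourier_series ` {c. rapid c}"])
  fix f :: "real ^ 'a \<Rightarrow> complex" and j assume "f \<in> fourier_series ` {c. rapid c}"
  then obtain c where c: "rapid c" "f = fourier_series c" by blast
  have "(\<lambda>x. 1 / \<i> * fourier_series (\<lambda>\<xi>. (\<i> * of_int (\<xi> $ j)) * c \<xi>) x) = Dx j f"
    unfolding c by (simp add: fun_eq_iff Dx_def pd_eqI[OF has_pd_fourier_series[OF c(1)]])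
  also have "\<dots> = fourier_series (\<lambda>\<xi>. of_int (\<xi> $ j) * c \<xi>)"
    unfolding c by (rule Dx_fourier_series[OF c(1)])
  also have "\<dots> \<in> fourier_series ` {c. rapid c}"
    by (intro imageI CollectI rapid_mult tempered_component c)
  finally show "\<exists>f'. has_pd j f f' \<and> (\<lambda>x. 1 / \<i> * f' x) \<in> fourier_series ` {c. rapid c}"
    using has_pd_fourier_series[OF c(1), of j] unfolding c(2) by blast
qed (use assms in \<open>auto intro: continuous_fourier_series\<close>)

lemma torus_smooth_fourier_series: "rapid c \<Longrightarrow> fourier_series c \<in> torus_smooth"
  by (simp add: torus_smooth_iff smooth_fourier_series periodic_fourier_series)

text \<open>Multiplied by a character the series still converges uniformly on the box, hence may be
  integrated termwise, and orthogonality leaves a single term.\<close>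

lemma fcoeff_fourier_series:
  fixes c :: "int ^ 'n::finite \<Rightarrow> complex"
  assumes "rapid c" shows "fcoeff (fourier_series c) \<xi> = c \<xi>"
proof -
  let ?top = "finite_subsets_at_top (UNIV :: (int ^ 'n) set)"
  have "uniform_limit torus_box (\<lambda>F x. \<Sum>\<eta>\<in>F. (c \<eta> * character \<eta> x) * character (- \<xi>) x)
      (\<lambda>x. \<Sum>\<^sub>\<infinity>\<eta>. (c \<eta> * character \<eta> x) * character (- \<xi>) x) ?top"
    by (rule Weierstrass_m_test_general[OF _ rapid_norm_summable[OF assms]]) (simp add: norm_mult)
  then obtain I J where IJ:
    "\<And>F. ((\<lambda>x. \<Sum>\<eta>\<in>F. (c \<eta> * character \<eta> x) * character (- \<xi>) x) has_integral I F) torus_box"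
    "((\<lambda>x. \<Sum>\<^sub>\<infinity>\<eta>. (c \<eta> * character \<eta> x) * character (- \<xi>) x) has_integral J) torus_box" "(I \<longlongrightarrow> J) ?top"
    by (rule uniform_limit_integral_cbox) (auto intro!: continuous_intros)
  define V :: complex where "V = of_real ((2 * pi) ^ CARD('n))"
  have V: "V \<noteq> 0" by (simp add: V_def)
  have "I F = (if \<xi> \<in> F then c \<xi> * V else 0)" if "finite F" for F
  proof -
    have "((\<lambda>x. (c \<eta> * character \<eta> x) * character (- \<xi>) x) has_integral (if \<xi> = \<eta> then c \<eta> * V else 0)) torus_box" for \<eta>
    proof -
      have "((\<lambda>x. character \<eta> x * character (- \<xi>) x) has_integral
          integral torus_box (\<lambda>x. character \<eta> x * character (- \<xi>) x)) torus_box"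
        by (intro integrable_integral integrable_continuous continuous_intros)
      also have "integral torus_box (\<lambda>x. character \<eta> x * character (- \<xi>) x) = fcoeff (character \<eta>) \<xi> * V"
        using V by (simp add: fcoeff_def V_def)
      finally have "((\<lambda>x. c \<eta> * (character \<eta> x * character (- \<xi>) x)) has_integral
          c \<eta> * (fcoeff (character \<eta>) \<xi> * V)) torus_box"
        by (rule has_integral_mult_right)
      then show ?thesis
        by (cases "\<xi> = \<eta>") (simp_all add: fcoeff_character mult.assoc)
    qed
    then have "((\<lambda>x. \<Sum>\<eta>\<in>F. (c \<eta> * character \<eta> x) * character (- \<xi>) x) has_integral
        (\<Sum>\<eta>\<in>F. if \<xi> = \<eta> then c \<eta> * V else 0)) torus_box"
      by (intro has_integral_sum that)
    then have "I F = (\<Sum>\<eta>\<in>F. if \<xi> = \<eta> then c \<eta> * V else 0)"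
      using IJ(1) by (rule has_integral_unique[rotated])
    with that show ?thesis by simp
  qed
  \<comment> \<open>The partial integrals are constant as soon as the finite set contains
    \<xi>.\<close>
  then have "\<forall>\<^sub>F F in ?top. I F = c \<xi> * V"
    by (intro eventually_finite_subsets_at_top[THEN iffD2] exI[of _ "{\<xi>}"]) auto
  then have "(I \<longlongrightarrow> c \<xi> * V) ?top"
    by (simp add: tendsto_eventually)
  then have "J = c \<xi> * V"
    using IJ(3) by (intro tendsto_unique[OF _ IJ(3)]) auto
  moreover have "(\<lambda>x. \<Sum>\<^sub>\<infinity>\<eta>. (c \<eta> * character \<eta> x) * character (- \<xi>) x) =
      (\<lambda>x. fourier_series c x * character (- \<xi>) x)"
    by (simp add: fourier_series_def infsum_cmult_left')
  ultimately show ?thesis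
    using IJ(2) V by (simp add: fcoeff_def V_def integral_unique)
qed

section \<open>Multi-index derivatives as multipliers\<close>

definition monomial :: "nat ^ 'n::finite \<Rightarrow> int ^ 'n \<Rightarrow> complex" where
  "monomial \<alpha> \<xi> = (\<Prod>j\<in>UNIV. of_int (\<xi> $ j) ^ (\<alpha> $ j))"

lemma tempered_monomial: "tempered (monomial \<alpha>)"
  unfolding monomial_def[abs_def] by (intro tempered_prod tempered_power tempered_component)

lemma norm_monomial_le: "norm (monomial \<alpha> \<xi>) \<le> (norm (rvec \<xi>)) ^ mi_order \<alpha>"
proof -
  have "norm (monomial \<alpha> \<xi>) = (\<Prod>j\<in>UNIV. \<bar>rvec \<xi> $ j\<bar> ^ (\<alpha> $ j))"
    by (simp add: monomial_def prod_norm[symmetric] norm_power)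
  also have "\<dots> \<le> (\<Prod>j\<in>UNIV. norm (rvec \<xi>) ^ (\<alpha> $ j))"
    by (intro prod_mono conjI power_mono component_le_norm_cart) auto
  finally show ?thesis by (simp add: mi_order_def power_sum)
qed

lemma prod_list_count_list:
  fixes h :: "'n::finite \<Rightarrow> complex"
  shows "prod_list (map h js) = (\<Prod>j\<in>UNIV. h j ^ count_list js j)"
proof (induction js)
  case (Cons a js)
  have "(\<Prod>j\<in>UNIV. h j ^ count_list (a # js) j) = (\<Prod>j\<in>UNIV. (if j = a then h j else 1) * h j ^ count_list js j)"
    by (intro prod.cong) auto
  also have "\<dots> = h a * (\<Prod>j\<in>UNIV. h j ^ count_list js j)"
    by (simp add: prod.distrib)
  finally show ?case using Cons by simp
qed simp

lemma ex_list_with_counts: "\<exists>js. \<forall>j::'n::finite. count_list js j = \<alpha> $ j"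
proof -
  define M where "M = (\<Sum>j\<in>UNIV. replicate_mset (\<alpha> $ j) j)"
  obtain js where "mset js = M" using ex_mset by blast
  moreover have "count M j = \<alpha> $ j" for j
    by (simp add: M_def count_sum if_distrib cong: if_cong)
  ultimately show ?thesis by (metis count_mset)
qed

text \<open>The unspecified order of derivatives in \<open>mi_D\<close> becomes harmless here: on
  Fourier coefficients a list of derivatives acts through the product of its frequencies, which
  depends only on the counts.\<close>

lemma mi_D_obtain:
  obtains js where "mi_D \<alpha> = foldr Dx js"
    "\<And>\<xi>. prod_list (map (\<lambda>j. of_int (\<xi> $ j)) js) = monomial \<alpha> \<xi>"
proof
  let ?js = "SOME js. \<forall>j. count_list js j = \<alpha> $ j"
  have "\<forall>j. count_list ?js j = \<alpha> $ j"
    by (rule someI_ex) (rule ex_list_with_counts)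
  then show "prod_list (map (\<lambda>j. of_int (\<xi> $ j)) ?js) = monomial \<alpha> \<xi>" for \<xi>
    by (simp add: prod_list_count_list monomial_def)
qed (simp add: mi_D_def)

lemma foldr_Dx_fourier_series:
  assumes "rapid c"
  shows "rapid (\<lambda>\<xi>. prod_list (map (\<lambda>j. of_int (\<xi> $ j)) js) * c \<xi>) \<and> foldr Dx js (fourier_series c) =
    fourier_series (\<lambda>\<xi>. prod_list (map (\<lambda>j. of_int (\<xi> $ j)) js) * c \<xi>)"
proof (induction js)
  case (Cons j js)
  then show ?case
    using rapid_mult[OF tempered_component, of "\<lambda>\<xi>. prod_list (map (\<lambda>j. of_int (\<xi> $ j)) js) * c \<xi>" j]
    by (simp add: Dx_fourier_series mult.assoc)
qed (use assms in simp)

lemma mi_D_fourier_series: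
  assumes "rapid c" shows "mi_D \<alpha> (fourier_series c) = fourier_series (\<lambda>\<xi>. monomial \<alpha> \<xi> * c \<xi>)"
proof (rule mi_D_obtain[of \<alpha>])
  fix js assume "mi_D \<alpha> = foldr Dx js" "\<And>\<xi>. prod_list (map (\<lambda>j. of_int (\<xi> $ j)) js) = monomial \<alpha> \<xi>"
  with foldr_Dx_fourier_series[OF assms, of js] show ?thesis by simp
qed

lemma torus_smooth_mi_D: "\<phi> \<in> torus_smooth \<Longrightarrow> mi_D \<alpha> \<phi> \<in> torus_smooth"
  by (simp add: mi_D_def torus_smooth_foldr)

lemma fcoeff_foldr_Dx:
  assumes "\<phi> \<in> torus_smooth"
  shows "fcoeff (foldr Dx js \<phi>) \<xi> = prod_list (map (\<lambda>j. of_int (\<xi> $ j)) js) * fcoeff \<phi> \<xi>"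
proof (induction js)
  case (Cons j js)
  have "fcoeff (Dx j (foldr Dx js \<phi>)) \<xi> = of_int (\<xi> $ j) * fcoeff (foldr Dx js \<phi>) \<xi>"
    by (intro fcoeff_Dx torus_smooth_foldr assms)
  with Cons show ?case by (simp add: mult.assoc)
qed simp

lemma fcoeff_mi_D:
  assumes "\<phi> \<in> torus_smooth" shows "fcoeff (mi_D \<alpha> \<phi>) \<xi> = monomial \<alpha> \<xi> * fcoeff \<phi> \<xi>"
proof (rule mi_D_obtain[of \<alpha>])
  fix js assume js: "mi_D \<alpha> = foldr Dx js" "\<And>\<xi>. prod_list (map (\<lambda>j. of_int (\<xi> $ j)) js) = monomial \<alpha> \<xi>"
  then show ?thesis using fcoeff_foldr_Dx[OF assms, of js] by simp
qed

section \<open>Decay of the coefficients of smooth functions and Fourier inversion\<close>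

text \<open>The seminorm that controls functionals in the definition of
  \<open>distributions\<close>.\<close>

definition seminorm_C :: "nat \<Rightarrow> (real ^ 'n::finite \<Rightarrow> complex) \<Rightarrow> real" where
  "seminorm_C k \<phi> = (\<Sum>\<alpha> | mi_order \<alpha> \<le> k. SUP x. norm (mi_D \<alpha> \<phi> x))"

lemma finite_mi_order: "finite {\<alpha> :: nat ^ 'n::finite. mi_order \<alpha> \<le> k}"
proof (rule finite_subset)
  have le: "\<alpha> $ j \<le> mi_order \<alpha>" for \<alpha> :: "nat ^ 'n" and j
    unfolding mi_order_def by (rule member_le_sum) auto
  show "{\<alpha> :: nat ^ 'n. mi_order \<alpha> \<le> k} \<subseteq> vec_lambda ` (PiE UNIV (\<lambda>_. {..k}))"
  proof
    fix \<alpha> :: "nat ^ 'n" assume "\<alpha> \<in> {\<alpha>. mi_order \<alpha> \<le> k}"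
    then have "vec_nth \<alpha> \<in> PiE UNIV (\<lambda>_. {..k})"
      using le[of \<alpha>] by (auto intro: order_trans)
    then have "vec_lambda (vec_nth \<alpha>) \<in> vec_lambda ` (PiE UNIV (\<lambda>_. {..k}))"
      by (rule imageI)
    then show "\<alpha> \<in> vec_lambda ` (PiE UNIV (\<lambda>_. {..k}))" by simp
  qed
  show "finite (vec_lambda ` (PiE (UNIV :: 'n set) (\<lambda>_. {..k})))"
    by (intro finite_imageI finite_PiE) auto
qed

lemma norm_mi_D_le_seminorm:
  assumes "\<phi> \<in> torus_smooth" "mi_order \<alpha> \<le> k"
  shows "norm (mi_D \<alpha> \<phi> x) \<le> seminorm_C k \<phi>"
proof -
  have pos: "0 \<le> (SUP x. norm (mi_D \<beta> \<phi> x))" for \<beta>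
  proof -
    have "norm (mi_D \<beta> \<phi> 0) \<le> (SUP x. norm (mi_D \<beta> \<phi> x))"
      by (intro cSUP_upper torus_smooth_bdd torus_smooth_mi_D assms) simp
    then show ?thesis using norm_ge_zero order_trans by blast
  qed
  have "norm (mi_D \<alpha> \<phi> x) \<le> (SUP x. norm (mi_D \<alpha> \<phi> x))"
    by (intro cSUP_upper torus_smooth_bdd torus_smooth_mi_D assms) simp
  also have "\<dots> \<le> seminorm_C k \<phi>"
    unfolding seminorm_C_def by (rule member_le_sum) (use assms pos finite_mi_order in auto)
  finally show ?thesis .
qed

lemma norm_monomial_fcoeff_le:
  assumes "\<phi> \<in> torus_smooth" "mi_order \<alpha> \<le> k"
  shows "norm (monomial \<alpha> \<xi>) * norm (fcoeff \<phi> \<xi>) \<le> seminorm_C k \<phi>"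
proof -
  have "norm (fcoeff (mi_D \<alpha> \<phi>) \<xi>) \<le> seminorm_C k \<phi>"
    by (intro norm_fcoeff_le norm_mi_D_le_seminorm torus_smooth_continuous torus_smooth_mi_D assms)
  then show ?thesis by (simp add: fcoeff_mi_D assms norm_mult)
qed

lemma mi_order_axis: "mi_order (axis j k) = k"
  by (simp add: mi_order_def axis_def)

lemma norm_monomial_axis: "norm (monomial (axis j k) \<xi>) = \<bar>of_int (\<xi> $ j)\<bar> ^ k"
proof -
  have "monomial (axis j k) \<xi> = (\<Prod>i\<in>UNIV. if i = j then of_int (\<xi> $ j) ^ k else 1)"
    unfolding monomial_def axis_def by (intro prod.cong) auto
  then show ?thesis by (simp add: norm_power)
qed

text \<open>With j the dominant component, the weight is at most (1 + N) max 1 |\<xi>_j|, and the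
  k-th power of this maximum is at most 1 + |\<xi>_j|^k. The two summands are controlled by the
  function itself and by its k-th derivative in direction j, whence the factor 2.\<close>

lemma fcoeff_decay:
  fixes \<phi> :: "real ^ 'n::finite \<Rightarrow> complex"
  assumes "\<phi> \<in> torus_smooth"
  shows "norm (fcoeff \<phi> \<xi>) * weight \<xi> ^ k \<le> 2 * (1 + real CARD('n)) ^ k * seminorm_C k \<phi>"
proof -
  obtain j where "norm (rvec \<xi>) \<le> real CARD('n) * \<bar>real_of_int (\<xi> $ j)\<bar>"
    using norm_rvec_le_component by blast
  then have "weight \<xi> \<le> 1 + real CARD('n) * \<bar>real_of_int (\<xi> $ j)\<bar>" by (simp add: weight_def)
  also have "\<dots> \<le> (1 + real CARD('n)) * max 1 \<bar>real_of_int (\<xi> $ j)\<bar>"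
    by (simp add: distrib_right add_mono mult_left_mono)
  finally have "weight \<xi> ^ k \<le> ((1 + real CARD('n)) * max 1 \<bar>of_int (\<xi> $ j)\<bar>) ^ k"
    by (intro power_mono) (auto simp: weight_nonneg)
  also have "\<dots> \<le> (1 + real CARD('n)) ^ k * (1 + \<bar>of_int (\<xi> $ j)\<bar> ^ k)"
    unfolding power_mult_distrib by (intro mult_left_mono) (auto simp: max_def)
  finally have "norm (fcoeff \<phi> \<xi>) * weight \<xi> ^ k \<le>
      norm (fcoeff \<phi> \<xi>) * ((1 + real CARD('n)) ^ k * (1 + \<bar>of_int (\<xi> $ j)\<bar> ^ k))"
    by (rule mult_left_mono) simp
  also have "\<dots> = (1 + real CARD('n)) ^ k * (norm (fcoeff \<phi> \<xi>) + \<bar>of_int (\<xi> $ j)\<bar> ^ k * norm (fcoeff \<phi> \<xi>))"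
    by (simp add: algebra_simps)
  also have "\<dots> \<le> (1 + real CARD('n)) ^ k * (seminorm_C k \<phi> + seminorm_C k \<phi>)"
  proof (intro mult_left_mono add_mono)
    show "norm (fcoeff \<phi> \<xi>) \<le> seminorm_C k \<phi>"
      using norm_monomial_fcoeff_le[OF assms, of 0 k \<xi>] by (simp add: mi_order_def monomial_def)
    show "\<bar>of_int (\<xi> $ j)\<bar> ^ k * norm (fcoeff \<phi> \<xi>) \<le> seminorm_C k \<phi>"
      using norm_monomial_fcoeff_le[OF assms, of "axis j k" k \<xi>] by (simp add: mi_order_axis norm_monomial_axis)
  qed simp
  finally show ?thesis by simp
qed

lemma rapid_fcoeff: "\<phi> \<in> torus_smooth \<Longrightarrow> rapid (fcoeff \<phi>)"
  unfolding rapid_def using fcoeff_decay by blast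

lemma fcoeff_add_mult:
  assumes "continuous_on UNIV f" "continuous_on UNIV g"
  shows "fcoeff (\<lambda>x. f x + c * g x) \<xi> = fcoeff f \<xi> + c * fcoeff g \<xi>"
proof -
  have "integral torus_box (\<lambda>x. f x * character (- \<xi>) x + c * (g x * character (- \<xi>) x)) =
      integral torus_box (\<lambda>x. f x * character (- \<xi>) x) + integral torus_box (\<lambda>x. c * (g x * character (- \<xi>) x))"
    by (intro integral_add integrable_continuous continuous_intros assms[THEN continuous_on_subset]) auto
  then show ?thesis
    by (simp add: fcoeff_def distrib_right add_divide_distrib mult.assoc)
qed

text \<open>Inversion through uniqueness: the difference of the two sides is continuous and periodic
  and all its coefficients vanish.\<close>

lemma fourier_series_fcoeff:
  assumes "\<phi> \<in> torus_smooth" shows "fourier_series (fcoeff \<phi>) = \<phi>"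
proof
  fix x
  note r = rapid_fcoeff[OF assms]
  have "fourier_series (fcoeff \<phi>) x + (-1) * \<phi> x = 0"
  proof (rule fcoeff_eq_0_imp)
    show "continuous_on UNIV (\<lambda>x. fourier_series (fcoeff \<phi>) x + (-1) * \<phi> x)"
      by (intro continuous_intros continuous_fourier_series r torus_smooth_continuous assms)
    show "periodic (\<lambda>x. fourier_series (fcoeff \<phi>) x + (-1) * \<phi> x)"
      using torus_smooth_add_mult[OF torus_smooth_fourier_series[OF r] assms, of "-1"] by (simp add: torus_smooth_iff)
    show "fcoeff (\<lambda>x. fourier_series (fcoeff \<phi>) x + (-1) * \<phi> x) \<xi> = 0" for \<xi>
      by (subst fcoeff_add_mult)
        (simp_all add: continuous_fourier_series r torus_smooth_continuous assms fcoeff_fourier_series)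
  qed
  then show "fourier_series (fcoeff \<phi>) x = \<phi> x" by simp
qed

section \<open>Distributions as tempered coefficient families\<close>

text \<open>The formal pairing of two Fourier series. The index of \<open>c\<close> is reflected
  because the coefficient at \<xi> of a distribution is its value at the character of
  -\<xi>.\<close>

definition distr_of :: "(int ^ 'n::finite \<Rightarrow> complex) \<Rightarrow> 'n functional" where
  "distr_of c = (\<lambda>\<phi>. if \<phi> \<in> torus_smooth then \<Sum>\<^sub>\<infinity>\<xi>. c (- \<xi>) * fcoeff \<phi> \<xi> else 0)"

lemma tempered_uminus: "tempered c \<Longrightarrow> tempered (\<lambda>\<xi>. c (- \<xi>))"
  unfolding tempered_def by (metis weight_uminus)

lemma rapid_distr_terms:
  "tempered c \<Longrightarrow> \<phi> \<in> torus_smooth \<Longrightarrow> rapid (\<lambda>\<xi>. c (- \<xi>) * fcoeff \<phi> \<xi>)"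
  by (intro rapid_mult tempered_uminus rapid_fcoeff)

lemma has_sum_distr_of:
  assumes "tempered c" "\<phi> \<in> torus_smooth"
  shows "((\<lambda>\<xi>. c (- \<xi>) * fcoeff \<phi> \<xi>) has_sum distr_of c \<phi>) UNIV"
proof -
  have "(\<lambda>\<xi>. norm (c (- \<xi>) * fcoeff \<phi> \<xi>)) summable_on UNIV"
    by (intro rapid_norm_summable rapid_distr_terms assms)
  from has_sum_infsum[OF abs_summable_summable[OF this]] show ?thesis
    using assms(2) by (simp add: distr_of_def)
qed

text \<open>The l powers of the weight lost to the growth of \<open>c\<close> and the 2N powers
  spent on summability are paid for by k = l + 2N derivatives of the test function.\<close>

lemma distr_of_bound:
  fixes c :: "int ^ 'n::finite \<Rightarrow> complex"
  assumes "tempered c"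
  shows "\<exists>C k. \<forall>\<phi>\<in>torus_smooth. norm (distr_of c \<phi>) \<le> C * seminorm_C k \<phi>"
proof -
  obtain B l where c: "\<And>\<xi>. norm (c \<xi>) \<le> B * weight \<xi> ^ l"
    using assms unfolding tempered_def by metis
  define k where "k = l + 2 * CARD('n)"
  define K where "K = 2 * (1 + real CARD('n)) ^ k"
  define W where "W = (\<Sum>\<^sub>\<infinity>\<xi>::int ^ 'n. 1 / weight \<xi> ^ (2 * CARD('n)))"
  have "norm (distr_of c \<phi>) \<le> (\<bar>B\<bar> * K * W) * seminorm_C k \<phi>" if \<phi>: "\<phi> \<in> torus_smooth" for \<phi> :: "real ^ 'n \<Rightarrow> complex"
  proof -
    have "((\<lambda>\<xi>::int ^ 'n. (\<bar>B\<bar> * K * seminorm_C k \<phi>) * (1 / weight \<xi> ^ (2 * CARD('n)))) has_sum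
        (\<bar>B\<bar> * K * seminorm_C k \<phi>) * W) UNIV"
      unfolding W_def by (intro has_sum_cmult_right has_sum_infsum summable_weight)
    moreover have "norm (c (- \<xi>) * fcoeff \<phi> \<xi>) \<le>
        (\<bar>B\<bar> * K * seminorm_C k \<phi>) * (1 / weight \<xi> ^ (2 * CARD('n)))" for \<xi>
    proof -
      have "norm (c (- \<xi>)) * norm (fcoeff \<phi> \<xi>) \<le> (\<bar>B\<bar> * weight \<xi> ^ l) * norm (fcoeff \<phi> \<xi>)"
      proof (rule mult_right_mono)
        have "B * weight (- \<xi>) ^ l \<le> \<bar>B\<bar> * weight \<xi> ^ l"
          by (simp add: mult_right_mono weight_nonneg)
        then show "norm (c (- \<xi>)) \<le> \<bar>B\<bar> * weight \<xi> ^ l"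
          using c[of "- \<xi>"] by linarith
      qed simp
      then have "norm (c (- \<xi>) * fcoeff \<phi> \<xi>) * weight \<xi> ^ (2 * CARD('n)) \<le>
          ((\<bar>B\<bar> * weight \<xi> ^ l) * norm (fcoeff \<phi> \<xi>)) * weight \<xi> ^ (2 * CARD('n))"
        unfolding norm_mult by (rule mult_right_mono) (simp add: weight_nonneg)
      also have "\<dots> = \<bar>B\<bar> * (norm (fcoeff \<phi> \<xi>) * weight \<xi> ^ k)"
        by (simp add: k_def power_add mult_ac)
      also have "\<dots> \<le> \<bar>B\<bar> * (K * seminorm_C k \<phi>)"
        unfolding K_def by (intro mult_left_mono fcoeff_decay \<phi>) simp
      finally show ?thesis
        using weight_pos[of \<xi>] by (simp add: le_divide_eq mult.assoc)
    qed
    ultimately have "norm (distr_of c \<phi>) \<le> (\<bar>B\<bar> * K * seminorm_C k \<phi>) * W"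
      by (rule norm_infsum_le[OF has_sum_distr_of[OF assms \<phi>]])
    then show ?thesis by (simp add: mult_ac)
  qed
  then show ?thesis by blast
qed

lemma distr_of_in_distributions:
  assumes "tempered c" shows "distr_of c \<in> distributions"
  unfolding distributions_def
proof (intro CollectI conjI allI ballI impI)
  fix \<phi> \<psi> :: "real ^ 'a \<Rightarrow> complex" and a assume \<phi>: "\<phi> \<in> torus_smooth" "\<psi> \<in> torus_smooth"
  have "((\<lambda>\<xi>. c (- \<xi>) * fcoeff \<phi> \<xi> + a * (c (- \<xi>) * fcoeff \<psi> \<xi>)) has_sum
      (distr_of c \<phi> + a * distr_of c \<psi>)) UNIV"
    by (intro has_sum_add has_sum_cmult_right has_sum_distr_of assms \<phi>)
  then have "((\<lambda>\<xi>. c (- \<xi>) * fcoeff (\<lambda>x. \<phi> x + a * \<psi> x) \<xi>) has_sum (distr_of c \<phi> + a * distr_of c \<psi>)) UNIV"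
    by (simp add: fcoeff_add_mult torus_smooth_continuous \<phi> algebra_simps)
  then show "distr_of c (\<lambda>x. \<phi> x + a * \<psi> x) = distr_of c \<phi> + a * distr_of c \<psi>"
    using has_sum_unique[OF has_sum_distr_of[OF assms torus_smooth_add_mult[OF \<phi>]]] by blast
next
  show "\<exists>C k. \<forall>\<phi>\<in>torus_smooth. norm (distr_of c \<phi>) \<le> C * (\<Sum>\<alpha> | mi_order \<alpha> \<le> k. SUP x. norm (mi_D \<alpha> \<phi> x))"
    using distr_of_bound[OF assms] by (simp add: seminorm_C_def)
qed (simp add: distr_of_def)

lemma fourier_distr_of: "fourier (distr_of c) \<xi> = c \<xi>"
proof -
  have "((\<lambda>\<eta>. c (- \<eta>) * fcoeff (character (- \<xi>)) \<eta>) has_sum c \<xi>) UNIV"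
    by (rule has_sum_finite_neutralI[of "{- \<xi>}"]) (auto simp: fcoeff_character)
  then show ?thesis
    by (simp add: fourier_eq distr_of_def torus_smooth_character infsumI)
qed

lemma seminorm_C_fourier_series_le:
  fixes c :: "int ^ 'n::finite \<Rightarrow> complex"
  assumes "rapid c"
  shows "seminorm_C k (fourier_series c) \<le>
    card {\<alpha> :: nat ^ 'n. mi_order \<alpha> \<le> k} * (\<Sum>\<^sub>\<infinity>\<xi>. norm (c \<xi>) * weight \<xi> ^ k)"
  unfolding seminorm_C_def
proof (rule sum_bounded_above)
  fix \<alpha> :: "nat ^ 'n" assume "\<alpha> \<in> {\<alpha>. mi_order \<alpha> \<le> k}"
  then have \<alpha>: "mi_order \<alpha> \<le> k" by simp
  show "(SUP x. norm (mi_D \<alpha> (fourier_series c) x)) \<le> (\<Sum>\<^sub>\<infinity>\<xi>. norm (c \<xi>) * weight \<xi> ^ k)"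
  proof (rule cSUP_least)
    fix x
    have r: "rapid (\<lambda>\<xi>. monomial \<alpha> \<xi> * c \<xi>)"
      by (intro rapid_mult tempered_monomial assms)
    have "norm (mi_D \<alpha> (fourier_series c) x) \<le> (\<Sum>\<^sub>\<infinity>\<xi>. norm (monomial \<alpha> \<xi> * c \<xi>))"
      unfolding mi_D_fourier_series[OF assms] by (rule norm_fourier_series_le[OF r])
    also have "\<dots> \<le> (\<Sum>\<^sub>\<infinity>\<xi>. norm (c \<xi>) * weight \<xi> ^ k)"
    proof (intro infsum_mono rapid_norm_summable[OF r] rapid_summable assms)
      fix \<xi> :: "int ^ 'n"
      have "norm (monomial \<alpha> \<xi>) \<le> norm (rvec \<xi>) ^ mi_order \<alpha>" by (rule norm_monomial_le)
      also have "\<dots> \<le> weight \<xi> ^ mi_order \<alpha>" by (intro power_mono) (auto simp: weight_def)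
      also have "\<dots> \<le> weight \<xi> ^ k" by (intro power_increasing \<alpha> weight_ge_1)
      finally show "norm (monomial \<alpha> \<xi> * c \<xi>) \<le> norm (c \<xi>) * weight \<xi> ^ k"
        by (simp add: norm_mult mult_left_mono mult.commute)
    qed
    finally show "norm (mi_D \<alpha> (fourier_series c) x) \<le> (\<Sum>\<^sub>\<infinity>\<xi>. norm (c \<xi>) * weight \<xi> ^ k)" .
  qed simp
qed

lemma distributionsD:
  assumes "u \<in> distributions"
  shows "\<phi> \<notin> torus_smooth \<Longrightarrow> u \<phi> = 0"
    and "\<phi> \<in> torus_smooth \<Longrightarrow> \<psi> \<in> torus_smooth \<Longrightarrow> u (\<lambda>x. \<phi> x + c * \<psi> x) = u \<phi> + c * u \<psi>"
    and "\<exists>C k. 0 \<le> C \<and> (\<forall>\<phi>\<in>torus_smooth. norm (u \<phi>) \<le> C * seminorm_C k \<phi>)"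
proof -
  show "\<phi> \<notin> torus_smooth \<Longrightarrow> u \<phi> = 0"
    and "\<phi> \<in> torus_smooth \<Longrightarrow> \<psi> \<in> torus_smooth \<Longrightarrow> u (\<lambda>x. \<phi> x + c * \<psi> x) = u \<phi> + c * u \<psi>"
    using assms by (auto simp: distributions_def)
  obtain C k where C: "\<And>\<phi>. \<phi> \<in> torus_smooth \<Longrightarrow> norm (u \<phi>) \<le> C * seminorm_C k \<phi>"
    using assms unfolding distributions_def seminorm_C_def by blast
  \<comment> \<open>The constant in \<open>distributions\<close> carries no sign; since the seminorm
    is non-negative, its absolute value serves as well.\<close>
  have "norm (u \<phi>) \<le> \<bar>C\<bar> * seminorm_C k \<phi>" if "\<phi> \<in> torus_smooth" for \<phi>
  proof -
    have "0 \<le> seminorm_C k \<phi>"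
      by (rule order_trans[OF norm_ge_zero norm_mi_D_le_seminorm[OF that, of 0 k 0]]) (simp add: mi_order_def)
    then have "C * seminorm_C k \<phi> \<le> \<bar>C\<bar> * seminorm_C k \<phi>"
      by (simp add: mult_right_mono)
    then show ?thesis
      using C[OF that] by linarith
  qed
  then show "\<exists>C k. 0 \<le> C \<and> (\<forall>\<phi>\<in>torus_smooth. norm (u \<phi>) \<le> C * seminorm_C k \<phi>)"
    by (intro exI[of _ "\<bar>C\<bar>"] exI[of _ k]) auto
qed

text \<open>Three facts in one induction. With \<open>c\<close> the negative of the coefficients of
  \<phi>, the sum removes the frequencies in \<open>F\<close> from \<phi>, and linearity of
  \<open>u\<close>, stated only for binary combinations, is extended to this finite
  truncation.\<close>

lemma distributions_sum:
  assumes u: "u \<in> distributions" and "finite F" and \<phi>: "\<phi> \<in> torus_smooth"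
  shows "(\<lambda>x. \<phi> x + (\<Sum>\<xi>\<in>F. c \<xi> * character \<xi> x)) \<in> torus_smooth \<and>
    u (\<lambda>x. \<phi> x + (\<Sum>\<xi>\<in>F. c \<xi> * character \<xi> x)) = u \<phi> + (\<Sum>\<xi>\<in>F. c \<xi> * u (character \<xi>)) \<and>
    (\<forall>\<eta>. fcoeff (\<lambda>x. \<phi> x + (\<Sum>\<xi>\<in>F. c \<xi> * character \<xi> x)) \<eta> = fcoeff \<phi> \<eta> + (if \<eta> \<in> F then c \<eta> else 0))"
  using assms(2)
proof (induction F)
  case empty
  then show ?case using \<phi> by simp
next
  case (insert \<xi> F)
  let ?\<psi> = "\<lambda>x. \<phi> x + (\<Sum>\<xi>\<in>F. c \<xi> * character \<xi> x)"
  have eq: "(\<lambda>x. \<phi> x + (\<Sum>\<xi>\<in>insert \<xi> F. c \<xi> * character \<xi> x)) = (\<lambda>x. ?\<psi> x + c \<xi> * character \<xi> x)"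
    using insert.hyps by (simp add: fun_eq_iff add_ac)
  show ?case
    unfolding eq using insert
    by (auto simp: torus_smooth_add_mult torus_smooth_character distributionsD(2)[OF u]
        fcoeff_add_mult torus_smooth_continuous fcoeff_character)
qed

text \<open>By inversion the continuity estimate of \<open>u\<close> becomes a bound by the weighted
  absolute sum of the coefficients of the test function. Applied to a character it gives
  temperedness; applied to the tail of \<phi> it shows that the Fourier partial sums of the pairing
  converge to \<open>u \<phi>\<close>.\<close>

lemma distributions_eq:
  fixes u :: "'n::finite functional"
  assumes u: "u \<in> distributions"
  shows tempered_fourier: "tempered (fourier u)" and distr_of_fourier: "distr_of (fourier u) = u"
proof -
  obtain C k where C: "0 \<le> C" "\<And>\<phi>. \<phi> \<in> torus_smooth \<Longrightarrow> norm (u \<phi>) \<le> C * seminorm_C k \<phi>"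
    using distributionsD(3)[OF u] by blast
  define K where "K = C * real (card {\<alpha> :: nat ^ 'n. mi_order \<alpha> \<le> k})"
  have K: "norm (u \<phi>) \<le> K * (\<Sum>\<^sub>\<infinity>\<xi>. norm (fcoeff \<phi> \<xi>) * weight \<xi> ^ k)" if \<phi>: "\<phi> \<in> torus_smooth" for \<phi>
  proof -
    have "norm (u \<phi>) \<le> C * seminorm_C k (fourier_series (fcoeff \<phi>))"
      using C(2)[OF \<phi>] by (simp add: fourier_series_fcoeff \<phi>)
    also have "\<dots> \<le> K * (\<Sum>\<^sub>\<infinity>\<xi>. norm (fcoeff \<phi> \<xi>) * weight \<xi> ^ k)"
      unfolding K_def mult.assoc by (intro mult_left_mono seminorm_C_fourier_series_le rapid_fcoeff \<phi> C)
    finally show ?thesis .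
  qed
  have "norm (fourier u \<xi>) \<le> K * weight \<xi> ^ k" for \<xi>
  proof -
    have "((\<lambda>\<eta>. norm (fcoeff (character (- \<xi>)) \<eta>) * weight \<eta> ^ k) has_sum weight \<xi> ^ k) UNIV"
      by (rule has_sum_finite_neutralI[of "{- \<xi>}"]) (auto simp: fcoeff_character)
    then show ?thesis
      using K[OF torus_smooth_character, of "- \<xi>"] by (simp add: fourier_eq infsumI)
  qed
  then show t: "tempered (fourier u)" unfolding tempered_def by blast
  show "distr_of (fourier u) = u"
  proof
    fix \<phi>
    show "distr_of (fourier u) \<phi> = u \<phi>"
    proof (cases "\<phi> \<in> torus_smooth")
      case False
      then show ?thesis by (simp add: distr_of_def distributionsD(1)[OF u])
    next
      case \<phi>: True
      let ?top = "finite_subsets_at_top (UNIV :: (int ^ 'n) set)"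
      define a where "a \<xi> = norm (fcoeff \<phi> \<xi>) * weight \<xi> ^ k" for \<xi>
      have a: "(a has_sum infsum a UNIV) UNIV"
        unfolding a_def by (intro has_sum_infsum rapid_summable rapid_fcoeff \<phi>)
      have "((\<lambda>\<xi>. fourier u (- \<xi>) * fcoeff \<phi> \<xi>) has_sum u \<phi>) UNIV"
        unfolding has_sum_def
      proof (rule Lim_transform2)
        show "((\<lambda>F. u \<phi>) \<longlongrightarrow> u \<phi>) ?top" by simp
        show "((\<lambda>F. u \<phi> - (\<Sum>\<xi>\<in>F. fourier u (- \<xi>) * fcoeff \<phi> \<xi>)) \<longlongrightarrow> 0) ?top"
        proof (rule Lim_null_comparison)
          have "((\<lambda>F. K * (infsum a UNIV - sum a F)) \<longlongrightarrow> K * (infsum a UNIV - infsum a UNIV)) ?top"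
            using a unfolding has_sum_def by (intro tendsto_intros)
          then show "((\<lambda>F. K * (infsum a UNIV - sum a F)) \<longlongrightarrow> 0) ?top" by simp
          have "norm (u \<phi> - (\<Sum>\<xi>\<in>F. fourier u (- \<xi>) * fcoeff \<phi> \<xi>)) \<le> K * (infsum a UNIV - sum a F)"
            if F: "finite F" for F
          proof -
            \<comment> \<open>The tail of \<phi>: its coefficients in \<open>F\<close> are removed,
              so its weighted sum is the remainder of a convergent series.\<close>
            let ?\<psi> = "\<lambda>x. \<phi> x + (\<Sum>\<xi>\<in>F. - fcoeff \<phi> \<xi> * character \<xi> x)"
            have \<psi>: "?\<psi> \<in> torus_smooth" "u ?\<psi> = u \<phi> + (\<Sum>\<xi>\<in>F. - fcoeff \<phi> \<xi> * u (character \<xi>))"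
              "\<And>\<eta>. fcoeff ?\<psi> \<eta> = fcoeff \<phi> \<eta> + (if \<eta> \<in> F then - fcoeff \<phi> \<eta> else 0)"
              using distributions_sum[OF u F \<phi>, of "\<lambda>\<xi>. - fcoeff \<phi> \<xi>"] by blast+
            have "((\<lambda>\<xi>. a \<xi> + - (if \<xi> \<in> F then a \<xi> else 0)) has_sum infsum a UNIV + - sum a F) UNIV"
              by (intro has_sum_add a has_sum_uminusI has_sum_finite_neutralI[OF F]) auto
            moreover have "a \<xi> + - (if \<xi> \<in> F then a \<xi> else 0) = norm (fcoeff ?\<psi> \<xi>) * weight \<xi> ^ k" for \<xi>
              unfolding \<psi>(3) a_def by simp
            ultimately have "(\<Sum>\<^sub>\<infinity>\<xi>. norm (fcoeff ?\<psi> \<xi>) * weight \<xi> ^ k) = infsum a UNIV - sum a F"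
              by (simp add: infsumI)
            moreover have "u \<phi> - (\<Sum>\<xi>\<in>F. fourier u (- \<xi>) * fcoeff \<phi> \<xi>) = u ?\<psi>"
              unfolding \<psi>(2) by (simp add: fourier_eq sum_negf mult.commute)
            ultimately show ?thesis
              using K[OF \<psi>(1)] by simp
          qed
          then show "\<forall>\<^sub>F F in ?top. norm (u \<phi> - (\<Sum>\<xi>\<in>F. fourier u (- \<xi>) * fcoeff \<phi> \<xi>)) \<le> K * (infsum a UNIV - sum a F)"
            by (intro eventually_finite_subsets_at_top_weakI)
        qed
      qed
      then show ?thesis
        using has_sum_unique[OF has_sum_distr_of[OF t \<phi>]] by blast
    qed
  qed
qed

lemma distributions_eqI:
  assumes "u \<in> distributions" "v \<in> distributions" "\<And>\<xi>. fourier u \<xi> = fourier v \<xi>"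
  shows "u = v"
proof -
  have eq: "fourier u = fourier v" using assms(3) by (rule ext)
  have "u = distr_of (fourier u)" by (rule distr_of_fourier[OF assms(1), symmetric])
  also have "\<dots> = v" unfolding eq by (rule distr_of_fourier[OF assms(2)])
  finally show ?thesis .
qed

section \<open>Differential operators as Fourier multipliers\<close>

lemma tempered_minus: "tempered c \<Longrightarrow> tempered (\<lambda>\<xi>. - c \<xi>)"
  by (simp add: tempered_def)

lemma distr_of_add:
  assumes "tempered c" "tempered d"
  shows "distr_of c + distr_of d = distr_of (\<lambda>\<xi>. c \<xi> + d \<xi>)"
proof
  fix \<phi>
  show "(distr_of c + distr_of d) \<phi> = distr_of (\<lambda>\<xi>. c \<xi> + d \<xi>) \<phi>"
  proof (cases "\<phi> \<in> torus_smooth")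
    case True
    have "((\<lambda>\<xi>. c (- \<xi>) * fcoeff \<phi> \<xi> + d (- \<xi>) * fcoeff \<phi> \<xi>) has_sum distr_of c \<phi> + distr_of d \<phi>) UNIV"
      by (intro has_sum_add has_sum_distr_of assms True)
    then show ?thesis
      using True by (simp add: distr_of_def distrib_right infsumI)
  qed (simp add: distr_of_def)
qed

lemma smul_distr_of: "a *\<^sub>D distr_of c = distr_of (\<lambda>\<xi>. a * c \<xi>)"
  by (simp add: smul_def distr_of_def fun_eq_iff mult.assoc infsum_cmult_right')

lemma uminus_distr_of: "- distr_of c = distr_of (\<lambda>\<xi>. - c \<xi>)"
  by (simp add: distr_of_def fun_eq_iff infsum_uminus)

lemma distr_of_sum:
  "finite I \<Longrightarrow> (\<And>i. i \<in> I \<Longrightarrow> tempered (c i)) \<Longrightarrow> (\<Sum>i\<in>I. distr_of (c i)) = distr_of (\<lambda>\<xi>. \<Sum>i\<in>I. c i \<xi>)"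
proof (induction I rule: finite_induct)
  case empty
  show ?case by (simp add: distr_of_def fun_eq_iff)
qed (simp add: distr_of_add tempered_sum)

lemma distr_pd_distr_of: "distr_pd j (distr_of c) = distr_of (\<lambda>\<xi>. \<i> * of_int (\<xi> $ j) * c \<xi>)"
proof
  fix \<phi>
  show "distr_pd j (distr_of c) \<phi> = distr_of (\<lambda>\<xi>. \<i> * of_int (\<xi> $ j) * c \<xi>) \<phi>"
  proof (cases "\<phi> \<in> torus_smooth")
    case True
    have "fcoeff (pd j \<phi>) \<xi> = \<i> * of_int (\<xi> $ j) * fcoeff \<phi> \<xi>" for \<xi>
      by (simp add: pd_eq_Dx fcoeff_cmult fcoeff_Dx[OF True])
    then have "(\<Sum>\<^sub>\<infinity>\<xi>. \<i> * of_int ((- \<xi>) $ j) * c (- \<xi>) * fcoeff \<phi> \<xi>) =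
        (\<Sum>\<^sub>\<infinity>\<xi>. - (c (- \<xi>) * fcoeff (pd j \<phi>) \<xi>))"
      by (intro infsum_cong) simp
    then show ?thesis
      using True by (simp add: distr_pd_def distr_of_def torus_smooth_pd infsum_uminus)
  qed (simp add: distr_pd_def distr_of_def)
qed

text \<open>The Laplacian multiplies by -|\<xi>|^2, so the leading term has a positive sign and each
  coefficient y of a solution satisfies D_t y + symbol y = F, where F is the coefficient of
  f.\<close>

definition symbol :: "(real \<Rightarrow> complex) \<Rightarrow> ('n::finite \<Rightarrow> real \<Rightarrow> complex) \<Rightarrow> (real \<Rightarrow> complex) \<Rightarrow>
    real \<Rightarrow> int ^ 'n \<Rightarrow> complex" where
  "symbol a2 a1 a0 t \<xi> = a2 t * of_real ((norm (rvec \<xi>))\<^sup>2) + (\<Sum>j\<in>UNIV. a1 j t * of_int (\<xi> $ j)) + a0 t"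

lemma norm_rvec_square: "(norm (rvec \<xi>))\<^sup>2 = (\<Sum>j\<in>UNIV. (of_int (\<xi> $ j))\<^sup>2)"
  by (simp add: norm_vec_def L2_set_def sum_nonneg)

lemma tempered_symbol: "tempered (symbol a2 a1 a0 t)"
  unfolding symbol_def[abs_def] norm_rvec_square of_real_sum of_real_power of_real_of_int_eq
  by (intro tempered_add tempered_mult tempered_sum tempered_const tempered_power tempered_component)

lemma spatial_part_distr_of:
  fixes c :: "int ^ 'n::finite \<Rightarrow> complex"
  assumes "tempered c"
  shows "spatial_part a2 a1 a0 t (distr_of c) = distr_of (\<lambda>\<xi>. symbol a2 a1 a0 t \<xi> * c \<xi>)"
proof -
  note ts = tempered_add tempered_mult tempered_sum tempered_const tempered_power tempered_component assms
  have lap: "laplacian (distr_of c) = distr_of (\<lambda>\<xi>. \<Sum>j\<in>UNIV. \<i> * of_int (\<xi> $ j) * (\<i> * of_int (\<xi> $ j) * c \<xi>))"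
    unfolding laplacian_def distr_pd_distr_of by (intro distr_of_sum ts) auto
  have one: "(\<Sum>j\<in>UNIV. a1 j t *\<^sub>D distr_Dx j (distr_of c)) =
      distr_of (\<lambda>\<xi>. \<Sum>j\<in>UNIV. a1 j t * (1 / \<i> * (\<i> * of_int (\<xi> $ j) * c \<xi>)))"
    unfolding distr_Dx_def distr_pd_distr_of smul_distr_of by (intro distr_of_sum ts) auto
  have "spatial_part a2 a1 a0 t (distr_of c) =
      distr_of (\<lambda>\<xi>. - (a2 t * (\<Sum>j\<in>UNIV. \<i> * of_int (\<xi> $ j) * (\<i> * of_int (\<xi> $ j) * c \<xi>))) +
        (\<Sum>j\<in>UNIV. a1 j t * (1 / \<i> * (\<i> * of_int (\<xi> $ j) * c \<xi>))) + a0 t * c \<xi>)"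
    unfolding spatial_part_def lap one smul_distr_of uminus_distr_of
    by (subst distr_of_add; (intro tempered_minus ts)?)+ (rule refl)
  also have "(\<lambda>\<xi>. - (a2 t * (\<Sum>j\<in>UNIV. \<i> * of_int (\<xi> $ j) * (\<i> * of_int (\<xi> $ j) * c \<xi>))) +
        (\<Sum>j\<in>UNIV. a1 j t * (1 / \<i> * (\<i> * of_int (\<xi> $ j) * c \<xi>))) + a0 t * c \<xi>) =
      (\<lambda>\<xi>. symbol a2 a1 a0 t \<xi> * c \<xi>)"
  proof
    fix \<xi>
    have "(\<Sum>j\<in>UNIV. \<i> * of_int (\<xi> $ j) * (\<i> * of_int (\<xi> $ j) * c \<xi>)) =
        - (\<Sum>j\<in>UNIV. (of_int (\<xi> $ j))\<^sup>2) * c \<xi>"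
      unfolding sum_negf[symmetric] sum_distrib_right
      by (intro sum.cong) (simp_all add: power2_eq_square mult_ac)
    moreover have "(\<Sum>j\<in>UNIV. a1 j t * (1 / \<i> * (\<i> * of_int (\<xi> $ j) * c \<xi>))) =
        (\<Sum>j\<in>UNIV. a1 j t * of_int (\<xi> $ j)) * c \<xi>"
      unfolding sum_distrib_right by (intro sum.cong) (simp_all add: field_simps)
    ultimately show "- (a2 t * (\<Sum>j\<in>UNIV. \<i> * of_int (\<xi> $ j) * (\<i> * of_int (\<xi> $ j) * c \<xi>))) +
        (\<Sum>j\<in>UNIV. a1 j t * (1 / \<i> * (\<i> * of_int (\<xi> $ j) * c \<xi>))) + a0 t * c \<xi> =
      symbol a2 a1 a0 t \<xi> * c \<xi>"
      by (simp add: symbol_def norm_rvec_square algebra_simps)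
  qed
  finally show ?thesis .
qed

text \<open>Obtained by comparing coefficients of two distributions, which takes the place of a
  Parseval identity; what has to be checked is that integration against \<open>F\<close> is
  continuous in the test function.\<close>

lemma fun_distr_eq:
  assumes F: "F \<in> torus_smooth" shows "fun_distr F = distr_of (fcoeff F)"
proof (rule distributions_eqI)
  show "distr_of (fcoeff F) \<in> distributions"
  proof (rule distr_of_in_distributions)
    obtain A where "\<And>\<xi>. norm (fcoeff F \<xi>) * weight \<xi> ^ 0 \<le> A"
      using rapid_fcoeff[OF F] unfolding rapid_def by metis
    then show "tempered (fcoeff F)"
      unfolding tempered_def by (intro exI[of _ A] exI[of _ 0]) simp
  qed
  show "fourier (fun_distr F) \<xi> = fourier (distr_of (fcoeff F)) \<xi>" for \<xi>
    by (simp add: fourier_distr_of) (simp add: fourier_eq fun_distr_def torus_smooth_character fcoeff_def)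
  have eq: "fun_distr F \<phi> = fcoeff (\<lambda>x. F x * \<phi> x) 0" if "\<phi> \<in> torus_smooth" for \<phi>
    using that by (simp add: fun_distr_def fcoeff_def)
  show "fun_distr F \<in> distributions"
    unfolding distributions_def
  proof (intro CollectI conjI allI ballI impI)
    fix \<phi> \<psi> :: "real ^ 'a \<Rightarrow> complex" and a assume \<phi>: "\<phi> \<in> torus_smooth" "\<psi> \<in> torus_smooth"
    have "(\<lambda>x. F x * (\<phi> x + a * \<psi> x)) = (\<lambda>x. F x * \<phi> x + a * (F x * \<psi> x))"
      by (simp add: fun_eq_iff algebra_simps)
    then show "fun_distr F (\<lambda>x. \<phi> x + a * \<psi> x) = fun_distr F \<phi> + a * fun_distr F \<psi>"
      using fcoeff_add_mult[of "\<lambda>x. F x * \<phi> x" "\<lambda>x. F x * \<psi> x" a 0]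
      by (simp add: eq \<phi> torus_smooth_add_mult continuous_on_mult torus_smooth_continuous F)
  next
    obtain B where B: "\<And>x. norm (F x) \<le> B"
      using torus_smooth_bdd[OF F] by (auto simp: bdd_above_def)
    have "norm (fun_distr F \<phi>) \<le> B * seminorm_C 0 \<phi>" if \<phi>: "\<phi> \<in> torus_smooth" for \<phi>
      unfolding eq[OF \<phi>]
    proof (rule norm_fcoeff_le)
      show "continuous_on UNIV (\<lambda>x. F x * \<phi> x)"
        by (intro continuous_intros torus_smooth_continuous F \<phi>)
      have "mi_D 0 \<phi> = fourier_series (\<lambda>\<xi>. monomial 0 \<xi> * fcoeff \<phi> \<xi>)"
        using mi_D_fourier_series[OF rapid_fcoeff[OF \<phi>]] by (simp add: fourier_series_fcoeff \<phi>)
      then have "mi_D 0 \<phi> = \<phi>" by (simp add: monomial_def fourier_series_fcoeff \<phi>)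
      then have "norm (\<phi> x) \<le> seminorm_C 0 \<phi>" for x
        using norm_mi_D_le_seminorm[OF \<phi>, of 0 0 x] by (simp add: mi_order_def)
      then show "norm (F x * \<phi> x) \<le> B * seminorm_C 0 \<phi>" for x
        unfolding norm_mult using B[of x] by (intro mult_mono) (auto intro: order_trans[OF norm_ge_zero])
    qed
    then show "\<exists>C k. \<forall>\<phi>\<in>torus_smooth. norm (fun_distr F \<phi>) \<le> C * (\<Sum>\<alpha> | mi_order \<alpha> \<le> k. SUP x. norm (mi_D \<alpha> \<phi> x))"
      unfolding seminorm_C_def by blast
  qed (simp add: fun_distr_def)
qed

section \<open>Convergence in Sobolev spaces\<close>

text \<open>Dominated convergence for unconditional sums along an arbitrary filter. A finite set
  carries all but e/3 of the majorant; on it the convergence is that of a finite sum, and off it the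
  majorant bounds what is left.\<close>

lemma infsum_tendsto_0_dominated:
  fixes g :: "'a \<Rightarrow> 'b \<Rightarrow> real"
  assumes h: "h summable_on UNIV"
    and bound: "\<forall>\<^sub>F t in F. \<forall>x. 0 \<le> g t x \<and> g t x \<le> h x"
    and lim: "\<And>x. ((\<lambda>t. g t x) \<longlongrightarrow> 0) F"
  shows "((\<lambda>t. infsum (g t) UNIV) \<longlongrightarrow> 0) F"
proof (rule tendstoI)
  fix e :: real assume "e > 0"
  have "(sum h \<longlongrightarrow> infsum h UNIV) (finite_subsets_at_top UNIV)"
    using has_sum_infsum[OF h] by (simp add: has_sum_def)
  then have "\<forall>\<^sub>F A in finite_subsets_at_top UNIV. dist (sum h A) (infsum h UNIV) < e / 3"
    using \<open>e > 0\<close> by (intro tendstoD) auto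
  then obtain A where A: "finite A" "dist (sum h A) (infsum h UNIV) < e / 3"
    unfolding eventually_finite_subsets_at_top by blast
  have "((\<lambda>t. \<Sum>x\<in>A. g t x) \<longlongrightarrow> (\<Sum>x\<in>A. 0)) F"
    by (intro tendsto_sum lim)
  then have "\<forall>\<^sub>F t in F. dist (\<Sum>x\<in>A. g t x) 0 < e / 3"
    using \<open>e > 0\<close> by (intro tendstoD) auto
  with bound show "\<forall>\<^sub>F t in F. dist (infsum (g t) UNIV) 0 < e"
  proof eventually_elim
    fix t assume t: "\<forall>x. 0 \<le> g t x \<and> g t x \<le> h x" "dist (\<Sum>x\<in>A. g t x) 0 < e / 3"
    then have h0: "0 \<le> h x" for x using order_trans by blast
    have summ: "g t summable_on UNIV"
      by (rule summable_on_comparison_test[OF h]) (use t in auto)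
    \<comment> \<open>One third of e comes from the finite set and one from the tail; the last third
      makes the final inequality strict.\<close>
    have "infsum (g t) UNIV \<le> 2 * e / 3"
    proof (rule infsum_le_finite_sums[OF summ])
      fix B :: "'b set" assume B: "finite B"
      have "sum (g t) B \<le> sum (g t) (A \<union> (B - A))"
        using A B t by (intro sum_mono2) auto
      also have "\<dots> = sum (g t) A + sum (g t) (B - A)"
        using A B by (intro sum.union_disjoint) auto
      also have "sum (g t) (B - A) \<le> sum h (B - A)"
        using t by (intro sum_mono) auto
      also have "sum h (B - A) = sum h (A \<union> (B - A)) - sum h A"
        using A B by (subst sum.union_disjoint) auto
      also have "sum h (A \<union> (B - A)) \<le> infsum h UNIV"
        using A B h h0 by (intro finite_sum_le_infsum) auto
      finally show "sum (g t) B \<le> 2 * e / 3"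
        using A(2) t(2) unfolding dist_real_def by linarith
    qed
    moreover have "0 \<le> infsum (g t) UNIV"
      by (intro infsum_nonneg) (use t in auto)
    ultimately show "dist (infsum (g t) UNIV) 0 < e"
      using \<open>e > 0\<close> by (simp add: dist_real_def)
  qed
qed

section \<open>Sobolev spaces as weighted square-summable families\<close>

lemma fourier_add: "fourier (u + v) \<xi> = fourier u \<xi> + fourier v \<xi>"
  and fourier_diff: "fourier (u - v) \<xi> = fourier u \<xi> - fourier v \<xi>"
  and fourier_smul: "fourier (a *\<^sub>D u) \<xi> = a * fourier u \<xi>"
  by (simp_all add: fourier_def smul_def)

lemma distributions_add:
  assumes "u \<in> distributions" "v \<in> distributions" shows "u + v \<in> distributions"
proof -
  have "distr_of (fourier u) + distr_of (fourier v) \<in> distributions"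
    by (simp add: distr_of_add tempered_fourier assms distr_of_in_distributions tempered_add)
  then show ?thesis by (simp only: distr_of_fourier assms)
qed

lemma distributions_smul:
  assumes "u \<in> distributions" shows "a *\<^sub>D u \<in> distributions"
proof -
  have "a *\<^sub>D distr_of (fourier u) \<in> distributions"
    by (simp add: smul_distr_of tempered_fourier assms distr_of_in_distributions tempered_mult tempered_const)
  then show ?thesis by (simp only: distr_of_fourier assms)
qed

lemma distributions_diff:
  assumes "u \<in> distributions" "v \<in> distributions" shows "u - v \<in> distributions"
proof -
  have "u - v = u + (-1) *\<^sub>D v" by (simp add: fun_eq_iff smul_def)
  then show ?thesis by (simp only: assms distributions_add distributions_smul)
qed

text \<open>Written as the square of a weighted modulus so that a finite partial sum is the square
  of an \<open>L2_set\<close>; \<open>sobolev_term_eq\<close> recovers the form used in the Sobolev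
  norm.\<close>

definition sobolev_term :: "real \<Rightarrow> (int ^ 'n::finite \<Rightarrow> complex) \<Rightarrow> int ^ 'n \<Rightarrow> real" where
  "sobolev_term r c \<xi> = (norm (c \<xi>) * weight \<xi> powr r)\<^sup>2"

lemma sobolev_term_eq: "sobolev_term r c \<xi> = (norm (c \<xi>))\<^sup>2 * weight \<xi> powr (2 * r)"
  using powr_powr[of "weight \<xi>" r 2] weight_pos[of \<xi>]
  by (simp add: sobolev_term_def power_mult_distrib mult.commute)

lemma sobolev_term_nonneg [simp]: "0 \<le> sobolev_term r c \<xi>"
  by (simp add: sobolev_term_def)

lemma sobolev_iff: "u \<in> sobolev r \<longleftrightarrow> u \<in> distributions \<and> sobolev_term r (fourier u) summable_on UNIV"
  unfolding sobolev_def sobolev_term_eq[abs_def] weight_def by simp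

lemma sobolev_norm_eq: "sobolev_norm r u = sqrt (infsum (sobolev_term r (fourier u)) UNIV)"
  unfolding sobolev_norm_def sobolev_term_eq[abs_def] weight_def by simp

lemma sobolev_norm_nonneg: "0 \<le> sobolev_norm r u"
  by (simp add: sobolev_norm_eq infsum_nonneg)

lemma sobolev_term_mono:
  assumes "norm (c \<xi>) \<le> norm (d \<xi>)" "r \<le> r'"
  shows "sobolev_term r c \<xi> \<le> sobolev_term r' d \<xi>"
  unfolding sobolev_term_def
  by (intro power_mono mult_mono powr_mono assms weight_ge_1) auto

text \<open>Minkowski's inequality on each finite set of frequencies, with right-hand sides
  independent of the set; summability and the triangle inequality follow together.\<close>

lemma sobolev_term_triangle:
  fixes c d :: "int ^ 'n::finite \<Rightarrow> complex"
  assumes c: "sobolev_term r c summable_on UNIV" and d: "sobolev_term r d summable_on UNIV"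
  shows "sobolev_term r (\<lambda>\<xi>. c \<xi> + d \<xi>) summable_on UNIV"
    and "sqrt (infsum (sobolev_term r (\<lambda>\<xi>. c \<xi> + d \<xi>)) UNIV) \<le>
      sqrt (infsum (sobolev_term r c) UNIV) + sqrt (infsum (sobolev_term r d) UNIV)"
proof -
  let ?S = "sqrt (infsum (sobolev_term r c) UNIV) + sqrt (infsum (sobolev_term r d) UNIV)"
  have fin: "sum (sobolev_term r (\<lambda>\<xi>. c \<xi> + d \<xi>)) F \<le> ?S\<^sup>2" if F: "finite F" for F
  proof -
    have "L2_set (\<lambda>\<xi>. norm (c \<xi> + d \<xi>) * weight \<xi> powr r) F \<le>
        L2_set (\<lambda>\<xi>. norm (c \<xi>) * weight \<xi> powr r + norm (d \<xi>) * weight \<xi> powr r) F"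
      by (intro L2_set_mono) (auto simp: norm_triangle_ineq mult_right_mono simp flip: distrib_right)
    also have "\<dots> \<le> L2_set (\<lambda>\<xi>. norm (c \<xi>) * weight \<xi> powr r) F + L2_set (\<lambda>\<xi>. norm (d \<xi>) * weight \<xi> powr r) F"
      by (rule L2_set_triangle_ineq)
    also have "\<dots> = sqrt (sum (sobolev_term r c) F) + sqrt (sum (sobolev_term r d) F)"
      by (simp add: L2_set_def sobolev_term_def)
    also have "\<dots> \<le> ?S"
      by (intro add_mono real_sqrt_le_mono finite_sum_le_infsum F c d) auto
    finally have "sqrt (sum (sobolev_term r (\<lambda>\<xi>. c \<xi> + d \<xi>)) F) \<le> ?S"
      by (simp add: L2_set_def sobolev_term_def)
    then show ?thesis by (rule sqrt_le_D)
  qed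
  show s: "sobolev_term r (\<lambda>\<xi>. c \<xi> + d \<xi>) summable_on UNIV"
    by (rule nonneg_bdd_above_summable_on) (auto intro!: bdd_aboveI2 fin)
  show "sqrt (infsum (sobolev_term r (\<lambda>\<xi>. c \<xi> + d \<xi>)) UNIV) \<le> ?S"
    by (intro real_le_lsqrt infsum_le_finite_sums s fin infsum_nonneg add_nonneg_nonneg real_sqrt_ge_zero) auto
qed

lemma sobolev_term_cmult: "sobolev_term r (\<lambda>\<xi>. a * c \<xi>) \<xi> = (norm a)\<^sup>2 * sobolev_term r c \<xi>"
  by (simp add: sobolev_term_def norm_mult power_mult_distrib)

lemma sobolev_add:
  assumes "u \<in> sobolev r" "v \<in> sobolev r"
  shows "u + v \<in> sobolev r" and "sobolev_norm r (u + v) \<le> sobolev_norm r u + sobolev_norm r v"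
  using assms sobolev_term_triangle[of r "fourier u" "fourier v"]
  by (simp_all add: sobolev_iff sobolev_norm_eq distributions_add fourier_add[abs_def])

lemma sobolev_smul:
  assumes "u \<in> sobolev r"
  shows "a *\<^sub>D u \<in> sobolev r" and "sobolev_norm r (a *\<^sub>D u) = norm a * sobolev_norm r u"
  using assms
  by (simp_all add: sobolev_iff sobolev_norm_eq distributions_smul fourier_smul[abs_def] sobolev_term_cmult[abs_def]
      summable_on_cmult_right infsum_cmult_right' real_sqrt_mult)

lemma sobolev_diff:
  assumes "u \<in> sobolev r" "v \<in> sobolev r" shows "u - v \<in> sobolev r"
proof -
  have "u - v = u + (-1) *\<^sub>D v" by (simp add: fun_eq_iff smul_def)
  then show ?thesis by (simp only: assms sobolev_add sobolev_smul)
qed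

lemma sobolev_norm_minus_commute: "sobolev_norm r (u - v) = sobolev_norm r (v - u)"
  by (simp add: sobolev_norm_eq sobolev_term_def[abs_def] fourier_diff norm_minus_commute)

lemma norm_fourier_le_sobolev_norm:
  assumes "u \<in> sobolev r"
  shows "norm (fourier u \<xi>) \<le> weight \<xi> powr (- r) * sobolev_norm r u"
proof -
  have "sum (sobolev_term r (fourier u)) {\<xi>} \<le> infsum (sobolev_term r (fourier u)) UNIV"
    using assms by (intro finite_sum_le_infsum) (auto simp: sobolev_iff)
  then have "norm (fourier u \<xi>) * weight \<xi> powr r \<le> sobolev_norm r u"
    by (simp add: sobolev_norm_eq sobolev_term_def real_le_rsqrt)
  then have "weight \<xi> powr (- r) * (norm (fourier u \<xi>) * weight \<xi> powr r) \<le> weight \<xi> powr (- r) * sobolev_norm r u"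
    by (rule mult_left_mono) simp
  then show ?thesis
    using weight_pos[of \<xi>] by (simp add: powr_minus field_simps)
qed

lemma Metric_space_sobolev: "Metric_space (sobolev r) (\<lambda>u v. sobolev_norm r (u - v))"
proof
  show "0 \<le> sobolev_norm r (u - v)" for u v :: "'n::finite functional" by (rule sobolev_norm_nonneg)
  show "sobolev_norm r (u - v) = sobolev_norm r (v - u)" for u v :: "'n::finite functional"
    by (rule sobolev_norm_minus_commute)
next
  fix u v :: "'n::finite functional" assume uv: "u \<in> sobolev r" "v \<in> sobolev r"
  show "sobolev_norm r (u - v) = 0 \<longleftrightarrow> u = v"
  proof
    assume 0: "sobolev_norm r (u - v) = 0"
    have "fourier u \<xi> = fourier v \<xi>" for \<xi>
      using norm_fourier_le_sobolev_norm[OF sobolev_diff[OF uv], of \<xi>] 0 by (simp add: fourier_diff)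
    then show "u = v" using uv by (intro distributions_eqI) (auto simp: sobolev_iff)
  qed (simp add: sobolev_norm_eq fourier_def sobolev_term_def[abs_def])
next
  fix u v w :: "'n::finite functional" assume uvw: "u \<in> sobolev r" "v \<in> sobolev r" "w \<in> sobolev r"
  have "u - w = (u - v) + (v - w)" by simp
  then show "sobolev_norm r (u - w) \<le> sobolev_norm r (u - v) + sobolev_norm r (v - w)"
    using sobolev_add(2)[of "u - v" r "v - w"] uvw by (simp add: sobolev_diff)
qed

lemma topspace_sobolev: "topspace (sobolev_top r) = sobolev r"
  unfolding sobolev_top_def by (rule Metric_space.topspace_mtopology[OF Metric_space_sobolev])

lemma limitin_sobolev:
  "limitin (sobolev_top r) f l F \<longleftrightarrow> l \<in> sobolev r \<and> (\<forall>\<^sub>F t in F. f t \<in> sobolev r) \<and>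
     ((\<lambda>t. sobolev_norm r (f t - l)) \<longlongrightarrow> 0) F"
  unfolding sobolev_top_def by (rule Metric_space.limitin_metric_dist_null[OF Metric_space_sobolev])

section \<open>Continuous maps in time\<close>

text \<open>Expresses continuity into an arbitrary topology by limits along
  \<open>at t within S\<close>, so that continuity and difference quotients in all three spaces are
  handled by the same \<open>limitin\<close> criteria.\<close>

lemma continuous_map_top_of_set_limitin:
  "continuous_map (top_of_set S) X f \<longleftrightarrow> (\<forall>t\<in>S. limitin X f (f t) (at t within S))"
proof -
  have "atin_within euclidean t S = at t within S" for t :: 'a
    unfolding filter_eq_iff eventually_atin_within eventually_at_topological by auto
  then show ?thesis
    by (simp add: continuous_map_atin atin_subtopology_within)
qed

lemma C0_maps_iff:
  "u \<in> C0_maps T X \<longleftrightarrow> u \<in> extensional {0..T} \<and> (\<forall>t\<in>{0..T}. limitin X u (u t) (at t within {0..T}))"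
  by (simp add: C0_maps_def continuous_map_top_of_set_limitin)

lemma C0_maps_mem: "u \<in> C0_maps T X \<Longrightarrow> t \<in> {0..T} \<Longrightarrow> u t \<in> topspace X"
  unfolding C0_maps_iff by (auto intro: limitin_topspace)

lemma sobolev_mono:
  assumes "r \<le> r'" shows "u \<in> sobolev r' \<Longrightarrow> u \<in> sobolev r"
    and "u \<in> sobolev r' \<Longrightarrow> sobolev_norm r u \<le> sobolev_norm r' u"
proof -
  assume u: "u \<in> sobolev r'"
  then have s: "sobolev_term r' (fourier u) summable_on UNIV" by (simp add: sobolev_iff)
  then have s': "sobolev_term r (fourier u) summable_on UNIV"
    by (rule summable_on_comparison_test) (auto intro: sobolev_term_mono assms)
  with u show "u \<in> sobolev r" by (simp add: sobolev_iff)
  show "sobolev_norm r u \<le> sobolev_norm r' u"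
    unfolding sobolev_norm_eq
    by (intro real_sqrt_le_mono infsum_mono s s' sobolev_term_mono assms order_refl)
qed

lemma limitin_sobolev_mono:
  assumes "r \<le> r'" "limitin (sobolev_top r') f l F"
  shows "limitin (sobolev_top r) f l F"
proof -
  have l: "l \<in> sobolev r'" and ev: "\<forall>\<^sub>F t in F. f t \<in> sobolev r'"
    and lim: "((\<lambda>t. sobolev_norm r' (f t - l)) \<longlongrightarrow> 0) F"
    using assms(2) by (auto simp: limitin_sobolev)
  have "((\<lambda>t. sobolev_norm r (f t - l)) \<longlongrightarrow> 0) F"
  proof (rule Lim_null_comparison[OF _ lim])
    show "\<forall>\<^sub>F t in F. norm (sobolev_norm r (f t - l)) \<le> sobolev_norm r' (f t - l)"
      using ev by eventually_elim (simp add: sobolev_norm_nonneg sobolev_mono(2)[OF assms(1)] sobolev_diff l)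
  qed
  with l ev show ?thesis
    by (auto simp: limitin_sobolev sobolev_mono[OF assms(1)] elim: eventually_mono)
qed

text \<open>The criterion behind continuity of the solution: convergence of each coefficient
  together with one majorant in the weighted square-summable class. Differences are dominated by
  twice the majorant, and dominated convergence applies to their squares.\<close>

lemma limitin_sobolev_dominated:
  fixes M :: "int ^ 'n::finite \<Rightarrow> real"
  assumes M: "sobolev_term r (\<lambda>\<xi>. of_real (M \<xi>)) summable_on UNIV"
    and l: "l \<in> distributions" "\<And>\<xi>. norm (fourier l \<xi>) \<le> M \<xi>"
    and f: "\<forall>\<^sub>F t in F. f t \<in> distributions \<and> (\<forall>\<xi>. norm (fourier (f t) \<xi>) \<le> M \<xi>)"
    and lim: "\<And>\<xi>. ((\<lambda>t. fourier (f t) \<xi>) \<longlongrightarrow> fourier l \<xi>) F"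
  shows "limitin (sobolev_top r) f l F"
  unfolding limitin_sobolev
proof (intro conjI)
  have M0: "0 \<le> M \<xi>" for \<xi> using l(2)[of \<xi>] norm_ge_zero order_trans by blast
  have summ: "sobolev_term r c summable_on UNIV" if "\<And>\<xi>. norm (c \<xi>) \<le> M \<xi>" for c
    by (rule summable_on_comparison_test[OF M]) (use that M0 in \<open>auto intro!: sobolev_term_mono\<close>)
  show "l \<in> sobolev r" using l summ by (simp add: sobolev_iff)
  show "\<forall>\<^sub>F t in F. f t \<in> sobolev r"
    using f by eventually_elim (simp add: sobolev_iff summ)
  have "((\<lambda>t. infsum (sobolev_term r (fourier (f t - l))) UNIV) \<longlongrightarrow> 0) F"
  proof (rule infsum_tendsto_0_dominated)
    show "sobolev_term r (\<lambda>\<xi>. 2 * of_real (M \<xi>)) summable_on UNIV"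
      unfolding sobolev_term_cmult[abs_def] by (intro summable_on_cmult_right M)
    show "\<forall>\<^sub>F t in F. \<forall>\<xi>. 0 \<le> sobolev_term r (fourier (f t - l)) \<xi> \<and>
        sobolev_term r (fourier (f t - l)) \<xi> \<le> sobolev_term r (\<lambda>\<xi>. 2 * of_real (M \<xi>)) \<xi>"
      using f
    proof eventually_elim
      fix t assume t: "f t \<in> distributions \<and> (\<forall>\<xi>. norm (fourier (f t) \<xi>) \<le> M \<xi>)"
      have "norm (fourier (f t - l) \<xi>) \<le> norm (2 * of_real (M \<xi>) :: complex)" for \<xi>
      proof -
        have "norm (fourier (f t) \<xi> - fourier l \<xi>) \<le> M \<xi> + M \<xi>"
          using t l(2)[of \<xi>] by (intro order_trans[OF norm_triangle_ineq4] add_mono) auto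
        then show ?thesis using M0[of \<xi>] by (simp add: fourier_diff norm_mult)
      qed
      then show "\<forall>\<xi>. 0 \<le> sobolev_term r (fourier (f t - l)) \<xi> \<and>
        sobolev_term r (fourier (f t - l)) \<xi> \<le> sobolev_term r (\<lambda>\<xi>. 2 * of_real (M \<xi>)) \<xi>"
        by (auto intro!: sobolev_term_mono)
    qed
    fix \<xi>
    have "((\<lambda>t. (norm (fourier (f t) \<xi> - fourier l \<xi>) * weight \<xi> powr r)\<^sup>2) \<longlongrightarrow>
        (norm (fourier l \<xi> - fourier l \<xi>) * weight \<xi> powr r)\<^sup>2) F"
      by (intro tendsto_intros lim)
    then show "((\<lambda>t. sobolev_term r (fourier (f t - l)) \<xi>) \<longlongrightarrow> 0) F"
      by (simp add: sobolev_term_def fourier_diff)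
  qed
  then show "((\<lambda>t. sobolev_norm r (f t - l)) \<longlongrightarrow> 0) F"
    unfolding sobolev_norm_eq using tendsto_real_sqrt[of _ 0] by simp
qed

lemma limitin_sobolev_fourier:
  assumes "limitin (sobolev_top r) f l F"
  shows "((\<lambda>t. fourier (f t) \<xi>) \<longlongrightarrow> fourier l \<xi>) F"
proof -
  have l: "l \<in> sobolev r" and ev: "\<forall>\<^sub>F t in F. f t \<in> sobolev r"
    and lim: "((\<lambda>t. sobolev_norm r (f t - l)) \<longlongrightarrow> 0) F"
    using assms by (auto simp: limitin_sobolev)
  have "((\<lambda>t. fourier (f t) \<xi> - fourier l \<xi>) \<longlongrightarrow> 0) F"
  proof (rule Lim_null_comparison)
    show "\<forall>\<^sub>F t in F. norm (fourier (f t) \<xi> - fourier l \<xi>) \<le> weight \<xi> powr (- r) * sobolev_norm r (f t - l)"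
      using ev
    proof eventually_elim
      fix t assume "f t \<in> sobolev r"
      from norm_fourier_le_sobolev_norm[OF sobolev_diff[OF this l], of \<xi>]
      show "norm (fourier (f t) \<xi> - fourier l \<xi>) \<le> weight \<xi> powr (- r) * sobolev_norm r (f t - l)"
        by (simp add: fourier_diff)
    qed
    show "((\<lambda>t. weight \<xi> powr (- r) * sobolev_norm r (f t - l)) \<longlongrightarrow> 0) F"
      using tendsto_mult_right_zero[OF lim] by simp
  qed
  then show ?thesis by (simp add: LIM_zero_iff)
qed

lemma C0_sobolev_continuous_fourier:
  assumes "u \<in> C0_maps T (sobolev_top r)"
  shows "continuous_on {0..T} (\<lambda>t. fourier (u t) \<xi>)"
  unfolding continuous_on_def
  using assms by (auto simp: C0_maps_iff intro: limitin_sobolev_fourier)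

text \<open>The reverse triangle inequality makes the norm of \<open>u t\<close> a continuous
  function on a compact interval.\<close>

lemma C0_sobolev_bounded:
  assumes u: "u \<in> C0_maps T (sobolev_top r)"
  obtains B where "\<And>t. t \<in> {0..T} \<Longrightarrow> sobolev_norm r (u t) \<le> B"
proof -
  have mem: "u t \<in> sobolev r" if "t \<in> {0..T}" for t
    using C0_maps_mem[OF u that] by (simp add: topspace_sobolev)
  have "continuous_on {0..T} (\<lambda>t. sobolev_norm r (u t))"
    unfolding continuous_on_def
  proof
    fix t assume t: "t \<in> {0..T}"
    let ?F = "at t within {0..T}"
    have lim: "((\<lambda>\<tau>. sobolev_norm r (u \<tau> - u t)) \<longlongrightarrow> 0) ?F"
      using u t by (auto simp: C0_maps_iff limitin_sobolev)
    have "((\<lambda>\<tau>. sobolev_norm r (u \<tau>) - sobolev_norm r (u t)) \<longlongrightarrow> 0) ?F"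
    proof (rule Lim_null_comparison[OF _ lim])
      show "\<forall>\<^sub>F \<tau> in ?F. norm (sobolev_norm r (u \<tau>) - sobolev_norm r (u t)) \<le> sobolev_norm r (u \<tau> - u t)"
        unfolding eventually_at_filter
      proof (intro always_eventually allI impI)
        fix \<tau> assume \<tau>: "\<tau> \<in> {0..T}"
        have "sobolev_norm r (u \<tau>) \<le> sobolev_norm r (u \<tau> - u t) + sobolev_norm r (u t)"
          using sobolev_add(2)[OF sobolev_diff[OF mem[OF \<tau>] mem[OF t]] mem[OF t]] by simp
        moreover have "sobolev_norm r (u t) \<le> sobolev_norm r (u t - u \<tau>) + sobolev_norm r (u \<tau>)"
          using sobolev_add(2)[OF sobolev_diff[OF mem[OF t] mem[OF \<tau>]] mem[OF \<tau>]] by simp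
        ultimately show "norm (sobolev_norm r (u \<tau>) - sobolev_norm r (u t)) \<le> sobolev_norm r (u \<tau> - u t)"
          using sobolev_norm_minus_commute[of r "u t" "u \<tau>"] by simp
      qed
    qed
    then show "((\<lambda>t. sobolev_norm r (u t)) \<longlongrightarrow> sobolev_norm r (u t)) ?F"
      by (simp add: LIM_zero_iff)
  qed
  then have "bounded ((\<lambda>t. sobolev_norm r (u t)) ` {0..T})"
    by (intro compact_imp_bounded compact_continuous_image) auto
  then obtain B where "\<forall>x\<in>(\<lambda>t. sobolev_norm r (u t)) ` {0..T}. norm x \<le> B"
    unfolding bounded_iff by blast
  then show ?thesis by (intro that[of B]) force
qed

subsection \<open>Smooth functions as distributions\<close>

text \<open>For the converse direction r is rounded up to a natural number k. In the squared
  weighted coefficient one factor is bounded and the other summable, both by rapid decay.\<close>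

lemma Cinf_iff: "u \<in> Cinf \<longleftrightarrow> u \<in> distributions \<and> rapid (fourier u)"
proof (intro iffI conjI)
  assume u: "u \<in> Cinf"
  then show "u \<in> distributions" by (auto simp: Cinf_def sobolev_iff)
  show "rapid (fourier u)"
    unfolding rapid_def
  proof
    fix k
    have "u \<in> sobolev (real k)" using u by (auto simp: Cinf_def)
    note * = norm_fourier_le_sobolev_norm[OF this]
    have "norm (fourier u \<xi>) * weight \<xi> ^ k \<le> sobolev_norm k u" for \<xi>
      using weight_pos[of \<xi>] *[of \<xi>] by (simp add: powr_minus powr_realpow[OF weight_pos] field_simps)
    then show "\<exists>C. \<forall>\<xi>. norm (fourier u \<xi>) * weight \<xi> ^ k \<le> C" by blast
  qed
next
  assume u: "u \<in> distributions \<and> rapid (fourier u)"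
  show "u \<in> Cinf"
    unfolding Cinf_def
  proof
    fix r :: real
    define k where "k = nat \<lceil>r\<rceil>"
    have rk: "r \<le> real k" by (simp add: k_def of_nat_ceiling)
    obtain C where C: "\<And>\<xi>. norm (fourier u \<xi>) * weight \<xi> ^ k \<le> C"
      using u unfolding rapid_def by metis
    have "(\<lambda>\<xi>. C * (norm (fourier u \<xi>) * weight \<xi> ^ k)) summable_on UNIV"
      by (intro summable_on_cmult_right rapid_summable) (use u in blast)
    then have "sobolev_term r (fourier u) summable_on UNIV"
    proof (rule summable_on_comparison_test)
      fix \<xi>
      have "sobolev_term r (fourier u) \<xi> \<le> sobolev_term k (fourier u) \<xi>"
        by (intro sobolev_term_mono rk order_refl)
      also have "\<dots> = (norm (fourier u \<xi>) * weight \<xi> ^ k) * (norm (fourier u \<xi>) * weight \<xi> ^ k)"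
        by (simp add: sobolev_term_def powr_realpow weight_pos power2_eq_square)
      also have "\<dots> \<le> C * (norm (fourier u \<xi>) * weight \<xi> ^ k)"
        by (intro mult_right_mono C) (simp add: weight_nonneg)
      finally show "sobolev_term r (fourier u) \<xi> \<le> C * (norm (fourier u \<xi>) * weight \<xi> ^ k)" .
    qed simp
    with u show "u \<in> sobolev r" by (simp add: sobolev_iff)
  qed
qed

text \<open>Convergence in the projective limit is convergence in every Sobolev space. The topology
  is given by generators, so the converse direction is an induction over how an open set is
  generated.\<close>

lemma limitin_Cinf:
  "limitin Cinf_top f l F \<longleftrightarrow> l \<in> Cinf \<and> (\<forall>\<^sub>F t in F. f t \<in> Cinf) \<and> (\<forall>r. limitin (sobolev_top r) f l F)"
proof (intro iffI conjI allI)
  let ?B = "{Cinf \<inter> U | U r. openin (sobolev_top r) U}"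
  assume lim: "limitin Cinf_top f l F"
  have "l \<in> \<Union>?B" using limitin_topspace[OF lim] by (simp add: Cinf_top_def)
  then show l: "l \<in> Cinf" by blast
  have ev: "\<forall>\<^sub>F t in F. f t \<in> Cinf \<inter> U" if "openin (sobolev_top r) U" "l \<in> U" for U r
  proof -
    have "openin Cinf_top (Cinf \<inter> U)"
      unfolding Cinf_top_def openin_topology_generated_by_iff
      by (rule generate_topology_on.Basis) (use that in blast)
    then show ?thesis using lim l that unfolding limitin_def by blast
  qed
  \<comment> \<open>The order 0 is an arbitrary choice: any one order shows that \<open>f t\<close>
    eventually lies in \<open>Cinf\<close>.\<close>
  have "l \<in> sobolev 0" using l by (auto simp: Cinf_def)
  then have "\<forall>\<^sub>F t in F. f t \<in> Cinf \<inter> sobolev 0"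
    by (intro ev[of 0]) (simp_all flip: topspace_sobolev)
  then show "\<forall>\<^sub>F t in F. f t \<in> Cinf" by (rule eventually_mono) simp
  fix r
  show "limitin (sobolev_top r) f l F"
    unfolding limitin_def
  proof (intro conjI allI impI)
    show "l \<in> topspace (sobolev_top r)" using l by (auto simp: Cinf_def topspace_sobolev)
    fix U assume "openin (sobolev_top r) U \<and> l \<in> U"
    then show "\<forall>\<^sub>F t in F. f t \<in> U" using ev[of r U] by (auto elim: eventually_mono)
  qed
next
  let ?B = "{Cinf \<inter> U | U r. openin (sobolev_top r) U}"
  assume *: "l \<in> Cinf \<and> (\<forall>\<^sub>F t in F. f t \<in> Cinf) \<and> (\<forall>r. limitin (sobolev_top r) f l F)"
  show "limitin Cinf_top f l F"
    unfolding limitin_def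
  proof (intro conjI allI impI)
    have "l \<in> Cinf \<inter> topspace (sobolev_top 0)" using * by (auto simp: Cinf_def topspace_sobolev)
    moreover have "Cinf \<inter> topspace (sobolev_top 0) \<in> ?B" by blast
    ultimately show "l \<in> topspace Cinf_top"
      unfolding Cinf_top_def topology_generated_by_topspace by blast
    fix U assume "openin Cinf_top U \<and> l \<in> U"
    then have "generate_topology_on ?B U" "l \<in> U"
      by (simp_all add: Cinf_top_def openin_topology_generated_by_iff)
    then show "\<forall>\<^sub>F t in F. f t \<in> U"
    proof (induction)
      case (Int a b)
      then show ?case by (simp add: eventually_conj_iff)
    next
      case (UN K)
      then obtain k where "k \<in> K" "l \<in> k" by blast
      with UN have "\<forall>\<^sub>F t in F. f t \<in> k" by blast
      then show ?case by (rule eventually_mono) (use \<open>k \<in> K\<close> in blast)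
    next
      case (Basis s)
      then obtain V r where V: "s = Cinf \<inter> V" "openin (sobolev_top r) V" by blast
      then have "\<forall>\<^sub>F t in F. f t \<in> V"
        using * Basis.prems unfolding limitin_def by blast
      moreover have "\<forall>\<^sub>F t in F. f t \<in> Cinf" using * by blast
      ultimately show ?case unfolding V(1) by (auto elim: eventually_elim2)
    qed simp
  qed
qed

lemma topspace_Cinf: "topspace Cinf_top = Cinf"
proof
  show "topspace Cinf_top \<subseteq> Cinf" by (auto simp: Cinf_top_def)
  have "Cinf \<inter> topspace (sobolev_top 0) \<in> {Cinf \<inter> U | U r. openin (sobolev_top r) U}" by blast
  then have "Cinf \<inter> topspace (sobolev_top 0) \<subseteq> topspace Cinf_top"
    unfolding Cinf_top_def topology_generated_by_topspace by blast
  then show "Cinf \<subseteq> topspace Cinf_top"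
    by (auto simp: topspace_sobolev Cinf_def)
qed

lemma C0_maps_Cinf_iff:
  "u \<in> C0_maps T Cinf_top \<longleftrightarrow> (\<forall>r. u \<in> C0_maps T (sobolev_top r)) \<and> (\<forall>t\<in>{0..T}. u t \<in> Cinf)"
proof (intro iffI conjI allI)
  assume u: "u \<in> C0_maps T Cinf_top"
  then show "u \<in> C0_maps T (sobolev_top r)" for r by (auto simp: C0_maps_iff limitin_Cinf)
  show "\<forall>t\<in>{0..T}. u t \<in> Cinf" using C0_maps_mem[OF u] by (simp add: topspace_Cinf)
next
  assume u: "(\<forall>r. u \<in> C0_maps T (sobolev_top r)) \<and> (\<forall>t\<in>{0..T}. u t \<in> Cinf)"
  then show "u \<in> C0_maps T Cinf_top"
    by (auto simp: C0_maps_iff limitin_Cinf eventually_at_filter)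
qed

section \<open>Gevrey spaces\<close>

text \<open>One term of the exponential series is at most its sum. The Gevrey estimates and the flat
  functions both rest on this comparison.\<close>

lemma power_div_fact_le_exp:
  fixes y :: real assumes "0 \<le> y" shows "y ^ k / fact k \<le> exp y"
proof -
  have "(\<Sum>n\<in>{k}. y ^ n /\<^sub>R fact n) \<le> (\<Sum>n. y ^ n /\<^sub>R fact n)"
    using assms by (intro sum_le_suminf summable_exp_generic) auto
  then show ?thesis by (simp add: exp_def divide_inverse mult.commute)
qed

text \<open>The coefficient decay that corresponds to derivative bounds \<open>h^k k!^s\<close>: a
  smaller \<epsilon> goes with a larger h. The two directions are
  \<open>gevrey_derivative_bound\<close> and \<open>gevrey_coefficient_bound\<close>.\<close>

definition gevrey_decay :: "real \<Rightarrow> real \<Rightarrow> int ^ 'n::finite \<Rightarrow> real" where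
  "gevrey_decay s \<epsilon> \<xi> = exp (- \<epsilon> * norm (rvec \<xi>) powr (1 / s))"

lemma gevrey_decay_pos [simp]: "0 < gevrey_decay s \<epsilon> \<xi>"
  by (simp add: gevrey_decay_def)

text \<open>Any constant that bounds a modulus in this way is non-negative, so constants obtained
  from existence statements need no separate sign condition.\<close>

lemma gevrey_bound_nonneg:
  assumes "norm z \<le> A * gevrey_decay s \<epsilon> \<xi>" shows "0 \<le> A"
proof (rule ccontr)
  assume "\<not> 0 \<le> A"
  then have "A * gevrey_decay s \<epsilon> \<xi> < 0" by (intro mult_neg_pos) auto
  with assms norm_ge_zero[of z] show False by linarith
qed

text \<open>Half of the rate is regularly sacrificed: one factor absorbs polynomial growth, gives
  summability or supplies smallness, while the other keeps exponential decay.\<close>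

lemma gevrey_decay_split: "gevrey_decay s \<epsilon> \<xi> = gevrey_decay s (\<epsilon> / 2) \<xi> * gevrey_decay s (\<epsilon> / 2) \<xi>"
  by (simp add: gevrey_decay_def flip: exp_add)

text \<open>Apply y^k / k! \<le> exp y at y = (\<epsilon>/s) x^(1/s), solve for x^(k/s), and raise
  to the power s.\<close>

lemma power_exp_decay_le:
  fixes x :: real
  assumes "s > 0" "\<epsilon> > 0" "x \<ge> 0"
  shows "x ^ k * exp (- \<epsilon> * x powr (1 / s)) \<le> ((s / \<epsilon>) powr s) ^ k * fact k powr s"
proof (cases "x = 0")
  case True
  then show ?thesis using assms by (cases k) auto
next
  case False
  with assms have x: "x > 0" by simp
  define y where "y = x powr (1 / s)"
  have y: "y > 0" using x by (simp add: y_def)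
  have "(\<epsilon> / s * y) ^ k / fact k \<le> exp (\<epsilon> / s * y)"
    using assms y by (intro power_div_fact_le_exp) auto
  then have "(\<epsilon> / s * y) ^ k \<le> fact k * exp (\<epsilon> / s * y)"
    by (simp add: divide_le_eq mult.commute[of "fact k"])
  then have "(\<epsilon> / s) ^ k * y ^ k \<le> fact k * exp (\<epsilon> / s * y)"
    by (simp only: power_mult_distrib)
  then have "(s / \<epsilon>) ^ k * ((\<epsilon> / s) ^ k * y ^ k) \<le> (s / \<epsilon>) ^ k * (fact k * exp (\<epsilon> / s * y))"
    using assms by (intro mult_left_mono) auto
  moreover have "(s / \<epsilon>) ^ k * ((\<epsilon> / s) ^ k * y ^ k) = y ^ k"
    using assms by (simp add: mult.assoc[symmetric] power_mult_distrib[symmetric])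
  ultimately have "y ^ k * exp (- (\<epsilon> / s * y)) \<le> (s / \<epsilon>) ^ k * (fact k * exp (\<epsilon> / s * y)) * exp (- (\<epsilon> / s * y))"
    by (intro mult_right_mono) auto
  also have "\<dots> = (s / \<epsilon>) ^ k * fact k"
    by (simp add: mult.assoc flip: exp_add)
  finally have "(y ^ k * exp (- (\<epsilon> / s * y))) powr s \<le> ((s / \<epsilon>) ^ k * fact k) powr s"
    using assms y by (intro powr_mono2) auto
  moreover have "(y ^ k * exp (- (\<epsilon> / s * y))) powr s = x ^ k * exp (- \<epsilon> * y)"
  proof -
    have "(y ^ k) powr s = x ^ k"
      using x assms by (simp add: y_def powr_powr mult.commute flip: powr_realpow)
    moreover have "exp (- (\<epsilon> / s * y)) powr s = exp (- \<epsilon> * y)"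
      using assms by (simp add: exp_powr_real)
    ultimately show ?thesis by (simp add: powr_mult)
  qed
  moreover have "((s / \<epsilon>) ^ k * fact k) powr s = ((s / \<epsilon>) powr s) ^ k * fact k powr s"
  proof -
    have "((s / \<epsilon>) ^ k) powr s = ((s / \<epsilon>) powr s) ^ k"
      using assms by (simp add: powr_powr mult.commute flip: powr_realpow)
    then show ?thesis by (simp add: powr_mult)
  qed
  ultimately show ?thesis by (simp add: y_def)
qed

text \<open>Instead of optimizing over k, the hypotheses are summed. After taking powers 1/s they
  read B y^k \<le> k!; dividing by 2^k k! and summing over k gives B exp(y/2) \<le> 2. Raising to
  the power s produces the factor 2^s and the rate s/2.\<close>

lemma exp_decay_of_power_bounds:
  fixes x :: real
  assumes "s > 0" "h > 0" "x \<ge> 0" "a \<ge> 0" "A \<ge> 0"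
    and bound: "\<And>k. x ^ k * a \<le> A * h ^ k * fact k powr s"
  shows "a \<le> 2 powr s * A * exp (- (s / 2) * (x / h) powr (1 / s))"
proof (cases "a = 0 \<or> x = 0")
  case True
  have "a \<le> A" using bound[of 0] by simp
  moreover have "1 * A \<le> 2 powr s * A"
    using assms by (intro mult_right_mono ge_one_powr_ge_zero) auto
  ultimately show ?thesis using True assms by auto
next
  case False
  with assms have x: "x > 0" and a: "a > 0" by auto
  have A: "A > 0" using bound[of 0] a by simp
  define y where "y = (x / h) powr (1 / s)"
  define B where "B = (a / A) powr (1 / s)"
  have y: "y > 0" and B: "B > 0" using x a A assms by (simp_all add: y_def B_def)
  have By: "B * y ^ k \<le> fact k" for k
  proof -
    have "(a / A) * (x / h) ^ k \<le> fact k powr s"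
      using bound[of k] A assms by (simp add: power_divide divide_simps mult_ac)
    then have "((a / A) * (x / h) ^ k) powr (1 / s) \<le> (fact k powr s) powr (1 / s)"
      using A a x assms by (intro powr_mono2) auto
    moreover have "((x / h) ^ k) powr (1 / s) = y ^ k"
      using x assms by (simp add: y_def powr_powr mult.commute flip: powr_realpow)
    moreover have "((a / A) * (x / h) ^ k) powr (1 / s) = (a / A) powr (1 / s) * ((x / h) ^ k) powr (1 / s)"
      by (rule powr_mult)
    moreover have "(fact k powr s) powr (1 / s) = fact k"
      using assms by (simp add: powr_powr)
    ultimately show ?thesis
      by (simp only: B_def)
  qed
  have "B * exp (y / 2) \<le> 2"
  proof -
    have "(\<lambda>k. B * ((y / 2) ^ k /\<^sub>R fact k)) sums (B * exp (y / 2))"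
      by (intro sums_mult exp_converges)
    moreover have "(\<lambda>k. (1 / 2 :: real) ^ k) sums 2"
      using geometric_sums[of "1 / 2 :: real"] by simp
    moreover have "B * ((y / 2) ^ k /\<^sub>R fact k) \<le> (1 / 2) ^ k" for k
      using By[of k] by (simp add: power_divide divide_simps mult_ac)
    ultimately show ?thesis by (rule sums_le[rotated])
  qed
  then have "B \<le> 2 * exp (- (y / 2))"
    by (simp add: exp_minus field_simps)
  then have "B powr s \<le> (2 * exp (- (y / 2))) powr s"
    using B assms by (intro powr_mono2) auto
  moreover have "B powr s = a / A" using a A assms by (simp add: B_def powr_powr)
  moreover have "(2 * exp (- (y / 2))) powr s = 2 powr s * exp (- (s / 2) * y)"
    by (simp add: powr_mult exp_powr_real mult.commute)
  ultimately have "a / A \<le> 2 powr s * exp (- (s / 2) * y)" by simp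
  then show ?thesis using A by (simp add: y_def divide_le_eq mult_ac)
qed

lemma rapid_gevrey_decay:
  assumes "s > 0" "\<epsilon> > 0" shows "rapid (\<lambda>\<xi>. of_real (gevrey_decay s \<epsilon> \<xi>))"
  unfolding rapid_def
proof (intro allI exI)
  fix k and \<xi> :: "int ^ 'a"
  define x where "x = norm (rvec \<xi>)"
  have x: "x \<ge> 0" by (simp add: x_def)
  have d: "gevrey_decay s \<epsilon> \<xi> = exp (- \<epsilon> * x powr (1 / s))" by (simp add: gevrey_decay_def x_def)
  have "weight \<xi> ^ k \<le> (2 * max 1 x) ^ k"
    unfolding weight_def x_def[symmetric] by (intro power_mono) (use x in auto)
  also have "\<dots> \<le> 2 ^ k * (1 + x ^ k)"
    unfolding power_mult_distrib by (intro mult_left_mono) (use x in \<open>auto simp: max_def\<close>)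
  finally have "gevrey_decay s \<epsilon> \<xi> * weight \<xi> ^ k \<le> gevrey_decay s \<epsilon> \<xi> * (2 ^ k * (1 + x ^ k))"
    by (intro mult_left_mono) (simp_all add: less_imp_le)
  also have "\<dots> = 2 ^ k * (gevrey_decay s \<epsilon> \<xi> + x ^ k * gevrey_decay s \<epsilon> \<xi>)"
    by (simp add: algebra_simps)
  also have "\<dots> \<le> 2 ^ k * (1 + ((s / \<epsilon>) powr s) ^ k * fact k powr s)"
    unfolding d by (intro mult_left_mono add_mono power_exp_decay_le assms x) (use assms in auto)
  finally show "norm (complex_of_real (gevrey_decay s \<epsilon> \<xi>)) * weight \<xi> ^ k
      \<le> 2 ^ k * (1 + ((s / \<epsilon>) powr s) ^ k * fact k powr s)"
    by (simp add: less_imp_le)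
qed

lemma rapid_dominated:
  assumes "rapid d" "\<And>\<xi>. norm (c \<xi>) \<le> A * norm (d \<xi>)" shows "rapid c"
  unfolding rapid_def
proof
  fix k
  obtain B where B: "\<And>\<xi>. norm (d \<xi>) * weight \<xi> ^ k \<le> B"
    using assms(1) unfolding rapid_def by metis
  have "norm (c \<xi>) * weight \<xi> ^ k \<le> \<bar>A\<bar> * B" for \<xi>
  proof -
    have "norm (c \<xi>) \<le> \<bar>A\<bar> * norm (d \<xi>)"
      using assms(2)[of \<xi>] mult_right_mono[OF abs_ge_self[of A] norm_ge_zero[of "d \<xi>"]] by linarith
    then have "norm (c \<xi>) * weight \<xi> ^ k \<le> (\<bar>A\<bar> * norm (d \<xi>)) * weight \<xi> ^ k"
      by (intro mult_right_mono) (simp_all add: weight_nonneg)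
    also have "\<dots> \<le> \<bar>A\<bar> * B"
      unfolding mult.assoc by (intro mult_left_mono B) simp
    finally show ?thesis .
  qed
  then show "\<exists>C. \<forall>\<xi>. norm (c \<xi>) * weight \<xi> ^ k \<le> C" by blast
qed

lemma rapid_gevrey:
  assumes "s > 0" "\<epsilon> > 0" "\<And>\<xi>. norm (c \<xi>) \<le> A * gevrey_decay s \<epsilon> \<xi>" shows "rapid c"
  by (rule rapid_dominated[OF rapid_gevrey_decay[OF assms(1,2)], of _ A]) (use assms(3) in \<open>simp add: less_imp_le\<close>)

text \<open>The constants h and K are fixed before the coefficients: all families with decay rate
  \<epsilon> land in the same step \<open>gevrey_h h s\<close>, with norm at most proportional to A.
  Half of the rate absorbs the monomial, the other half makes the sum finite.\<close>

lemma gevrey_derivative_bound: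
  assumes s: "s > 0" and \<epsilon>: "\<epsilon> > 0"
  obtains h K where "h > 0" "K > 0"
    "\<forall>(c :: int ^ 'n::finite \<Rightarrow> complex) A \<alpha> x. (\<forall>\<xi>. norm (c \<xi>) \<le> A * gevrey_decay s \<epsilon> \<xi>) \<longrightarrow>
       norm (mi_D \<alpha> (fourier_series c) x) \<le> A * K * (h ^ mi_order \<alpha> * fact (mi_order \<alpha>) powr s)"
proof
  let ?d = "\<lambda>\<xi> :: int ^ 'n. gevrey_decay s (\<epsilon> / 2) \<xi>"
  have summ: "?d summable_on UNIV"
    using rapid_norm_summable[OF rapid_gevrey_decay[of s "\<epsilon> / 2", where 'a = 'n]] s \<epsilon> by (simp add: less_imp_le)
  define h where "h = (s / (\<epsilon> / 2)) powr s"
  show "h > 0" using s \<epsilon> by (simp add: h_def)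
  \<comment> \<open>The added 1 turns non-negativity of the sum into positivity of K.\<close>
  define K where "K = infsum ?d UNIV + 1"
  have "infsum ?d UNIV \<ge> 0" by (intro infsum_nonneg) (simp add: less_imp_le)
  then show "K > 0" by (simp add: K_def)
  show "\<forall>(c :: int ^ 'n \<Rightarrow> complex) A \<alpha> x. (\<forall>\<xi>. norm (c \<xi>) \<le> A * gevrey_decay s \<epsilon> \<xi>) \<longrightarrow>
       norm (mi_D \<alpha> (fourier_series c) x) \<le> A * K * (h ^ mi_order \<alpha> * fact (mi_order \<alpha>) powr s)"
  proof (intro allI impI)
    fix c :: "int ^ 'n \<Rightarrow> complex" and A and \<alpha> :: "nat ^ 'n" and x
    assume "\<forall>\<xi>. norm (c \<xi>) \<le> A * gevrey_decay s \<epsilon> \<xi>"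
    then have c: "norm (c \<xi>) \<le> A * gevrey_decay s \<epsilon> \<xi>" for \<xi> by blast
    have A: "A \<ge> 0"
      by (rule gevrey_bound_nonneg[OF c])
    let ?H = "h ^ mi_order \<alpha> * fact (mi_order \<alpha>) powr s"
    have H: "?H \<ge> 0" using \<open>h > 0\<close> by simp
    have rc: "rapid c" by (rule rapid_gevrey[OF s \<epsilon> c])
    have r: "rapid (\<lambda>\<xi>. monomial \<alpha> \<xi> * c \<xi>)" by (intro rapid_mult tempered_monomial rc)
    have "norm (mi_D \<alpha> (fourier_series c) x) \<le> (\<Sum>\<^sub>\<infinity>\<xi>. norm (monomial \<alpha> \<xi> * c \<xi>))"
      unfolding mi_D_fourier_series[OF rc] by (rule norm_fourier_series_le[OF r])
    also have "\<dots> \<le> (\<Sum>\<^sub>\<infinity>\<xi>. A * ?H * ?d \<xi>)"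
    proof (intro infsum_mono rapid_norm_summable[OF r] summable_on_cmult_right summ)
      fix \<xi>
      have "norm (monomial \<alpha> \<xi> * c \<xi>) \<le> norm (rvec \<xi>) ^ mi_order \<alpha> * (A * gevrey_decay s \<epsilon> \<xi>)"
        unfolding norm_mult by (intro mult_mono norm_monomial_le c) auto
      also have "\<dots> = A * (norm (rvec \<xi>) ^ mi_order \<alpha> * ?d \<xi>) * ?d \<xi>"
        by (simp add: gevrey_decay_split[of s \<epsilon>] mult_ac)
      also have "\<dots> \<le> A * ?H * ?d \<xi>"
        using power_exp_decay_le[of s "\<epsilon> / 2" "norm (rvec \<xi>)" "mi_order \<alpha>"] s \<epsilon> A
        by (intro mult_right_mono mult_left_mono) (auto simp: h_def gevrey_decay_def)
      finally show "norm (monomial \<alpha> \<xi> * c \<xi>) \<le> A * ?H * ?d \<xi>" .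
    qed
    also have "\<dots> = A * ?H * infsum ?d UNIV" by (rule infsum_cmult_right')
    also have "\<dots> \<le> A * ?H * K"
      using A H by (intro mult_left_mono mult_nonneg_nonneg[of A]) (auto simp: K_def)
    finally show "norm (mi_D \<alpha> (fourier_series c) x) \<le> A * K * ?H" by (simp add: mult_ac)
  qed
qed

text \<open>\<open>the_fun\<close> chooses a preimage under \<open>fun_distr\<close>. The Fourier
  series of \<open>u\<close> is one, so the choice is legitimate; the chosen function has the
  coefficients of \<open>u\<close> and inversion identifies it with the series.\<close>

lemma the_fun_eq:
  assumes "u \<in> Cinf"
  shows "the_fun u = fourier_series (fourier u)" and "the_fun u \<in> torus_smooth" and "fcoeff (the_fun u) = fourier u"
proof -
  have u: "u \<in> distributions" "rapid (fourier u)" using assms by (auto simp: Cinf_iff)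
  have "fun_distr (fourier_series (fourier u)) = distr_of (fcoeff (fourier_series (fourier u)))"
    by (intro fun_distr_eq torus_smooth_fourier_series u)
  also have "fcoeff (fourier_series (fourier u)) = fourier u"
    using fcoeff_fourier_series[OF u(2)] by (rule ext)
  also have "distr_of (fourier u) = u" by (rule distr_of_fourier[OF u(1)])
  finally have "u \<in> fun_distr ` torus_smooth"
    using torus_smooth_fourier_series[OF u(2)] by (intro image_eqI[of _ _ "fourier_series (fourier u)"]) auto
  then have F: "the_fun u \<in> torus_smooth" "fun_distr (the_fun u) = u"
    unfolding the_fun_def by (simp_all add: inv_into_into f_inv_into_f)
  show "the_fun u \<in> torus_smooth" by (rule F)
  have "fourier u = fourier (distr_of (fcoeff (the_fun u)))"
    using F(2) unfolding fun_distr_eq[OF F(1)] by (rule arg_cong[OF sym])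
  also have "\<dots> = fcoeff (the_fun u)" by (rule ext) (rule fourier_distr_of)
  finally show eq: "fcoeff (the_fun u) = fourier u" by (rule sym)
  show "the_fun u = fourier_series (fourier u)"
    unfolding eq[symmetric] by (rule fourier_series_fcoeff[OF F(1), symmetric])
qed

text \<open>Pure derivatives in the dominant direction give the power bounds of
  \<open>exp_decay_of_power_bounds\<close> for that component. As before, \<epsilon> depends only on
  s, h and the dimension, not on \<open>u\<close>.\<close>

lemma gevrey_coefficient_bound:
  assumes s: "s > 0" and h: "h > 0"
  obtains \<epsilon> where "\<epsilon> > 0"
    "\<forall>(u :: 'n::finite functional) A \<xi>. u \<in> Cinf \<and>
       (\<forall>\<alpha> x. norm (mi_D \<alpha> (the_fun u) x) \<le> A * h ^ mi_order \<alpha> * fact (mi_order \<alpha>) powr s) \<longrightarrow>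
       norm (fourier u \<xi>) \<le> 2 powr s * A * gevrey_decay s \<epsilon> \<xi>"
proof
  let ?N = "real CARD('n)"
  have N: "?N > 0" by simp
  \<comment> \<open>The rate s/2 in terms of (x/h)^(1/s), with the dominant component x replaced by
    its lower bound |\<xi>|/N.\<close>
  define \<epsilon> where "\<epsilon> = (s / 2) * (1 / (?N * h)) powr (1 / s)"
  show "\<epsilon> > 0" using s h N by (simp add: \<epsilon>_def)
  show "\<forall>(u :: 'n functional) A \<xi>. u \<in> Cinf \<and>
       (\<forall>\<alpha> x. norm (mi_D \<alpha> (the_fun u) x) \<le> A * h ^ mi_order \<alpha> * fact (mi_order \<alpha>) powr s) \<longrightarrow>
       norm (fourier u \<xi>) \<le> 2 powr s * A * gevrey_decay s \<epsilon> \<xi>"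
  proof (intro allI impI)
    fix u :: "'n functional" and A and \<xi> :: "int ^ 'n"
    assume "u \<in> Cinf \<and> (\<forall>\<alpha> x. norm (mi_D \<alpha> (the_fun u) x) \<le> A * h ^ mi_order \<alpha> * fact (mi_order \<alpha>) powr s)"
    then have u: "u \<in> Cinf" and
      bound: "norm (mi_D \<alpha> (the_fun u) x) \<le> A * h ^ mi_order \<alpha> * fact (mi_order \<alpha>) powr s" for \<alpha> x
      by blast+
    have A: "A \<ge> 0" using order_trans[OF norm_ge_zero bound[of 0]] by (simp add: mi_order_def)
    obtain j where j: "norm (rvec \<xi>) \<le> ?N * \<bar>of_int (\<xi> $ j)\<bar>"
      using norm_rvec_le_component by blast
    define x where "x = \<bar>of_int (\<xi> $ j) :: real\<bar>"
    have "x ^ k * norm (fourier u \<xi>) \<le> A * h ^ k * fact k powr s" for k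
    proof -
      have "norm (fcoeff (mi_D (axis j k) (the_fun u)) \<xi>) \<le> A * h ^ k * fact k powr s"
        using bound[of "axis j k"]
        by (intro norm_fcoeff_le torus_smooth_continuous torus_smooth_mi_D the_fun_eq u) (simp add: mi_order_axis)
      then show ?thesis
        unfolding fcoeff_mi_D[OF the_fun_eq(2)[OF u]] the_fun_eq(3)[OF u]
        by (simp add: norm_mult norm_monomial_axis x_def)
    qed
    then have "norm (fourier u \<xi>) \<le> 2 powr s * A * exp (- (s / 2) * (x / h) powr (1 / s))"
      using s h A by (intro exp_decay_of_power_bounds) (auto simp: x_def)
    also have "\<dots> \<le> 2 powr s * A * gevrey_decay s \<epsilon> \<xi>"
    proof -
      have "norm (rvec \<xi>) / (?N * h) \<le> x / h"
        using j N h by (simp add: x_def field_simps)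
      then have "(norm (rvec \<xi>) * (1 / (?N * h))) powr (1 / s) \<le> (x / h) powr (1 / s)"
        using s h by (intro powr_mono2) auto
      then have "norm (rvec \<xi>) powr (1 / s) * (1 / (?N * h)) powr (1 / s) \<le> (x / h) powr (1 / s)"
        by (simp only: powr_mult)
      then have "(s / 2) * (norm (rvec \<xi>) powr (1 / s) * (1 / (?N * h)) powr (1 / s)) \<le> (s / 2) * (x / h) powr (1 / s)"
        using s by (intro mult_left_mono) auto
      then have "- (s / 2) * (x / h) powr (1 / s) \<le> - \<epsilon> * norm (rvec \<xi>) powr (1 / s)"
        by (simp add: \<epsilon>_def mult_ac)
      then show ?thesis
        unfolding gevrey_decay_def using A by (intro mult_left_mono) auto
    qed
    finally show "norm (fourier u \<xi>) \<le> 2 powr s * A * gevrey_decay s \<epsilon> \<xi>" .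
  qed
qed

lemma gevrey_iff:
  assumes s: "s > 0"
  shows "u \<in> gevrey s \<longleftrightarrow> u \<in> distributions \<and> (\<exists>C. \<exists>\<epsilon>>0. \<forall>\<xi>. norm (fourier u \<xi>) \<le> C * gevrey_decay s \<epsilon> \<xi>)"
proof
  assume "u \<in> gevrey s"
  then obtain C h where u: "u \<in> Cinf" "h > 0"
    "\<And>\<alpha> x. norm (mi_D \<alpha> (the_fun u) x) \<le> C * h ^ mi_order \<alpha> * fact (mi_order \<alpha>) powr s"
    by (auto simp: gevrey_def)
  obtain \<epsilon> where \<epsilon>: "\<epsilon> > 0" "\<And>\<xi>. norm (fourier u \<xi>) \<le> 2 powr s * C * gevrey_decay s \<epsilon> \<xi>"
    using gevrey_coefficient_bound[OF s u(2)] u(1,3) by metis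
  then show "u \<in> distributions \<and> (\<exists>C. \<exists>\<epsilon>>0. \<forall>\<xi>. norm (fourier u \<xi>) \<le> C * gevrey_decay s \<epsilon> \<xi>)"
    using u(1) by (auto simp: Cinf_iff)
next
  assume "u \<in> distributions \<and> (\<exists>C. \<exists>\<epsilon>>0. \<forall>\<xi>. norm (fourier u \<xi>) \<le> C * gevrey_decay s \<epsilon> \<xi>)"
  then obtain C \<epsilon> where u: "u \<in> distributions" "\<epsilon> > 0" "\<And>\<xi>. norm (fourier u \<xi>) \<le> C * gevrey_decay s \<epsilon> \<xi>"
    by blast
  have Cinf: "u \<in> Cinf" using u(1) rapid_gevrey[OF s u(2,3)] by (simp add: Cinf_iff)
  obtain h K where hK: "h > 0" "K > 0"
    "\<forall>(c :: int ^ 'a \<Rightarrow> complex) A \<alpha> x. (\<forall>\<xi>. norm (c \<xi>) \<le> A * gevrey_decay s \<epsilon> \<xi>) \<longrightarrow>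
       norm (mi_D \<alpha> (fourier_series c) x) \<le> A * K * (h ^ mi_order \<alpha> * fact (mi_order \<alpha>) powr s)"
    by (rule gevrey_derivative_bound[OF s u(2), where 'n = 'a])
  have C: "C \<ge> 0"
    by (rule gevrey_bound_nonneg[OF u(3)])
  \<comment> \<open>The added 1 provides the strictly positive constant that \<open>gevrey\<close>
    demands.\<close>
  have "norm (mi_D \<alpha> (the_fun u) x) \<le> (C * K + 1) * h ^ mi_order \<alpha> * fact (mi_order \<alpha>) powr s" for \<alpha> x
  proof -
    have "norm (mi_D \<alpha> (the_fun u) x) \<le> C * K * (h ^ mi_order \<alpha> * fact (mi_order \<alpha>) powr s)"
      unfolding the_fun_eq(1)[OF Cinf] using hK(3) u(3) by blast
    also have "\<dots> \<le> (C * K + 1) * (h ^ mi_order \<alpha> * fact (mi_order \<alpha>) powr s)"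
      using hK(1) by (intro mult_right_mono) auto
    finally show ?thesis by (simp add: mult.assoc)
  qed
  moreover have "C * K + 1 > 0" using C hK(2) by (simp add: add_nonneg_pos)
  ultimately show "u \<in> gevrey s"
    using Cinf hK(1) unfolding gevrey_def by blast
qed

lemma gevrey_normD:
  assumes "gevrey_norm h s v < ennreal \<eta>" "h > 0"
  shows "norm (mi_D \<alpha> (the_fun v) x) \<le> \<eta> * h ^ mi_order \<alpha> * fact (mi_order \<alpha>) powr s"
proof -
  let ?H = "h ^ mi_order \<alpha> * fact (mi_order \<alpha>) powr s"
  have H: "?H > 0" using assms(2) by simp
  have "ennreal (norm (mi_D \<alpha> (the_fun v) x) / ?H) \<le> gevrey_norm h s v"
    unfolding gevrey_norm_def by (rule SUP_upper2[OF UNIV_I], rule SUP_upper2[OF UNIV_I]) (rule order_refl)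
  also have "\<dots> < ennreal \<eta>" by (rule assms)
  finally have "norm (mi_D \<alpha> (the_fun v) x) / ?H < \<eta>"
    using H by (subst (asm) ennreal_less_iff) auto
  then show ?thesis using H by (simp add: divide_less_eq mult_ac less_imp_le)
qed

lemma gevrey_normI:
  fixes v :: "'n::finite functional"
  assumes "\<And>\<alpha> x. norm (mi_D \<alpha> (the_fun v) x) \<le> \<eta> * (h ^ mi_order \<alpha> * fact (mi_order \<alpha>) powr s)" "h > 0"
  shows "gevrey_norm h s v \<le> ennreal \<eta>"
  unfolding gevrey_norm_def
proof (intro SUP_least ennreal_leI)
  fix \<alpha> :: "nat ^ 'n" and x
  have "h ^ mi_order \<alpha> * fact (mi_order \<alpha>) powr s > 0" using assms(2) by simp
  then show "norm (mi_D \<alpha> (the_fun v) x) / (h ^ mi_order \<alpha> * fact (mi_order \<alpha>) powr s) \<le> \<eta>"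
    using assms(1)[of \<alpha> x] by (simp add: divide_le_eq)
qed

lemma finite_rvec_ball: "finite {\<xi> :: int ^ 'n::finite. norm (rvec \<xi>) \<le> R}"
proof (rule finite_subset)
  show "{\<xi> :: int ^ 'n. norm (rvec \<xi>) \<le> R} \<subseteq> vec_lambda ` (PiE UNIV (\<lambda>_. {- \<lceil>R\<rceil>..\<lceil>R\<rceil>}))"
  proof
    fix \<xi> :: "int ^ 'n" assume "\<xi> \<in> {\<xi>. norm (rvec \<xi>) \<le> R}"
    then have "\<bar>of_int (\<xi> $ j)\<bar> \<le> R" for j
      using component_le_norm_cart[of "rvec \<xi>" j] by simp
    then have "vec_nth \<xi> \<in> PiE UNIV (\<lambda>_. {- \<lceil>R\<rceil>..\<lceil>R\<rceil>})"
      by (auto simp: abs_le_iff) (smt (verit) ceiling_correct le_of_int_ceiling of_int_le_iff of_int_minus)+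
    then have "vec_lambda (vec_nth \<xi>) \<in> vec_lambda ` (PiE UNIV (\<lambda>_. {- \<lceil>R\<rceil>..\<lceil>R\<rceil>}))"
      by (rule imageI)
    then show "\<xi> \<in> vec_lambda ` (PiE UNIV (\<lambda>_. {- \<lceil>R\<rceil>..\<lceil>R\<rceil>}))" by simp
  qed
  show "finite (vec_lambda ` (PiE (UNIV :: 'n set) (\<lambda>_. {- \<lceil>R\<rceil>..\<lceil>R\<rceil>})))"
    by (intro finite_imageI finite_PiE) auto
qed

lemma finite_gevrey_decay_ge:
  assumes "s > 0" "\<epsilon> > 0" "\<delta> > 0"
  shows "finite {\<xi> :: int ^ 'n::finite. \<delta> \<le> gevrey_decay s \<epsilon> \<xi>}"
proof (rule finite_subset[OF _ finite_rvec_ball])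
  show "{\<xi> :: int ^ 'n. \<delta> \<le> gevrey_decay s \<epsilon> \<xi>} \<subseteq> {\<xi>. norm (rvec \<xi>) \<le> \<bar>ln \<delta> / \<epsilon>\<bar> powr s}"
  proof
    fix \<xi> :: "int ^ 'n" assume "\<xi> \<in> {\<xi>. \<delta> \<le> gevrey_decay s \<epsilon> \<xi>}"
    then have "ln \<delta> \<le> ln (gevrey_decay s \<epsilon> \<xi>)"
      using assms(3) by (intro ln_le_cancel_iff[THEN iffD2]) auto
    then have "ln \<delta> \<le> - \<epsilon> * norm (rvec \<xi>) powr (1 / s)"
      by (simp add: gevrey_decay_def)
    then have "norm (rvec \<xi>) powr (1 / s) \<le> \<bar>ln \<delta> / \<epsilon>\<bar>"
      using assms(2) by (simp add: abs_if field_simps split: if_splits)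
    then have "(norm (rvec \<xi>) powr (1 / s)) powr s \<le> \<bar>ln \<delta> / \<epsilon>\<bar> powr s"
      using assms(1) by (intro powr_mono2) auto
    then show "\<xi> \<in> {\<xi>. norm (rvec \<xi>) \<le> \<bar>ln \<delta> / \<epsilon>\<bar> powr s}"
      using assms(1) by (simp add: powr_powr)
  qed
qed

lemma gevrey_decay_mono: "\<epsilon> \<le> \<epsilon>' \<Longrightarrow> gevrey_decay s \<epsilon>' \<xi> \<le> gevrey_decay s \<epsilon> \<xi>"
  by (simp add: gevrey_decay_def mult_right_mono)

section \<open>The inductive limit topology\<close>

lemma gevrey_lincomb:
  assumes s: "s > 0" and u: "u \<in> gevrey s" and v: "v \<in> gevrey s"
  shows "a *\<^sub>D u + b *\<^sub>D v \<in> gevrey s"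
proof -
  obtain C1 \<epsilon>1 where 1: "u \<in> distributions" "\<epsilon>1 > 0" "\<And>\<xi>. norm (fourier u \<xi>) \<le> C1 * gevrey_decay s \<epsilon>1 \<xi>"
    using u unfolding gevrey_iff[OF s] by blast
  obtain C2 \<epsilon>2 where 2: "v \<in> distributions" "\<epsilon>2 > 0" "\<And>\<xi>. norm (fourier v \<xi>) \<le> C2 * gevrey_decay s \<epsilon>2 \<xi>"
    using v unfolding gevrey_iff[OF s] by blast
  let ?\<epsilon> = "min \<epsilon>1 \<epsilon>2"
  have "norm (fourier (a *\<^sub>D u + b *\<^sub>D v) \<xi>) \<le> (norm a * C1 + norm b * C2) * gevrey_decay s ?\<epsilon> \<xi>" for \<xi>
  proof -
    have "norm (fourier u \<xi>) \<le> C1 * gevrey_decay s ?\<epsilon> \<xi>"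
      by (rule order_trans[OF 1(3)]) (intro mult_left_mono gevrey_decay_mono gevrey_bound_nonneg[OF 1(3)], simp)
    moreover have "norm (fourier v \<xi>) \<le> C2 * gevrey_decay s ?\<epsilon> \<xi>"
      by (rule order_trans[OF 2(3)]) (intro mult_left_mono gevrey_decay_mono gevrey_bound_nonneg[OF 2(3)], simp)
    ultimately have "norm (a * fourier u \<xi>) + norm (b * fourier v \<xi>) \<le>
        norm a * (C1 * gevrey_decay s ?\<epsilon> \<xi>) + norm b * (C2 * gevrey_decay s ?\<epsilon> \<xi>)"
      unfolding norm_mult by (intro add_mono mult_left_mono) auto
    then show ?thesis
      unfolding fourier_add fourier_smul
      by (intro order_trans[OF norm_triangle_ineq]) (simp add: algebra_simps)
  qed
  moreover have "a *\<^sub>D u + b *\<^sub>D v \<in> distributions"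
    by (intro distributions_add distributions_smul 1 2)
  moreover have "?\<epsilon> > 0" using 1 2 by simp
  ultimately show ?thesis unfolding gevrey_iff[OF s] by blast
qed

lemma gevrey_add: "s > 0 \<Longrightarrow> u \<in> gevrey s \<Longrightarrow> v \<in> gevrey s \<Longrightarrow> u + v \<in> gevrey s"
  using gevrey_lincomb[of s u v 1 1] by (simp add: smul_def)

text \<open>Weights of this kind define the continuous seminorms \<open>sup\<^sub>\<xi> \<bar>fourier u \<xi>\<bar> \<cdot> w \<xi>\<close> of the
  inductive limit; they detect boundedness in a single step.\<close>

definition gevrey_weight :: "real \<Rightarrow> (int ^ 'n::finite \<Rightarrow> real) \<Rightarrow> bool" where
  "gevrey_weight s w \<longleftrightarrow> (\<forall>\<xi>. 0 \<le> w \<xi>) \<and> (\<forall>\<epsilon>>0. \<exists>C. \<forall>\<xi>. w \<xi> * gevrey_decay s \<epsilon> \<xi> \<le> C)"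

lemma gevrey_weight_cmult:
  assumes "gevrey_weight s w" "0 \<le> c" shows "gevrey_weight s (\<lambda>\<xi>. c * w \<xi>)"
  unfolding gevrey_weight_def
proof (intro conjI allI impI)
  show "0 \<le> c * w \<xi>" for \<xi> using assms by (simp add: gevrey_weight_def)
  fix \<epsilon> :: real assume "\<epsilon> > 0"
  then obtain C where "\<And>\<xi>. w \<xi> * gevrey_decay s \<epsilon> \<xi> \<le> C"
    using assms unfolding gevrey_weight_def by metis
  then show "\<exists>C. \<forall>\<xi>. c * w \<xi> * gevrey_decay s \<epsilon> \<xi> \<le> C"
    using assms(2) by (intro exI[of _ "c * C"] allI) (simp add: mult.assoc mult_left_mono)
qed

text \<open>The unit ball of a weighted seminorm is a neighbourhood of 0. Absolute convexity is
  immediate, and on each step h all coefficients decay at one rate \<epsilon>, against which the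
  weight is bounded.\<close>

lemma gevrey_nbhd0_weighted:
  fixes w :: "int ^ 'n::finite \<Rightarrow> real"
  assumes s: "s > 0" and w: "gevrey_weight s w"
  shows "gevrey_nbhd0 s {v \<in> gevrey s. \<forall>\<xi>. norm (fourier v \<xi>) * w \<xi> \<le> 1}"
  unfolding gevrey_nbhd0_def
proof (intro conjI allI impI)
  let ?V = "{v \<in> gevrey s. \<forall>\<xi>. norm (fourier v \<xi>) * w \<xi> \<le> 1}"
  have w0: "0 \<le> w \<xi>" for \<xi> using w by (simp add: gevrey_weight_def)
  show "?V \<subseteq> gevrey s" by blast
  show "abs_convex ?V"
    unfolding abs_convex_def
  proof (intro ballI allI impI CollectI conjI)
    fix u v :: "'n functional" and a b :: complex and \<xi> :: "int ^ 'n" assume uv: "u \<in> ?V" "v \<in> ?V" and ab: "norm a + norm b \<le> 1"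
    show "a *\<^sub>D u + b *\<^sub>D v \<in> gevrey s" using uv by (intro gevrey_lincomb s) auto
    have "norm (a * fourier u \<xi> + b * fourier v \<xi>) * w \<xi> \<le> (norm a * norm (fourier u \<xi>) + norm b * norm (fourier v \<xi>)) * w \<xi>"
      by (intro mult_right_mono w0 order_trans[OF norm_triangle_ineq]) (simp add: norm_mult)
    also have "\<dots> = norm a * (norm (fourier u \<xi>) * w \<xi>) + norm b * (norm (fourier v \<xi>) * w \<xi>)"
      by (simp add: algebra_simps)
    also have "\<dots> \<le> norm a * 1 + norm b * 1"
      using uv by (intro add_mono mult_left_mono) auto
    finally show "norm (fourier (a *\<^sub>D u + b *\<^sub>D v) \<xi>) * w \<xi> \<le> 1"
      using ab by (simp add: fourier_add fourier_smul)
  qed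
  fix h :: real assume h: "h > 0"
  obtain \<epsilon> where \<epsilon>: "\<epsilon> > 0"
    "\<forall>(u :: 'n functional) A \<xi>. u \<in> Cinf \<and>
       (\<forall>\<alpha> x. norm (mi_D \<alpha> (the_fun u) x) \<le> A * h ^ mi_order \<alpha> * fact (mi_order \<alpha>) powr s) \<longrightarrow>
       norm (fourier u \<xi>) \<le> 2 powr s * A * gevrey_decay s \<epsilon> \<xi>"
    by (rule gevrey_coefficient_bound[OF s h, where 'n = 'n])
  obtain C where C: "\<And>\<xi>. w \<xi> * gevrey_decay s \<epsilon> \<xi> \<le> C"
    using w \<epsilon>(1) unfolding gevrey_weight_def by metis
  \<comment> \<open>Chosen so that a Gevrey norm below 1/D gives weighted coefficients at most 1;
    the added 1 keeps D positive.\<close>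
  define D where "D = 2 powr s * (\<bar>C\<bar> + 1)"
  have D: "D > 0" by (simp add: D_def add_nonneg_pos)
  show "\<exists>\<eta>>0. {v \<in> gevrey_h h s. gevrey_norm h s v < ennreal \<eta>} \<subseteq> ?V"
  proof (intro exI[of _ "1 / D"] conjI subsetI)
    show "1 / D > 0" using D by simp
    fix v :: "'n functional" assume "v \<in> {v \<in> gevrey_h h s. gevrey_norm h s v < ennreal (1 / D)}"
    then have v: "v \<in> Cinf" "gevrey_norm h s v < ennreal (1 / D)" by (auto simp: gevrey_h_def)
    have b: "norm (fourier v \<xi>) \<le> 2 powr s * (1 / D) * gevrey_decay s \<epsilon> \<xi>" for \<xi>
      by (rule \<epsilon>(2)[rule_format]) (use v(1) gevrey_normD[OF v(2) h] in blast)
    have "norm (fourier v \<xi>) * w \<xi> \<le> 1" for \<xi>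
    proof -
      have "norm (fourier v \<xi>) * w \<xi> \<le> (2 powr s * (1 / D) * gevrey_decay s \<epsilon> \<xi>) * w \<xi>"
        by (intro mult_right_mono b w0)
      also have "\<dots> = (2 powr s / D) * (w \<xi> * gevrey_decay s \<epsilon> \<xi>)" by simp
      also have "\<dots> \<le> (2 powr s / D) * (\<bar>C\<bar> + 1)"
        using C[of \<xi>] D by (intro mult_left_mono) auto
      also have "\<dots> = 1" using D by (simp add: D_def)
      finally show ?thesis .
    qed
    moreover have "v \<in> gevrey s"
    proof -
      have "v \<in> distributions" using v(1) by (simp add: Cinf_iff)
      then show ?thesis unfolding gevrey_iff[OF s] using \<epsilon>(1) b by blast
    qed
    ultimately show "v \<in> ?V" by simp
  qed
qed

lemma topspace_gevrey:
  assumes "s > 0" shows "topspace (gevrey_top s) = (gevrey s :: 'n::finite functional set)"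
proof
  show "topspace (gevrey_top s) \<subseteq> (gevrey s :: 'n functional set)"
    unfolding topspace_def openin_gevrey_top by (auto simp: gevrey_open_def)
  \<comment> \<open>The weight 0 imposes no condition, so its unit ball is the whole space.\<close>
  have "gevrey_nbhd0 s {v \<in> gevrey s. \<forall>\<xi> :: int ^ 'n. norm (fourier v \<xi>) * 0 \<le> 1}"
    by (intro gevrey_nbhd0_weighted assms) (auto simp: gevrey_weight_def)
  then have "gevrey_nbhd0 s (gevrey s :: 'n functional set)" by simp
  then have "gevrey_open s (gevrey s :: 'n functional set)"
    unfolding gevrey_open_def using gevrey_add[OF assms] by blast
  then show "(gevrey s :: 'n functional set) \<subseteq> topspace (gevrey_top s)"
    unfolding openin_gevrey_top[symmetric] by (rule openin_subset)
qed

lemma limitin_gevrey_weighted: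
  fixes w :: "int ^ 'n::finite \<Rightarrow> real"
  assumes s: "s > 0" and lim: "limitin (gevrey_top s) f l F" and w: "gevrey_weight s w"
  shows "\<forall>\<^sub>F t in F. \<forall>\<xi>. norm (fourier (f t) \<xi> - fourier l \<xi>) * w \<xi> \<le> 1"
proof -
  have w0: "0 \<le> w \<xi>" for \<xi> using w by (simp add: gevrey_weight_def)
  \<comment> \<open>The bound \<rho> < 1 is uniform in \<xi>: it leaves room (1 - \<rho>)/2 for a
    neighbourhood, whereas strict inequality at each frequency would not yield an open set
    directly.\<close>
  define U where "U = {u \<in> gevrey s. \<exists>\<rho><1. \<forall>\<xi>. norm (fourier u \<xi> - fourier l \<xi>) * w \<xi> \<le> \<rho>}"
  have "gevrey_open s U"
    unfolding gevrey_open_def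
  proof (intro conjI ballI)
    show "U \<subseteq> gevrey s" by (auto simp: U_def)
    fix u assume "u \<in> U"
    then obtain \<rho> where u: "u \<in> gevrey s" "\<rho> < 1" "\<And>\<xi>. norm (fourier u \<xi> - fourier l \<xi>) * w \<xi> \<le> \<rho>"
      by (auto simp: U_def)
    let ?V = "{v \<in> gevrey s. \<forall>\<xi>. norm (fourier v \<xi>) * (2 / (1 - \<rho>) * w \<xi>) \<le> 1}"
    have "gevrey_nbhd0 s ?V"
      using u(2) by (intro gevrey_nbhd0_weighted s gevrey_weight_cmult w) auto
    moreover have "u + v \<in> U" if v: "v \<in> ?V" for v
      unfolding U_def
    proof (intro CollectI conjI exI[of _ "(1 + \<rho>) / 2"] allI)
      show "u + v \<in> gevrey s" using u v by (intro gevrey_add s) auto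
      show "(1 + \<rho>) / 2 < 1" using u(2) by simp
      fix \<xi>
      have "norm (fourier v \<xi>) * (2 / (1 - \<rho>) * w \<xi>) \<le> 1" using v by blast
      then have "norm (fourier v \<xi>) * w \<xi> \<le> (1 - \<rho>) / 2"
        using u(2) by (simp add: field_simps)
      moreover have "norm (fourier (u + v) \<xi> - fourier l \<xi>) * w \<xi> \<le>
          (norm (fourier u \<xi> - fourier l \<xi>) + norm (fourier v \<xi>)) * w \<xi>"
        using norm_triangle_ineq[of "fourier u \<xi> - fourier l \<xi>" "fourier v \<xi>"]
        by (intro mult_right_mono w0) (simp add: fourier_add algebra_simps)
      ultimately show "norm (fourier (u + v) \<xi> - fourier l \<xi>) * w \<xi> \<le> (1 + \<rho>) / 2"
        using u(3)[of \<xi>] by (simp add: distrib_right)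
    qed
    ultimately show "\<exists>V. gevrey_nbhd0 s V \<and> (\<forall>v\<in>V. u + v \<in> U)" by blast
  qed
  moreover have "l \<in> gevrey s"
    using limitin_topspace[OF lim] by (simp add: topspace_gevrey[OF s])
  then have "l \<in> U" by (auto simp: U_def intro!: exI[of _ 0])
  ultimately have "\<forall>\<^sub>F t in F. f t \<in> U"
    using lim unfolding limitin_def openin_gevrey_top by blast
  then show ?thesis
  proof eventually_elim
    fix t assume "f t \<in> U"
    then obtain \<rho> where "\<rho> < 1" "\<And>\<xi>. norm (fourier (f t) \<xi> - fourier l \<xi>) * w \<xi> \<le> \<rho>"
      by (auto simp: U_def)
    then show "\<forall>\<xi>. norm (fourier (f t) \<xi> - fourier l \<xi>) * w \<xi> \<le> 1"
      by (meson less_imp_le order_trans)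
  qed
qed

text \<open>A weight supported at one frequency reads off the coefficient there; its height 2/e
  gives closeness e/2.\<close>

lemma limitin_gevrey_fourier:
  assumes s: "s > 0" and lim: "limitin (gevrey_top s) f l F"
  shows "((\<lambda>t. fourier (f t) \<xi>) \<longlongrightarrow> fourier l \<xi>) F"
proof (rule tendstoI)
  fix e :: real assume e: "e > 0"
  define w where "w \<eta> = (if \<eta> = \<xi> then 2 / e else 0)" for \<eta>
  have "gevrey_weight s w"
    unfolding gevrey_weight_def
  proof (intro conjI allI impI exI)
    show "0 \<le> w \<eta>" for \<eta> using e by (simp add: w_def)
    show "w \<eta> * gevrey_decay s \<epsilon> \<eta> \<le> 2 / e * gevrey_decay s \<epsilon> \<xi>" for \<eta> \<epsilon>
      using e by (simp add: w_def less_imp_le)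
  qed
  from limitin_gevrey_weighted[OF s lim this]
  show "\<forall>\<^sub>F t in F. dist (fourier (f t) \<xi>) (fourier l \<xi>) < e"
  proof eventually_elim
    fix t assume "\<forall>\<eta>. norm (fourier (f t) \<eta> - fourier l \<eta>) * w \<eta> \<le> 1"
    from spec[OF this, of \<xi>] e show "dist (fourier (f t) \<xi>) (fourier l \<xi>) < e"
      by (simp add: w_def dist_norm field_simps)
  qed
qed

text \<open>The differences \<open>f t - l\<close> decay at rate \<epsilon>, and at the reduced rate
  \<epsilon>/2 they become small: outside a finite set of frequencies the second half of the rate is
  small, and on the finite set convergence of coefficients suffices. Smallness at rate \<epsilon>/2
  is smallness in a single step h, which every neighbourhood respects.\<close>

lemma limitin_gevrey_dominated:
  fixes f :: "'a \<Rightarrow> 'n::finite functional"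
  assumes s: "s > 0" and \<epsilon>: "\<epsilon> > 0"
    and l: "l \<in> distributions" "\<And>\<xi>. norm (fourier l \<xi>) \<le> C * gevrey_decay s \<epsilon> \<xi>"
    and f: "\<forall>\<^sub>F t in F. f t \<in> distributions \<and> (\<forall>\<xi>. norm (fourier (f t) \<xi>) \<le> C * gevrey_decay s \<epsilon> \<xi>)"
    and lim: "\<And>\<xi>. ((\<lambda>t. fourier (f t) \<xi>) \<longlongrightarrow> fourier l \<xi>) F"
  shows "limitin (gevrey_top s) f l F"
  unfolding limitin_def openin_gevrey_top
proof (intro conjI allI impI)
  have C: "C \<ge> 0" by (rule gevrey_bound_nonneg[OF l(2)])
  show "l \<in> topspace (gevrey_top s)"
    unfolding topspace_gevrey[OF s] gevrey_iff[OF s] using l \<epsilon> by blast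
  fix U assume U: "gevrey_open s U \<and> l \<in> U"
  then obtain V where V: "gevrey_nbhd0 s V" "\<And>v. v \<in> V \<Longrightarrow> l + v \<in> U"
    unfolding gevrey_open_def by blast
  have \<epsilon>2: "\<epsilon> / 2 > 0" using \<epsilon> by simp
  obtain h K where hK: "h > 0" "K > 0"
    "\<forall>(c :: int ^ 'n \<Rightarrow> complex) A \<alpha> x. (\<forall>\<xi>. norm (c \<xi>) \<le> A * gevrey_decay s (\<epsilon> / 2) \<xi>) \<longrightarrow>
       norm (mi_D \<alpha> (fourier_series c) x) \<le> A * K * (h ^ mi_order \<alpha> * fact (mi_order \<alpha>) powr s)"
    by (rule gevrey_derivative_bound[OF s \<epsilon>2, where 'n = 'n])
  obtain \<eta> where \<eta>: "\<eta> > 0" "{v \<in> gevrey_h h s. gevrey_norm h s v < ennreal \<eta>} \<subseteq> V"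
    using V(1) hK(1) unfolding gevrey_nbhd0_def by blast
  \<comment> \<open>With this choice A K = \<eta>/2, strictly below \<eta>.\<close>
  define A where "A = \<eta> / (2 * K)"
  have A: "A > 0" using \<eta> hK by (simp add: A_def)
  \<comment> \<open>Ensures 2 C \<delta> \<le> A, so the dominated frequencies obey the same bound
    as those in \<open>S\<close>.\<close>
  define \<delta> where "\<delta> = A / (2 * C + 1)"
  have \<delta>: "\<delta> > 0" using A C by (simp add: \<delta>_def)
  define S where "S = {\<xi> :: int ^ 'n. \<delta> \<le> gevrey_decay s (\<epsilon> / 2) \<xi>}"
  have "finite S" unfolding S_def by (rule finite_gevrey_decay_ge[OF s \<epsilon>2 \<delta>])
  then have "\<forall>\<^sub>F t in F. \<forall>\<xi>\<in>S. dist (fourier (f t) \<xi>) (fourier l \<xi>) < A * gevrey_decay s (\<epsilon> / 2) \<xi>"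
    using A by (intro eventually_ball_finite ballI tendstoD lim) auto
  with f show "\<forall>\<^sub>F t in F. f t \<in> U"
  proof eventually_elim
    fix t assume f: "f t \<in> distributions \<and> (\<forall>\<xi>. norm (fourier (f t) \<xi>) \<le> C * gevrey_decay s \<epsilon> \<xi>)"
      and near: "\<forall>\<xi>\<in>S. dist (fourier (f t) \<xi>) (fourier l \<xi>) < A * gevrey_decay s (\<epsilon> / 2) \<xi>"
    let ?v = "f t - l"
    have v: "?v \<in> distributions" using f l by (intro distributions_diff) auto
    have b: "norm (fourier ?v \<xi>) \<le> A * gevrey_decay s (\<epsilon> / 2) \<xi>" for \<xi>
    proof (cases "\<xi> \<in> S")
      case True
      then show ?thesis using near by (simp add: fourier_diff dist_norm less_imp_le)
    next
      case False
      then have d: "gevrey_decay s (\<epsilon> / 2) \<xi> \<le> \<delta>" by (simp add: S_def)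
      have "norm (fourier ?v \<xi>) \<le> C * gevrey_decay s \<epsilon> \<xi> + C * gevrey_decay s \<epsilon> \<xi>"
        unfolding fourier_diff using f l(2) by (intro order_trans[OF norm_triangle_ineq4] add_mono) auto
      also have "\<dots> = (2 * C) * gevrey_decay s (\<epsilon> / 2) \<xi> * gevrey_decay s (\<epsilon> / 2) \<xi>"
        by (simp add: gevrey_decay_split[of s \<epsilon>])
      also have "\<dots> \<le> (2 * C) * \<delta> * gevrey_decay s (\<epsilon> / 2) \<xi>"
        using C d by (intro mult_right_mono mult_left_mono) (auto simp: less_imp_le)
      also have "(2 * C) * \<delta> \<le> A"
        using C A by (simp add: \<delta>_def divide_le_eq field_simps)
      finally show ?thesis by (simp add: mult_right_mono less_imp_le)
    qed
    have Cinf: "?v \<in> Cinf"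
      using v rapid_gevrey[OF s \<epsilon>2 b] by (simp add: Cinf_iff)
    have "norm (mi_D \<alpha> (the_fun ?v) x) \<le> (A * K) * (h ^ mi_order \<alpha> * fact (mi_order \<alpha>) powr s)" for \<alpha> x
      unfolding the_fun_eq(1)[OF Cinf] using hK(3) b by blast
    then have "gevrey_norm h s ?v \<le> ennreal (A * K)"
      by (intro gevrey_normI hK)
    also have "\<dots> < ennreal \<eta>"
      using \<eta>(1) hK(2) by (intro ennreal_lessI) (auto simp: A_def)
    finally have "gevrey_norm h s ?v < ennreal \<eta>" .
    moreover have "gevrey_norm h s ?v < \<infinity>"
      by (rule less_trans[OF calculation]) simp
    ultimately have "?v \<in> V" using \<eta>(2) Cinf by (auto simp: gevrey_h_def)
    from V(2)[OF this] show "f t \<in> U" by simp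
  qed
qed

text \<open>If no single step contained \<open>f\<close>, the violations at level \<open>n\<close> would assemble to a weight
  whose seminorm is unbounded along a convergent sequence.\<close>

lemma C0_gevrey_uniform_bound:
  fixes f :: "real \<Rightarrow> 'n::finite functional"
  assumes s: "s > 0" and f: "f \<in> C0_maps T (gevrey_top s)"
  obtains C \<epsilon> where "\<epsilon> > 0" "\<And>t \<xi>. t \<in> {0..T} \<Longrightarrow> norm (fourier (f t) \<xi>) \<le> C * gevrey_decay s \<epsilon> \<xi>"
proof (rule ccontr)
  assume "\<not> thesis"
  then have neg: "\<exists>t\<in>{0..T}. \<exists>\<xi>. C * gevrey_decay s \<epsilon> \<xi> < norm (fourier (f t) \<xi>)" if "\<epsilon> > 0" for C \<epsilon>
    using that \<open>\<And>\<epsilon> C. \<epsilon> > 0 \<Longrightarrow> (\<And>t \<xi>. t \<in> {0..T} \<Longrightarrow> norm (fourier (f t) \<xi>) \<le> C * gevrey_decay s \<epsilon> \<xi>) \<Longrightarrow> thesis\<close>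
    by (meson not_less)
  \<comment> \<open>Level n refutes the constant n at the rate 1/(n+1), so every fixed rate is
    eventually undercut.\<close>
  define \<epsilon> where "\<epsilon> n = 1 / (real n + 1)" for n
  have \<epsilon>: "\<epsilon> n > 0" for n by (simp add: \<epsilon>_def add_nonneg_pos)
  have \<epsilon>_anti: "\<epsilon> n \<le> \<epsilon> m" if "m \<le> n" for m n
    unfolding \<epsilon>_def by (rule divide_left_mono) (use that in auto)
  have "\<forall>n. \<exists>p. fst p \<in> {0..T} \<and> real n * gevrey_decay s (\<epsilon> n) (snd p) < norm (fourier (f (fst p)) (snd p))"
    using neg[OF \<epsilon>] by (metis fst_conv snd_conv)
  then obtain p where p: "\<And>n. fst (p n) \<in> {0..T}"
      "\<And>n. real n * gevrey_decay s (\<epsilon> n) (snd (p n)) < norm (fourier (f (fst (p n))) (snd (p n)))"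
    by metis
  define t where "t n = fst (p n)" for n
  define \<xi> where "\<xi> n = snd (p n)" for n
  have t: "t n \<in> {0..T}" and big: "real n * gevrey_decay s (\<epsilon> n) (\<xi> n) < norm (fourier (f (t n)) (\<xi> n))" for n
    using p[of n] by (simp_all add: t_def \<xi>_def)
  \<comment> \<open>The frequencies \<xi> n may repeat, so the weight at a frequency refers to the
    first level at which it occurs. An earlier level has a larger rate, hence a heavier weight, and
    \<open>unbdd\<close> still holds at later occurrences.\<close>
  define L where "L \<eta> = (LEAST n. \<xi> n = \<eta>)" for \<eta>
  have L: "\<xi> (L (\<xi> n)) = \<xi> n" "L (\<xi> n) \<le> n" for n
    unfolding L_def by (auto intro: LeastI[of _ n] Least_le)
  define w where "w \<eta> = (if \<eta> \<in> range \<xi> then 1 / gevrey_decay s (\<epsilon> (L \<eta>)) \<eta> else 0)" for \<eta>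
  have w0: "0 \<le> w \<eta>" for \<eta> by (simp add: w_def less_imp_le)
  have w: "gevrey_weight s w"
    unfolding gevrey_weight_def
  proof (intro conjI allI impI w0)
    fix e :: real assume "e > 0"
    then obtain N where N: "inverse (real (Suc N)) < e" using reals_Archimedean by blast
    then have N: "\<epsilon> N \<le> e" by (simp add: \<epsilon>_def inverse_eq_divide add.commute)
    \<comment> \<open>Against a fixed rate e only the levels below \<open>N\<close> can exceed 1;
      their finitely many contributions are simply added.\<close>
    define C where "C = 1 + (\<Sum>n<N. w (\<xi> n) * gevrey_decay s e (\<xi> n))"
    have pos: "0 \<le> w \<eta> * gevrey_decay s e \<eta>" for \<eta> by (simp add: w0 less_imp_le)
    have C1: "1 \<le> C" by (simp add: C_def sum_nonneg pos)
    have "w \<eta> * gevrey_decay s e \<eta> \<le> C" for \<eta>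
    proof (cases "\<eta> \<in> range \<xi>")
      case False
      then show ?thesis using C1 by (simp add: w_def)
    next
      case True
      then obtain n where n: "\<eta> = \<xi> n" by blast
      show ?thesis
      proof (cases "L \<eta> < N")
        case True
        have "w (\<xi> (L \<eta>)) * gevrey_decay s e (\<xi> (L \<eta>)) \<le> (\<Sum>n<N. w (\<xi> n) * gevrey_decay s e (\<xi> n))"
          using True by (intro member_le_sum) (auto simp: pos)
        then show ?thesis by (simp add: n L C_def)
      next
        case False
        then have "gevrey_decay s e \<eta> \<le> gevrey_decay s (\<epsilon> (L \<eta>)) \<eta>"
          using N \<epsilon>_anti[of N "L \<eta>"] by (intro gevrey_decay_mono) auto
        then have "w \<eta> * gevrey_decay s e \<eta> \<le> 1"
          using \<open>\<eta> \<in> range \<xi>\<close> by (simp add: w_def divide_le_eq)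
        with C1 show ?thesis by linarith
      qed
    qed
    then show "\<exists>C. \<forall>\<eta>. w \<eta> * gevrey_decay s e \<eta> \<le> C" by blast
  qed
  have unbdd: "real n \<le> norm (fourier (f (t n)) (\<xi> n)) * w (\<xi> n)" for n
  proof -
    have le: "gevrey_decay s (\<epsilon> (L (\<xi> n))) (\<xi> n) \<le> gevrey_decay s (\<epsilon> n) (\<xi> n)"
      by (intro gevrey_decay_mono \<epsilon>_anti L)
    have "real n * gevrey_decay s (\<epsilon> (L (\<xi> n))) (\<xi> n) \<le> real n * gevrey_decay s (\<epsilon> n) (\<xi> n)"
      by (intro mult_left_mono le) simp
    also have "\<dots> \<le> norm (fourier (f (t n)) (\<xi> n))" using big[of n] by simp
    finally show ?thesis by (simp add: w_def le_divide_eq)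
  qed
  \<comment> \<open>The violating times accumulate at \<open>t0\<close>. Continuity there bounds the
    weighted seminorm near \<open>t0\<close>, contrary to \<open>unbdd\<close> along the
    subsequence.\<close>
  obtain t0 r where t0: "t0 \<in> {0..T}" "strict_mono r" "(t \<circ> r) \<longlonglongrightarrow> t0"
    using compact_Icc[of 0 T] t unfolding compact_def by metis
  have lim: "limitin (gevrey_top s) f (f t0) (at t0 within {0..T})"
    using f t0(1) by (simp add: C0_maps_iff)
  have ft0: "f t0 \<in> gevrey s"
    using limitin_topspace[OF lim] by (simp add: topspace_gevrey[OF s])
  obtain C e where Ce: "e > 0" "\<And>\<eta>. norm (fourier (f t0) \<eta>) \<le> C * gevrey_decay s e \<eta>"
    using ft0 unfolding gevrey_iff[OF s] by blast
  obtain D where D: "\<And>\<eta>. w \<eta> * gevrey_decay s e \<eta> \<le> D"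
    using w Ce(1) unfolding gevrey_weight_def by metis
  have P: "norm (fourier (f t0) \<eta>) * w \<eta> \<le> C * D" for \<eta>
  proof -
    have "norm (fourier (f t0) \<eta>) * w \<eta> \<le> (C * gevrey_decay s e \<eta>) * w \<eta>"
      by (intro mult_right_mono Ce w0)
    also have "\<dots> = C * (w \<eta> * gevrey_decay s e \<eta>)" by simp
    also have "\<dots> \<le> C * D" by (intro mult_left_mono D gevrey_bound_nonneg[OF Ce(2)])
    finally show ?thesis .
  qed
  obtain d where d: "d > 0" "\<And>\<tau> \<eta>. \<tau> \<in> {0..T} \<Longrightarrow> \<tau> \<noteq> t0 \<Longrightarrow> dist \<tau> t0 < d \<Longrightarrow>
      norm (fourier (f \<tau>) \<eta> - fourier (f t0) \<eta>) * w \<eta> \<le> 1"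
    using limitin_gevrey_weighted[OF s lim w] unfolding eventually_at by blast
  have near: "norm (fourier (f \<tau>) \<eta>) * w \<eta> \<le> 1 + C * D" if "\<tau> \<in> {0..T}" "dist \<tau> t0 < d" for \<tau> \<eta>
  proof (cases "\<tau> = t0")
    case True
    then show ?thesis using P[of \<eta>] by simp
  next
    case False
    have "norm (fourier (f \<tau>) \<eta>) * w \<eta> \<le> (norm (fourier (f \<tau>) \<eta> - fourier (f t0) \<eta>) + norm (fourier (f t0) \<eta>)) * w \<eta>"
      using norm_triangle_ineq[of "fourier (f \<tau>) \<eta> - fourier (f t0) \<eta>" "fourier (f t0) \<eta>"]
      by (intro mult_right_mono w0) simp
    then show ?thesis
      using d(2)[OF that(1) False that(2), of \<eta>] P[of \<eta>] by (simp add: distrib_right)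
  qed
  have "\<forall>\<^sub>F n in sequentially. dist ((t \<circ> r) n) t0 < d"
    by (rule tendstoD[OF t0(3) d(1)])
  moreover have "\<forall>\<^sub>F n in sequentially. 1 + C * D < real n"
    using filterlim_real_sequentially unfolding filterlim_at_top_dense by blast
  ultimately have "\<forall>\<^sub>F n in sequentially. False"
  proof eventually_elim
    fix n assume n: "dist ((t \<circ> r) n) t0 < d" "1 + C * D < real n"
    have "real n \<le> real (r n)" using t0(2) by (simp add: seq_suble)
    also have "\<dots> \<le> norm (fourier (f (t (r n))) (\<xi> (r n))) * w (\<xi> (r n))" by (rule unbdd)
    also have "\<dots> \<le> 1 + C * D" using n(1) by (intro near t) simp
    finally show False using n(2) by simp
  qed
  then show False by simp
qed

section \<open>Test functions in time\<close>

text \<open>The family containing all derivatives of the standard bump exp(-1/(1-x^2)): a polynomial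
  over a power of 1-x^2 times the exponential. Differentiation stays in it and raises k by
  2.\<close>

definition flat :: "real poly \<Rightarrow> nat \<Rightarrow> real \<Rightarrow> real" where
  "flat p k x = (if \<bar>x\<bar> < 1 then poly p x / (1 - x\<^sup>2) ^ k * exp (- 1 / (1 - x\<^sup>2)) else 0)"

text \<open>The numerator over (1-x^2)^(k+2): with Y = 1-x^2, the three summands differentiate the
  polynomial, the power Y^(-k) and the exponential.\<close>

definition flat_deriv :: "real poly \<Rightarrow> nat \<Rightarrow> real poly" where
  "flat_deriv p k = pderiv p * [:1, 0, -1:] ^ 2 + [:0, 2 * real k:] * p * [:1, 0, -1:] - [:0, 2:] * p"

text \<open>With y = 1-z^2, the term of order k+2 of the series of exp(1/y) gives y^(-k) exp(-1/y)
  \<le> (k+2)! y^2, and y \<le> 2 |z-x| for any x outside the open interval. Thus the function and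
  its derivative vanish at such x.\<close>

lemma flat_quadratic_bound:
  obtains K where "K \<ge> 0" "\<And>x z. 1 \<le> \<bar>x\<bar> \<Longrightarrow> \<bar>flat p k z\<bar> \<le> K * (z - x)\<^sup>2"
proof -
  have "bounded (poly p ` {-1..1})"
    by (intro compact_imp_bounded compact_continuous_image continuous_intros) auto
  then obtain B where "\<forall>x\<in>poly p ` {-1..1}. norm x \<le> B"
    unfolding bounded_iff by blast
  then have B: "\<bar>poly p z\<bar> \<le> B" if "z \<in> {-1..1}" for z
    using that by auto
  have B0: "0 \<le> B" using B[of 0] by simp
  let ?K = "B * fact (k + 2) * 4"
  show ?thesis
  proof (rule that[of ?K])
    show "?K \<ge> 0" using B0 by simp
    fix x z :: real assume x: "1 \<le> \<bar>x\<bar>"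
    show "\<bar>flat p k z\<bar> \<le> ?K * (z - x)\<^sup>2"
    proof (cases "\<bar>z\<bar> < 1")
      case False
      then show ?thesis using B0 by (simp add: flat_def)
    next
      case True
      define y where "y = 1 - z\<^sup>2"
      have y: "y > 0" using True by (simp add: y_def abs_square_less_1)
      have yx: "y \<le> 2 * \<bar>z - x\<bar>"
      proof -
        have "y = (1 - \<bar>z\<bar>) * (1 + \<bar>z\<bar>)" by (simp add: y_def algebra_simps power2_eq_square)
        also have "\<dots> \<le> (1 - \<bar>z\<bar>) * 2" using True by (intro mult_left_mono) auto
        also have "\<dots> \<le> 2 * \<bar>z - x\<bar>" using x abs_triangle_ineq2[of x z] abs_minus_commute[of x z] by simp
        finally show ?thesis .
      qed
      define c :: real where "c = fact (k + 2)"
      have c: "c > 0" by (simp only: c_def fact_gt_zero)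
      have "(1 / y) ^ (k + 2) / c \<le> exp (1 / y)"
        unfolding c_def using y by (intro power_div_fact_le_exp) simp
      then have "(1 / y) ^ (k + 2) \<le> c * exp (1 / y)"
        unfolding pos_divide_le_eq[OF c] by (simp only: mult.commute)
      then have "(1 / y) ^ (k + 2) * (y\<^sup>2 * exp (- 1 / y)) \<le> (c * exp (1 / y)) * (y\<^sup>2 * exp (- 1 / y))"
        by (intro mult_right_mono) auto
      moreover have "(1 / y) ^ (k + 2) * (y\<^sup>2 * exp (- 1 / y)) = 1 / y ^ k * exp (- 1 / y)"
        using y by (simp add: power_add power_one_over power2_eq_square)
      moreover have "(c * exp (1 / y)) * (y\<^sup>2 * exp (- 1 / y)) = c * y\<^sup>2 * (exp (1 / y) * exp (- 1 / y))"
        by (simp add: mult_ac)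
      moreover have "exp (1 / y) * exp (- 1 / y) = 1"
        by (simp flip: exp_add)
      ultimately have "1 / y ^ k * exp (- 1 / y) \<le> fact (k + 2) * y\<^sup>2"
        by (simp only: c_def mult_1_right)
      then have "B * (1 / y ^ k * exp (- 1 / y)) \<le> B * (fact (k + 2) * y\<^sup>2)"
        using B0 by (rule mult_left_mono)
      also have "y\<^sup>2 \<le> (2 * \<bar>z - x\<bar>)\<^sup>2" using y yx by (intro power_mono) auto
      then have "B * (fact (k + 2) * y\<^sup>2) \<le> B * (fact (k + 2) * (2 * \<bar>z - x\<bar>)\<^sup>2)"
        using B0 by (intro mult_left_mono) auto
      finally have "B * (1 / y ^ k * exp (- 1 / y)) \<le> ?K * (z - x)\<^sup>2"
        by (simp add: power_mult_distrib)
      moreover have "\<bar>flat p k z\<bar> = \<bar>poly p z\<bar> * (1 / y ^ k * exp (- 1 / y))"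
        using True y by (simp add: flat_def y_def abs_mult)
      moreover have "\<bar>poly p z\<bar> * (1 / y ^ k * exp (- 1 / y)) \<le> B * (1 / y ^ k * exp (- 1 / y))"
        using True y by (intro mult_right_mono B) auto
      ultimately show ?thesis by linarith
    qed
  qed
qed

lemma flat_has_derivative:
  "(flat p k has_real_derivative flat (flat_deriv p k) (k + 2) x) (at x)"
proof (cases "\<bar>x\<bar> < 1")
  case False
  then have x: "1 \<le> \<bar>x\<bar>" by simp
  obtain K where K: "\<And>x z. 1 \<le> \<bar>x\<bar> \<Longrightarrow> \<bar>flat p k z\<bar> \<le> K * (z - x)\<^sup>2"
    using flat_quadratic_bound by metis
  have "(flat p k has_vector_derivative 0) (at x)"
  proof (rule has_vector_derivative_quadratic)
    fix s
    show "norm (flat p k (x + s) - flat p k x - s *\<^sub>R 0) \<le> K * s\<^sup>2"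
      using K[OF x, of "x + s"] False by (simp add: flat_def[of p k x])
  qed
  then show ?thesis
    using False by (simp add: flat_def has_real_derivative_iff_has_vector_derivative)
next
  case True
  then have y: "1 - x\<^sup>2 > 0" by (simp add: abs_square_less_1)
  define Y where "Y = 1 - x\<^sup>2"
  define E where "E = exp (- 1 / Y)"
  have Y0: "Y \<noteq> 0" using y by (simp add: Y_def)
  have d1: "((\<lambda>x. poly p x / (1 - x\<^sup>2) ^ k) has_real_derivative
     (poly (pderiv p) x * Y ^ k - poly p x * (real k * Y ^ (k - 1) * (- 2 * x))) / (Y ^ k * Y ^ k)) (at x)"
    unfolding Y_def using y by (auto intro!: derivative_eq_intros)
  have d2: "((\<lambda>x. exp (- 1 / (1 - x\<^sup>2))) has_real_derivative E * (- 2 * x / Y\<^sup>2)) (at x)"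
    unfolding Y_def E_def using y by (auto intro!: derivative_eq_intros simp: power2_eq_square)
  have alg: "(poly (pderiv p) x * Y ^ k - poly p x * (real k * Y ^ (k - 1) * (- 2 * x))) / (Y ^ k * Y ^ k) * E +
      E * (- 2 * x / Y\<^sup>2) * (poly p x / Y ^ k) = poly (flat_deriv p k) x / Y ^ (k + 2) * E"
  proof -
    have polyY: "poly [:1, 0, -1:] x = Y" by (simp add: Y_def power2_eq_square)
    have P: "poly (flat_deriv p k) x = poly (pderiv p) x * Y\<^sup>2 + 2 * real k * x * poly p x * Y - 2 * x * poly p x"
      unfolding flat_deriv_def poly_diff poly_add poly_mult poly_power polyY by simp
    have Yk: "real k * Y ^ (k - 1) = real k * Y ^ k / Y"
      using Y0 by (cases k) auto
    show ?thesis
      unfolding Yk P using Y0 by (simp add: field_simps power2_eq_square power_add)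
  qed
  have "(flat p k has_real_derivative poly (flat_deriv p k) x / Y ^ (k + 2) * E) (at x)"
  proof -
    have "open {x::real. \<bar>x\<bar> < 1}"
      by (intro open_Collect_less continuous_intros)
    then obtain e where "e > 0" "\<And>z. dist z x < e \<Longrightarrow> \<bar>z\<bar> < 1"
      using True unfolding open_dist by blast
    then show ?thesis
      using DERIV_mult[OF d1 d2] unfolding Y_def[symmetric] E_def[symmetric] alg
      by (elim has_field_derivative_transform_within) (auto simp: flat_def)
  qed
  then show ?thesis using True by (simp add: flat_def Y_def E_def)
qed

abbreviation bump :: "real \<Rightarrow> real" where "bump \<equiv> flat 1 0"

text \<open>An antiderivative of the bump. Starting at -2 keeps every x \<ge> -1 inside the interval
  on which the fundamental theorem is applied; for x < -2 the interval is empty and the integral is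
  0, as it should be.\<close>

definition step :: "real \<Rightarrow> real" where "step x = integral {-2..x} bump"

lemma continuous_flat: "continuous_on A (flat p k)"
  by (intro continuous_at_imp_continuous_on ballI DERIV_isCont[OF flat_has_derivative])

lemma bump_nonneg: "0 \<le> bump x"
  by (simp add: flat_def)

lemma step_left: "x \<le> -1 \<Longrightarrow> step x = 0"
  unfolding step_def by (subst integral_cong[of _ _ "\<lambda>_. 0"]) (auto simp: flat_def)

lemma step_has_derivative: "(step has_real_derivative bump x) (at x)"
proof (cases "x < -1")
  case True
  have "(step has_real_derivative 0) (at x)"
  proof (rule has_field_derivative_transform_within[OF DERIV_const[of 0], of "-1 - x"])
    show "0 = step z" if "dist z x < -1 - x" for z
      using that by (auto simp: dist_real_def step_left)
  qed (use True in auto)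
  then show ?thesis using True by (simp add: flat_def)
next
  case False
  have "((\<lambda>u. integral {-2..u} bump) has_real_derivative bump x) (at x within {-2..x + 1})"
    using False by (intro integral_has_real_derivative continuous_flat) auto
  then show ?thesis
    using False unfolding step_def[abs_def]
    by (subst (asm) at_within_interior) (auto simp: interior_atLeastAtMost_real)
qed

lemma step_right: "1 \<le> x \<Longrightarrow> step x = step 1"
proof -
  assume x: "1 \<le> x"
  have "integral {-2..1} bump + integral {1..x} bump = integral {-2..x} bump"
    by (rule Henstock_Kurzweil_Integration.integral_combine) (use x in \<open>auto intro: integrable_continuous_interval continuous_flat\<close>)
  moreover have "integral {1..x} bump = 0"
    by (subst integral_cong[of _ _ "\<lambda>_. 0"]) (auto simp: flat_def)
  ultimately show ?thesis by (simp add: step_def)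
qed

lemma step_1_pos: "step 1 > 0"
proof -
  have "step 1 \<ge> 0" unfolding step_def by (intro integral_nonneg integrable_continuous_interval continuous_flat) (simp add: bump_nonneg)
  moreover have "step 1 \<noteq> 0"
  proof
    assume "step 1 = 0"
    then have "bump 0 = 0"
      using integral_eq_0_iff[of "-2" 1 bump] continuous_flat bump_nonneg by (simp add: step_def)
    then show False by (simp add: flat_def)
  qed
  ultimately show ?thesis by simp
qed

text \<open>As for \<open>smooth_coinduct\<close>: a class closed under differentiation contains all
  iterates.\<close>

lemma time_smooth_coinduct:
  assumes "\<phi> \<in> X"
    and "\<And>f. f \<in> X \<Longrightarrow> \<exists>f'. (\<forall>t. (f has_vector_derivative f' t) (at t)) \<and> (\<lambda>t. 1 / \<i> * f' t) \<in> X"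
  shows "(Dt ^^ k) \<phi> differentiable (at t)"
proof -
  have "(Dt ^^ k) \<phi> \<in> X" for k
  proof (induction k)
    case (Suc k)
    obtain f' where f': "\<And>t. ((Dt ^^ k) \<phi> has_vector_derivative f' t) (at t)" "(\<lambda>t. 1 / \<i> * f' t) \<in> X"
      using assms(2)[OF Suc] by blast
    have "(Dt ^^ Suc k) \<phi> = (\<lambda>t. 1 / \<i> * f' t)"
      using vector_derivative_at[OF f'(1)] by (simp add: Dt_def[abs_def])
    with f'(2) show ?case by simp
  qed (use assms in simp)
  then show ?thesis
    using assms(2) differentiableI_vector by blast
qed

text \<open>A smoothed indicator of [a, b] of height \<open>step 1\<close>. Its derivative is a bump
  at a minus a bump at b, which is what compares a function at the two points.\<close>

definition step_diff :: "real \<Rightarrow> real \<Rightarrow> real \<Rightarrow> real \<Rightarrow> complex" where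
  "step_diff a b e t = of_real (step ((t - a) / e) - step ((t - b) / e))"

lemma step_diff_has_derivative:
  assumes "e > 0"
  shows "(step_diff a b e has_vector_derivative of_real (1 / e * bump ((t - a) / e) - 1 / e * bump ((t - b) / e))) (at t)"
proof -
  have "((\<lambda>t. step ((t - a) / e) - step ((t - b) / e)) has_real_derivative
      bump ((t - a) / e) * (1 / e) - bump ((t - b) / e) * (1 / e)) (at t)"
    using assms
    by (intro DERIV_diff DERIV_chain2[where f = step, OF step_has_derivative]) (auto intro!: derivative_eq_intros)
  then show ?thesis
    unfolding step_diff_def[abs_def]
    by (intro has_vector_derivative_of_real) (simp add: mult.commute)
qed

lemma step_diff_time_test:
  assumes e: "e > 0" and a: "0 < a - e" "a \<le> b" "b + e < T"
  shows "step_diff a b e \<in> time_test T"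
proof -
  let ?G = "\<lambda>c1 p1 k1 c2 p2 k2 t. c1 * of_real (flat p1 k1 ((t - a) / e)) + c2 * complex_of_real (flat p2 k2 ((t - b) / e))"
  \<comment> \<open>After one differentiation only flat functions centred at a and b remain, so this
    class is closed.\<close>
  let ?X = "insert (step_diff a b e) {?G c1 p1 k1 c2 p2 k2 | c1 p1 k1 c2 p2 k2. True}"
  have "(Dt ^^ k) (step_diff a b e) differentiable (at t)" for k t
  proof (rule time_smooth_coinduct[of _ ?X])
    fix f assume "f \<in> ?X"
    then consider "f = step_diff a b e" | c1 p1 k1 c2 p2 k2 where "f = ?G c1 p1 k1 c2 p2 k2" by blast
    then show "\<exists>f'. (\<forall>t. (f has_vector_derivative f' t) (at t)) \<and> (\<lambda>t. 1 / \<i> * f' t) \<in> ?X"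
    proof cases
      case 1
      have "(\<lambda>t. 1 / \<i> * of_real (1 / e * bump ((t - a) / e) - 1 / e * bump ((t - b) / e))) =
          ?G (1 / \<i> * of_real (1 / e)) 1 0 (- 1 / \<i> * of_real (1 / e)) 1 0"
        by (simp add: fun_eq_iff algebra_simps)
      then have mem: "(\<lambda>t. 1 / \<i> * of_real (1 / e * bump ((t - a) / e) - 1 / e * bump ((t - b) / e))) \<in> ?X"
        by blast
      show ?thesis
        unfolding 1 by (rule exI, rule conjI, rule allI, rule step_diff_has_derivative[OF e], rule mem)
    next
      case 2
      let ?f' = "\<lambda>t. c1 * of_real (flat (flat_deriv p1 k1) (k1 + 2) ((t - a) / e) * (1 / e)) +
          c2 * complex_of_real (flat (flat_deriv p2 k2) (k2 + 2) ((t - b) / e) * (1 / e))"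
      have "((\<lambda>t. flat p k ((t - c) / e)) has_real_derivative flat (flat_deriv p k) (k + 2) ((t - c) / e) * (1 / e)) (at t)"
        for p k c t
        using e by (intro DERIV_chain2[where f = "flat p k", OF flat_has_derivative]) (auto intro!: derivative_eq_intros)
      then have "((\<lambda>t. complex_of_real (flat p k ((t - c) / e))) has_vector_derivative
          of_real (flat (flat_deriv p k) (k + 2) ((t - c) / e) * (1 / e))) (at t)" for p k c t
        by (rule has_vector_derivative_of_real)
      then have der: "\<forall>t. (f has_vector_derivative ?f' t) (at t)"
        unfolding 2 by (intro allI has_vector_derivative_add has_vector_derivative_mult_right)
      have "(\<lambda>t. 1 / \<i> * ?f' t) = ?G (1 / \<i> * c1 * of_real (1 / e)) (flat_deriv p1 k1) (k1 + 2)
          (1 / \<i> * c2 * of_real (1 / e)) (flat_deriv p2 k2) (k2 + 2)"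
        by (simp add: fun_eq_iff algebra_simps)
      then have mem: "(\<lambda>t. 1 / \<i> * ?f' t) \<in> ?X" by blast
      show ?thesis by (rule exI, rule conjI, rule der, rule mem)
    qed
  qed simp
  moreover have "step_diff a b e t = 0" if "t \<notin> {a - e..b + e}" for t
  proof (cases "t < a - e")
    case True
    then have "(t - a) / e \<le> -1" "(t - b) / e \<le> -1"
      using e a by (auto simp: divide_le_eq)
    then show ?thesis by (simp add: step_diff_def step_left)
  next
    case False
    with that have "b + e < t" by auto
    then have "1 \<le> (t - a) / e" "1 \<le> (t - b) / e"
      using e a by (auto simp: le_divide_eq)
    then have "step ((t - a) / e) = step 1" "step ((t - b) / e) = step 1"
      by (blast intro: step_right)+
    then show ?thesis by (simp add: step_diff_def)
  qed
  ultimately show ?thesis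
    unfolding time_test_def using e a
    by (intro CollectI conjI exI[of _ "{a - e..b + e}"]) auto
qed

section \<open>The lemma of du Bois-Reymond and integration by parts in time\<close>

text \<open>The rescaled bump has mass \<open>step 1\<close>, since its antiderivative is the
  rescaled step; it vanishes farther than e from a, where \<open>close\<close> gives
  nothing.\<close>

lemma bump_average:
  fixes H :: "real \<Rightarrow> complex"
  assumes e: "e > 0" and a: "0 < a - e" "a + e < T" and H: "continuous_on {0..T} H"
    and close: "\<And>t. \<bar>t - a\<bar> \<le> e \<Longrightarrow> norm (H t - H a) \<le> \<eta>"
  shows "norm (integral {0..T} (\<lambda>t. of_real (1 / e * bump ((t - a) / e)) * H t) - of_real (step 1) * H a) \<le> step 1 * \<eta>"
proof -
  let ?b = "\<lambda>t. 1 / e * bump ((t - a) / e)"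
  have cb: "continuous_on {0..T} ?b"
    using e by (intro continuous_intros continuous_on_compose2[OF continuous_flat[of UNIV]]) auto
  have "((\<lambda>t. step ((t - a) / e)) has_real_derivative bump ((t - a) / e) * (1 / e)) (at t within {0..T})" for t
    using e by (intro DERIV_chain2[where f = step, OF step_has_derivative]) (auto intro!: derivative_eq_intros)
  then have "(?b has_integral step ((T - a) / e) - step ((0 - a) / e)) {0..T}"
    using e a by (intro fundamental_theorem_of_calculus)
      (auto simp: has_real_derivative_iff_has_vector_derivative mult.commute)
  moreover have "step ((T - a) / e) = step 1"
    by (rule step_right) (use e a in \<open>simp add: le_divide_eq\<close>)
  moreover have "step ((0 - a) / e) = 0"
    by (rule step_left) (use e a in \<open>simp add: divide_le_eq\<close>)
  ultimately have ib: "(?b has_integral step 1) {0..T}" by simp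
  have "((\<lambda>t. complex_of_real (?b t)) has_integral of_real (step 1)) {0..T}"
    by (rule has_integral_linear[OF ib bounded_linear_of_real, unfolded o_def])
  then have "((\<lambda>t. complex_of_real (?b t) * H a) has_integral of_real (step 1) * H a) {0..T}"
    by (rule has_integral_mult_left)
  moreover have "((\<lambda>t. complex_of_real (?b t) * H t) has_integral
      integral {0..T} (\<lambda>t. complex_of_real (?b t) * H t)) {0..T}"
    by (intro integrable_integral integrable_continuous_interval continuous_intros cb H continuous_on_of_real)
  ultimately have d: "((\<lambda>t. complex_of_real (?b t) * H t - complex_of_real (?b t) * H a) has_integral
      integral {0..T} (\<lambda>t. complex_of_real (?b t) * H t) - of_real (step 1) * H a) {0..T}"
    by (rule has_integral_diff[rotated])
  have "norm (integral {0..T} (\<lambda>t. complex_of_real (?b t) * H t - complex_of_real (?b t) * H a)) \<le>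
      integral {0..T} (\<lambda>t. ?b t * \<eta>)"
  proof (rule integral_norm_bound_integral)
    show "(\<lambda>t. complex_of_real (?b t) * H t - complex_of_real (?b t) * H a) integrable_on {0..T}"
      using d by blast
    show "(\<lambda>t. ?b t * \<eta>) integrable_on {0..T}"
      by (intro integrable_continuous_interval continuous_intros cb)
    fix t
    have nn: "0 \<le> ?b t" using e bump_nonneg by simp
    have "norm (complex_of_real (?b t) * (H t - H a)) \<le> ?b t * \<eta>"
    proof (cases "\<bar>t - a\<bar> \<le> e")
      case True
      have "norm (complex_of_real (?b t) * (H t - H a)) = ?b t * norm (H t - H a)"
        unfolding norm_mult norm_of_real using nn by (simp only: abs_of_nonneg)
      also have "\<dots> \<le> ?b t * \<eta>" by (intro mult_left_mono close True nn)
      finally show ?thesis .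
    next
      case False
      then have "?b t = 0" using e by (simp add: flat_def divide_less_eq)
      then show ?thesis by (simp only: of_real_0 mult_zero_left norm_zero order_refl)
    qed
    then show "norm (complex_of_real (?b t) * H t - complex_of_real (?b t) * H a) \<le> ?b t * \<eta>"
      by (simp only: right_diff_distrib)
  qed
  moreover have "integral {0..T} (\<lambda>t. ?b t * \<eta>) = step 1 * \<eta>"
    by (intro integral_unique has_integral_mult_left ib)
  ultimately show ?thesis
    using integral_unique[OF d] by simp
qed

text \<open>Tested against differences of two mollified steps.\<close>

lemma du_Bois_Reymond:
  fixes H :: "real \<Rightarrow> complex"
  assumes H: "continuous_on {0..T} H"
    and weak: "\<And>\<phi>. \<phi> \<in> time_test T \<Longrightarrow> integral {0..T} (\<lambda>t. vector_derivative \<phi> (at t) * H t) = 0"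
    and ab: "0 < a" "a < b" "b < T"
  shows "H a = H b"
proof (rule ccontr)
  assume ne: "H a \<noteq> H b"
  define \<eta> where "\<eta> = norm (H a - H b) / 3"
  have \<eta>: "\<eta> > 0" using ne by (simp add: \<eta>_def)
  have cont: "\<exists>d>0. \<forall>t. \<bar>t - c\<bar> < d \<longrightarrow> norm (H t - H c) < \<eta>" if "0 < c" "c < T" for c
  proof -
    have "isCont H c"
      using H that continuous_on_interior[of "{0..T}" H c] by (simp add: interior_atLeastAtMost_real)
    then show ?thesis
      using \<eta> unfolding continuous_at_eps_delta by (simp add: dist_norm)
  qed
  obtain d1 where d1: "d1 > 0" "\<And>t. \<bar>t - a\<bar> < d1 \<Longrightarrow> norm (H t - H a) < \<eta>" using cont[of a] ab by auto
  obtain d2 where d2: "d2 > 0" "\<And>t. \<bar>t - b\<bar> < d2 \<Longrightarrow> norm (H t - H b) < \<eta>" using cont[of b] ab by auto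
  define e where "e = min (min (d1 / 2) (d2 / 2)) (min (a / 2) ((T - b) / 2))"
  have e: "e > 0" using d1 d2 ab by (simp add: e_def)
  have le: "e \<le> d1 / 2" "e \<le> d2 / 2" "e \<le> a / 2" "e \<le> (T - b) / 2" unfolding e_def by linarith+
  have "e < a" "e < T - b" using le(3,4) ab by (simp_all add: field_simps)
  then have bounds: "0 < a - e" "a + e < T" "0 < b - e" "b + e < T"
    using ab by simp_all
  let ?I = "\<lambda>c. integral {0..T} (\<lambda>t. of_real (1 / e * bump ((t - c) / e)) * H t)"
  have Ia: "norm (?I a - of_real (step 1) * H a) \<le> step 1 * \<eta>"
    using d1 le e by (intro bump_average H bounds less_imp_le[OF d1(2)]) auto
  have Ib: "norm (?I b - of_real (step 1) * H b) \<le> step 1 * \<eta>"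
    using d2 le e by (intro bump_average H bounds less_imp_le[OF d2(2)]) auto
  have int: "(\<lambda>t. of_real (1 / e * bump ((t - c) / e)) * H t) integrable_on {0..T}" for c
    using e by (intro integrable_continuous_interval continuous_intros H continuous_on_of_real
        continuous_on_compose2[OF continuous_flat[of UNIV]]) auto
  have "integral {0..T} (\<lambda>t. vector_derivative (step_diff a b e) (at t) * H t) = 0"
    by (intro weak step_diff_time_test e bounds) (use ab in simp)
  moreover have "vector_derivative (step_diff a b e) (at t) * H t =
      of_real (1 / e * bump ((t - a) / e)) * H t - of_real (1 / e * bump ((t - b) / e)) * H t" for t
    unfolding vector_derivative_at[OF step_diff_has_derivative[OF e]] of_real_diff by (rule left_diff_distrib)
  ultimately have eq: "?I a = ?I b"
    using integral_diff[OF int int, of a b] by simp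
  have "p - q = (Y - q) - (X - p)" if "X = Y" for X Y p q :: complex using that by simp
  from this[OF eq] have eq2: "of_real (step 1) * H a - of_real (step 1) * H b =
      (?I b - of_real (step 1) * H b) - (?I a - of_real (step 1) * H a)" .
  have "norm (of_real (step 1) * (H a - H b)) \<le> step 1 * \<eta> + step 1 * \<eta>"
    unfolding right_diff_distrib eq2 by (rule order_trans[OF norm_triangle_ineq4 add_mono[OF Ib Ia]])
  then have "step 1 * norm (H a - H b) \<le> step 1 * (2 * \<eta>)"
    using step_1_pos by (simp add: norm_mult)
  then show False
    using step_1_pos \<eta> by (simp add: \<eta>_def)
qed

lemma time_testD:
  assumes "\<phi> \<in> time_test T"
  shows "(\<phi> has_vector_derivative vector_derivative \<phi> (at t)) (at t)"
    and "vector_derivative \<phi> (at t) = \<i> * Dt \<phi> t"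
    and "continuous_on A \<phi>" and "continuous_on A (Dt \<phi>)"
    and "\<phi> 0 = 0" and "\<phi> T = 0"
proof -
  have 0: "\<phi> differentiable (at t)" for t
    using assms unfolding time_test_def by (auto dest: spec[of _ 0])
  have 1: "Dt \<phi> differentiable (at t)" for t
    using assms unfolding time_test_def by (auto dest: spec[of _ 1])
  show "(\<phi> has_vector_derivative vector_derivative \<phi> (at t)) (at t)"
    using 0 by (simp add: vector_derivative_works)
  show "vector_derivative \<phi> (at t) = \<i> * Dt \<phi> t" by (simp add: Dt_def)
  show "continuous_on A \<phi>" "continuous_on A (Dt \<phi>)"
    using 0 1 by (auto intro!: continuous_at_imp_continuous_on differentiable_imp_continuous_within)
  show "\<phi> 0 = 0" "\<phi> T = 0"
    using assms by (auto simp: time_test_def)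
qed

lemma time_test_by_parts:
  fixes G G' :: "real \<Rightarrow> complex"
  assumes \<phi>: "\<phi> \<in> time_test T" and T: "0 \<le> T"
    and G: "\<And>t. t \<in> {0..T} \<Longrightarrow> (G has_vector_derivative G' t) (at t within {0..T})"
    and G': "continuous_on {0..T} G'"
  shows "integral {0..T} (\<lambda>t. vector_derivative \<phi> (at t) * G t) = - integral {0..T} (\<lambda>t. \<phi> t * G' t)"
proof -
  have cG: "continuous_on {0..T} G"
    using G has_vector_derivative_continuous continuous_on_eq_continuous_within by blast
  have "((\<lambda>t. \<phi> t * G' t + vector_derivative \<phi> (at t) * G t) has_integral (\<phi> T * G T - \<phi> 0 * G 0)) {0..T}"
    by (intro fundamental_theorem_of_calculus T has_vector_derivative_mult G
        has_vector_derivative_at_within[OF time_testD(1)[OF \<phi>]])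
  then have "integral {0..T} (\<lambda>t. \<phi> t * G' t + vector_derivative \<phi> (at t) * G t) = 0"
    by (simp add: integral_unique time_testD(5,6)[OF \<phi>])
  moreover have "(\<lambda>t. \<phi> t * G' t) integrable_on {0..T}"
    by (intro integrable_continuous_interval continuous_intros time_testD(3)[OF \<phi>] G')
  moreover have "(\<lambda>t. vector_derivative \<phi> (at t) * G t) integrable_on {0..T}"
    unfolding time_testD(2)[OF \<phi>]
    by (intro integrable_continuous_interval continuous_intros time_testD(4)[OF \<phi>] cG)
  ultimately show ?thesis
    by (simp add: integral_add add_eq_0_iff2)
qed

section \<open>The linear equation for one Fourier coefficient\<close>

text \<open>Integrating the zero order term by parts shows that \<i> w minus the primitive of a w
  has weak derivative 0, hence is constant, and it is 0 at time 0. So w is differentiable after all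
  and solves the equation classically, where an integrating factor forces it to vanish.\<close>

lemma weak_ode_unique:
  fixes w a :: "real \<Rightarrow> complex"
  assumes T: "T > 0" and w: "continuous_on {0..T} w" and a: "continuous_on {0..T} a" and w0: "w 0 = 0"
    and weak: "\<And>\<phi>. \<phi> \<in> time_test T \<Longrightarrow>
      integral {0..T} (\<lambda>t. - Dt \<phi> t * w t) + integral {0..T} (\<lambda>t. \<phi> t * (a t * w t)) = 0"
    and t: "t \<in> {0..T}"
  shows "w t = 0"
proof -
  define G where "G t = integral {0..t} (\<lambda>s. a s * w s)" for t
  have caw: "continuous_on {0..T} (\<lambda>t. a t * w t)" by (intro continuous_intros a w)
  have G: "(G has_vector_derivative a t * w t) (at t within {0..T})" if "t \<in> {0..T}" for t
    unfolding G_def[abs_def] by (rule integral_has_vector_derivative[OF caw that])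
  have cG: "continuous_on {0..T} G"
    using G has_vector_derivative_continuous continuous_on_eq_continuous_within by blast
  define H where "H t = \<i> * w t - G t" for t
  have cH: "continuous_on {0..T} H" unfolding H_def[abs_def] by (intro continuous_intros w cG)
  have H_int: "integral {0..T} (\<lambda>t. vector_derivative \<phi> (at t) * H t) = 0" if \<phi>: "\<phi> \<in> time_test T" for \<phi>
  proof -
    have "integral {0..T} (\<lambda>t. - Dt \<phi> t * w t - vector_derivative \<phi> (at t) * G t) =
        integral {0..T} (\<lambda>t. - Dt \<phi> t * w t) - integral {0..T} (\<lambda>t. vector_derivative \<phi> (at t) * G t)"
      unfolding time_testD(2)[OF \<phi>]
      by (intro integral_diff integrable_continuous_interval continuous_intros time_testD(4)[OF \<phi>] w cG)
    also have "\<dots> = 0"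
      using weak[OF \<phi>] time_test_by_parts[OF \<phi> less_imp_le[OF T] G caw] by simp
    finally show ?thesis
      unfolding H_def time_testD(2)[OF \<phi>] by (simp add: algebra_simps)
  qed
  have dBR: "H x = H y" if "0 < x" "x < y" "y < T" for x y
    by (rule du_Bois_Reymond[OF cH _ that]) (rule H_int)
  have const: "H x = H (T / 2)" if "x \<in> {0<..<T}" for x
  proof -
    consider "x < T / 2" | "x = T / 2" | "T / 2 < x" by linarith
    then show ?thesis
    proof cases
      case 1
      then show ?thesis using that T by (intro dBR) auto
    next
      case 3
      then show ?thesis using that T by (intro dBR[symmetric]) auto
    qed (rule arg_cong)
  qed
  \<comment> \<open>The test functions see only interior points; continuity carries the constant to
    the endpoint 0, where the initial value is known.\<close>
  have constc: "H x = H (T / 2)" if "x \<in> {0..T}" for x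
  proof -
    have cl: "closure {0<..<T} = {0..T}" using T by simp
    show ?thesis
      by (rule continuous_constant_on_closure[of "{0<..<T}" H]) (unfold cl, rule cH, rule const, assumption, rule that)
  qed
  have H0: "H x = 0" if "x \<in> {0..T}" for x
  proof -
    have "H 0 = 0" by (simp add: H_def G_def w0)
    then show ?thesis using constc[of 0] constc[OF that] T by simp
  qed
  have w_eq: "w x = - \<i> * G x" if "x \<in> {0..T}" for x
  proof -
    have "\<i> * w x = G x" using H0[OF that] by (simp add: H_def)
    then have "- \<i> * (\<i> * w x) = - \<i> * G x" by simp
    then show ?thesis by simp
  qed
  have dw: "(w has_vector_derivative - \<i> * (a x * w x)) (at x within {0..T})" if x: "x \<in> {0..T}" for x
    by (rule has_vector_derivative_transform[OF x _ has_vector_derivative_mult_right[OF G[OF x]]]) (simp add: w_eq)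
  define P where "P t = integral {0..t} a" for t
  have dP: "(P has_vector_derivative a x) (at x within {0..T})" if "x \<in> {0..T}" for x
    unfolding P_def[abs_def] by (rule integral_has_vector_derivative[OF a that])
  have dE: "((\<lambda>x. exp (\<i> * P x)) has_vector_derivative (\<i> * a x) * exp (\<i> * P x)) (at x within {0..T})"
    if x: "x \<in> {0..T}" for x
    using field_vector_diff_chain_within[OF has_vector_derivative_mult_right[OF dP[OF x], of \<i>] DERIV_subset[OF DERIV_exp]]
    by (simp add: o_def mult.commute)
  have der: "((\<lambda>x. w x * exp (\<i> * P x)) has_vector_derivative 0) (at x within {0..T})" if x: "x \<in> {0..T}" for x
    using has_vector_derivative_mult[OF dw[OF x] dE[OF x]] by (simp add: algebra_simps)
  show ?thesis
  proof (rule has_vector_derivative_zero_constant[of "{0..T}" "\<lambda>x. w x * exp (\<i> * P x)"])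
    fix c assume c: "\<And>x. x \<in> {0..T} \<Longrightarrow> w x * exp (\<i> * P x) = c"
    from c[of 0] c[OF t] T show ?thesis by (simp add: w0)
  qed (auto intro: der)
qed

text \<open>Variation of constants. The kernel from s to t has modulus exp of the integral of
  \<open>Im a\<close> over [s, t], which the hypothesis bounds by exp L for all s \<le> t; this
  yields the estimate for data and source at once.\<close>

lemma ode_solution:
  fixes a F :: "real \<Rightarrow> complex"
  assumes T: "T > 0" and a: "continuous_on {0..T} a" and F: "continuous_on {0..T} F"
    and L: "\<And>s t. 0 \<le> s \<Longrightarrow> s \<le> t \<Longrightarrow> t \<le> T \<Longrightarrow> integral {s..t} (\<lambda>\<tau>. Im (a \<tau>)) \<le> L"
  shows "\<exists>y. y 0 = y0 \<and>
    (\<forall>t\<in>{0..T}. (y has_vector_derivative \<i> * F t - \<i> * (a t * y t)) (at t within {0..T})) \<and>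
    (\<forall>t\<in>{0..T}. norm (y t) \<le> exp L * (norm y0 + integral {0..T} (\<lambda>s. norm (F s))))"
proof -
  define P where "P t = integral {0..t} a" for t
  have dP: "(P has_vector_derivative a t) (at t within {0..T})" if "t \<in> {0..T}" for t
    unfolding P_def[abs_def] by (rule integral_has_vector_derivative[OF a that])
  have cP: "continuous_on {0..T} P"
    using dP has_vector_derivative_continuous continuous_on_eq_continuous_within by blast
  have norm_exp: "norm (exp (- \<i> * (P t - P s))) \<le> exp L" if st: "0 \<le> s" "s \<le> t" "t \<le> T" for s t
  proof -
    have "P s + integral {s..t} a = P t"
      unfolding P_def using st
      by (intro Henstock_Kurzweil_Integration.integral_combine integrable_continuous_interval continuous_on_subset[OF a]) auto
    then have "Im (P t - P s) = Im (integral {s..t} a)" by (metis add_diff_cancel_left')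
    also have "\<dots> = integral {s..t} (\<lambda>\<tau>. Im (a \<tau>))"
      using st by (intro integral_linear[symmetric, unfolded o_def] bounded_linear_Im
          integrable_continuous_interval continuous_on_subset[OF a]) auto
    also have "\<dots> \<le> L" by (rule L[OF st])
    finally show ?thesis by simp
  qed
  define I where "I t = integral {0..t} (\<lambda>s. exp (\<i> * P s) * F s)" for t
  have cI: "continuous_on {0..T} (\<lambda>s. exp (\<i> * P s) * F s)" by (intro continuous_intros cP F)
  have dI: "(I has_vector_derivative exp (\<i> * P t) * F t) (at t within {0..T})" if "t \<in> {0..T}" for t
    unfolding I_def[abs_def] by (rule integral_has_vector_derivative[OF cI that])
  define y where "y t = exp (- \<i> * P t) * (y0 + \<i> * I t)" for t
  show ?thesis
  proof (intro exI[of _ y] conjI ballI)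
    show "y 0 = y0" by (simp add: y_def P_def I_def)
  next
    fix t assume t: "t \<in> {0..T}"
    have dE: "((\<lambda>x. exp (- \<i> * P x)) has_vector_derivative (- \<i> * a t) * exp (- \<i> * P t)) (at t within {0..T})"
      using field_vector_diff_chain_within[OF has_vector_derivative_mult_right[OF dP[OF t], of "- \<i>"] DERIV_subset[OF DERIV_exp]]
      by (simp add: o_def mult.commute)
    have dJ: "((\<lambda>x. y0 + \<i> * I x) has_vector_derivative \<i> * (exp (\<i> * P t) * F t)) (at t within {0..T})"
      using has_vector_derivative_add[OF has_vector_derivative_const has_vector_derivative_mult_right[OF dI[OF t]]] by simp
    have "exp (- \<i> * P t) * exp (\<i> * P t) = 1" by (simp flip: exp_add)
    then have eq: "exp (- \<i> * P t) * (\<i> * (exp (\<i> * P t) * F t)) + (- \<i> * a t) * exp (- \<i> * P t) * (y0 + \<i> * I t) =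
        \<i> * F t - \<i> * (a t * y t)"
      unfolding y_def by algebra
    have "(y has_vector_derivative exp (- \<i> * P t) * (\<i> * (exp (\<i> * P t) * F t)) +
        (- \<i> * a t) * exp (- \<i> * P t) * (y0 + \<i> * I t)) (at t within {0..T})"
      unfolding y_def[abs_def] by (rule has_vector_derivative_mult[OF dE dJ])
    then show "(y has_vector_derivative \<i> * F t - \<i> * (a t * y t)) (at t within {0..T})"
      unfolding eq .
  next
    fix t assume t: "t \<in> {0..T}"
    have int: "(\<lambda>s. exp (\<i> * P s) * F s) integrable_on {0..t}"
      using t by (intro integrable_continuous_interval continuous_on_subset[OF cI]) auto
    have nF: "(\<lambda>s. norm (F s)) integrable_on {0..T}"
      by (intro integrable_continuous_interval continuous_intros F)
    have "exp (- \<i> * P t) * I t = integral {0..t} (\<lambda>s. exp (- \<i> * P t) * (exp (\<i> * P s) * F s))"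
      unfolding I_def by (rule integral_mult_right[symmetric])
    also have "norm \<dots> \<le> integral {0..t} (\<lambda>s. exp L * norm (F s))"
    proof (rule integral_norm_bound_integral)
      show "(\<lambda>s. exp (- \<i> * P t) * (exp (\<i> * P s) * F s)) integrable_on {0..t}"
        by (intro integrable_on_mult_right int)
      show "(\<lambda>s. exp L * norm (F s)) integrable_on {0..t}"
        using t by (intro integrable_on_mult_right integrable_on_subinterval[OF nF]) auto
      fix s assume s: "s \<in> {0..t}"
      have "exp (- \<i> * P t) * (exp (\<i> * P s) * F s) = exp (- \<i> * (P t - P s)) * F s"
        by (simp add: right_diff_distrib exp_diff exp_minus field_simps)
      also have "norm \<dots> \<le> exp L * norm (F s)"
        unfolding norm_mult by (intro mult_right_mono norm_exp) (use s t in auto)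
      finally show "norm (exp (- \<i> * P t) * (exp (\<i> * P s) * F s)) \<le> exp L * norm (F s)" .
    qed
    also have "\<dots> = exp L * integral {0..t} (\<lambda>s. norm (F s))" by (rule integral_mult_right)
    also have "\<dots> \<le> exp L * integral {0..T} (\<lambda>s. norm (F s))"
      using t by (intro mult_left_mono integral_subset_le integrable_on_subinterval[OF nF] nF) auto
    finally have 1: "norm (exp (- \<i> * P t) * I t) \<le> exp L * integral {0..T} (\<lambda>s. norm (F s))" .
    have 2: "norm (exp (- \<i> * P t) * y0) \<le> exp L * norm y0"
      using norm_exp[of 0 t] t unfolding norm_mult by (intro mult_right_mono) (auto simp: P_def)
    have "y t = exp (- \<i> * P t) * y0 + \<i> * (exp (- \<i> * P t) * I t)"
      by (simp add: y_def algebra_simps)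
    also have "norm \<dots> \<le> exp L * norm y0 + exp L * integral {0..T} (\<lambda>s. norm (F s))"
      using norm_triangle_ineq[of "exp (- \<i> * P t) * y0" "\<i> * (exp (- \<i> * P t) * I t)"] 1 2
      by (simp add: norm_mult)
    finally show "norm (y t) \<le> exp L * (norm y0 + integral {0..T} (\<lambda>s. norm (F s)))"
      by (simp add: distrib_left)
  qed
qed

section \<open>The energy estimate\<close>

lemma rpow_nonneg: "0 \<le> rpow x q"
  by (simp add: rpow_def)

lemma rpow_pos_eq: "0 < x \<Longrightarrow> rpow x q = x powr q"
  by (simp add: rpow_def)

lemma rpow_mono_base: "0 \<le> x \<Longrightarrow> x \<le> y \<Longrightarrow> 0 \<le> q \<Longrightarrow> rpow x q \<le> rpow y q"
  by (simp add: rpow_def powr_mono2)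

lemma rpow_anti_exponent:
  assumes "0 \<le> x" "x \<le> 1" "0 \<le> q" "q \<le> q'" shows "rpow x q' \<le> rpow x q"
proof (cases "x = 0")
  case True
  then show ?thesis using assms by (auto simp: rpow_def)
next
  case False
  with assms show ?thesis by (simp add: rpow_pos_eq powr_mono')
qed

text \<open>For frequencies of size \<open>x\<close> the first order term dominates only for \<open>\<tau> \<le> \<sigma>\<close>, where it is at most
  \<open>B x \<sigma>\<^sup>q\<close>; since \<open>p \<le> 2 q + 1\<close> the product of the two stays bounded in \<open>x\<close>.\<close>

lemma critical_time:
  assumes "p > 0" "q \<ge> 0" "q < p" "p \<le> 2 * q + 1" "\<epsilon> > 0" "B > 0" "x \<ge> 1"
  defines "\<sigma> \<equiv> (B / (\<epsilon> * x)) powr (1 / (p - q))"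
  shows "\<sigma> < \<tau> \<Longrightarrow> B * rpow \<tau> q * x \<le> \<epsilon> * rpow \<tau> p * x\<^sup>2"
    and "0 \<le> \<tau> \<Longrightarrow> \<tau> \<le> \<sigma> \<Longrightarrow> B * rpow \<tau> q * x \<le> B * x * rpow \<sigma> q"
    and "\<sigma> * (B * x * rpow \<sigma> q) \<le> B * (B / \<epsilon>) powr ((q + 1) / (p - q))"
    and "0 \<le> \<sigma>"
proof -
  have \<sigma>: "\<sigma> > 0" using assms by (simp add: \<sigma>_def)
  then show "0 \<le> \<sigma>" by simp
  show "B * rpow \<tau> q * x \<le> \<epsilon> * rpow \<tau> p * x\<^sup>2" if "\<sigma> < \<tau>"
  proof -
    have \<tau>: "\<tau> > 0" using \<sigma> that by simp
    \<comment> \<open>\<sigma> is the time at which the two terms balance: \<epsilon> \<sigma>^p x^2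
      = B \<sigma>^q x.\<close>
    have "\<sigma> powr (p - q) = B / (\<epsilon> * x)"
      using assms by (simp add: \<sigma>_def powr_powr)
    then have "B / (\<epsilon> * x) \<le> \<tau> powr (p - q)"
      using powr_mono2[of "p - q" \<sigma> \<tau>] that \<sigma> assms by simp
    then have "B \<le> \<tau> powr (p - q) * (\<epsilon> * x)"
      using assms by (simp add: divide_le_eq)
    then have "B * (\<tau> powr q * x) \<le> (\<tau> powr (p - q) * (\<epsilon> * x)) * (\<tau> powr q * x)"
      using assms by (intro mult_right_mono) auto
    also have "\<dots> = \<epsilon> * (\<tau> powr (p - q) * \<tau> powr q) * x\<^sup>2"
      by (simp add: power2_eq_square mult_ac)
    also have "\<tau> powr (p - q) * \<tau> powr q = \<tau> powr p"
      by (simp flip: powr_add)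
    finally show ?thesis by (simp add: rpow_pos_eq \<tau> mult.assoc)
  qed
  show "B * rpow \<tau> q * x \<le> B * x * rpow \<sigma> q" if "0 \<le> \<tau>" "\<tau> \<le> \<sigma>"
    using rpow_mono_base[OF that assms(2)] assms by (simp add: mult.assoc mult.commute[of x] mult_left_mono mult_right_mono)
  define e where "e = (q + 1) / (p - q)"
  \<comment> \<open>This is where p \<le> 2 q + 1 enters: it says exactly that q + 1 \<ge> p - q.
    Then (1/x)^e \<le> 1/x for x \<ge> 1, which cancels the factor x of the first order
    term.\<close>
  have e: "e \<ge> 1" using assms by (simp add: e_def le_divide_eq)
  have "\<sigma> * rpow \<sigma> q = \<sigma> powr (q + 1)"
    using \<sigma> by (simp add: rpow_pos_eq powr_add)
  also have "\<dots> = (B / \<epsilon> * (1 / x)) powr e"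
    by (simp add: \<sigma>_def powr_powr e_def)
  also have "\<dots> = (B / \<epsilon>) powr e * (1 / x) powr e"
    by (rule powr_mult)
  also have "\<dots> \<le> (B / \<epsilon>) powr e * (1 / x)"
    using powr_mono'[OF e, of "1 / x"] assms by (intro mult_left_mono) auto
  finally have "(B * x) * (\<sigma> * rpow \<sigma> q) \<le> (B * x) * ((B / \<epsilon>) powr e * (1 / x))"
    using assms by (intro mult_left_mono) auto
  then show "\<sigma> * (B * x * rpow \<sigma> q) \<le> B * (B / \<epsilon>) powr ((q + 1) / (p - q))"
    using assms by (simp add: mult_ac e_def)
qed

lemma integral_indicator_le:
  fixes c r H s t :: real
  assumes "0 \<le> r" "0 \<le> H"
  shows "(\<lambda>\<tau>. if \<bar>\<tau> - c\<bar> \<le> r then H else 0) integrable_on {s..t}"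
    and "integral {s..t} (\<lambda>\<tau>. if \<bar>\<tau> - c\<bar> \<le> r then H else 0) \<le> 2 * (r * H)"
proof -
  have eq: "(\<lambda>\<tau>. if \<bar>\<tau> - c\<bar> \<le> r then H else 0) = (\<lambda>\<tau>. if \<tau> \<in> {c - r..c + r} then H else 0)"
    by (auto simp: abs_le_iff fun_eq_iff)
  have int: "{s..t} \<inter> {c - r..c + r} = {max s (c - r)..min t (c + r)}" by auto
  show "(\<lambda>\<tau>. if \<bar>\<tau> - c\<bar> \<le> r then H else 0) integrable_on {s..t}"
    unfolding eq integrable_restrict_Int Int_commute[of _ "{s..t}"] int by (rule integrable_const_ivl)
  have "integral {s..t} (\<lambda>\<tau>. if \<bar>\<tau> - c\<bar> \<le> r then H else 0) = integral {max s (c - r)..min t (c + r)} (\<lambda>_. H)"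
    unfolding eq integral_restrict_Int Int_commute[of _ "{s..t}"] int by (rule refl)
  also have "\<dots> = measure lborel {max s (c - r)..min t (c + r)} * H"
    by (simp only: integral_const_real real_scaleR_def)
  also have "measure lborel {max s (c - r)..min t (c + r)} \<le> 2 * r"
    using assms(1) by (auto simp: min_def max_def)
  then have "measure lborel {max s (c - r)..min t (c + r)} * H \<le> 2 * r * H"
    using assms(2) by (rule mult_right_mono)
  finally show "integral {s..t} (\<lambda>\<tau>. if \<bar>\<tau> - c\<bar> \<le> r then H else 0) \<le> 2 * (r * H)" by simp
qed

text \<open>The integrand has a pointwise majorant: the constant A plus, for each zero, a height
  \<open>H k x\<close> on the interval of radius \<open>\<sigma> k x\<close> around it. Such an
  interval contributes at most twice the product of radius and height, which
  \<open>critical_time\<close> bounds independently of x.\<close>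

lemma quadratic_energy_bound:
  fixes c C :: "real \<Rightarrow> real" and tk p q \<epsilon> B :: "nat \<Rightarrow> real"
  assumes T: "T > 0" and c: "continuous_on {0..T} c" and C: "continuous_on {0..T} C" and K: "finite K"
    and pq: "\<And>k. k \<in> K \<Longrightarrow> p k > 0 \<and> q k \<ge> 0 \<and> q k < p k \<and> p k \<le> 2 * q k + 1 \<and> \<epsilon> k > 0 \<and> B k > 0"
    and near: "\<And>k t. k \<in> K \<Longrightarrow> t \<in> {0..T} \<Longrightarrow> \<bar>t - tk k\<bar> < \<delta> \<Longrightarrow>
      c t \<le> - \<epsilon> k * rpow \<bar>t - tk k\<bar> (p k) \<and> C t \<le> B k * rpow \<bar>t - tk k\<bar> (q k)"
    and far: "\<And>t. t \<in> {0..T} \<Longrightarrow> (\<And>k. k \<in> K \<Longrightarrow> \<delta> \<le> \<bar>t - tk k\<bar>) \<Longrightarrow> c t < 0"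
  shows "\<exists>L. \<forall>x\<ge>1. \<forall>s t. 0 \<le> s \<and> s \<le> t \<and> t \<le> T \<longrightarrow> integral {s..t} (\<lambda>\<tau>. c \<tau> * x\<^sup>2 + C \<tau> * x) \<le> L"
proof -
  define D where "D = {0..T} \<inter> (\<Inter>k\<in>K. {t. \<delta> \<le> \<bar>t - tk k\<bar>})"
  have "closed {t. \<delta> \<le> \<bar>t - tk k\<bar>}" for k
    by (intro closed_Collect_le continuous_intros)
  then have D: "compact D" unfolding D_def by (intro compact_Int_closed closed_INT ballI) auto
  have Dneg: "c t < 0" if "t \<in> D" for t using that far by (auto simp: D_def)
  \<comment> \<open>On the compact set away from the zeros c attains a negative maximum; if that set
    is empty, any \<eta> will do.\<close>
  have "\<exists>\<eta>>0. \<forall>t\<in>D. c t \<le> - \<eta>"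
  proof (cases "D = {}")
    case False
    have "continuous_on D c" by (rule continuous_on_subset[OF c]) (auto simp: D_def)
    from continuous_attains_sup[OF D False this]
    obtain t0 where t0: "t0 \<in> D" "\<And>t. t \<in> D \<Longrightarrow> c t \<le> c t0" by blast
    then show ?thesis using Dneg[OF t0(1)] by (intro exI[of _ "- c t0"]) auto
  qed (auto intro: exI[of _ 1])
  then obtain \<eta> where \<eta>: "\<eta> > 0" "\<And>t. t \<in> D \<Longrightarrow> c t \<le> - \<eta>" by blast
  have "bounded (C ` {0..T})" by (intro compact_imp_bounded compact_continuous_image C) simp
  then obtain M where "\<forall>y\<in>C ` {0..T}. norm y \<le> M" unfolding bounded_iff by blast
  then have M: "C t \<le> M" if "t \<in> {0..T}" for t using that by force
  \<comment> \<open>The maximum over x of -\<eta> x^2 + M x, found by completing the square.\<close>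
  define A where "A = M\<^sup>2 / (4 * \<eta>)"
  have A0: "0 \<le> A" using \<eta> by (simp add: A_def)
  define \<sigma> where "\<sigma> k x = (B k / (\<epsilon> k * x)) powr (1 / (p k - q k))" for k x
  define H where "H k x = B k * x * rpow (\<sigma> k x) (q k)" for k x
  define Q where "Q k = B k * (B k / \<epsilon> k) powr ((q k + 1) / (p k - q k))" for k
  show ?thesis
  proof (intro exI[of _ "A * T + (\<Sum>k\<in>K. 2 * Q k)"] allI impI)
    fix x s t :: real assume x: "x \<ge> 1" and st: "0 \<le> s \<and> s \<le> t \<and> t \<le> T"
    have crit: "\<sigma> k x < \<tau> \<Longrightarrow> B k * rpow \<tau> (q k) * x \<le> \<epsilon> k * rpow \<tau> (p k) * x\<^sup>2"
      "0 \<le> \<tau> \<Longrightarrow> \<tau> \<le> \<sigma> k x \<Longrightarrow> B k * rpow \<tau> (q k) * x \<le> H k x"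
      "\<sigma> k x * H k x \<le> Q k" "0 \<le> \<sigma> k x" if "k \<in> K" for k \<tau>
      unfolding \<sigma>_def H_def Q_def using pq[OF that] x by (intro critical_time; simp)+
    have H0: "0 \<le> H k x" if "k \<in> K" for k
      using pq[OF that] x by (simp add: H_def rpow_nonneg)
    let ?h = "\<lambda>k \<tau>. if \<bar>\<tau> - tk k\<bar> \<le> \<sigma> k x then H k x else 0"
    have h0: "0 \<le> ?h k \<tau>" if "k \<in> K" for k \<tau> using H0[OF that] by simp
    have pointwise: "c \<tau> * x\<^sup>2 + C \<tau> * x \<le> A + (\<Sum>k\<in>K. ?h k \<tau>)" if \<tau>: "\<tau> \<in> {0..T}" for \<tau>
    proof (cases "\<tau> \<in> D")
      case True
      have "c \<tau> * x\<^sup>2 + C \<tau> * x \<le> - \<eta> * x\<^sup>2 + M * x"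
        using \<eta>(2)[OF True] M[OF \<tau>] x by (intro add_mono mult_right_mono) auto
      also have "\<dots> \<le> A"
      proof -
        have "0 \<le> (2 * \<eta> * x - M)\<^sup>2" by simp
        then show ?thesis using \<eta>(1) by (simp add: A_def le_divide_eq power2_eq_square algebra_simps)
      qed
      finally show ?thesis using sum_nonneg[of K "\<lambda>k. ?h k \<tau>"] h0 by fastforce
    next
      case False
      then obtain k where k: "k \<in> K" "\<bar>\<tau> - tk k\<bar> < \<delta>" using \<tau> by (auto simp: D_def not_le)
      let ?a = "\<bar>\<tau> - tk k\<bar>"
      have "c \<tau> * x\<^sup>2 + C \<tau> * x \<le> (- \<epsilon> k * rpow ?a (p k)) * x\<^sup>2 + (B k * rpow ?a (q k)) * x"
        using near[OF k(1) \<tau> k(2)] x by (intro add_mono mult_right_mono) auto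
      also have "\<dots> \<le> ?h k \<tau>"
      proof (cases "?a \<le> \<sigma> k x")
        case True
        have "0 \<le> \<epsilon> k * rpow ?a (p k) * x\<^sup>2" using pq[OF k(1)] by (simp add: rpow_nonneg)
        then show ?thesis using crit(2)[OF k(1) _ True] True by simp
      next
        case False
        then show ?thesis using crit(1)[OF k(1), of ?a] by simp
      qed
      also have "\<dots> \<le> (\<Sum>k\<in>K. ?h k \<tau>)"
        using K k(1) h0 by (intro member_le_sum) auto
      finally show ?thesis using A0 by linarith
    qed
    have inth: "?h k integrable_on {s..t}" if "k \<in> K" for k
      by (rule integral_indicator_le(1)[OF crit(4)[OF that] H0[OF that]])
    have "integral {s..t} (\<lambda>\<tau>. c \<tau> * x\<^sup>2 + C \<tau> * x) \<le> integral {s..t} (\<lambda>\<tau>. A + (\<Sum>k\<in>K. ?h k \<tau>))"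
    proof (rule integral_le)
      show "(\<lambda>\<tau>. c \<tau> * x\<^sup>2 + C \<tau> * x) integrable_on {s..t}"
        by (intro integrable_continuous_interval continuous_intros c[THEN continuous_on_subset] C[THEN continuous_on_subset])
          (use st in auto)
      show "(\<lambda>\<tau>. A + (\<Sum>k\<in>K. ?h k \<tau>)) integrable_on {s..t}"
        by (intro integrable_add integrable_const_ivl integrable_sum K inth)
    qed (use pointwise st in auto)
    also have "\<dots> = integral {s..t} (\<lambda>\<tau>. A) + integral {s..t} (\<lambda>\<tau>. \<Sum>k\<in>K. ?h k \<tau>)"
      by (intro integral_add integrable_const_ivl integrable_sum K inth)
    also have "integral {s..t} (\<lambda>\<tau>. \<Sum>k\<in>K. ?h k \<tau>) = (\<Sum>k\<in>K. integral {s..t} (?h k))"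
      by (intro integral_sum K inth)
    also have "\<dots> \<le> (\<Sum>k\<in>K. 2 * Q k)"
    proof (rule sum_mono)
      fix k assume k: "k \<in> K"
      have "integral {s..t} (?h k) \<le> 2 * (\<sigma> k x * H k x)"
        by (rule integral_indicator_le(2)[OF crit(4)[OF k] H0[OF k]])
      then show "integral {s..t} (?h k) \<le> 2 * Q k" using crit(3)[OF k] by linarith
    qed
    also have "integral {s..t} (\<lambda>\<tau>. A) \<le> A * T"
      using st A0 by (simp add: mult.commute mult_left_mono)
    finally show "integral {s..t} (\<lambda>\<tau>. c \<tau> * x\<^sup>2 + C \<tau> * x) \<le> A * T + (\<Sum>k\<in>K. 2 * Q k)" by simp
  qed
qed

section \<open>The energy bound for the symbol\<close>

lemma Im_symbol_le:
  "Im (symbol a2 a1 a0 t \<xi>) \<le> Im (a2 t) * (norm (rvec \<xi>))\<^sup>2 + (\<Sum>j\<in>UNIV. \<bar>Im (a1 j t)\<bar>) * norm (rvec \<xi>) + Im (a0 t)"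
proof -
  have "(\<Sum>j\<in>UNIV. Im (a1 j t * of_int (\<xi> $ j))) \<le> (\<Sum>j\<in>UNIV. \<bar>Im (a1 j t)\<bar> * norm (rvec \<xi>))"
  proof (rule sum_mono)
    fix j
    have "Im (a1 j t * of_int (\<xi> $ j)) \<le> \<bar>Im (a1 j t)\<bar> * \<bar>rvec \<xi> $ j\<bar>"
      by (simp flip: abs_mult)
    also have "\<dots> \<le> \<bar>Im (a1 j t)\<bar> * norm (rvec \<xi>)"
      by (intro mult_left_mono component_le_norm_cart) simp
    finally show "Im (a1 j t * of_int (\<xi> $ j)) \<le> \<bar>Im (a1 j t)\<bar> * norm (rvec \<xi>)" .
  qed
  then show ?thesis
    unfolding symbol_def by (simp add: sum_distrib_right del: of_real_power)
qed

lemma norm_rvec_ge_1: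
  assumes "\<xi> \<noteq> 0" shows "1 \<le> norm (rvec \<xi>)"
proof -
  obtain j where "\<xi> $ j \<noteq> 0" using assms by (auto simp: vec_eq_iff)
  then have "1 \<le> \<bar>rvec \<xi> $ j\<bar>" by (simp flip: of_int_abs)
  then show ?thesis using component_le_norm_cart[of "rvec \<xi>" j] by linarith
qed

lemma continuous_symbol:
  assumes "continuous_on S a2" "\<And>j. continuous_on S (a1 j)" "continuous_on S a0"
  shows "continuous_on S (\<lambda>t. symbol a2 a1 a0 t \<xi>)"
  unfolding symbol_def by (intro continuous_intros assms)

text \<open>Reduces to \<open>quadratic_energy_bound\<close> with x = |\<xi>|. All first order
  coefficients are collected into \<open>C\<close>, and near each zero their different exponents are
  replaced by one smaller exponent \<open>q' k\<close> that meets the requirements of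
  \<open>critical_time\<close>.\<close>

lemma symbol_energy_bound:
  fixes T \<delta> :: real and a1 :: "'n::finite \<Rightarrow> real \<Rightarrow> complex"
    and m :: nat and tk p :: "nat \<Rightarrow> real" and q :: "'n \<Rightarrow> nat \<Rightarrow> real"
  assumes T: "T > 0"
    and cont: "continuous_on {0..T} a2" "\<And>j. continuous_on {0..T} (a1 j)" "continuous_on {0..T} a0"
    and c2_nonpos: "\<And>t. t \<in> {0..T} \<Longrightarrow> Im (a2 t) \<le> 0"
    and c2_zeros: "\<And>t. t \<in> {0..T} \<Longrightarrow> Im (a2 t) = 0 \<longleftrightarrow> t \<in> tk ` {1..m}"
    and \<delta>: "\<delta> > 0"
    and c2_order: "\<And>k. k \<in> {1..m} \<Longrightarrow> p k > 0 \<and>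
      (\<exists>(\<alpha> :: real \<Rightarrow> real) \<epsilon>. \<epsilon> > 0 \<and>
        (\<forall>t \<in> {tk k - \<delta>..tk k + \<delta>} \<inter> {0..T}.
           \<alpha> t \<le> - \<epsilon> \<and> Im (a2 t) = \<alpha> t * rpow \<bar>t - tk k\<bar> (p k)))"
    and c1_order: "\<And>j k. k \<in> {1..m} \<Longrightarrow> q j k \<ge> 0 \<and>
      (\<exists>\<beta> :: real \<Rightarrow> real. bounded (\<beta> ` ({tk k - \<delta>..tk k + \<delta>} \<inter> {0..T})) \<and>
        (\<forall>t \<in> {tk k - \<delta>..tk k + \<delta>} \<inter> {0..T}. Im (a1 j t) = \<beta> t * rpow \<bar>t - tk k\<bar> (q j k)))"
    and pq: "\<And>k. k \<in> {1..m} \<Longrightarrow> p k \<le> 2 * Min (range (\<lambda>j. q j k)) + 1"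
  shows "\<exists>L. \<forall>\<xi> s t. 0 \<le> s \<and> s \<le> t \<and> t \<le> T \<longrightarrow> integral {s..t} (\<lambda>\<tau>. Im (symbol a2 a1 a0 \<tau> \<xi>)) \<le> L"
proof -
  define C where "C t = (\<Sum>j\<in>UNIV. \<bar>Im (a1 j t)\<bar>)" for t
  have cC: "continuous_on {0..T} C" unfolding C_def by (intro continuous_intros cont)
  \<comment> \<open>The smallest non-negative exponent with p \<le> 2 q' + 1. Unlike the given
    exponents it is always below p, and it does not exceed any of them.\<close>
  define q' where "q' k = max 0 ((p k - 1) / 2)" for k
  have q': "q' k \<ge> 0" "q' k < p k" "p k \<le> 2 * q' k + 1" "\<And>j. q' k \<le> q j k" if k: "k \<in> {1..m}" for k
  proof -
    have "p k > 0" using c2_order[OF k] by blast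
    then show "q' k \<ge> 0" "q' k < p k" "p k \<le> 2 * q' k + 1"
      by (simp_all add: q'_def max_def field_simps)
    have aux: "max 0 ((a - 1) / 2) \<le> c" if "M \<le> c" "0 \<le> c" "a \<le> 2 * M + 1" for a M c :: real
      using that by (auto simp: max_def)
    fix j
    have "Min (range (\<lambda>j. q j k)) \<le> q j k" by (intro Min_le) auto
    then show "q' k \<le> q j k"
      unfolding q'_def by (rule aux[OF _ _ pq[OF k]]) (use c1_order[OF k] in blast)
  qed
  have "\<forall>k\<in>{1..m}. \<exists>\<epsilon>>0. \<forall>t \<in> {tk k - \<delta>..tk k + \<delta>} \<inter> {0..T}. Im (a2 t) \<le> - \<epsilon> * rpow \<bar>t - tk k\<bar> (p k)"
  proof
    fix k assume "k \<in> {1..m}"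
    then obtain \<alpha> :: "real \<Rightarrow> real" and \<epsilon> where "\<epsilon> > 0"
      and *: "\<forall>t \<in> {tk k - \<delta>..tk k + \<delta>} \<inter> {0..T}. \<alpha> t \<le> - \<epsilon> \<and> Im (a2 t) = \<alpha> t * rpow \<bar>t - tk k\<bar> (p k)"
      using c2_order by blast
    moreover have "Im (a2 t) \<le> - \<epsilon> * rpow \<bar>t - tk k\<bar> (p k)" if "t \<in> {tk k - \<delta>..tk k + \<delta>} \<inter> {0..T}" for t
    proof -
      have "\<alpha> t \<le> - \<epsilon>" "Im (a2 t) = \<alpha> t * rpow \<bar>t - tk k\<bar> (p k)" using * that by blast+
      then show ?thesis using mult_right_mono[OF _ rpow_nonneg] by metis
    qed
    ultimately show "\<exists>\<epsilon>>0. \<forall>t \<in> {tk k - \<delta>..tk k + \<delta>} \<inter> {0..T}. Im (a2 t) \<le> - \<epsilon> * rpow \<bar>t - tk k\<bar> (p k)"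
      by blast
  qed
  then obtain \<epsilon> where \<epsilon>: "\<And>k. k \<in> {1..m} \<Longrightarrow> \<epsilon> k > 0"
    "\<And>k t. k \<in> {1..m} \<Longrightarrow> t \<in> {tk k - \<delta>..tk k + \<delta>} \<inter> {0..T} \<Longrightarrow> Im (a2 t) \<le> - \<epsilon> k * rpow \<bar>t - tk k\<bar> (p k)"
    by metis
  have "\<forall>j. \<forall>k\<in>{1..m}. \<exists>b. \<forall>t \<in> {tk k - \<delta>..tk k + \<delta>} \<inter> {0..T}. \<bar>Im (a1 j t)\<bar> \<le> \<bar>b\<bar> * rpow \<bar>t - tk k\<bar> (q j k)"
  proof (intro allI ballI)
    fix j k assume "k \<in> {1..m}"
    then obtain \<beta> :: "real \<Rightarrow> real" where \<beta>: "bounded (\<beta> ` ({tk k - \<delta>..tk k + \<delta>} \<inter> {0..T}))"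
      and *: "\<forall>t \<in> {tk k - \<delta>..tk k + \<delta>} \<inter> {0..T}. Im (a1 j t) = \<beta> t * rpow \<bar>t - tk k\<bar> (q j k)"
      using c1_order by blast
    obtain b where b: "\<forall>y\<in>\<beta> ` ({tk k - \<delta>..tk k + \<delta>} \<inter> {0..T}). norm y \<le> b"
      using \<beta> unfolding bounded_iff by blast
    have "\<bar>Im (a1 j t)\<bar> \<le> \<bar>b\<bar> * rpow \<bar>t - tk k\<bar> (q j k)" if t: "t \<in> {tk k - \<delta>..tk k + \<delta>} \<inter> {0..T}" for t
    proof -
      have "\<bar>\<beta> t\<bar> \<le> \<bar>b\<bar>" using b t by force
      moreover have "Im (a1 j t) = \<beta> t * rpow \<bar>t - tk k\<bar> (q j k)" using * t by blast
      ultimately show ?thesis by (simp add: abs_mult rpow_nonneg mult_right_mono)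
    qed
    then show "\<exists>b. \<forall>t \<in> {tk k - \<delta>..tk k + \<delta>} \<inter> {0..T}. \<bar>Im (a1 j t)\<bar> \<le> \<bar>b\<bar> * rpow \<bar>t - tk k\<bar> (q j k)"
      by blast
  qed
  then obtain b where b: "\<And>j k t. k \<in> {1..m} \<Longrightarrow> t \<in> {tk k - \<delta>..tk k + \<delta>} \<inter> {0..T} \<Longrightarrow>
      \<bar>Im (a1 j t)\<bar> \<le> \<bar>b j k\<bar> * rpow \<bar>t - tk k\<bar> (q j k)"
    by metis
  \<comment> \<open>The added 1 makes \<open>B k\<close> positive even if all first order
    coefficients vanish near the zero.\<close>
  define B where "B k = (\<Sum>j\<in>UNIV. \<bar>b j k\<bar>) + 1" for k
  have "\<exists>L. \<forall>x\<ge>1. \<forall>s t. 0 \<le> s \<and> s \<le> t \<and> t \<le> T \<longrightarrow> integral {s..t} (\<lambda>\<tau>. Im (a2 \<tau>) * x\<^sup>2 + C \<tau> * x) \<le> L"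
  \<comment> \<open>The radius is cut down to at most 1 so that lowering the exponent from
    \<open>q j k\<close> to \<open>q' k\<close> increases the power of the distance.\<close>
  proof (rule quadratic_energy_bound[where K = "{1..m}" and p = p and q = q' and \<epsilon> = \<epsilon> and B = B and tk = tk and \<delta> = "min \<delta> 1"])
    show "p k > 0 \<and> q' k \<ge> 0 \<and> q' k < p k \<and> p k \<le> 2 * q' k + 1 \<and> \<epsilon> k > 0 \<and> B k > 0" if "k \<in> {1..m}" for k
      using q'[OF that] \<epsilon>(1)[OF that] c2_order[OF that] by (auto simp: B_def add_nonneg_pos sum_nonneg)
    fix k t assume k: "k \<in> {1..m}" and t: "t \<in> {0..T}" and d: "\<bar>t - tk k\<bar> < min \<delta> 1"
    have t': "t \<in> {tk k - \<delta>..tk k + \<delta>} \<inter> {0..T}" using t d by auto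
    have "C t \<le> (\<Sum>j\<in>UNIV. \<bar>b j k\<bar> * rpow \<bar>t - tk k\<bar> (q' k))"
      unfolding C_def
    proof (rule sum_mono)
      fix j
      have "rpow \<bar>t - tk k\<bar> (q j k) \<le> rpow \<bar>t - tk k\<bar> (q' k)"
        using d q'[OF k] by (intro rpow_anti_exponent) auto
      then have "\<bar>b j k\<bar> * rpow \<bar>t - tk k\<bar> (q j k) \<le> \<bar>b j k\<bar> * rpow \<bar>t - tk k\<bar> (q' k)"
        by (intro mult_left_mono) auto
      then show "\<bar>Im (a1 j t)\<bar> \<le> \<bar>b j k\<bar> * rpow \<bar>t - tk k\<bar> (q' k)"
        using b[OF k t', of j] by linarith
    qed
    also have "\<dots> \<le> B k * rpow \<bar>t - tk k\<bar> (q' k)"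
      unfolding B_def sum_distrib_right[symmetric] by (intro mult_right_mono rpow_nonneg) simp
    finally show "Im (a2 t) \<le> - \<epsilon> k * rpow \<bar>t - tk k\<bar> (p k) \<and> C t \<le> B k * rpow \<bar>t - tk k\<bar> (q' k)"
      using \<epsilon>(2)[OF k t'] by blast
  next
    fix t assume t: "t \<in> {0..T}" and d: "\<And>k. k \<in> {1..m} \<Longrightarrow> min \<delta> 1 \<le> \<bar>t - tk k\<bar>"
    have "t \<notin> tk ` {1..m}"
    proof
      assume "t \<in> tk ` {1..m}"
      then obtain k where "k \<in> {1..m}" "t = tk k" by blast
      with d[of k] \<delta> show False by simp
    qed
    then show "Im (a2 t) < 0" using c2_zeros[OF t] c2_nonpos[OF t] by linarith
  qed (use T cC in \<open>auto intro!: continuous_intros cont\<close>)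
  then obtain L where L: "\<And>x s t. x \<ge> 1 \<Longrightarrow> 0 \<le> s \<and> s \<le> t \<and> t \<le> T \<Longrightarrow>
      integral {s..t} (\<lambda>\<tau>. Im (a2 \<tau>) * x\<^sup>2 + C \<tau> * x) \<le> L"
    by blast
  have "bounded ((\<lambda>t. Im (a0 t)) ` {0..T})"
    by (intro compact_imp_bounded compact_continuous_image continuous_intros cont) simp
  then obtain m0 where m0: "\<forall>y\<in>(\<lambda>t. Im (a0 t)) ` {0..T}. norm y \<le> m0" unfolding bounded_iff by blast
  have a0: "Im (a0 t) \<le> \<bar>m0\<bar>" if "t \<in> {0..T}" for t using m0 that by force
  show ?thesis
  proof (intro exI[of _ "\<bar>L\<bar> + \<bar>m0\<bar> * T"] allI impI)
    fix \<xi> :: "int ^ 'n" and s t assume st: "0 \<le> s \<and> s \<le> t \<and> t \<le> T"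
    let ?x = "norm (rvec \<xi>)"
    have sub: "{s..t} \<subseteq> {0..T}" using st by auto
    have i1: "(\<lambda>\<tau>. Im (a2 \<tau>) * ?x\<^sup>2 + C \<tau> * ?x) integrable_on {s..t}"
      by (intro integrable_continuous_interval continuous_intros continuous_on_subset[OF cC sub]
          continuous_on_subset[OF cont(1) sub])
    have "integral {s..t} (\<lambda>\<tau>. Im (symbol a2 a1 a0 \<tau> \<xi>)) \<le>
        integral {s..t} (\<lambda>\<tau>. (Im (a2 \<tau>) * ?x\<^sup>2 + C \<tau> * ?x) + \<bar>m0\<bar>)"
    proof (rule integral_le)
      show "(\<lambda>\<tau>. Im (symbol a2 a1 a0 \<tau> \<xi>)) integrable_on {s..t}"
        by (intro integrable_continuous_interval continuous_on_Im continuous_on_subset[OF continuous_symbol sub] cont)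
      show "(\<lambda>\<tau>. (Im (a2 \<tau>) * ?x\<^sup>2 + C \<tau> * ?x) + \<bar>m0\<bar>) integrable_on {s..t}"
        by (intro integrable_add i1 integrable_const_ivl)
      fix \<tau> assume "\<tau> \<in> {s..t}"
      with sub have "Im (a0 \<tau>) \<le> \<bar>m0\<bar>" by (intro a0) auto
      then show "Im (symbol a2 a1 a0 \<tau> \<xi>) \<le> (Im (a2 \<tau>) * ?x\<^sup>2 + C \<tau> * ?x) + \<bar>m0\<bar>"
        using Im_symbol_le[of a2 a1 a0 \<tau> \<xi>] by (simp add: C_def)
    qed
    also have "\<dots> = integral {s..t} (\<lambda>\<tau>. Im (a2 \<tau>) * ?x\<^sup>2 + C \<tau> * ?x) + integral {s..t} (\<lambda>\<tau>. \<bar>m0\<bar>)"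
      by (intro integral_add i1 integrable_const_ivl)
    also have "\<dots> \<le> \<bar>L\<bar> + \<bar>m0\<bar> * T"
    proof (rule add_mono)
      show "integral {s..t} (\<lambda>\<tau>. Im (a2 \<tau>) * ?x\<^sup>2 + C \<tau> * ?x) \<le> \<bar>L\<bar>"
      \<comment> \<open>Non-zero lattice points have norm at least 1, as the estimate requires; at 0
        the integrand vanishes.\<close>
      proof (cases "\<xi> = 0")
        case False
        then show ?thesis using L[OF norm_rvec_ge_1[OF False] st] by linarith
      qed simp
      show "integral {s..t} (\<lambda>\<tau>. \<bar>m0\<bar>) \<le> \<bar>m0\<bar> * T"
        using st mult_right_mono[of "t - s" T "\<bar>m0\<bar>"] by (simp add: mult.commute)
    qed
    finally show "integral {s..t} (\<lambda>\<tau>. Im (symbol a2 a1 a0 \<tau> \<xi>)) \<le> \<bar>L\<bar> + \<bar>m0\<bar> * T" .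
  qed
qed

section \<open>Solving the Cauchy problem\<close>

text \<open>The integral of the squared deviation of h from its mean m is non-negative; expanded,
  this is the claim.\<close>

lemma Cauchy_Schwarz_integral:
  fixes h :: "real \<Rightarrow> real"
  assumes "a \<le> b" and h: "continuous_on {a..b} h"
  shows "(integral {a..b} h)\<^sup>2 \<le> (b - a) * integral {a..b} (\<lambda>s. (h s)\<^sup>2)"
proof (cases "a = b")
  case False
  with assms have ab: "a < b" by simp
  define m where "m = integral {a..b} h / (b - a)"
  have I: "(h has_integral m * (b - a)) {a..b}"
    using ab by (simp add: m_def has_integral_integral[symmetric] integrable_continuous_interval h)
  have I2: "((\<lambda>s. (h s)\<^sup>2) has_integral integral {a..b} (\<lambda>s. (h s)\<^sup>2)) {a..b}"
    by (intro integrable_integral integrable_continuous_interval continuous_intros h)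
  have I3: "((\<lambda>s. m\<^sup>2) has_integral (b - a) * m\<^sup>2) {a..b}"
    using has_integral_const_real[of "m\<^sup>2" a b] ab by simp
  have "((\<lambda>s. (h s)\<^sup>2 - (2 * m) * h s + m\<^sup>2) has_integral
      (integral {a..b} (\<lambda>s. (h s)\<^sup>2) - (2 * m) * (m * (b - a)) + (b - a) * m\<^sup>2)) {a..b}"
    by (intro has_integral_add has_integral_diff has_integral_mult_right I I2 I3)
  then have "0 \<le> integral {a..b} (\<lambda>s. (h s)\<^sup>2) - (2 * m) * (m * (b - a)) + (b - a) * m\<^sup>2"
  proof (rule has_integral_nonneg)
    fix s
    have "(h s)\<^sup>2 - (2 * m) * h s + m\<^sup>2 = (h s - m)\<^sup>2" by (simp add: power2_eq_square algebra_simps)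
    then show "0 \<le> (h s)\<^sup>2 - (2 * m) * h s + m\<^sup>2" by simp
  qed
  then have "(b - a) * m\<^sup>2 \<le> integral {a..b} (\<lambda>s. (h s)\<^sup>2)"
    by (simp add: power2_eq_square algebra_simps)
  then have "(b - a) * ((b - a) * m\<^sup>2) \<le> (b - a) * integral {a..b} (\<lambda>s. (h s)\<^sup>2)"
    using ab by (intro mult_left_mono) auto
  moreover have "(b - a) * ((b - a) * m\<^sup>2) = (integral {a..b} h)\<^sup>2"
    using ab by (simp add: m_def power2_eq_square)
  ultimately show ?thesis by simp
qed simp

text \<open>A Minkowski-type bound: the Sobolev norm of a time integral is at most the length times
  the supremum of the norms. It is stated on finite sets of frequencies, where sum and integral
  commute, and serves both for the source term and for difference quotients.\<close>

lemma sobolev_term_integral_le: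
  fixes h :: "int ^ 'n::finite \<Rightarrow> real \<Rightarrow> complex"
  assumes ab: "a \<le> b" and h: "\<And>\<xi>. continuous_on {a..b} (h \<xi>)" and G: "finite G"
    and E: "\<And>s. s \<in> {a..b} \<Longrightarrow> (\<Sum>\<xi>\<in>G. sobolev_term r (\<lambda>\<xi>. h \<xi> s) \<xi>) \<le> E"
  shows "(\<Sum>\<xi>\<in>G. sobolev_term r (\<lambda>\<xi>. of_real (integral {a..b} (\<lambda>s. norm (h \<xi> s)))) \<xi>) \<le> (b - a)\<^sup>2 * E"
proof -
  have int: "(\<lambda>s. sobolev_term r (\<lambda>\<xi>. h \<xi> s) \<xi>) integrable_on {a..b}" for \<xi>
    unfolding sobolev_term_def by (intro integrable_continuous_interval continuous_intros h)
  have "sobolev_term r (\<lambda>\<xi>. of_real (integral {a..b} (\<lambda>s. norm (h \<xi> s)))) \<xi> \<le>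
      (b - a) * integral {a..b} (\<lambda>s. sobolev_term r (\<lambda>\<xi>. h \<xi> s) \<xi>)" for \<xi>
  proof -
    have "(integral {a..b} (\<lambda>s. norm (h \<xi> s) * weight \<xi> powr r))\<^sup>2 \<le>
        (b - a) * integral {a..b} (\<lambda>s. (norm (h \<xi> s) * weight \<xi> powr r)\<^sup>2)"
      by (intro Cauchy_Schwarz_integral ab continuous_intros h)
    moreover have "integral {a..b} (\<lambda>s. norm (h \<xi> s) * weight \<xi> powr r) =
        integral {a..b} (\<lambda>s. norm (h \<xi> s)) * weight \<xi> powr r"
      by (rule integral_mult_left)
    ultimately show ?thesis
      by (simp add: sobolev_term_def power_mult_distrib)
  qed
  then have "(\<Sum>\<xi>\<in>G. sobolev_term r (\<lambda>\<xi>. of_real (integral {a..b} (\<lambda>s. norm (h \<xi> s)))) \<xi>) \<le>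
      (\<Sum>\<xi>\<in>G. (b - a) * integral {a..b} (\<lambda>s. sobolev_term r (\<lambda>\<xi>. h \<xi> s) \<xi>))"
    by (rule sum_mono)
  also have "\<dots> = (b - a) * integral {a..b} (\<lambda>s. \<Sum>\<xi>\<in>G. sobolev_term r (\<lambda>\<xi>. h \<xi> s) \<xi>)"
    unfolding sum_distrib_left[symmetric] by (simp only: integral_sum[OF G int])
  also have "\<dots> \<le> (b - a) * integral {a..b} (\<lambda>s. E)"
    using ab by (intro mult_left_mono integral_le integrable_sum G int integrable_const_ivl E) auto
  also have "\<dots> = (b - a)\<^sup>2 * E" using ab by (simp add: power2_eq_square)
  finally show ?thesis .
qed

text \<open>The quadratic growth of the symbol is exactly compensated by lowering the Sobolev order
  by 2.\<close>

lemma sobolev_term_scale_weight: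
  "sobolev_term (r - 2) (\<lambda>\<xi>. of_real (S * (weight \<xi>)\<^sup>2 * M \<xi>)) \<xi> = sobolev_term r (\<lambda>\<xi>. of_real (S * M \<xi>)) \<xi>"
proof -
  have "weight \<xi> powr 2 * weight \<xi> powr (r - 2) = weight \<xi> powr (2 + (r - 2))"
    by (rule powr_add[symmetric])
  then have "(weight \<xi>)\<^sup>2 * weight \<xi> powr (r - 2) = weight \<xi> powr r"
    using weight_pos[of \<xi>] by simp
  then have "\<bar>S * (weight \<xi>)\<^sup>2 * M \<xi>\<bar> * weight \<xi> powr (r - 2) = \<bar>S * M \<xi>\<bar> * weight \<xi> powr r"
    by (simp add: abs_mult mult_ac)
  then show ?thesis unfolding sobolev_term_def by (simp only: norm_of_real)
qed

lemma limitin_sobolev_add: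
  assumes "limitin (sobolev_top r) f l F" "limitin (sobolev_top r) g k F"
  shows "limitin (sobolev_top r) (\<lambda>t. a *\<^sub>D f t + g t) (a *\<^sub>D l + k) F"
  unfolding limitin_sobolev
proof (intro conjI)
  have f: "l \<in> sobolev r" "\<forall>\<^sub>F t in F. f t \<in> sobolev r" "((\<lambda>t. sobolev_norm r (f t - l)) \<longlongrightarrow> 0) F"
    and g: "k \<in> sobolev r" "\<forall>\<^sub>F t in F. g t \<in> sobolev r" "((\<lambda>t. sobolev_norm r (g t - k)) \<longlongrightarrow> 0) F"
    using assms by (auto simp: limitin_sobolev)
  show "a *\<^sub>D l + k \<in> sobolev r" by (intro sobolev_add sobolev_smul f g)
  show "\<forall>\<^sub>F t in F. a *\<^sub>D f t + g t \<in> sobolev r"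
    using f(2) g(2) by eventually_elim (intro sobolev_add sobolev_smul)
  show "((\<lambda>t. sobolev_norm r (a *\<^sub>D f t + g t - (a *\<^sub>D l + k))) \<longlongrightarrow> 0) F"
  proof (rule Lim_null_comparison)
    show "\<forall>\<^sub>F t in F. norm (sobolev_norm r (a *\<^sub>D f t + g t - (a *\<^sub>D l + k))) \<le>
        norm a * sobolev_norm r (f t - l) + sobolev_norm r (g t - k)"
      using f(2) g(2)
    proof eventually_elim
      fix t assume t: "f t \<in> sobolev r" "g t \<in> sobolev r"
      have eq: "a *\<^sub>D f t + g t - (a *\<^sub>D l + k) = a *\<^sub>D (f t - l) + (g t - k)"
        by (simp add: fun_eq_iff smul_def algebra_simps)
      have "sobolev_norm r (a *\<^sub>D (f t - l) + (g t - k)) \<le>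
          sobolev_norm r (a *\<^sub>D (f t - l)) + sobolev_norm r (g t - k)"
        by (intro sobolev_add(2) sobolev_smul(1) sobolev_diff t f(1) g(1))
      moreover have "sobolev_norm r (a *\<^sub>D (f t - l)) = norm a * sobolev_norm r (f t - l)"
        by (intro sobolev_smul(2) sobolev_diff t f(1))
      ultimately show "norm (sobolev_norm r (a *\<^sub>D f t + g t - (a *\<^sub>D l + k))) \<le>
          norm a * sobolev_norm r (f t - l) + sobolev_norm r (g t - k)"
        unfolding eq by (simp add: sobolev_norm_nonneg)
    qed
    have "((\<lambda>t. norm a * sobolev_norm r (f t - l) + sobolev_norm r (g t - k)) \<longlongrightarrow> norm a * 0 + 0) F"
      by (intro tendsto_intros f g)
    then show "((\<lambda>t. norm a * sobolev_norm r (f t - l) + sobolev_norm r (g t - k)) \<longlongrightarrow> 0) F" by simp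
  qed
qed

text \<open>The coefficients of an element of H^r grow at most like the weight to the power -r,
  while those of a test function decay rapidly; so evaluation at a fixed test function is continuous
  on H^r.\<close>

lemma sobolev_eval_bound:
  assumes \<psi>: "\<psi> \<in> torus_smooth"
  shows "\<exists>C. \<forall>w\<in>sobolev r. norm (w \<psi>) \<le> C * sobolev_norm r w"
proof -
  define k where "k = nat \<lceil>- r\<rceil>"
  have k: "- r \<le> real k" by (simp add: k_def of_nat_ceiling)
  let ?s = "\<lambda>\<xi>. norm (fcoeff \<psi> \<xi>) * weight \<xi> ^ k"
  have "norm (w \<psi>) \<le> infsum ?s UNIV * sobolev_norm r w" if w: "w \<in> sobolev r" for w
  proof -
    have wd: "w \<in> distributions" using w by (simp add: sobolev_iff)
    have "((\<lambda>\<xi>. ?s \<xi> * sobolev_norm r w) has_sum infsum ?s UNIV * sobolev_norm r w) UNIV"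
      by (intro has_sum_cmult_left has_sum_infsum rapid_summable rapid_fcoeff \<psi>)
    moreover have "norm (fourier w (- \<xi>) * fcoeff \<psi> \<xi>) \<le> ?s \<xi> * sobolev_norm r w" for \<xi>
    proof -
      have "norm (fourier w (- \<xi>)) \<le> weight \<xi> powr (- r) * sobolev_norm r w"
        using norm_fourier_le_sobolev_norm[OF w, of "- \<xi>"] by simp
      also have "\<dots> \<le> weight \<xi> powr k * sobolev_norm r w"
        by (intro mult_right_mono powr_mono k weight_ge_1 sobolev_norm_nonneg)
      finally have "norm (fourier w (- \<xi>)) \<le> weight \<xi> ^ k * sobolev_norm r w"
        by (simp add: powr_realpow weight_pos)
      then have "norm (fourier w (- \<xi>)) * norm (fcoeff \<psi> \<xi>) \<le> weight \<xi> ^ k * sobolev_norm r w * norm (fcoeff \<psi> \<xi>)"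
        by (intro mult_right_mono) auto
      then show ?thesis by (simp add: norm_mult mult_ac)
    qed
    ultimately have "norm (distr_of (fourier w) \<psi>) \<le> infsum ?s UNIV * sobolev_norm r w"
      by (rule norm_infsum_le[OF has_sum_distr_of[OF tempered_fourier[OF wd] \<psi>]])
    then show ?thesis by (simp only: distr_of_fourier[OF wd])
  qed
  then show ?thesis by blast
qed

lemma limitin_sobolev_eval:
  assumes lim: "limitin (sobolev_top r) f l F" and \<psi>: "\<psi> \<in> torus_smooth"
  shows "((\<lambda>t. f t \<psi>) \<longlongrightarrow> l \<psi>) F"
proof -
  obtain C where C: "\<And>w. w \<in> sobolev r \<Longrightarrow> norm (w \<psi>) \<le> C * sobolev_norm r w"
    using sobolev_eval_bound[OF \<psi>] by blast
  have l: "l \<in> sobolev r" and ev: "\<forall>\<^sub>F t in F. f t \<in> sobolev r"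
    and lim: "((\<lambda>t. sobolev_norm r (f t - l)) \<longlongrightarrow> 0) F"
    using lim by (auto simp: limitin_sobolev)
  have "((\<lambda>t. f t \<psi> - l \<psi>) \<longlongrightarrow> 0) F"
  proof (rule Lim_null_comparison[OF _ tendsto_mult_right_zero[OF lim, of C]])
    show "\<forall>\<^sub>F t in F. norm (f t \<psi> - l \<psi>) \<le> C * sobolev_norm r (f t - l)"
      using ev
    proof eventually_elim
      fix t assume "f t \<in> sobolev r"
      from C[OF sobolev_diff[OF this l]] show "norm (f t \<psi> - l \<psi>) \<le> C * sobolev_norm r (f t - l)" by simp
    qed
  qed
  then show ?thesis by (simp add: LIM_zero_iff)
qed

text \<open>Matches scalar derivatives with the difference quotients that define
  \<open>C1_maps\<close>.\<close>

lemma has_vector_derivative_iff_quotient: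
  fixes v :: "real \<Rightarrow> complex"
  shows "(v has_vector_derivative D) (at t within S) \<longleftrightarrow>
    ((\<lambda>\<tau>. of_real (1 / (\<tau> - t)) * (v \<tau> - v t)) \<longlongrightarrow> D) (at t within S)"
proof -
  have eq: "norm (v \<tau> - v t - (\<tau> - t) *\<^sub>R D) / norm (\<tau> - t) = norm (of_real (1 / (\<tau> - t)) * (v \<tau> - v t) - D)"
    if "\<tau> \<noteq> t" for \<tau>
  proof -
    have "of_real (1 / (\<tau> - t)) * (v \<tau> - v t) - D = of_real (1 / (\<tau> - t)) * (v \<tau> - v t - (\<tau> - t) *\<^sub>R D)"
      using that by (simp add: scaleR_conv_of_real field_simps)
    then show ?thesis by (simp only: norm_mult norm_of_real) simp
  qed
  have "(v has_vector_derivative D) (at t within S) \<longleftrightarrow>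
      ((\<lambda>\<tau>. norm (v \<tau> - v t - (\<tau> - t) *\<^sub>R D) / norm (\<tau> - t)) \<longlongrightarrow> 0) (at t within S)"
    unfolding has_vector_derivative_def has_derivative_iff_norm by (simp add: bounded_linear_scaleR_left)
  also have "\<dots> \<longleftrightarrow> ((\<lambda>\<tau>. norm (of_real (1 / (\<tau> - t)) * (v \<tau> - v t) - D)) \<longlongrightarrow> 0) (at t within S)"
    by (intro filterlim_cong refl) (use eq in \<open>auto simp: eventually_at_filter\<close>)
  also have "\<dots> \<longleftrightarrow> ((\<lambda>\<tau>. of_real (1 / (\<tau> - t)) * (v \<tau> - v t)) \<longlongrightarrow> D) (at t within S)"
    by (simp only: tendsto_norm_zero_iff LIM_zero_iff)
  finally show ?thesis .
qed

lemma spatial_part_eq: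
  assumes "u \<in> distributions"
  shows "spatial_part a2 a1 a0 t u = distr_of (\<lambda>\<xi>. symbol a2 a1 a0 t \<xi> * fourier u \<xi>)"
  using spatial_part_distr_of[OF tempered_fourier[OF assms], of a2 a1 a0 t] by (simp only: distr_of_fourier[OF assms])

lemma fourier_spatial_part:
  "u \<in> distributions \<Longrightarrow> fourier (spatial_part a2 a1 a0 t u) \<xi> = symbol a2 a1 a0 t \<xi> * fourier u \<xi>"
  by (simp add: spatial_part_eq fourier_distr_of)

lemma spatial_part_distributions: "u \<in> distributions \<Longrightarrow> spatial_part a2 a1 a0 t u \<in> distributions"
  by (simp add: spatial_part_eq distr_of_in_distributions tempered_mult tempered_symbol tempered_fourier)

section \<open>Uniqueness\<close>

text \<open>Evaluating the weak equation at a character leaves a scalar equation for the difference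
  of coefficients. Two solutions may be continuous into different Sobolev spaces, so this one
  statement serves all three classes of data.\<close>

lemma solves_CP_unique:
  fixes u v :: "real \<Rightarrow> 'n::finite functional"
  assumes T: "T > 0"
    and cont: "continuous_on {0..T} a2" "\<And>j. continuous_on {0..T} (a1 j)" "continuous_on {0..T} a0"
    and u: "solves_CP T a2 a1 a0 f g u" and v: "solves_CP T a2 a1 a0 f g v"
  shows "u = v"
proof -
  obtain r1 r2 where r: "u \<in> C0_maps T (sobolev_top r1)" "v \<in> C0_maps T (sobolev_top r2)"
    using u v unfolding solves_CP_def by blast
  have ud: "u t \<in> distributions" and vd: "v t \<in> distributions" if "t \<in> {0..T}" for t
    using C0_maps_mem[OF r(1) that] C0_maps_mem[OF r(2) that] by (simp_all add: topspace_sobolev sobolev_iff)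
  have eq: "fourier (u t) \<xi> = fourier (v t) \<xi>" if t: "t \<in> {0..T}" for t \<xi>
  proof -
    let ?U = "\<lambda>t. fourier (u t) \<xi>" and ?V = "\<lambda>t. fourier (v t) \<xi>" and ?a = "\<lambda>t. symbol a2 a1 a0 t \<xi>"
    have cu: "continuous_on {0..T} ?U" and cv: "continuous_on {0..T} ?V"
      by (rule C0_sobolev_continuous_fourier, rule r)+
    have ca: "continuous_on {0..T} ?a" by (intro continuous_symbol cont)
    have test: "integral {0..T} (\<lambda>t. - Dt \<phi> t * fourier (w t) \<xi>) + integral {0..T} (\<lambda>t. \<phi> t * (?a t * fourier (w t) \<xi>)) =
        time_distr T f \<phi> (character (- \<xi>))"
      if w: "solves_CP T a2 a1 a0 f g w" and wd: "\<And>t. t \<in> {0..T} \<Longrightarrow> w t \<in> distributions" and \<phi>: "\<phi> \<in> time_test T" for w \<phi>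
    proof -
      have "weak_Dt T w \<phi> (character (- \<xi>)) + time_distr T (\<lambda>t. spatial_part a2 a1 a0 t (w t)) \<phi> (character (- \<xi>)) =
          time_distr T f \<phi> (character (- \<xi>))"
        using w \<phi> unfolding solves_CP_def by (metis plus_fun_apply)
      moreover have "weak_Dt T w \<phi> (character (- \<xi>)) = integral {0..T} (\<lambda>t. - Dt \<phi> t * fourier (w t) \<xi>)"
        by (simp only: weak_Dt_def distr_integral_def smul_def fourier_eq)
      moreover have "time_distr T (\<lambda>t. spatial_part a2 a1 a0 t (w t)) \<phi> (character (- \<xi>)) =
          integral {0..T} (\<lambda>t. \<phi> t * (?a t * fourier (w t) \<xi>))"
        unfolding time_distr_def distr_integral_def smul_def
        by (intro integral_cong) (simp add: fourier_spatial_part wd flip: fourier_eq)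
      ultimately show ?thesis by simp
    qed
    have "?U t - ?V t = 0"
    proof (rule weak_ode_unique[OF T _ ca _ _ t])
      show "continuous_on {0..T} (\<lambda>t. ?U t - ?V t)" by (intro continuous_intros cu cv)
      show "?U 0 - ?V 0 = 0" using u v by (simp add: solves_CP_def)
      fix \<phi> assume \<phi>: "\<phi> \<in> time_test T"
      note c = time_testD(3,4)[OF \<phi>, of "{0..T}"]
      have e1: "integral {0..T} (\<lambda>t. - Dt \<phi> t * ?U t - - Dt \<phi> t * ?V t) =
          integral {0..T} (\<lambda>t. - Dt \<phi> t * ?U t) - integral {0..T} (\<lambda>t. - Dt \<phi> t * ?V t)"
        by (intro integral_diff integrable_continuous_interval continuous_intros c cu cv)
      have e2: "integral {0..T} (\<lambda>t. \<phi> t * (?a t * ?U t) - \<phi> t * (?a t * ?V t)) =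
          integral {0..T} (\<lambda>t. \<phi> t * (?a t * ?U t)) - integral {0..T} (\<lambda>t. \<phi> t * (?a t * ?V t))"
        by (intro integral_diff integrable_continuous_interval continuous_intros c cu cv ca)
      show "integral {0..T} (\<lambda>t. - Dt \<phi> t * (?U t - ?V t)) + integral {0..T} (\<lambda>t. \<phi> t * (?a t * (?U t - ?V t))) = 0"
        using test[OF u ud \<phi>] test[OF v vd \<phi>] unfolding right_diff_distrib e1 e2 add_diff_add[symmetric] by simp
    qed
    then show ?thesis by simp
  qed
  have "u t = v t" if t: "t \<in> {0..T}" for t
    by (intro distributions_eqI ud vd eq t)
  moreover have "u \<in> extensional {0..T}" "v \<in> extensional {0..T}"
    using r by (simp_all add: C0_maps_def)
  ultimately show ?thesis by (intro extensionalityI[of _ "{0..T}"])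
qed

section \<open>Criteria for continuous and differentiable maps in time\<close>

lemma rapid_imp_sobolev_term_summable:
  assumes "rapid c" shows "sobolev_term r c summable_on UNIV"
proof -
  have "\<exists>C. \<forall>\<xi>. norm (c \<xi>) * weight \<xi> ^ 0 \<le> C" using assms unfolding rapid_def by blast
  then have "\<exists>C. \<forall>\<xi>. norm (c \<xi>) \<le> C * weight \<xi> ^ 0" by simp
  then have "tempered c" unfolding tempered_def by blast
  then have "distr_of c \<in> Cinf"
    using assms by (simp add: Cinf_iff distr_of_in_distributions fourier_distr_of[abs_def])
  then have "distr_of c \<in> sobolev r" by (simp add: Cinf_def)
  then show ?thesis by (simp add: sobolev_iff fourier_distr_of[abs_def])
qed

lemma sum_sobolev_term_le:
  assumes u: "u \<in> sobolev r" and G: "finite G"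
  shows "(\<Sum>\<xi>\<in>G. sobolev_term r (\<lambda>\<xi>. fourier u \<xi>) \<xi>) \<le> (sobolev_norm r u)\<^sup>2"
proof -
  have "(\<Sum>\<xi>\<in>G. sobolev_term r (fourier u) \<xi>) \<le> infsum (sobolev_term r (fourier u)) UNIV"
    using u G by (intro finite_sum_le_infsum) (auto simp: sobolev_iff)
  then show ?thesis by (simp add: sobolev_norm_eq infsum_nonneg)
qed

lemma eventually_within_set: "\<forall>\<^sub>F \<tau> in at t within S. \<tau> \<in> S"
  by (simp add: eventually_at_filter)

lemma restrict_in_C0_maps:
  assumes "\<And>t. t \<in> {0..T} \<Longrightarrow> limitin X v (v t) (at t within {0..T})"
  shows "restrict v {0..T} \<in> C0_maps T X"
  unfolding C0_maps_iff
proof (intro conjI ballI)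
  fix t assume t: "t \<in> {0..T}"
  have "\<forall>\<^sub>F \<tau> in at t within {0..T}. v \<tau> = restrict v {0..T} \<tau>"
    using eventually_within_set by eventually_elim simp
  note limitin_transform_eventually[OF this assms[OF t]]
  moreover have "restrict v {0..T} t = v t" using t by simp
  ultimately show "limitin X (restrict v {0..T}) (restrict v {0..T} t) (at t within {0..T})" by (simp only:)
qed simp

text \<open>The derivative may be given by a map defined for all times; its restriction has the
  extensionality that \<open>C0_maps\<close> demands.\<close>

lemma C1_mapsI:
  assumes "u \<in> C0_maps T X"
    and "\<And>t. t \<in> {0..T} \<Longrightarrow> limitin X v (v t) (at t within {0..T})"
    and "\<And>t. t \<in> {0..T} \<Longrightarrow>
      limitin X (\<lambda>\<tau>. of_real (1 / (\<tau> - t)) *\<^sub>D (u \<tau> - u t)) (v t) (at t within {0..T})"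
  shows "u \<in> C1_maps T X"
  unfolding C1_maps_def
  using assms(1,3) restrict_in_C0_maps[of T X v, OF assms(2)]
  by (auto intro!: bexI[of _ "restrict v {0..T}"])

lemma norm_diff_le_derivative:
  fixes y :: "real \<Rightarrow> complex"
  assumes y: "\<And>t. t \<in> {0..T} \<Longrightarrow> (y has_vector_derivative y' t) (at t within {0..T})"
    and B: "\<And>t. t \<in> {0..T} \<Longrightarrow> norm (y' t) \<le> B" and st: "s \<in> {0..T}" "t \<in> {0..T}"
  shows "norm (y s - y t) \<le> B * norm (s - t)"
proof (rule differentiable_bound[of "{0..T}" y "\<lambda>t h. h *\<^sub>R y' t"])
  fix t assume t: "t \<in> {0..T}"
  show "(y has_derivative (\<lambda>h. h *\<^sub>R y' t)) (at t within {0..T})"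
    using y[OF t] by (simp add: has_vector_derivative_def)
  show "onorm (\<lambda>h. h *\<^sub>R y' t) \<le> B"
  proof (rule onorm_le)
    fix h :: real
    show "norm (h *\<^sub>R y' t) \<le> B * norm h"
      using mult_right_mono[OF B[OF t], of "norm h"] by (simp add: mult.commute)
  qed
qed (use st in auto)

text \<open>In each coefficient the quotient minus \<open>v t\<close> is the average of
  \<open>v s - v t\<close> over the interval between \<tau> and t. Cauchy-Schwarz in time moves the
  square-sum under the integral, so continuity of \<open>v\<close> in the norm bounds all
  frequencies simultaneously.\<close>

lemma limitin_sobolev_quotient:
  fixes u v :: "real \<Rightarrow> 'n::finite functional"
  assumes u: "\<And>t. t \<in> {0..T} \<Longrightarrow> u t \<in> sobolev \<rho>"
    and v: "\<And>t. t \<in> {0..T} \<Longrightarrow> limitin (sobolev_top \<rho>) v (v t) (at t within {0..T})"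
    and d: "\<And>\<xi> t. t \<in> {0..T} \<Longrightarrow>
      ((\<lambda>t. fourier (u t) \<xi>) has_vector_derivative fourier (v t) \<xi>) (at t within {0..T})"
    and t: "t \<in> {0..T}"
  shows "limitin (sobolev_top \<rho>) (\<lambda>\<tau>. of_real (1 / (\<tau> - t)) *\<^sub>D (u \<tau> - u t)) (v t) (at t within {0..T})"
  unfolding limitin_sobolev
proof (intro conjI)
  let ?q = "\<lambda>\<tau>. of_real (1 / (\<tau> - t)) *\<^sub>D (u \<tau> - u t)"
  have vs: "v s \<in> sobolev \<rho>" if "s \<in> {0..T}" for s using v[OF that] by (simp add: limitin_sobolev)
  show "v t \<in> sobolev \<rho>" by (rule vs[OF t])
  have q: "?q \<tau> \<in> sobolev \<rho>" if "\<tau> \<in> {0..T}" for \<tau> by (intro sobolev_smul sobolev_diff u that t)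
  show "\<forall>\<^sub>F \<tau> in at t within {0..T}. ?q \<tau> \<in> sobolev \<rho>"
    using eventually_within_set by eventually_elim (rule q)
  have cv: "continuous_on {0..T} (\<lambda>s. fourier (v s) \<xi>)" for \<xi>
    unfolding continuous_on_def using limitin_sobolev_fourier[OF v] by blast
  show "((\<lambda>\<tau>. sobolev_norm \<rho> (?q \<tau> - v t)) \<longlongrightarrow> 0) (at t within {0..T})"
  proof (rule tendstoI)
    fix e :: real assume e: "e > 0"
    have "((\<lambda>s. sobolev_norm \<rho> (v s - v t)) \<longlongrightarrow> 0) (at t within {0..T})"
      using v[OF t] by (simp add: limitin_sobolev)
    then have "\<forall>\<^sub>F s in at t within {0..T}. dist (sobolev_norm \<rho> (v s - v t)) 0 < e / 2"
      using e by (intro tendstoD) auto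
    then obtain \<eta> where \<eta>: "\<eta> > 0"
      "\<forall>s\<in>{0..T}. s \<noteq> t \<and> dist s t < \<eta> \<longrightarrow> dist (sobolev_norm \<rho> (v s - v t)) 0 < e / 2"
      unfolding eventually_at by blast
    have small: "sobolev_norm \<rho> (v s - v t) \<le> e / 2" if "s \<in> {0..T}" "dist s t < \<eta>" for s
    proof (cases "s = t")
      case True
      have "0 *\<^sub>D v t = v t - v t" by (simp add: smul_def fun_eq_iff)
      with sobolev_smul(2)[OF vs[OF t], of 0] True e show ?thesis by simp
    next
      case False
      then show ?thesis using \<eta>(2) that by force
    qed
    show "\<forall>\<^sub>F \<tau> in at t within {0..T}. dist (sobolev_norm \<rho> (?q \<tau> - v t)) 0 < e"
      unfolding eventually_at
    proof (intro exI[of _ \<eta>] conjI ballI impI \<eta>(1))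
      fix \<tau> assume \<tau>: "\<tau> \<in> {0..T}" and "\<tau> \<noteq> t \<and> dist \<tau> t < \<eta>"
      \<comment> \<open>The quotient is symmetric in \<tau> and t, so ordering the endpoints treats
        both sides of t together.\<close>
      define a b where "a = min \<tau> t" and "b = max \<tau> t"
      have ab: "a < b" "{a..b} \<subseteq> {0..T}" and near: "\<And>s. s \<in> {a..b} \<Longrightarrow> dist s t < \<eta>"
        using \<tau> t \<open>\<tau> \<noteq> t \<and> dist \<tau> t < \<eta>\<close> by (auto simp: a_def b_def dist_real_def min_def max_def split: if_splits)
      define h where "h = (\<lambda>\<xi> s. fourier (v s - v t) \<xi>)"
      have h: "continuous_on {a..b} (h \<xi>)" for \<xi>
        unfolding h_def fourier_diff by (intro continuous_intros continuous_on_subset[OF cv ab(2)])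
      have w: "norm (fourier (?q \<tau> - v t) \<xi>) \<le> 1 / (b - a) * integral {a..b} (\<lambda>s. norm (h \<xi> s))" for \<xi>
      proof -
        have "((\<lambda>s. fourier (v s) \<xi>) has_integral fourier (u b) \<xi> - fourier (u a) \<xi>) {a..b}"
          by (rule fundamental_theorem_of_calculus)
            (use ab in \<open>auto intro!: has_vector_derivative_within_subset[OF d]\<close>)
        then have "((\<lambda>s. fourier (v s) \<xi> - fourier (v t) \<xi>) has_integral
            fourier (u b) \<xi> - fourier (u a) \<xi> - (b - a) *\<^sub>R fourier (v t) \<xi>) {a..b}"
          using ab(1) has_integral_const_real[of "fourier (v t) \<xi>" a b] by (intro has_integral_diff) auto
        then have I: "integral {a..b} (h \<xi>) = fourier (u b) \<xi> - fourier (u a) \<xi> - (b - a) *\<^sub>R fourier (v t) \<xi>"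
          unfolding h_def fourier_diff by (rule integral_unique)
        have "fourier (?q \<tau> - v t) \<xi> = of_real (1 / (b - a)) * (fourier (u b) \<xi> - fourier (u a) \<xi>) - fourier (v t) \<xi>"
        proof (cases "\<tau> \<le> t")
          case True
          have "complex_of_real (1 / (\<tau> - t)) * z = of_real (1 / (t - \<tau>)) * - z" for z
            by (simp add: divide_simps) (simp add: algebra_simps)
          with True show ?thesis
            by (simp only: a_def b_def fourier_diff fourier_smul min_absorb1 max_absorb2 minus_diff_eq)
        qed (simp add: a_def b_def fourier_diff fourier_smul)
        also have "\<dots> = of_real (1 / (b - a)) * integral {a..b} (h \<xi>)"
          unfolding I using ab(1) by (simp add: scaleR_conv_of_real right_diff_distrib)
        finally have "norm (fourier (?q \<tau> - v t) \<xi>) = 1 / (b - a) * norm (integral {a..b} (h \<xi>))"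
          using ab(1) by (simp add: norm_mult norm_divide del: of_real_diff flip: of_real_diff)
        moreover have "norm (integral {a..b} (h \<xi>)) \<le> integral {a..b} (\<lambda>s. norm (h \<xi> s))"
          by (intro integral_norm_bound_integral integrable_continuous_interval continuous_intros h) auto
        ultimately show ?thesis using ab(1) by (simp add: divide_right_mono)
      qed
      have "infsum (sobolev_term \<rho> (fourier (?q \<tau> - v t))) UNIV \<le> (e / 2)\<^sup>2"
      proof (rule infsum_le_finite_sums)
        show "sobolev_term \<rho> (fourier (?q \<tau> - v t)) summable_on UNIV"
          using sobolev_diff[OF q[OF \<tau>] vs[OF t]] by (simp add: sobolev_iff)
        fix G :: "(int ^ 'n) set" assume G: "finite G"
        have E: "(\<Sum>\<xi>\<in>G. sobolev_term \<rho> (\<lambda>\<xi>. h \<xi> s) \<xi>) \<le> (e / 2)\<^sup>2" if s: "s \<in> {a..b}" for s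
        proof -
          have sT: "s \<in> {0..T}" using s ab(2) by blast
          have "(\<Sum>\<xi>\<in>G. sobolev_term \<rho> (\<lambda>\<xi>. h \<xi> s) \<xi>) \<le> (sobolev_norm \<rho> (v s - v t))\<^sup>2"
            unfolding h_def by (rule sum_sobolev_term_le[OF sobolev_diff[OF vs[OF sT] vs[OF t]] G])
          also have "\<dots> \<le> (e / 2)\<^sup>2"
            by (intro power_mono small sT near s sobolev_norm_nonneg)
          finally show ?thesis .
        qed
        have "(\<Sum>\<xi>\<in>G. sobolev_term \<rho> (fourier (?q \<tau> - v t)) \<xi>) \<le>
            (\<Sum>\<xi>\<in>G. (1 / (b - a))\<^sup>2 * sobolev_term \<rho> (\<lambda>\<xi>. of_real (integral {a..b} (\<lambda>s. norm (h \<xi> s)))) \<xi>)"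
        proof (rule sum_mono)
          fix \<xi>
          have "sobolev_term \<rho> (fourier (?q \<tau> - v t)) \<xi> \<le>
              sobolev_term \<rho> (\<lambda>\<xi>. of_real (1 / (b - a)) * of_real (integral {a..b} (\<lambda>s. norm (h \<xi> s)))) \<xi>"
          proof (rule sobolev_term_mono)
            have "1 / (b - a) * integral {a..b} (\<lambda>s. norm (h \<xi> s)) \<le>
                norm (complex_of_real (1 / (b - a)) * of_real (integral {a..b} (\<lambda>s. norm (h \<xi> s))))"
              by (simp only: of_real_mult[symmetric] norm_of_real abs_ge_self)
            with w[of \<xi>] show "norm (fourier (?q \<tau> - v t) \<xi>) \<le>
                norm (complex_of_real (1 / (b - a)) * of_real (integral {a..b} (\<lambda>s. norm (h \<xi> s))))" by linarith
          qed simp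
          then show "sobolev_term \<rho> (fourier (?q \<tau> - v t)) \<xi> \<le>
              (1 / (b - a))\<^sup>2 * sobolev_term \<rho> (\<lambda>\<xi>. of_real (integral {a..b} (\<lambda>s. norm (h \<xi> s)))) \<xi>"
            unfolding sobolev_term_cmult norm_of_real power2_abs .
        qed
        also have "\<dots> \<le> (1 / (b - a))\<^sup>2 * ((b - a)\<^sup>2 * (e / 2)\<^sup>2)"
          unfolding sum_distrib_left[symmetric] using ab(1)
          by (intro mult_left_mono sobolev_term_integral_le h G E) auto
        also have "\<dots> = (e / 2)\<^sup>2" using ab(1) by (simp add: field_simps)
        finally show "(\<Sum>\<xi>\<in>G. sobolev_term \<rho> (fourier (?q \<tau> - v t)) \<xi>) \<le> (e / 2)\<^sup>2" .
      qed
      then have "sobolev_norm \<rho> (?q \<tau> - v t) \<le> e / 2"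
        unfolding sobolev_norm_eq using e by (intro real_le_lsqrt infsum_nonneg) auto
      then show "dist (sobolev_norm \<rho> (?q \<tau> - v t)) 0 < e"
        using e by (simp add: sobolev_norm_nonneg)
    qed
  qed
qed

section \<open>Existence of solutions\<close>

text \<open>Isolates what existence uses: continuous coefficients and the uniform constant L. The
  zeros of the imaginary part and the exponents have already been spent on L.\<close>

locale cauchy_problem =
  fixes T L :: real and a2 a0 :: "real \<Rightarrow> complex" and a1 :: "'n::finite \<Rightarrow> real \<Rightarrow> complex"
  assumes T: "T > 0"
    and a2: "continuous_on {0..T} a2" and a1: "\<And>j. continuous_on {0..T} (a1 j)" and a0: "continuous_on {0..T} a0"
    and energy: "\<And>\<xi> s t. 0 \<le> s \<Longrightarrow> s \<le> t \<Longrightarrow> t \<le> T \<Longrightarrow> integral {s..t} (\<lambda>\<tau>. Im (symbol a2 a1 a0 \<tau> \<xi>)) \<le> L"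
begin

abbreviation \<sigma> :: "real \<Rightarrow> int ^ 'n \<Rightarrow> complex" where "\<sigma> \<equiv> symbol a2 a1 a0"

lemma continuous_\<sigma>: "continuous_on {0..T} (\<lambda>t. \<sigma> t \<xi>)"
  by (intro continuous_symbol a2 a1 a0)

lemma symbol_bound:
  obtains S where "S \<ge> 0" "\<And>t \<xi>. t \<in> {0..T} \<Longrightarrow> norm (\<sigma> t \<xi>) \<le> S * (weight \<xi>)\<^sup>2"
proof -
  have bdd: "\<exists>B. \<forall>t\<in>{0..T}. norm (a t) \<le> B" if "continuous_on {0..T} a" for a :: "real \<Rightarrow> complex"
    using compact_imp_bounded[OF compact_continuous_image[OF that compact_Icc]] unfolding bounded_iff by blast
  obtain B2 where B2: "\<And>t. t \<in> {0..T} \<Longrightarrow> norm (a2 t) \<le> B2" using bdd[OF a2] by blast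
  obtain B1 where B1: "\<And>j t. t \<in> {0..T} \<Longrightarrow> norm (a1 j t) \<le> B1 j" using bdd[OF a1] by metis
  obtain B0 where B0: "\<And>t. t \<in> {0..T} \<Longrightarrow> norm (a0 t) \<le> B0" using bdd[OF a0] by blast
  show ?thesis
  proof
    have 0: "0 \<in> {0..T}" using T by simp
    have nn: "0 \<le> B2" "0 \<le> B1 j" "0 \<le> B0" for j
      using B2[OF 0] B1[OF 0, of j] B0[OF 0] norm_ge_zero order_trans by blast+
    then show "0 \<le> B2 + (\<Sum>j\<in>UNIV. B1 j) + B0" by (simp add: sum_nonneg)
    fix t and \<xi> :: "int ^ 'n" assume t: "t \<in> {0..T}"
    have w: "1 \<le> weight \<xi>" "weight \<xi> \<le> (weight \<xi>)\<^sup>2" "1 \<le> (weight \<xi>)\<^sup>2"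
      using weight_ge_1[of \<xi>] by (auto simp: self_le_power one_le_power)
    have "norm (\<sigma> t \<xi>) \<le> norm (a2 t * of_real ((norm (rvec \<xi>))\<^sup>2)) +
        norm (\<Sum>j\<in>UNIV. a1 j t * of_int (\<xi> $ j)) + norm (a0 t)"
      unfolding symbol_def by (intro norm_triangle_le add_mono order_refl)
    also have "\<dots> \<le> B2 * (weight \<xi>)\<^sup>2 + (\<Sum>j\<in>UNIV. B1 j * (weight \<xi>)\<^sup>2) + B0 * (weight \<xi>)\<^sup>2"
    proof (intro add_mono)
      have "(norm (rvec \<xi>))\<^sup>2 \<le> (weight \<xi>)\<^sup>2" by (intro power_mono) (auto simp: weight_def)
      then show "norm (a2 t * of_real ((norm (rvec \<xi>))\<^sup>2)) \<le> B2 * (weight \<xi>)\<^sup>2"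
        using B2[OF t] nn(1) by (simp add: norm_mult norm_power mult_mono)
      show "norm (\<Sum>j\<in>UNIV. a1 j t * of_int (\<xi> $ j)) \<le> (\<Sum>j\<in>UNIV. B1 j * (weight \<xi>)\<^sup>2)"
      proof (rule sum_norm_le)
        fix j
        have "\<bar>real_of_int (\<xi> $ j)\<bar> \<le> (weight \<xi>)\<^sup>2"
          using component_le_weight[of \<xi> j] w(2) by linarith
        then show "norm (a1 j t * of_int (\<xi> $ j)) \<le> B1 j * (weight \<xi>)\<^sup>2"
          using B1[OF t, of j] nn(2)[of j] by (simp add: norm_mult mult_mono)
      qed
      show "norm (a0 t) \<le> B0 * (weight \<xi>)\<^sup>2"
        using B0[OF t] mult_left_mono[OF w(3) nn(3)] by simp
    qed
    also have "\<dots> = (B2 + (\<Sum>j\<in>UNIV. B1 j) + B0) * (weight \<xi>)\<^sup>2"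
      by (simp add: distrib_right sum_distrib_right)
    finally show "norm (\<sigma> t \<xi>) \<le> (B2 + (\<Sum>j\<in>UNIV. B1 j) + B0) * (weight \<xi>)\<^sup>2" .
  qed
qed

definition energy_bound :: "(real \<Rightarrow> 'n functional) \<Rightarrow> 'n functional \<Rightarrow> int ^ 'n \<Rightarrow> real" where
  "energy_bound f g \<xi> = exp L * (norm (fourier g \<xi>) + integral {0..T} (\<lambda>s. norm (fourier (f s) \<xi>)))"

text \<open>The value that the equation assigns to the time derivative: \<open>P u = f\<close> is
  solved for it, the factor \<i> undoing the 1/\<i> in D_t.\<close>

definition time_deriv :: "(real \<Rightarrow> 'n functional) \<Rightarrow> (real \<Rightarrow> 'n functional) \<Rightarrow> real \<Rightarrow> 'n functional" where
  "time_deriv f u t = \<i> *\<^sub>D f t + (- \<i>) *\<^sub>D spatial_part a2 a1 a0 t (u t)"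

text \<open>Collects what is known coefficient by coefficient, without reference to a function
  space. One such \<open>u\<close> is later shown regular in each of the spaces separately.\<close>

definition mode_solution :: "(real \<Rightarrow> 'n functional) \<Rightarrow> 'n functional \<Rightarrow> (real \<Rightarrow> 'n functional) \<Rightarrow> bool" where
  "mode_solution f g u \<longleftrightarrow> u \<in> extensional {0..T} \<and> u 0 = g \<and> (\<forall>t\<in>{0..T}. u t \<in> distributions) \<and>
     (\<forall>\<xi>. \<forall>t\<in>{0..T}. norm (fourier (u t) \<xi>) \<le> energy_bound f g \<xi> \<and>
        ((\<lambda>t. fourier (u t) \<xi>) has_vector_derivative fourier (time_deriv f u t) \<xi>) (at t within {0..T}))"

lemma fourier_time_deriv:
  "u t \<in> distributions \<Longrightarrow> fourier (time_deriv f u t) \<xi> = \<i> * fourier (f t) \<xi> - \<i> * (\<sigma> t \<xi> * fourier (u t) \<xi>)"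
  by (simp add: time_deriv_def fourier_add fourier_smul fourier_spatial_part)

lemma time_deriv_distributions:
  "f t \<in> distributions \<Longrightarrow> u t \<in> distributions \<Longrightarrow> time_deriv f u t \<in> distributions"
  unfolding time_deriv_def by (intro distributions_add distributions_smul spatial_part_distributions)

lemma mode_solutionD:
  assumes "mode_solution f g u" "t \<in> {0..T}"
  shows "u t \<in> distributions" and "norm (fourier (u t) \<xi>) \<le> energy_bound f g \<xi>"
    and "((\<lambda>t. fourier (u t) \<xi>) has_vector_derivative fourier (time_deriv f u t) \<xi>) (at t within {0..T})"
    and "((\<lambda>t. fourier (u t) \<xi>) \<longlongrightarrow> fourier (u t) \<xi>) (at t within {0..T})"
proof -
  show 1: "u t \<in> distributions" "norm (fourier (u t) \<xi>) \<le> energy_bound f g \<xi>"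
    "((\<lambda>t. fourier (u t) \<xi>) has_vector_derivative fourier (time_deriv f u t) \<xi>) (at t within {0..T})"
    using assms by (auto simp: mode_solution_def)
  show "((\<lambda>t. fourier (u t) \<xi>) \<longlongrightarrow> fourier (u t) \<xi>) (at t within {0..T})"
    using has_vector_derivative_continuous[OF 1(3)] by (simp add: continuous_within)
qed

text \<open>The equations are solved separately for every frequency; what remains is that the
  solutions grow at most polynomially and so assemble to a distribution at each time. The energy
  bound inherits such growth from the norm bound on f and the temperedness of g.\<close>

lemma mode_solution_exists:
  fixes f :: "real \<Rightarrow> 'n functional"
  assumes f: "f \<in> C0_maps T (sobolev_top r)" and g: "g \<in> distributions"
  shows "\<exists>u. mode_solution f g u"
proof -
  have "\<exists>y. y 0 = fourier g \<xi> \<and>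
      (\<forall>t\<in>{0..T}. (y has_vector_derivative \<i> * fourier (f t) \<xi> - \<i> * (\<sigma> t \<xi> * y t)) (at t within {0..T})) \<and>
      (\<forall>t\<in>{0..T}. norm (y t) \<le> energy_bound f g \<xi>)" for \<xi>
    unfolding energy_bound_def
    by (rule ode_solution[OF T continuous_\<sigma> C0_sobolev_continuous_fourier[OF f] energy])
  then obtain Y where Y0: "\<And>\<xi>. Y \<xi> 0 = fourier g \<xi>"
    and Yd: "\<And>\<xi> t. t \<in> {0..T} \<Longrightarrow>
      (Y \<xi> has_vector_derivative \<i> * fourier (f t) \<xi> - \<i> * (\<sigma> t \<xi> * Y \<xi> t)) (at t within {0..T})"
    and Yb: "\<And>\<xi> t. t \<in> {0..T} \<Longrightarrow> norm (Y \<xi> t) \<le> energy_bound f g \<xi>"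
    by metis
  obtain B where B: "\<And>t. t \<in> {0..T} \<Longrightarrow> sobolev_norm r (f t) \<le> B"
    using C0_sobolev_bounded[OF f] by blast
  have fs: "f t \<in> sobolev r" if "t \<in> {0..T}" for t using C0_maps_mem[OF f that] by (simp add: topspace_sobolev)
  have B0: "0 \<le> B" using B[of 0] sobolev_norm_nonneg[of r "f 0"] T by simp
  define k where "k = nat \<lceil>- r\<rceil>"
  have k: "- r \<le> real k" by (simp add: k_def of_nat_ceiling)
  obtain C l where C: "\<And>\<xi>. norm (fourier g \<xi>) \<le> C * weight \<xi> ^ l"
    using tempered_fourier[OF g] unfolding tempered_def by blast
  have C0: "0 \<le> C"
    using order_trans[OF norm_ge_zero C[of 0]] zero_less_power[OF weight_pos[of "0 :: int ^ 'n"], of l]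
    by (simp add: zero_le_mult_iff)
  have tempered: "tempered (\<lambda>\<xi>. Y \<xi> t)" if t: "t \<in> {0..T}" for t
    unfolding tempered_def
  proof (intro exI allI)
    fix \<xi> :: "int ^ 'n"
    have "norm (fourier (f s) \<xi>) \<le> weight \<xi> ^ (k + l) * B" if s: "s \<in> {0..T}" for s
    proof -
      have "norm (fourier (f s) \<xi>) \<le> weight \<xi> powr (- r) * sobolev_norm r (f s)"
        by (rule norm_fourier_le_sobolev_norm[OF fs[OF s]])
      also have "\<dots> \<le> weight \<xi> powr real (k + l) * B"
        using k by (intro mult_mono powr_mono B s weight_ge_1) (auto simp: sobolev_norm_nonneg)
      finally show ?thesis by (simp add: powr_realpow weight_pos del: of_nat_add)
    qed
    then have "integral {0..T} (\<lambda>s. norm (fourier (f s) \<xi>)) \<le> integral {0..T} (\<lambda>s. weight \<xi> ^ (k + l) * B)"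
      by (intro integral_le integrable_continuous_interval continuous_intros C0_sobolev_continuous_fourier[OF f])
    then have I: "integral {0..T} (\<lambda>s. norm (fourier (f s) \<xi>)) \<le> T * B * weight \<xi> ^ (k + l)"
      using T by (simp add: mult_ac)
    have "norm (fourier g \<xi>) \<le> C * weight \<xi> ^ (k + l)"
      using C[of \<xi>] mult_left_mono[OF power_increasing[OF _ weight_ge_1, of l "k + l" \<xi>] C0] by simp
    with I have "norm (fourier g \<xi>) + integral {0..T} (\<lambda>s. norm (fourier (f s) \<xi>)) \<le> (C + T * B) * weight \<xi> ^ (k + l)"
      by (simp add: distrib_right)
    then have "energy_bound f g \<xi> \<le> exp L * ((C + T * B) * weight \<xi> ^ (k + l))"
      unfolding energy_bound_def by (intro mult_left_mono) auto
    with Yb[OF t, of \<xi>] show "norm (Y \<xi> t) \<le> exp L * (C + T * B) * weight \<xi> ^ (k + l)" by simp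
  qed
  define u where "u = (\<lambda>t\<in>{0..T}. distr_of (\<lambda>\<xi>. Y \<xi> t))"
  have ud: "u t \<in> distributions" and uY: "fourier (u t) \<xi> = Y \<xi> t" if "t \<in> {0..T}" for t \<xi>
    using that distr_of_in_distributions[OF tempered[OF that]] by (simp_all add: u_def fourier_distr_of)
  have "mode_solution f g u"
    unfolding mode_solution_def
  proof (intro conjI ballI allI)
    show "u \<in> extensional {0..T}" by (simp add: u_def)
    show "u 0 = g" using T by (simp add: u_def Y0 distr_of_fourier g)
    fix t assume t: "t \<in> {0..T}"
    show "u t \<in> distributions" by (rule ud[OF t])
    fix \<xi>
    show "norm (fourier (u t) \<xi>) \<le> energy_bound f g \<xi>" using Yb t by (simp add: uY)
    show "((\<lambda>t. fourier (u t) \<xi>) has_vector_derivative fourier (time_deriv f u t) \<xi>) (at t within {0..T})"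
      unfolding fourier_time_deriv[of u t, OF ud[OF t]] uY[OF t]
      by (rule has_vector_derivative_transform[OF t _ Yd[OF t]]) (simp add: uY)
  qed
  then show ?thesis by blast
qed

text \<open>The majorant already contains an integral over all times, so it does not depend on t. It
  lies in H^r because f is bounded in H^r on [0, T], by the Minkowski-type bound on finite sets of
  frequencies.\<close>

lemma energy_bound_sobolev:
  assumes f: "f \<in> C0_maps T (sobolev_top r)" and g: "g \<in> sobolev r"
  shows "sobolev_term r (\<lambda>\<xi>. of_real (energy_bound f g \<xi>)) summable_on UNIV"
proof -
  let ?I = "\<lambda>\<xi>. of_real (integral {0..T} (\<lambda>s. norm (fourier (f s) \<xi>))) :: complex"
  obtain B where B: "\<And>t. t \<in> {0..T} \<Longrightarrow> sobolev_norm r (f t) \<le> B"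
    using C0_sobolev_bounded[OF f] by blast
  have fs: "f t \<in> sobolev r" if "t \<in> {0..T}" for t using C0_maps_mem[OF f that] by (simp add: topspace_sobolev)
  have I: "sobolev_term r ?I summable_on UNIV"
  proof (rule nonneg_bdd_above_summable_on)
    show "bdd_above (sum (sobolev_term r ?I) ` {G. G \<subseteq> UNIV \<and> finite G})"
    proof (rule bdd_aboveI2)
      fix G :: "(int ^ 'n) set" assume "G \<in> {G. G \<subseteq> UNIV \<and> finite G}"
      then have G: "finite G" by simp
      have E: "(\<Sum>\<xi>\<in>G. sobolev_term r (\<lambda>\<xi>. fourier (f s) \<xi>) \<xi>) \<le> B\<^sup>2" if s: "s \<in> {0..T}" for s
        using sum_sobolev_term_le[OF fs[OF s] G] power_mono[OF B[OF s] sobolev_norm_nonneg, of 2] by linarith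
      show "sum (sobolev_term r ?I) G \<le> (T - 0)\<^sup>2 * B\<^sup>2"
        using T by (intro sobolev_term_integral_le C0_sobolev_continuous_fourier[OF f] G E) auto
    qed
  qed simp
  have "sobolev_term r (\<lambda>\<xi>. of_real (norm (fourier g \<xi>))) summable_on UNIV"
    using g by (simp add: sobolev_iff sobolev_term_def[abs_def])
  from summable_on_cmult_right[OF sobolev_term_triangle(1)[OF this I], of "(norm (of_real (exp L) :: complex))\<^sup>2"]
  show ?thesis
    unfolding sobolev_term_cmult[symmetric] energy_bound_def of_real_mult of_real_add .
qed

text \<open>The energy bound is a majorant for \<open>u\<close> in H^r. Multiplied by the growth of
  the symbol it becomes a majorant in H^(r-2) for the spatial part, so the time derivative is
  continuous there, and \<open>limitin_sobolev_quotient\<close> upgrades the coefficientwise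
  derivative.\<close>

lemma mode_solution_sobolev:
  assumes ms: "mode_solution f g u" and f: "f \<in> C0_maps T (sobolev_top r)" and g: "g \<in> sobolev r"
  shows "u \<in> C0_maps T (sobolev_top r)"
    and "\<And>t. t \<in> {0..T} \<Longrightarrow> limitin (sobolev_top (r - 2)) (time_deriv f u) (time_deriv f u t) (at t within {0..T})"
    and "u \<in> C1_maps T (sobolev_top (r - 2))"
proof -
  note D = mode_solutionD[OF ms]
  show C0: "u \<in> C0_maps T (sobolev_top r)"
    unfolding C0_maps_iff
  proof (intro conjI ballI)
    show "u \<in> extensional {0..T}" using ms by (simp add: mode_solution_def)
    fix t assume t: "t \<in> {0..T}"
    show "limitin (sobolev_top r) u (u t) (at t within {0..T})"
    proof (rule limitin_sobolev_dominated[OF energy_bound_sobolev[OF f g]])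
      show "\<forall>\<^sub>F \<tau> in at t within {0..T}. u \<tau> \<in> distributions \<and> (\<forall>\<xi>. norm (fourier (u \<tau>) \<xi>) \<le> energy_bound f g \<xi>)"
        using eventually_within_set by eventually_elim (intro conjI allI D)
    qed (intro D t)+
  qed
  obtain S where S: "S \<ge> 0" "\<And>t \<xi>. t \<in> {0..T} \<Longrightarrow> norm (\<sigma> t \<xi>) \<le> S * (weight \<xi>)\<^sup>2"
    using symbol_bound by metis
  show lim: "limitin (sobolev_top (r - 2)) (time_deriv f u) (time_deriv f u t) (at t within {0..T})"
    if t: "t \<in> {0..T}" for t
    unfolding time_deriv_def[abs_def]
  proof (rule limitin_sobolev_add)
    show "limitin (sobolev_top (r - 2)) f (f t) (at t within {0..T})"
      by (rule limitin_sobolev_mono[of "r - 2" r]) (use f t in \<open>auto simp: C0_maps_iff\<close>)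
    let ?v = "\<lambda>t. (- \<i>) *\<^sub>D spatial_part a2 a1 a0 t (u t)"
    have v: "?v \<tau> \<in> distributions" "norm (fourier (?v \<tau>) \<xi>) \<le> S * (weight \<xi>)\<^sup>2 * energy_bound f g \<xi>"
      "fourier (?v \<tau>) \<xi> = - \<i> * (\<sigma> \<tau> \<xi> * fourier (u \<tau>) \<xi>)"
      if \<tau>: "\<tau> \<in> {0..T}" for \<tau> \<xi>
    proof -
      show "?v \<tau> \<in> distributions" by (intro distributions_smul spatial_part_distributions D \<tau>)
      show eq: "fourier (?v \<tau>) \<xi> = - \<i> * (\<sigma> \<tau> \<xi> * fourier (u \<tau>) \<xi>)"
        by (simp add: fourier_smul fourier_spatial_part D(1)[OF \<tau>])
      have "norm (\<sigma> \<tau> \<xi>) * norm (fourier (u \<tau>) \<xi>) \<le> S * (weight \<xi>)\<^sup>2 * energy_bound f g \<xi>"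
        using S(1) by (intro mult_mono S(2) D(2) \<tau>) auto
      then show "norm (fourier (?v \<tau>) \<xi>) \<le> S * (weight \<xi>)\<^sup>2 * energy_bound f g \<xi>"
        unfolding eq by (simp add: norm_mult)
    qed
    show "limitin (sobolev_top (r - 2)) ?v (?v t) (at t within {0..T})"
    proof (rule limitin_sobolev_dominated)
      have "sobolev_term r (\<lambda>\<xi>. of_real (S * energy_bound f g \<xi>)) summable_on UNIV"
        using summable_on_cmult_right[OF energy_bound_sobolev[OF f g], of "(norm (of_real S :: complex))\<^sup>2"]
        unfolding sobolev_term_cmult[symmetric] of_real_mult .
      then show "sobolev_term (r - 2) (\<lambda>\<xi>. of_real (S * (weight \<xi>)\<^sup>2 * energy_bound f g \<xi>)) summable_on UNIV"
        unfolding sobolev_term_scale_weight[abs_def] .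
      show "\<forall>\<^sub>F \<tau> in at t within {0..T}. ?v \<tau> \<in> distributions \<and>
          (\<forall>\<xi>. norm (fourier (?v \<tau>) \<xi>) \<le> S * (weight \<xi>)\<^sup>2 * energy_bound f g \<xi>)"
        using eventually_within_set by eventually_elim (intro conjI allI v)
      fix \<xi>
      have "((\<lambda>\<tau>. - \<i> * (\<sigma> \<tau> \<xi> * fourier (u \<tau>) \<xi>)) \<longlongrightarrow> - \<i> * (\<sigma> t \<xi> * fourier (u t) \<xi>)) (at t within {0..T})"
        using continuous_\<sigma>[of \<xi>] t by (intro tendsto_intros D(4)) (auto simp: continuous_on_def)
      moreover have "\<forall>\<^sub>F \<tau> in at t within {0..T}. - \<i> * (\<sigma> \<tau> \<xi> * fourier (u \<tau>) \<xi>) = fourier (?v \<tau>) \<xi>"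
        using eventually_within_set by eventually_elim (rule v(3)[symmetric])
      ultimately show "((\<lambda>\<tau>. fourier (?v \<tau>) \<xi>) \<longlongrightarrow> fourier (?v t) \<xi>) (at t within {0..T})"
        unfolding v(3)[OF t] by (rule Lim_transform_eventually)
    qed (intro v t)+
  qed
  have C0': "u \<in> C0_maps T (sobolev_top (r - 2))"
    using C0 limitin_sobolev_mono[of "r - 2" r] by (auto simp: C0_maps_iff)
  show "u \<in> C1_maps T (sobolev_top (r - 2))"
  proof (rule C1_mapsI[OF C0' lim])
    fix t assume t: "t \<in> {0..T}"
    show "limitin (sobolev_top (r - 2)) (\<lambda>\<tau>. of_real (1 / (\<tau> - t)) *\<^sub>D (u \<tau> - u t)) (time_deriv f u t) (at t within {0..T})"
      by (rule limitin_sobolev_quotient[OF _ lim D(3) t])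
        (use C0_maps_mem[OF C0'] in \<open>auto simp: topspace_sobolev\<close>)
  qed
qed

text \<open>The equation between functionals is checked at each test function \<psi>. Evaluation at
  \<psi> is continuous, so \<open>u t \<psi>\<close> is differentiable in time in the ordinary sense
  and integration by parts yields the weak form.\<close>

lemma mode_solution_solves_CP:
  assumes ms: "mode_solution f g u" and f: "f \<in> C0_maps T (sobolev_top r)" and g: "g \<in> sobolev r"
  shows "solves_CP T a2 a1 a0 f g u"
  unfolding solves_CP_def
proof (intro conjI exI ballI)
  note reg = mode_solution_sobolev[OF ms f g]
  show "u \<in> C0_maps T (sobolev_top r)" by (rule reg)
  show "u 0 = g" using ms by (simp add: mode_solution_def)
  have ud: "u t \<in> distributions" and fd: "f t \<in> distributions" if "t \<in> {0..T}" for t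
    using mode_solutionD(1)[OF ms that] C0_maps_mem[OF f that] by (simp_all add: topspace_sobolev sobolev_iff)
  fix \<phi> assume \<phi>: "\<phi> \<in> time_test T"
  show "weak_Dt T u \<phi> + time_distr T (\<lambda>t. spatial_part a2 a1 a0 t (u t)) \<phi> = time_distr T f \<phi>"
  proof
    fix \<psi> :: "real ^ 'n \<Rightarrow> complex"
    let ?P = "\<lambda>t. spatial_part a2 a1 a0 t (u t) \<psi>"
    have eq: "(weak_Dt T u \<phi> + time_distr T (\<lambda>t. spatial_part a2 a1 a0 t (u t)) \<phi>) \<psi> =
        integral {0..T} (\<lambda>t. - Dt \<phi> t * u t \<psi>) + integral {0..T} (\<lambda>t. \<phi> t * ?P t)"
      by (simp add: weak_Dt_def time_distr_def distr_integral_def smul_def)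
    have eqf: "time_distr T f \<phi> \<psi> = integral {0..T} (\<lambda>t. \<phi> t * f t \<psi>)"
      by (simp add: time_distr_def distr_integral_def smul_def)
    show "(weak_Dt T u \<phi> + time_distr T (\<lambda>t. spatial_part a2 a1 a0 t (u t)) \<phi>) \<psi> = time_distr T f \<phi> \<psi>"
    proof (cases "\<psi> \<in> torus_smooth")
      \<comment> \<open>Functionals are extended by 0 beyond the test space, so both sides vanish
        there.\<close>
      case False
      have z: "u t \<psi> = 0" "f t \<psi> = 0" "?P t = 0" if t: "t \<in> {0..T}" for t
        using distributionsD(1)[OF _ False] ud[OF t] fd[OF t] spatial_part_distributions[OF ud[OF t]] by blast+
      have "integral {0..T} (\<lambda>t. - Dt \<phi> t * u t \<psi>) = integral {0..T} (\<lambda>t. 0)"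
        "integral {0..T} (\<lambda>t. \<phi> t * ?P t) = integral {0..T} (\<lambda>t. 0)"
        "integral {0..T} (\<lambda>t. \<phi> t * f t \<psi>) = integral {0..T} (\<lambda>t. 0)"
        by (intro integral_cong, simp add: z)+
      then show ?thesis unfolding eq eqf by simp
    next
      case True
      have fl: "limitin (sobolev_top r) f (f t) (at t within {0..T})" if "t \<in> {0..T}" for t
        using f that by (simp add: C0_maps_iff)
      have cf: "continuous_on {0..T} (\<lambda>t. f t \<psi>)"
        unfolding continuous_on_def using limitin_sobolev_eval[OF fl True] by blast
      have cd: "continuous_on {0..T} (\<lambda>t. time_deriv f u t \<psi>)"
        unfolding continuous_on_def using limitin_sobolev_eval[OF reg(2) True] by blast
      have P: "?P t = f t \<psi> + \<i> * time_deriv f u t \<psi>" for t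
        by (simp add: time_deriv_def smul_def algebra_simps)
      have us: "u t \<in> sobolev (r - 2)" if "t \<in> {0..T}" for t
        using C0_maps_mem[OF reg(1) that] by (intro sobolev_mono(1)[of "r - 2" r]) (simp_all add: topspace_sobolev)
      have V: "((\<lambda>t. u t \<psi>) has_vector_derivative time_deriv f u t \<psi>) (at t within {0..T})" if t: "t \<in> {0..T}" for t
      proof -
        have "limitin (sobolev_top (r - 2)) (\<lambda>\<tau>. of_real (1 / (\<tau> - t)) *\<^sub>D (u \<tau> - u t)) (time_deriv f u t) (at t within {0..T})"
          by (rule limitin_sobolev_quotient[OF us reg(2) mode_solutionD(3)[OF ms] t])
        from limitin_sobolev_eval[OF this True] show ?thesis
          by (simp only: has_vector_derivative_iff_quotient smul_def minus_apply)
      qed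
      note c = time_testD(3,4)[OF \<phi>, of "{0..T}"]
      have "\<i> * integral {0..T} (\<lambda>t. Dt \<phi> t * u t \<psi>) = - integral {0..T} (\<lambda>t. \<phi> t * time_deriv f u t \<psi>)"
        using time_test_by_parts[OF \<phi> less_imp_le[OF T] V cd]
        by (simp only: time_testD(2)[OF \<phi>] mult.assoc integral_mult_right)
      from arg_cong[OF this, of uminus]
      have "integral {0..T} (\<lambda>t. \<phi> t * time_deriv f u t \<psi>) = - (\<i> * integral {0..T} (\<lambda>t. Dt \<phi> t * u t \<psi>))"
        by simp
      moreover have "integral {0..T} (\<lambda>t. \<phi> t * ?P t) =
          integral {0..T} (\<lambda>t. \<phi> t * f t \<psi>) + \<i> * integral {0..T} (\<lambda>t. \<phi> t * time_deriv f u t \<psi>)"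
      proof -
        have "integral {0..T} (\<lambda>t. \<phi> t * ?P t) =
            integral {0..T} (\<lambda>t. \<phi> t * f t \<psi> + \<i> * (\<phi> t * time_deriv f u t \<psi>))"
          by (simp only: P distrib_left mult.left_commute)
        also have "\<dots> = integral {0..T} (\<lambda>t. \<phi> t * f t \<psi>) + integral {0..T} (\<lambda>t. \<i> * (\<phi> t * time_deriv f u t \<psi>))"
          by (intro integral_add integrable_continuous_interval continuous_intros c cf cd)
        finally show ?thesis by simp
      qed
      ultimately show ?thesis unfolding eq eqf by simp
    qed
  qed
qed

lemma existence_sobolev:
  fixes f :: "real \<Rightarrow> 'n functional"
  assumes f: "f \<in> C0_maps T (sobolev_top r)" and g: "g \<in> sobolev r"
  shows "\<exists>!u. u \<in> C0_maps T (sobolev_top r) \<inter> C1_maps T (sobolev_top (r - 2)) \<and> solves_CP T a2 a1 a0 f g u"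
proof (rule ex_ex1I)
  obtain u where "mode_solution f g u" using mode_solution_exists[OF f] g by (auto simp: sobolev_iff)
  with mode_solution_sobolev[OF _ f g] mode_solution_solves_CP[OF _ f g]
  show "\<exists>u. u \<in> C0_maps T (sobolev_top r) \<inter> C1_maps T (sobolev_top (r - 2)) \<and> solves_CP T a2 a1 a0 f g u" by blast
qed (elim conjE, rule solves_CP_unique[OF T a2 a1 a0])

lemma existence_Cinf:
  fixes f :: "real \<Rightarrow> 'n functional"
  assumes f: "f \<in> C0_maps T Cinf_top" and g: "g \<in> Cinf"
  shows "\<exists>!u. u \<in> C1_maps T Cinf_top \<and> solves_CP T a2 a1 a0 f g u"
proof (rule ex_ex1I)
  have fr: "f \<in> C0_maps T (sobolev_top r)" and gr: "g \<in> sobolev r" for r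
    using f g by (auto simp: C0_maps_Cinf_iff Cinf_def)
  obtain u where u: "mode_solution f g u" using mode_solution_exists[OF fr] g by (auto simp: Cinf_iff)
  note reg = mode_solution_sobolev[OF u fr gr]
  have C0: "u \<in> C0_maps T (sobolev_top r)" for r by (rule reg(1))
  have us: "u t \<in> sobolev r" if "t \<in> {0..T}" for t r using C0_maps_mem[OF C0 that] by (simp add: topspace_sobolev)
  \<comment> \<open>The loss of two orders disappears when all orders are available.\<close>
  have lim: "limitin (sobolev_top r) (time_deriv f u) (time_deriv f u t) (at t within {0..T})" if "t \<in> {0..T}" for t r
    using reg(2)[OF that, of "r + 2"] by simp
  have ds: "time_deriv f u t \<in> sobolev r" if "t \<in> {0..T}" for t r using lim[OF that] by (simp add: limitin_sobolev)
  have uC: "u t \<in> Cinf" and dC: "time_deriv f u t \<in> Cinf" if "t \<in> {0..T}" for t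
    using us[OF that] ds[OF that] by (auto simp: Cinf_def)
  have "u \<in> C1_maps T Cinf_top"
  proof (rule C1_mapsI)
    show "u \<in> C0_maps T Cinf_top" using C0 uC by (simp add: C0_maps_Cinf_iff)
    fix t assume t: "t \<in> {0..T}"
    have "\<forall>\<^sub>F \<tau> in at t within {0..T}. time_deriv f u \<tau> \<in> Cinf"
      using eventually_within_set by eventually_elim (rule dC)
    then show "limitin Cinf_top (time_deriv f u) (time_deriv f u t) (at t within {0..T})"
      using dC[OF t] lim[OF t] by (simp add: limitin_Cinf)
    have "of_real (1 / (\<tau> - t)) *\<^sub>D (u \<tau> - u t) \<in> Cinf" if "\<tau> \<in> {0..T}" for \<tau>
      unfolding Cinf_def by (intro INT_I sobolev_smul sobolev_diff us that t)
    then have "\<forall>\<^sub>F \<tau> in at t within {0..T}. of_real (1 / (\<tau> - t)) *\<^sub>D (u \<tau> - u t) \<in> Cinf"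
      using eventually_within_set by (rule eventually_mono[rotated])
    moreover have "limitin (sobolev_top r) (\<lambda>\<tau>. of_real (1 / (\<tau> - t)) *\<^sub>D (u \<tau> - u t)) (time_deriv f u t) (at t within {0..T})" for r
      by (intro limitin_sobolev_quotient us lim mode_solutionD(3)[OF u] t)
    ultimately show "limitin Cinf_top (\<lambda>\<tau>. of_real (1 / (\<tau> - t)) *\<^sub>D (u \<tau> - u t)) (time_deriv f u t) (at t within {0..T})"
      using dC[OF t] by (simp add: limitin_Cinf)
  qed
  with mode_solution_solves_CP[OF u fr gr] show "\<exists>u. u \<in> C1_maps T Cinf_top \<and> solves_CP T a2 a1 a0 f g u" by blast
qed (elim conjE, rule solves_CP_unique[OF T a2 a1 a0])

text \<open>A single rate \<epsilon> dominates f at all times and g, hence also \<open>u\<close>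
  through the energy bound. The symbol grows only polynomially, so rate \<epsilon>/2 dominates the
  time derivative, and \<open>limitin_gevrey_dominated\<close> gives continuity and
  differentiability.\<close>

lemma existence_gevrey:
  fixes f :: "real \<Rightarrow> 'n functional"
  assumes s: "s \<ge> 1" and f: "f \<in> C0_maps T (gevrey_top s)" and g: "g \<in> gevrey s"
  shows "\<exists>!u. u \<in> C1_maps T (gevrey_top s) \<and> solves_CP T a2 a1 a0 f g u"
proof (rule ex_ex1I)
  have s0: "s > 0" using s by simp
  obtain Cf \<epsilon>f where Cf: "\<epsilon>f > 0" "\<And>t \<xi>. t \<in> {0..T} \<Longrightarrow> norm (fourier (f t) \<xi>) \<le> Cf * gevrey_decay s \<epsilon>f \<xi>"
    by (rule C0_gevrey_uniform_bound[OF s0 f]) (rule that)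
  obtain Cg \<epsilon>g where Cg: "\<epsilon>g > 0" "\<And>\<xi>. norm (fourier g \<xi>) \<le> Cg * gevrey_decay s \<epsilon>g \<xi>"
    using g unfolding gevrey_iff[OF s0] by blast
  define \<epsilon> where "\<epsilon> = min \<epsilon>f \<epsilon>g"
  have \<epsilon>: "\<epsilon> > 0" using Cf(1) Cg(1) by (simp add: \<epsilon>_def)
  have "0 \<in> {0..T}" using T by simp
  from gevrey_bound_nonneg[OF Cf(2)[OF this]] gevrey_bound_nonneg[OF Cg(2)] have nn: "0 \<le> Cf" "0 \<le> Cg" .
  have fb: "norm (fourier (f t) \<xi>) \<le> Cf * gevrey_decay s \<epsilon> \<xi>" if "t \<in> {0..T}" for t \<xi>
    by (rule order_trans[OF Cf(2)[OF that] mult_left_mono[OF gevrey_decay_mono nn(1)]]) (simp add: \<epsilon>_def)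
  have gb: "norm (fourier g \<xi>) \<le> Cg * gevrey_decay s \<epsilon> \<xi>" for \<xi>
    by (rule order_trans[OF Cg(2) mult_left_mono[OF gevrey_decay_mono nn(2)]]) (simp add: \<epsilon>_def)
  have fl: "limitin (gevrey_top s) f (f t) (at t within {0..T})" if "t \<in> {0..T}" for t
    using f that by (simp add: C0_maps_iff)
  have fg: "f t \<in> gevrey s" if "t \<in> {0..T}" for t using C0_maps_mem[OF f that] by (simp add: topspace_gevrey s0)
  have fd: "f t \<in> distributions" if "t \<in> {0..T}" for t using fg[OF that] by (simp add: gevrey_iff s0)
  have g0: "g \<in> sobolev 0" using g by (simp add: gevrey_def Cinf_def)
  then have gd: "g \<in> distributions" by (simp add: sobolev_iff)
  \<comment> \<open>The exponential majorant is square-summable, so f is also continuous into H^0.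
    This makes the mode solution and the weak equation available from the Sobolev case.\<close>
  have f0: "f \<in> C0_maps T (sobolev_top 0)"
    unfolding C0_maps_iff
  proof (intro conjI ballI)
    show "f \<in> extensional {0..T}" using f by (simp add: C0_maps_iff)
    fix t assume t: "t \<in> {0..T}"
    show "limitin (sobolev_top 0) f (f t) (at t within {0..T})"
    proof (rule limitin_sobolev_dominated)
      have "rapid (\<lambda>\<xi> :: int ^ 'n. of_real (Cf * gevrey_decay s \<epsilon> \<xi>))"
        by (rule rapid_gevrey[OF s0 \<epsilon>, of _ Cf]) (use nn(1) in \<open>simp add: norm_mult less_imp_le\<close>)
      then show "sobolev_term 0 (\<lambda>\<xi> :: int ^ 'n. of_real (Cf * gevrey_decay s \<epsilon> \<xi>)) summable_on UNIV"
        by (rule rapid_imp_sobolev_term_summable)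
      show "\<forall>\<^sub>F \<tau> in at t within {0..T}. f \<tau> \<in> distributions \<and> (\<forall>\<xi>. norm (fourier (f \<tau>) \<xi>) \<le> Cf * gevrey_decay s \<epsilon> \<xi>)"
        using eventually_within_set by eventually_elim (intro conjI allI fd fb)
    qed (intro fd fb t limitin_gevrey_fourier[OF s0] fl)+
  qed
  obtain u where u: "mode_solution f g u" using mode_solution_exists[OF f0 gd] by blast
  note D = mode_solutionD[OF u]
  define A where "A = exp L * (Cg + T * Cf)"
  have A0: "0 \<le> A" using nn T by (simp add: A_def)
  have ub: "norm (fourier (u t) \<xi>) \<le> A * gevrey_decay s \<epsilon> \<xi>" if t: "t \<in> {0..T}" for t \<xi>
  proof -
    have "integral {0..T} (\<lambda>s. norm (fourier (f s) \<xi>)) \<le> integral {0..T} (\<lambda>t. Cf * gevrey_decay s \<epsilon> \<xi>)"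
      by (intro integral_le integrable_continuous_interval continuous_intros C0_sobolev_continuous_fourier[OF f0] fb)
    then have "integral {0..T} (\<lambda>s. norm (fourier (f s) \<xi>)) \<le> T * Cf * gevrey_decay s \<epsilon> \<xi>"
      using T by (simp add: mult_ac)
    with gb[of \<xi>] have "norm (fourier g \<xi>) + integral {0..T} (\<lambda>s. norm (fourier (f s) \<xi>)) \<le> (Cg + T * Cf) * gevrey_decay s \<epsilon> \<xi>"
      by (simp add: distrib_right)
    then have "energy_bound f g \<xi> \<le> exp L * ((Cg + T * Cf) * gevrey_decay s \<epsilon> \<xi>)"
      unfolding energy_bound_def by (intro mult_left_mono) auto
    with D(2)[OF t, of \<xi>] show ?thesis by (simp add: A_def)
  qed
  obtain S where S: "S \<ge> 0" "\<And>t \<xi>. t \<in> {0..T} \<Longrightarrow> norm (\<sigma> t \<xi>) \<le> S * (weight \<xi>)\<^sup>2"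
    using symbol_bound by metis
  have "rapid (\<lambda>\<xi> :: int ^ 'n. of_real (gevrey_decay s (\<epsilon> / 2) \<xi>))"
    by (rule rapid_gevrey_decay[OF s0]) (use \<epsilon> in simp)
  then have "\<exists>W. \<forall>\<xi> :: int ^ 'n. norm (of_real (gevrey_decay s (\<epsilon> / 2) \<xi>) :: complex) * (weight \<xi>)\<^sup>2 \<le> W"
    unfolding rapid_def by blast
  then obtain W where W: "\<And>\<xi> :: int ^ 'n. gevrey_decay s (\<epsilon> / 2) \<xi> * (weight \<xi>)\<^sup>2 \<le> W"
    by (auto simp: less_imp_le)
  have W0: "0 \<le> W" by (rule order_trans[OF _ W[of 0]]) (simp add: less_imp_le)
  \<comment> \<open>One constant at rate \<epsilon>/2 for the solution, its time derivative and,
    below, its difference quotients.\<close>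
  define E where "E = A + Cf + S * A * W"
  have E: "A \<le> E" "Cf + S * A * W \<le> E" using nn(1) A0 S(1) W0 by (simp_all add: E_def)
  let ?d = "gevrey_decay s (\<epsilon> / 2) :: int ^ 'n \<Rightarrow> real"
  have dmono: "gevrey_decay s \<epsilon> \<xi> \<le> ?d \<xi>" for \<xi> by (rule gevrey_decay_mono) (use \<epsilon> in simp)
  have ub': "norm (fourier (u t) \<xi>) \<le> E * ?d \<xi>" if t: "t \<in> {0..T}" for t \<xi>
    using ub[OF t, of \<xi>] mult_mono[OF E(1) dmono[of \<xi>]] A0 E(1) by (auto simp: less_imp_le)
  have db: "norm (fourier (time_deriv f u t) \<xi>) \<le> E * ?d \<xi>" if t: "t \<in> {0..T}" for t \<xi>
  proof -
    have "norm (\<sigma> t \<xi>) * norm (fourier (u t) \<xi>) \<le> (S * (weight \<xi>)\<^sup>2) * (A * (?d \<xi> * ?d \<xi>))"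
      using S(1) ub[OF t, of \<xi>] by (intro mult_mono S(2) t) (auto simp: gevrey_decay_split[of s \<epsilon>])
    also have "\<dots> = S * A * (?d \<xi> * (weight \<xi>)\<^sup>2) * ?d \<xi>" by (simp add: mult_ac)
    also have "\<dots> \<le> S * A * W * ?d \<xi>"
      using S(1) A0 by (intro mult_right_mono mult_left_mono W) (auto simp: less_imp_le)
    finally have 1: "norm (\<sigma> t \<xi>) * norm (fourier (u t) \<xi>) \<le> S * A * W * ?d \<xi>" .
    have 2: "norm (fourier (f t) \<xi>) \<le> Cf * ?d \<xi>"
      using fb[OF t, of \<xi>] mult_left_mono[OF dmono[of \<xi>] nn(1)] by linarith
    have "norm (fourier (time_deriv f u t) \<xi>) \<le> norm (fourier (f t) \<xi>) + norm (\<sigma> t \<xi>) * norm (fourier (u t) \<xi>)"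
      unfolding fourier_time_deriv[of u t, OF D(1)[OF t]]
      using norm_triangle_ineq4[of "\<i> * fourier (f t) \<xi>" "\<i> * (\<sigma> t \<xi> * fourier (u t) \<xi>)"] by (simp add: norm_mult)
    also have "\<dots> \<le> (Cf + S * A * W) * ?d \<xi>" using 1 2 by (simp add: distrib_right)
    also have "\<dots> \<le> E * ?d \<xi>" by (intro mult_right_mono E) (simp add: less_imp_le)
    finally show ?thesis .
  qed
  have dd: "time_deriv f u t \<in> distributions" if "t \<in> {0..T}" for t
    by (intro time_deriv_distributions fd D(1) that)
  have e2: "\<epsilon> / 2 > 0" using \<epsilon> by simp
  have "u \<in> C1_maps T (gevrey_top s)"
  proof (rule C1_mapsI)
    show "u \<in> C0_maps T (gevrey_top s)"
      unfolding C0_maps_iff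
    proof (intro conjI ballI)
      show "u \<in> extensional {0..T}" using u by (simp add: mode_solution_def)
      fix t assume t: "t \<in> {0..T}"
      show "limitin (gevrey_top s) u (u t) (at t within {0..T})"
      proof (rule limitin_gevrey_dominated[OF s0 e2])
        show "\<forall>\<^sub>F \<tau> in at t within {0..T}. u \<tau> \<in> distributions \<and> (\<forall>\<xi>. norm (fourier (u \<tau>) \<xi>) \<le> E * ?d \<xi>)"
          using eventually_within_set by eventually_elim (intro conjI allI D(1) ub')
      qed (intro D(1,4) ub' t)+
    qed
    fix t assume t: "t \<in> {0..T}"
    show "limitin (gevrey_top s) (time_deriv f u) (time_deriv f u t) (at t within {0..T})"
    proof (rule limitin_gevrey_dominated[OF s0 e2])
      show "\<forall>\<^sub>F \<tau> in at t within {0..T}. time_deriv f u \<tau> \<in> distributions \<and>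
          (\<forall>\<xi>. norm (fourier (time_deriv f u \<tau>) \<xi>) \<le> E * ?d \<xi>)"
        using eventually_within_set by eventually_elim (intro conjI allI dd db)
      show "((\<lambda>\<tau>. fourier (time_deriv f u \<tau>) \<xi>) \<longlongrightarrow> fourier (time_deriv f u t) \<xi>) (at t within {0..T})" for \<xi>
        using mode_solution_sobolev(2)[OF u f0 g0 t] by (rule limitin_sobolev_fourier)
    qed (intro dd db t)+
    let ?q = "\<lambda>\<tau>. of_real (1 / (\<tau> - t)) *\<^sub>D (u \<tau> - u t)"
    have qF: "fourier (?q \<tau>) \<xi> = of_real (1 / (\<tau> - t)) * (fourier (u \<tau>) \<xi> - fourier (u t) \<xi>)" for \<tau> \<xi>
      by (simp only: fourier_smul fourier_diff)
    show "limitin (gevrey_top s) ?q (time_deriv f u t) (at t within {0..T})"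
    proof (rule limitin_gevrey_dominated[OF s0 e2])
      \<comment> \<open>By the mean value inequality the bound on the derivative also bounds the
        quotients; at \<tau> = t the convention 1/0 = 0 makes the quotient vanish.\<close>
      have qb: "norm (fourier (?q \<tau>) \<xi>) \<le> E * ?d \<xi>" if \<tau>: "\<tau> \<in> {0..T}" for \<tau> \<xi>
      proof (cases "\<tau> = t")
        case True
        with order_trans[OF norm_ge_zero db[OF t, of \<xi>]] show ?thesis unfolding qF by simp
      next
        case False
        have "norm (fourier (u \<tau>) \<xi> - fourier (u t) \<xi>) \<le> E * ?d \<xi> * norm (\<tau> - t)"
          by (rule norm_diff_le_derivative[OF D(3) db \<tau> t])
        then have "norm (fourier (u \<tau>) \<xi> - fourier (u t) \<xi>) / norm (\<tau> - t) \<le> E * ?d \<xi>"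
          using False by (simp add: pos_divide_le_eq)
        then show ?thesis unfolding qF norm_mult norm_of_real by (simp add: abs_divide)
      qed
      show "\<forall>\<^sub>F \<tau> in at t within {0..T}. ?q \<tau> \<in> distributions \<and> (\<forall>\<xi>. norm (fourier (?q \<tau>) \<xi>) \<le> E * ?d \<xi>)"
        using eventually_within_set
        by eventually_elim (intro conjI allI qb distributions_smul distributions_diff D(1) t)
      show "((\<lambda>\<tau>. fourier (?q \<tau>) \<xi>) \<longlongrightarrow> fourier (time_deriv f u t) \<xi>) (at t within {0..T})" for \<xi>
        unfolding qF using D(3)[OF t] by (simp only: has_vector_derivative_iff_quotient)
    qed (intro dd db t)+
  qed
  with mode_solution_solves_CP[OF u f0 g0]
  show "\<exists>u. u \<in> C1_maps T (gevrey_top s) \<and> solves_CP T a2 a1 a0 f g u" by blast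
qed (elim conjE, rule solves_CP_unique[OF T a2 a1 a0])

end

theorem corollary7p4:
  fixes T \<delta> :: real
    and a2 a0 :: "real \<Rightarrow> complex"
    and a1 :: "'n::finite \<Rightarrow> real \<Rightarrow> complex"
    and m :: nat
    and tk :: "nat \<Rightarrow> real"
    and p :: "nat \<Rightarrow> real"
    and q :: "'n \<Rightarrow> nat \<Rightarrow> real"
  assumes "T > 0"
    and "continuous_on {0..T} a2" and "\<And>j. continuous_on {0..T} (a1 j)" and "continuous_on {0..T} a0"
    and c2_nonpos: "\<And>t. t \<in> {0..T} \<Longrightarrow> Im (a2 t) \<le> 0"
    and tk_in: "tk ` {1..m} \<subseteq> {0..T}" and tk_mono: "strict_mono_on {1..m} tk"
    and c2_zeros: "\<And>t. t \<in> {0..T} \<Longrightarrow> Im (a2 t) = 0 \<longleftrightarrow> t \<in> tk ` {1..m}"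
    and "\<delta> > 0"
    and c2_order: "\<And>k. k \<in> {1..m} \<Longrightarrow> p k > 0 \<and>
      (\<exists>(\<alpha> :: real \<Rightarrow> real) \<epsilon>. \<epsilon> > 0 \<and> bounded (\<alpha> ` ({tk k - \<delta>..tk k + \<delta>} \<inter> {0..T})) \<and>
        (\<forall>t \<in> {tk k - \<delta>..tk k + \<delta>} \<inter> {0..T}.
           \<alpha> t \<le> - \<epsilon> \<and> Im (a2 t) = \<alpha> t * rpow \<bar>t - tk k\<bar> (p k)))"
    and c1_order: "\<And>j k. k \<in> {1..m} \<Longrightarrow> q j k \<ge> 0 \<and>
      (\<exists>\<beta> :: real \<Rightarrow> real. bounded (\<beta> ` ({tk k - \<delta>..tk k + \<delta>} \<inter> {0..T})) \<and>
        (\<forall>t \<in> {tk k - \<delta>..tk k + \<delta>} \<inter> {0..T}.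
           \<beta> t \<noteq> 0 \<and> Im (a1 j t) = \<beta> t * rpow \<bar>t - tk k\<bar> (q j k)))"
    and pq: "\<And>k. k \<in> {1..m} \<Longrightarrow> p k \<le> 2 * Min (range (\<lambda>j. q j k)) + 1"
  shows
    "(\<forall>(r :: real) (f :: real \<Rightarrow> 'n functional) g.
        f \<in> C0_maps T (sobolev_top r) \<and> g \<in> sobolev r \<longrightarrow>
        (\<exists>!u. u \<in> C0_maps T (sobolev_top r) \<inter> C1_maps T (sobolev_top (r - 2)) \<and>
              solves_CP T a2 a1 a0 f g u)) \<and>
     (\<forall>(f :: real \<Rightarrow> 'n functional) g.
        f \<in> C0_maps T Cinf_top \<and> g \<in> Cinf \<longrightarrow>
        (\<exists>!u. u \<in> C1_maps T Cinf_top \<and> solves_CP T a2 a1 a0 f g u)) \<and>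
     (\<forall>(s :: real) (f :: real \<Rightarrow> 'n functional) g.
        s \<ge> 1 \<and> f \<in> C0_maps T (gevrey_top s) \<and> g \<in> gevrey s \<longrightarrow>
        (\<exists>!u. u \<in> C1_maps T (gevrey_top s) \<and> solves_CP T a2 a1 a0 f g u))"
proof -
  have "\<exists>L. \<forall>(\<xi> :: int ^ 'n) s t. 0 \<le> s \<and> s \<le> t \<and> t \<le> T \<longrightarrow> integral {s..t} (\<lambda>\<tau>. Im (symbol a2 a1 a0 \<tau> \<xi>)) \<le> L"
  proof (rule symbol_energy_bound[OF assms(1-5) c2_zeros \<open>\<delta> > 0\<close> _ _ pq])
    fix k assume k: "k \<in> {1..m}"
    show "p k > 0 \<and> (\<exists>(\<alpha> :: real \<Rightarrow> real) \<epsilon>. \<epsilon> > 0 \<and>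
        (\<forall>t \<in> {tk k - \<delta>..tk k + \<delta>} \<inter> {0..T}. \<alpha> t \<le> - \<epsilon> \<and> Im (a2 t) = \<alpha> t * rpow \<bar>t - tk k\<bar> (p k)))"
      using c2_order[OF k] by blast
    fix j
    show "q j k \<ge> 0 \<and> (\<exists>\<beta> :: real \<Rightarrow> real. bounded (\<beta> ` ({tk k - \<delta>..tk k + \<delta>} \<inter> {0..T})) \<and>
        (\<forall>t \<in> {tk k - \<delta>..tk k + \<delta>} \<inter> {0..T}. Im (a1 j t) = \<beta> t * rpow \<bar>t - tk k\<bar> (q j k)))"
      using c1_order[OF k, of j] by blast
  qed
  then obtain L where L: "\<forall>(\<xi> :: int ^ 'n) s t. 0 \<le> s \<and> s \<le> t \<and> t \<le> T \<longrightarrow>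
      integral {s..t} (\<lambda>\<tau>. Im (symbol a2 a1 a0 \<tau> \<xi>)) \<le> L" by blast
  interpret cauchy_problem T L a2 a0 a1
    by unfold_locales (use assms(1-4) L in auto)
  show ?thesis
    by (intro conjI allI impI; elim conjE) (rule existence_sobolev existence_Cinf existence_gevrey; assumption)+
qed

end
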